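(* Let $\omega_0\in L^2(\log L)^{1/4}(\mathbb{R}^2)$ have compact support, and let $\omega\in L^\infty([0,T);L^2(\log L)^{1/4}(\mathbb{R}^2))$ be a viscosity solution with initial data $\omega_0$. Then, with $u=K\ast\omega$, \[\partial_t(|\omega|^2)+\operatorname{div}(u|\omega|^2)=0\] holds in the sense of distributions on $(0,T)\times\mathbb{R}^2$.
   Context: $K(x)=\frac{x^\perp}{2\pi|x|^2}$, $(x_1,x_2)^\perp=(-x_2,x_1)$. For $a\in\mathbb{R}$, $1\le p<\infty$, $A_{p,a}(s)=[s\log^a(2+s)]^p$ and $L^p(\log L)^a(\mathbb{R}^2)=\{f\in L^1_{loc}:\int A_{p,a}(|f|)\,dx<\infty\}$ with Luxemburg norm $\|f\|_{p,a}=\inf\{k>0:\int A_{p,a}(|f|/k)\le1\}$. A viscosity solution with initial data $\omega_0$ is a weak solution of the 2D Euler equations $\partial_t\omega+u\cdot\nabla\omega=0$, $u=K\ast\omega$, which is the weak-$\ast$ limit of solutions $\omega_{\nu_k}$ of the Navier–Stokes vorticity equations $\partial_t\omega_\nu+u_\nu\cdot\nabla\omega_\nu-\nu\Delta\omega_\nu=0$, $u_\nu=K\ast\omega_\nu$, $\omega_\nu(0)=\omega_0$, with $\nu_k\to0$. The nonlinear term is understood as follows: for $\omega(\cdot,t)\in L^2(\log L)^{1/4}\cap L^1$ and a test vector field $\Phi$, $\langle u|\omega|^2,\Phi\rangle=-\int_{\mathbb{R}^2}\omega(y)\int_{\mathbb{R}^2}K(y-x)\cdot\Phi(x)|\omega(x)|^2\,dx\,dy$.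 *)

theory Defs
  imports "HOL-Analysis.Analysis"
begin

definition perp :: "real^2 \<Rightarrow> real^2" where
  "perp x = (\<chi> i. if i = 1 then - (x $ 2) else x $ 1)"

(* K x = x^perp / (2 pi |x|^2); at x = 0 this gives 0 (a null set, irrelevant) *)
definition BS_K :: "real^2 \<Rightarrow> real^2" where
  "BS_K x = (1 / (2 * pi * (norm x)\<^sup>2)) *\<^sub>R perp x"

definition velocity :: "(real^2 \<Rightarrow> real) \<Rightarrow> real^2 \<Rightarrow> real^2" where
  "velocity w x = (\<integral>y. w y *\<^sub>R BS_K (x - y) \<partial>lborel)"

definition A_fun :: "real \<Rightarrow> real \<Rightarrow> real \<Rightarrow> real" where
  "A_fun p a s = (s * (ln (2 + s)) powr a) powr p"

definition LlogL :: "real \<Rightarrow> real \<Rightarrow> (real^2 \<Rightarrow> real) set" where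
  "LlogL p a = {f. f \<in> borel_measurable lborel
      \<and> (\<forall>r. set_integrable lborel (cball 0 r) f)
      \<and> (\<integral>\<^sup>+ x. ennreal (A_fun p a \<bar>f x\<bar>) \<partial>lborel) < \<infinity>}"

definition lux_norm :: "real \<Rightarrow> real \<Rightarrow> (real^2 \<Rightarrow> real) \<Rightarrow> real" where
  "lux_norm p a f = Inf {k. k > 0 \<and> (\<integral>\<^sup>+ x. ennreal (A_fun p a (\<bar>f x\<bar> / k)) \<partial>lborel) \<le> 1}"

definition Linf_LlogL :: "real \<Rightarrow> real \<Rightarrow> real \<Rightarrow> (real \<Rightarrow> real^2 \<Rightarrow> real) \<Rightarrow> bool" where
  "Linf_LlogL T p a w \<longleftrightarrow>
     (\<lambda>z. w (fst z) (snd z)) \<in> borel_measurable (borel :: (real \<times> (real^2)) measure)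
   \<and> (\<exists>M. AE t in lborel. t \<in> {0..<T} \<longrightarrow> w t \<in> LlogL p a \<and> lux_norm p a (w t) \<le> M)"

fun Ck :: "nat \<Rightarrow> ('a::euclidean_space \<Rightarrow> real) \<Rightarrow> bool" where
  "Ck 0 f \<longleftrightarrow> continuous_on UNIV f"
| "Ck (Suc k) f \<longleftrightarrow> f differentiable_on UNIV
      \<and> (\<forall>b\<in>Basis. Ck k (\<lambda>x. frechet_derivative f (at x) b))"

definition smooth_fun :: "('a::euclidean_space \<Rightarrow> real) \<Rightarrow> bool" where
  "smooth_fun f \<longleftrightarrow> (\<forall>k. Ck k f)"

definition tsupport :: "('a::euclidean_space \<Rightarrow> real) \<Rightarrow> 'a set" where
  "tsupport f = closure {x. f x \<noteq> 0}"

definition test_fun :: "(real \<times> (real^2)) set \<Rightarrow> (real \<times> (real^2) \<Rightarrow> real) \<Rightarrow> bool" where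
  "test_fun U \<phi> \<longleftrightarrow> smooth_fun \<phi> \<and> compact (tsupport \<phi>) \<and> tsupport \<phi> \<subseteq> U"

definition dt :: "(real \<times> (real^2) \<Rightarrow> real) \<Rightarrow> real \<Rightarrow> real^2 \<Rightarrow> real" where
  "dt \<phi> t x = frechet_derivative \<phi> (at (t, x)) (1, 0)"

definition dx :: "2 \<Rightarrow> (real \<times> (real^2) \<Rightarrow> real) \<Rightarrow> real \<Rightarrow> real^2 \<Rightarrow> real" where
  "dx i \<phi> t x = frechet_derivative \<phi> (at (t, x)) (0, axis i 1)"

definition gradx :: "(real \<times> (real^2) \<Rightarrow> real) \<Rightarrow> real \<Rightarrow> real^2 \<Rightarrow> real^2" where
  "gradx \<phi> t x = (\<chi> i. dx i \<phi> t x)"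

definition lapx :: "(real \<times> (real^2) \<Rightarrow> real) \<Rightarrow> real \<Rightarrow> real^2 \<Rightarrow> real" where
  "lapx \<phi> t x = (\<Sum>i\<in>UNIV. dx i (\<lambda>z. dx i \<phi> (fst z) (snd z)) t x)"

definition vort_weak :: "real \<Rightarrow> real \<Rightarrow> (real^2 \<Rightarrow> real) \<Rightarrow> (real \<Rightarrow> real^2 \<Rightarrow> real) \<Rightarrow> bool" where
  "vort_weak \<nu> T w0 w \<longleftrightarrow>
     (\<forall>\<phi>. test_fun ({..<T} \<times> UNIV) \<phi> \<longrightarrow>
        (LINT t:{0<..<T}|lborel. LINT x|lborel.
            w t x * (dt \<phi> t x + velocity (w t) x \<bullet> gradx \<phi> t x + \<nu> * lapx \<phi> t x))
        + (LINT x|lborel. w0 x * \<phi> (0, x)) = 0)"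

definition NS_solution :: "real \<Rightarrow> real \<Rightarrow> (real^2 \<Rightarrow> real) \<Rightarrow> (real \<Rightarrow> real^2 \<Rightarrow> real) \<Rightarrow> bool" where
  "NS_solution \<nu> T w0 w \<longleftrightarrow>
     (\<lambda>z. w (fst z) (snd z)) \<in> borel_measurable (borel :: (real \<times> (real^2)) measure)
   \<and> (\<exists>M. AE t in lborel. t \<in> {0<..<T} \<longrightarrow>
          integrable lborel (w t) \<and> integrable lborel (\<lambda>x. (w t x)\<^sup>2)
          \<and> (\<integral>x. \<bar>w t x\<bar> \<partial>lborel) + (\<integral>x. (w t x)\<^sup>2 \<partial>lborel) \<le> M)
   \<and> (\<forall>\<tau>>0. \<exists>M. AE z in (lborel :: (real \<times> (real^2)) measure).
          fst z \<in> {\<tau><..<T} \<longrightarrow> \<bar>w (fst z) (snd z)\<bar> \<le> M)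
   \<and> vort_weak \<nu> T w0 w"

definition viscosity_solution :: "real \<Rightarrow> (real^2 \<Rightarrow> real) \<Rightarrow> (real \<Rightarrow> real^2 \<Rightarrow> real) \<Rightarrow> bool" where
  "viscosity_solution T w0 w \<longleftrightarrow>
     vort_weak 0 T w0 w
   \<and> (\<exists>(\<nu>::nat \<Rightarrow> real) (w\<nu>::nat \<Rightarrow> real \<Rightarrow> real^2 \<Rightarrow> real).
        (\<forall>k. \<nu> k > 0) \<and> \<nu> \<longlonglongrightarrow> 0
      \<and> (\<forall>k. NS_solution (\<nu> k) T w0 (w\<nu> k))
      \<and> (\<forall>\<phi>. test_fun ({0<..<T} \<times> UNIV) \<phi> \<longrightarrow>
           (\<lambda>k. LINT t:{0<..<T}|lborel. LINT x|lborel. w\<nu> k t x * \<phi> (t, x))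
             \<longlonglongrightarrow> (LINT t:{0<..<T}|lborel. LINT x|lborel. w t x * \<phi> (t, x))))"

(* <u |w|^2, Phi> = - \<integral> w(y) \<integral> K(y-x)\<cdot>Phi(x) |w(x)|^2 dx dy *)
definition nl_pair :: "(real^2 \<Rightarrow> real) \<Rightarrow> (real^2 \<Rightarrow> real^2) \<Rightarrow> real" where
  "nl_pair w \<Phi> = - (LINT y|lborel. w y * (LINT x|lborel. (BS_K (y - x) \<bullet> \<Phi> x) * (w x)\<^sup>2))"

end

theory Submission
  imports Defs "HOL-Computational_Algebra.Polynomial"
begin

text \<open>
  This is the renormalisation argument of DiPerna and Lions. For $\omega \in L^1 \cap L^2$ the velocity has an $L^2$ gradient, because
  the squared gradient differs from the squared curl by a null Lagrangian. The commutator between the transport by $u$ and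
  mollification therefore vanishes in $L^1$, and $\beta(\omega)$ satisfies the transport equation (an inequality when there is
  viscosity and $\beta$ is convex) for every $\beta$ with bounded slope. Applied to the Navier--Stokes approximations with $\beta$
  close to the modulus, this gives a mass bound which is uniform in the viscosity, so that the limit $\omega$ is integrable on
  $(0, T_1) \times \mathbb{R}^2$ for every $T_1 < T$ and the commutator argument applies to it as well.
  Finally $\beta(s) = m s^2 / (m + s^2)$ with $m \to \infty$ yields the equation for $|\omega|^2$; the limit in the flux is dominated by
  $|\omega(x)|^2 |\omega(y)| / |x - y|$, which is integrable precisely because of the factor $(\log)^{1/4}$.
\<close>

text \<open>Membership in L^2 (log L)^(1/4) gives no decay at infinity, so it does not guarantee
  that the Biot--Savart integral converges. Integrability has to come from the approximations, yet
  \<open>NS_solution\<close> bounds their mass only by constants that may depend on the index. Those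
  bounds are therefore used qualitatively, to justify the renormalisation of each approximation; the
  bound that survives the limit contains the initial mass alone, finite because the data have
  compact support.

  The limit inherits a mass that is integrable in time, not one that is bounded in time. This shapes
  the estimates: the majorants for the limit are kept affine in the mass \<open>W t\<close>, so that
  they can be integrated over time.

  Products that must become small are estimated by a b \<le> (s a^2 + b^2 / s) / 2 with s free,
  which plays the part of Hoelder's inequality without square roots. With zero viscosity the
  one-sided statement holds for beta and for -beta, and this is how equality is obtained for the
  limit.\<close>

abbreviation L1 :: "('a::euclidean_space \<Rightarrow> 'b::{banach,second_countable_topology}) \<Rightarrow> bool" where
  "L1 \<equiv> integrable lborel"

abbreviation nn_lborel :: "('a::euclidean_space \<Rightarrow> ennreal) \<Rightarrow> ennreal" (binder "LBNN " 60) where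
  "nn_lborel \<equiv> nn_integral lborel"

section \<open>Translations and radial integrals\<close>

lemma nn_integral_affine:
  fixes f :: "'a::euclidean_space \<Rightarrow> ennreal"
  assumes [measurable]: "f \<in> borel_measurable borel" and c: "c \<noteq> 0"
  shows "(LBNN x. f x) = ennreal (\<bar>c\<bar> ^ DIM('a)) * (LBNN x. f (t + c *\<^sub>R x))"
  by (subst lborel_affine[OF c, of t])
     (simp add: nn_integral_density nn_integral_distr nn_integral_cmult)

lemma nn_integral_shift:
  fixes f :: "'a::euclidean_space \<Rightarrow> ennreal"
  assumes [measurable]: "f \<in> borel_measurable borel"
  shows "(LBNN x. f (x + t)) = (LBNN x. f x)"
    and "(LBNN x. f (x - t)) = (LBNN x. f x)"
    and "(LBNN x. f (t - x)) = (LBNN x. f x)"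
  using nn_integral_affine[OF assms, of 1 t] nn_integral_affine[OF assms, of 1 "-t"]
    nn_integral_affine[OF assms, of "-1" t] by (simp_all add: add.commute)

lemma integrable_affine_iff:
  fixes f :: "'a::euclidean_space \<Rightarrow> 'b::{banach, second_countable_topology}"
  assumes [measurable]: "f \<in> borel_measurable borel" and c: "c \<noteq> 0"
  shows "L1 (\<lambda>x. f (t + c *\<^sub>R x)) \<longleftrightarrow> L1 f"
proof -
  have m[measurable]: "(\<lambda>x. f (t + c *\<^sub>R x)) \<in> borel_measurable borel" by simp
  have "(LBNN x. ennreal (norm (f x))) =
      ennreal (\<bar>c\<bar> ^ DIM('a)) * (LBNN x. ennreal (norm (f (t + c *\<^sub>R x))))"
    by (rule nn_integral_affine[of "\<lambda>x. ennreal (norm (f x))"]) (use c in auto)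
  then show ?thesis using c
    by (auto simp: integrable_iff_bounded ennreal_mult_less_top ennreal_zero_less_mult_iff)
qed

lemma integral_affine:
  fixes f :: "'a::euclidean_space \<Rightarrow> 'b::{banach, second_countable_topology}"
  assumes [measurable]: "f \<in> borel_measurable borel" and c: "c \<noteq> 0"
  shows "(LBINT x. f x) = (\<bar>c\<bar> ^ DIM('a)) *\<^sub>R (LBINT x. f (t + c *\<^sub>R x))"
  by (subst lborel_affine[OF c, of t])
     (simp add: integral_density integral_distr)

lemma integral_shift:
  fixes f :: "'a::euclidean_space \<Rightarrow> 'b::{banach, second_countable_topology}"
  assumes [measurable]: "f \<in> borel_measurable borel"
  shows "(LBINT x. f (x + t)) = (LBINT x. f x)"
    and "(LBINT x. f (x - t)) = (LBINT x. f x)"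
    and "(LBINT x. f (t - x)) = (LBINT x. f x)"
  using integral_affine[OF assms, of 1 t] integral_affine[OF assms, of 1 "-t"]
    integral_affine[OF assms, of "-1" t] by (simp_all add: add.commute)

lemma integrable_shift:
  fixes f :: "'a::euclidean_space \<Rightarrow> 'b::{banach, second_countable_topology}"
  assumes [measurable]: "f \<in> borel_measurable borel"
  shows "L1 (\<lambda>x. f (x + t)) \<longleftrightarrow> L1 f"
    and "L1 (\<lambda>x. f (x - t)) \<longleftrightarrow> L1 f"
    and "L1 (\<lambda>x. f (t - x)) \<longleftrightarrow> L1 f"
  using integrable_affine_iff[OF assms, of 1 t] integrable_affine_iff[OF assms, of 1 "-t"]
    integrable_affine_iff[OF assms, of "-1" t] by (simp_all add: add.commute)

text \<open>Cauchy--Schwarz with respect to the measure k(x - y) dy, followed by Tonelli. In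
  \<open>ennreal\<close> the inequality carries no integrability assumptions, so it can be used to
  establish integrability.\<close>

lemma young_L2:
  fixes k a :: "'a::euclidean_space \<Rightarrow> ennreal"
  assumes [measurable]: "k \<in> borel_measurable borel" "a \<in> borel_measurable borel"
  shows "(LBNN x. (LBNN y. k (x - y) * a y)\<^sup>2)
    \<le> (LBNN x. k x)\<^sup>2 * (LBNN x. (a x)\<^sup>2)"
proof -
  let ?k = "LBNN x. k x"
  have kx: "(LBNN y. k (x - y)) = ?k" for x by (rule nn_integral_shift(3)) simp
  have 1: "(LBNN y. k (x - y) * a y)\<^sup>2 \<le> ?k * (LBNN y. k (x - y) * (a y)\<^sup>2)" for x
  proof -
    have m[measurable]: "(\<lambda>y. k (x - y)) \<in> borel_measurable borel" by measurable
    define \<mu> where "\<mu> = density lborel (\<lambda>y. k (x - y))"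
    have [measurable]: "a \<in> borel_measurable \<mu>" by (simp add: \<mu>_def)
    have "(\<integral>\<^sup>+y. a y * 1 \<partial>\<mu>)\<^sup>2 \<le> (\<integral>\<^sup>+y. (a y)^2 \<partial>\<mu>) * (\<integral>\<^sup>+y. 1^2 \<partial>\<mu>)"
      by (rule Cauchy_Schwarz_nn_integral) auto
    then show ?thesis unfolding \<mu>_def
      by (simp add: nn_integral_density kx emeasure_density mult.commute)
  qed
  have "(LBNN x. (LBNN y. k (x - y) * a y)\<^sup>2)
    \<le> (LBNN x. ?k * (LBNN y. k (x - y) * (a y)\<^sup>2))"
    by (intro nn_integral_mono 1)
  also have "\<dots> = ?k * (LBNN x. (LBNN y. k (x - y) * (a y)\<^sup>2))"
    by (rule nn_integral_cmult) measurable
  also have "(LBNN x. (LBNN y. k (x - y) * (a y)\<^sup>2))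
     = (LBNN y. (LBNN x. k (x - y) * (a y)\<^sup>2))"
    by (rule lborel_pair.Fubini') measurable
  also have "\<dots> = (LBNN y. ?k * (a y)\<^sup>2)"
  proof (intro nn_integral_cong)
    fix y
    have "(LBNN x. k (x - y) * (a y)\<^sup>2) = (LBNN x. k (x - y)) * (a y)\<^sup>2"
      by (rule nn_integral_multc) measurable
    then show "(LBNN x. k (x - y) * (a y)\<^sup>2) = ?k * (a y)\<^sup>2"
      by (simp add: nn_integral_shift(2))
  qed
  also have "\<dots> = ?k * (LBNN x. (a x)\<^sup>2)" by (rule nn_integral_cmult) measurable
  finally show ?thesis by (simp add: power2_eq_square mult.assoc)
qed

text \<open>Only the area of a disc enters: both measures give \<open>{..a}\<close> the mass pi a^2
  (0 for negative \<open>a\<close>), and these half-lines form an intersection-stable generator.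
  This takes the place of polar coordinates.\<close>

lemma radial_measure:
  "distr (lborel :: (real^2) measure) borel norm = density lborel (\<lambda>r. ennreal (2 * pi * r) * indicator {0..} r)"
proof (rule measure_eqI_generator_eq[where E="range (\<lambda>a::real. {..a})" and A="\<lambda>n. {..real n}" and \<Omega>=UNIV])
  show "Int_stable (range (\<lambda>a::real. {..a}))" by (auto simp: Int_stable_def)
  show "sets (distr (lborel::(real^2) measure) borel norm) = sigma_sets UNIV (range (\<lambda>a::real. {..a}))"
    using borel_eq_atMost[where 'a=real] by (metis sets_distr sets_measure_of top_greatest UNIV_I Pow_UNIV)
  show "sets (density lborel (\<lambda>r. ennreal (2 * pi * r) * indicator {0..} r)) = sigma_sets UNIV (range (\<lambda>a::real. {..a}))"
    using borel_eq_atMost[where 'a=real] by (metis sets_density sets_lborel sets_measure_of top_greatest UNIV_I Pow_UNIV)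
  show "(\<Union>i. {..real i}) = UNIV" by (auto simp: real_arch_simple)
  have L: "emeasure (distr (lborel::(real^2) measure) borel norm) {..a} = ennreal (if a \<ge> 0 then pi * a^2 else 0)" for a
  proof -
    have "emeasure (distr (lborel::(real^2) measure) borel norm) {..a} = emeasure lborel (norm -` {..a} :: (real^2) set)"
      by (subst emeasure_distr) auto
    also have "(norm -` {..a} :: (real^2) set) = (if a \<ge> 0 then cball 0 a else {})"
      by (auto simp: dist_norm) (meson norm_ge_zero order_trans)
    finally show ?thesis by (auto simp: emeasure_cball unit_ball_vol_numeral eval_unit_ball_vol)
  qed
  have R: "emeasure (density lborel (\<lambda>r. ennreal (2 * pi * r) * indicator {0..} r)) {..a} = ennreal (if a \<ge> 0 then pi * a^2 else 0)" for a
  proof -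
    have "emeasure (density lborel (\<lambda>r. ennreal (2 * pi * r) * indicator {0..} r)) {..a}
      = (LBNN r. ennreal (2 * pi * r) * indicator {0..a} r)"
      by (subst emeasure_density) (auto intro!: nn_integral_cong simp: indicator_def)
    also have "\<dots> = ennreal (if a \<ge> 0 then pi * a^2 else 0)"
    proof (cases "a \<ge> 0")
      case True
      have "(LBNN r. ennreal (2 * pi * r) * indicator {0..a} r) = pi * a^2 - pi * 0^2"
        by (rule nn_integral_FTC_Icc) (use True in \<open>auto intro!: derivative_eq_intros\<close>)
      then show ?thesis using True by simp
    qed auto
    finally show ?thesis .
  qed
  show "emeasure (distr (lborel::(real^2) measure) borel norm) X = emeasure (density lborel (\<lambda>r. ennreal (2 * pi * r) * indicator {0..} r)) X"
    if "X \<in> range (\<lambda>a::real. {..a})" for X using that L R by auto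
  show "emeasure (distr (lborel::(real^2) measure) borel norm) {..real i} \<noteq> \<infinity>" for i by (simp add: L)
qed auto

lemma nn_integral_radial:
  fixes F :: "real \<Rightarrow> ennreal"
  assumes [measurable]: "F \<in> borel_measurable borel"
  shows "(LBNN x. F (norm (x::real^2))) = (LBNN r. ennreal (2 * pi * r) * F r * indicator {0..} r)"
proof -
  have "(LBNN x. F (norm (x::real^2))) = (\<integral>\<^sup>+r. F r \<partial>distr (lborel :: (real^2) measure) borel norm)"
    by (simp add: nn_integral_distr)
  then show ?thesis unfolding radial_measure
    by (simp add: nn_integral_density mult_ac)
qed

section \<open>Continuity of translations in L^1 and L^2\<close>

lemma translation_L1_open:
  fixes U :: "'a::euclidean_space set"
  assumes U: "open U" and fin: "emeasure lborel U < \<infinity>" and h: "h \<longlonglongrightarrow> 0"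
  shows "(\<lambda>n. LBINT x. \<bar>indicator U (x - h n) - indicator U x :: real\<bar>) \<longlonglongrightarrow> 0"
proof -
  let ?i = "\<lambda>x. indicator U x :: real"
  have [measurable]: "U \<in> sets borel" using U by simp
  have iU: "L1 ?i" using fin by simp
  have iUs: "L1 (\<lambda>x. ?i (x - h n))" for n
    using iU integrable_shift(2)[of ?i "h n"] by simp
  have imin: "L1 (\<lambda>x. ?i (x - h n) * ?i x)" for n
    by (rule Bochner_Integration.integrable_bound[OF iU]) (auto simp: indicator_def)
  \<comment> \<open>Openness is used here: a point of \<open>U\<close> stays in \<open>U\<close>
    under small shifts. Outside \<open>U\<close> the second factor vanishes anyway.\<close>
  have lim: "(\<lambda>n. LBINT x. ?i (x - h n) * ?i x) \<longlonglongrightarrow> (LBINT x. ?i x)"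
  proof (rule integral_dominated_convergence[where w="?i"])
    show "AE x in lborel. (\<lambda>n. ?i (x - h n) * ?i x) \<longlonglongrightarrow> ?i x"
    proof (rule AE_I2)
      fix x
      show "(\<lambda>n. ?i (x - h n) * ?i x) \<longlonglongrightarrow> ?i x"
      proof (cases "x \<in> U")
        case True
        have "(\<lambda>n. x - h n) \<longlonglongrightarrow> x - 0" by (intro tendsto_intros h)
        then have "eventually (\<lambda>n. x - h n \<in> U) sequentially"
          using U True by (simp add: tendsto_def)
        then have "eventually (\<lambda>n. ?i (x - h n) * ?i x = ?i x) sequentially"
          by eventually_elim (auto simp: indicator_def)
        then show ?thesis by (rule tendsto_eventually)
      qed (auto simp: indicator_def)
    qed
  qed (use iU in \<open>auto split: split_indicator\<close>)
  \<comment> \<open>For indicator functions |a - b| = a + b - 2 a b, so only the integral of the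
    product has to converge.\<close>
  have eq: "(LBINT x. \<bar>?i (x - h n) - ?i x\<bar>) = 2 * (LBINT x. ?i x) - 2 * (LBINT x. ?i (x - h n) * ?i x)" for n
  proof -
    have "(LBINT x. \<bar>?i (x - h n) - ?i x\<bar>) = (LBINT x. ?i (x - h n) + ?i x - 2 * (?i (x - h n) * ?i x))"
      by (intro Bochner_Integration.integral_cong) (auto simp: indicator_def)
    also have "\<dots> = (LBINT x. ?i (x - h n)) + (LBINT x. ?i x) - 2 * (LBINT x. ?i (x - h n) * ?i x)"
      using iU iUs[of n] imin[of n] by (subst Bochner_Integration.integral_diff) auto
    finally show ?thesis using integral_shift(2)[of ?i "h n"] by simp
  qed
  have "(\<lambda>n. 2 * (LBINT x. ?i x) - 2 * (LBINT x. ?i (x - h n) * ?i x)) \<longlonglongrightarrow> 2 * (LBINT x. ?i x) - 2 * (LBINT x. ?i x)"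
    by (intro tendsto_intros lim)
  then show ?thesis unfolding eq by simp
qed

text \<open>Translations are isometries of L^1, so the functions whose translates converge form a
  closed set. This serves the base of the induction below, where a measurable set is replaced by an
  open one, as well as its limit step.\<close>

lemma translation_L1_closure:
  fixes f :: "'a::euclidean_space \<Rightarrow> real"
  assumes f: "L1 f"
    and appr: "\<And>e. e > 0 \<Longrightarrow> \<exists>g. L1 g \<and> (LBINT x. \<bar>f x - g x\<bar>) \<le> e
       \<and> (\<lambda>n. LBINT x. \<bar>g (x - h n) - g x\<bar>) \<longlonglongrightarrow> 0"
  shows "(\<lambda>n. LBINT x. \<bar>f (x - h n) - f x\<bar>) \<longlonglongrightarrow> 0"
proof (rule LIMSEQ_I)
  fix r :: real assume "r > 0"
  then obtain g where g: "L1 g" and fg: "(LBINT x. \<bar>f x - g x\<bar>) \<le> r / 4"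
    and lim: "(\<lambda>n. LBINT x. \<bar>g (x - h n) - g x\<bar>) \<longlonglongrightarrow> 0" using appr[of "r/4"] by auto
  from LIMSEQ_D[OF lim, of "r/4"] \<open>r > 0\<close> obtain N where
    N: "\<And>n. n \<ge> N \<Longrightarrow> \<bar>LBINT x. \<bar>g (x - h n) - g x\<bar>\<bar> < r/4" by auto
  have [measurable]: "f \<in> borel_measurable borel" "g \<in> borel_measurable borel" using f g by auto
  show "\<exists>no. \<forall>n\<ge>no. norm ((LBINT x. \<bar>f (x - h n) - f x\<bar>) - 0) < r"
  proof (intro exI[of _ N] allI impI)
    fix n assume "n \<ge> N"
    have fs: "L1 (\<lambda>x. f (x - h n))" "L1 (\<lambda>x. g (x - h n))"
      using f g by (auto simp: integrable_shift)
    have "(LBINT x. \<bar>f (x - h n) - f x\<bar>) \<le> (LBINT x. \<bar>f (x - h n) - g (x - h n)\<bar> + \<bar>f x - g x\<bar> + \<bar>g (x - h n) - g x\<bar>)"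
      by (rule integral_mono) (use fs f g in \<open>auto\<close>)
    also have "\<dots> = (LBINT x. \<bar>f (x - h n) - g (x - h n)\<bar>) + (LBINT x. \<bar>f x - g x\<bar>) + (LBINT x. \<bar>g (x - h n) - g x\<bar>)"
      using fs f g by (subst Bochner_Integration.integral_add) auto
    also have "(LBINT x. \<bar>f (x - h n) - g (x - h n)\<bar>) = (LBINT x. \<bar>f x - g x\<bar>)"
      by (rule integral_shift(2)) simp
    finally have "(LBINT x. \<bar>f (x - h n) - f x\<bar>) < r" using fg N[OF \<open>n \<ge> N\<close>] \<open>r > 0\<close> by linarith
    moreover have "0 \<le> (LBINT x. \<bar>f (x - h n) - f x\<bar>)" by simp
    ultimately show "norm ((LBINT x. \<bar>f (x - h n) - f x\<bar>) - 0) < r" by simp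
  qed
qed

lemma translation_L1_seq:
  fixes f :: "'a::euclidean_space \<Rightarrow> real"
  assumes f: "L1 f" and h: "h \<longlonglongrightarrow> 0"
  shows "(\<lambda>n. LBINT x. \<bar>f (x - h n) - f x\<bar>) \<longlonglongrightarrow> 0"
  using f
proof (induction f rule: integrable_induct)
  case (base A c)
  show ?case
  proof (rule translation_L1_closure)
    show "L1 (\<lambda>x. indicator A x *\<^sub>R c)" using base by simp
    fix e :: real assume e: "e > 0"
    \<comment> \<open>The error is |c| times the measure of \<open>U - A\<close>; dividing by |c| +
      1 covers c = 0 as well.\<close>
    obtain U where U: "open U" "A \<subseteq> U" "emeasure lborel (U - A) < ennreal (e / (\<bar>c\<bar> + 1))"
      using outer_regular_lborel[of A "e / (\<bar>c\<bar> + 1)"] base e by auto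
    have [measurable]: "A \<in> sets borel" "U \<in> sets borel" using base U by auto
    have "emeasure lborel U \<le> emeasure lborel A + emeasure lborel (U - A)"
      using U by (subst plus_emeasure) (auto simp: Un_absorb1)
    also have "\<dots> < \<infinity>" using base U by (metis ennreal_add_less_top infinity_ennreal_def order_less_trans top.not_eq_extremum ennreal_less_top)
    finally have fin: "emeasure lborel U < \<infinity>" .
    let ?g = "\<lambda>x. indicator U x * c"
    have "(\<lambda>n. \<bar>c\<bar> * (LBINT x. \<bar>indicator U (x - h n) - indicator U x\<bar>)) \<longlonglongrightarrow> \<bar>c\<bar> * 0"
      by (intro tendsto_intros translation_L1_open U fin h)
    moreover have "\<bar>c\<bar> * (LBINT x. \<bar>indicator U (x - h n) - indicator U x\<bar>) = (LBINT x. \<bar>?g (x - h n) - ?g x\<bar>)" for n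
      by (subst integral_mult_right_zero[symmetric], intro Bochner_Integration.integral_cong)
         (auto simp: abs_mult[symmetric] algebra_simps)
    ultimately have 1: "(\<lambda>n. LBINT x. \<bar>?g (x - h n) - ?g x\<bar>) \<longlonglongrightarrow> 0" by simp
    have "(LBINT x. \<bar>indicator A x *\<^sub>R c - ?g x\<bar>) = (LBINT x. \<bar>c\<bar> * indicator (U - A) x)"
      using U by (intro Bochner_Integration.integral_cong) (auto simp: indicator_def)
    also have "\<dots> = \<bar>c\<bar> * measure lborel (U - A)" by simp
    also have "\<dots> \<le> \<bar>c\<bar> * (e / (\<bar>c\<bar> + 1))"
    proof (intro mult_left_mono)
      show "measure lborel (U - A) \<le> e / (\<bar>c\<bar> + 1)"
        using U(3) e unfolding measure_def
        by (intro enn2real_leI) (auto intro: less_imp_le)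
    qed auto
    also have "\<dots> \<le> e" using e by (simp add: field_simps)
    finally show "\<exists>g. L1 g \<and> (LBINT x. \<bar>indicator A x *\<^sub>R c - g x\<bar>) \<le> e
       \<and> (\<lambda>n. LBINT x. \<bar>g (x - h n) - g x\<bar>) \<longlonglongrightarrow> 0"
      using 1 fin by (intro exI[of _ ?g]) (auto intro!: integrable_mult_left)
  qed
next
  case (add f g)
  have [measurable]: "f \<in> borel_measurable borel" "g \<in> borel_measurable borel" using add by auto
  have fs: "L1 (\<lambda>x. f (x - h n))" "L1 (\<lambda>x. g (x - h n))" for n
      using add by (auto simp: integrable_shift)
  show ?case
  proof (rule tendsto_sandwich[of "\<lambda>_. 0" _ _ "\<lambda>n. (LBINT x. \<bar>f (x - h n) - f x\<bar>) + (LBINT x. \<bar>g (x - h n) - g x\<bar>)"])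
    show "\<forall>\<^sub>F n in sequentially. (LBINT x. \<bar>f (x - h n) + g (x - h n) - (f x + g x)\<bar>)
          \<le> (LBINT x. \<bar>f (x - h n) - f x\<bar>) + (LBINT x. \<bar>g (x - h n) - g x\<bar>)"
    proof (intro always_eventually allI)
      fix n
      have "(LBINT x. \<bar>f (x - h n) + g (x - h n) - (f x + g x)\<bar>)
        \<le> (LBINT x. \<bar>f (x - h n) - f x\<bar> + \<bar>g (x - h n) - g x\<bar>)"
        using add(1,2) fs by (intro integral_mono) auto
      also have "\<dots> = (LBINT x. \<bar>f (x - h n) - f x\<bar>) + (LBINT x. \<bar>g (x - h n) - g x\<bar>)"
        using add(1,2) fs by (intro Bochner_Integration.integral_add) auto
      finally show "(LBINT x. \<bar>f (x - h n) + g (x - h n) - (f x + g x)\<bar>)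
          \<le> (LBINT x. \<bar>f (x - h n) - f x\<bar>) + (LBINT x. \<bar>g (x - h n) - g x\<bar>)" .
    qed
    show "(\<lambda>n. (LBINT x. \<bar>f (x - h n) - f x\<bar>) + (LBINT x. \<bar>g (x - h n) - g x\<bar>)) \<longlonglongrightarrow> 0"
      using tendsto_add[OF add(3) add(4)] by simp
  qed auto
next
  case (lim f s)
  show ?case
  proof (rule translation_L1_closure)
    fix e :: real assume e: "e > 0"
    have "(\<lambda>i. LBINT x. \<bar>f x - s i x\<bar>) \<longlonglongrightarrow> (\<integral>x. 0 \<partial>(lborel::'a measure))"
    proof (rule integral_dominated_convergence[where w="\<lambda>x. 3 * \<bar>f x\<bar>"])
      show "AE x in lborel. (\<lambda>i. \<bar>f x - s i x\<bar>) \<longlonglongrightarrow> 0"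
      proof (rule AE_I2)
        fix x
        have "(\<lambda>i. \<bar>f x - s i x\<bar>) \<longlonglongrightarrow> \<bar>f x - f x\<bar>" by (intro tendsto_intros lim) simp
        then show "(\<lambda>i. \<bar>f x - s i x\<bar>) \<longlonglongrightarrow> 0" by simp
      qed
      show "AE x in lborel. norm \<bar>f x - s i x\<bar> \<le> 3 * \<bar>f x\<bar>" for i
      proof (rule AE_I2)
        fix x show "norm \<bar>f x - s i x\<bar> \<le> 3 * \<bar>f x\<bar>" using lim.hyps(3)[of x i] abs_triangle_ineq4[of "f x" "s i x"] by simp
      qed
    qed (use lim in auto)
    from LIMSEQ_D[OF this, of e] e obtain i where i: "norm ((LBINT x. \<bar>f x - s i x\<bar>) - (\<integral>x. 0 \<partial>(lborel::'a measure))) < e" by auto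
    show "\<exists>g. L1 g \<and> (LBINT x. \<bar>f x - g x\<bar>) \<le> e
       \<and> (\<lambda>n. LBINT x. \<bar>g (x - h n) - g x\<bar>) \<longlonglongrightarrow> 0"
      using i lim by (intro exI[of _ "s i"]) auto
  qed (rule lim)
qed

text \<open>Truncation at height N: the squared increment of the truncation is at most 2 N times the
  increment of f, which is small in L^1, and the two truncation errors are small in L^2. Squaring a
  sum of three terms costs a factor 3; hence the threshold r / 12, used twice, and r / (12 (N + 1))
  against 6 N.\<close>

lemma translation_L2_seq:
  fixes f :: "'a::euclidean_space \<Rightarrow> real"
  assumes f: "L1 f" and f2: "L1 (\<lambda>x. (f x)\<^sup>2)" and h: "h \<longlonglongrightarrow> 0"
  shows "(\<lambda>n. LBINT x. (f (x - h n) - f x)\<^sup>2) \<longlonglongrightarrow> 0"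
proof (rule LIMSEQ_I)
  fix r :: real assume r: "r > 0"
  have [measurable]: "f \<in> borel_measurable borel" using f by auto
  define g where "g N x = max (- real N) (min (real N) (f x))" for N x
  have [measurable]: "g N \<in> borel_measurable borel" for N unfolding g_def by measurable
  have dg: "\<bar>f x - g N x\<bar> \<le> \<bar>f x\<bar>" "\<bar>g N x - g N y\<bar> \<le> \<bar>f x - f y\<bar>" "\<bar>g N x\<bar> \<le> N" "\<bar>g N x\<bar> \<le> \<bar>f x\<bar>" for N x y
    unfolding g_def by (auto simp: max_def min_def abs_if)
  have sq: "(f x - g N x)\<^sup>2 \<le> (f x)\<^sup>2" for N x using dg(1)[of x N] by (rule abs_le_square_iff[THEN iffD1])
  have i2: "L1 (\<lambda>x. (f x - g N x)\<^sup>2)" for N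
    by (rule Bochner_Integration.integrable_bound[OF f2]) (auto simp: sq)
  have "(\<lambda>N. LBINT x. (f x - g N x)\<^sup>2) \<longlonglongrightarrow> (\<integral>x. 0 \<partial>(lborel::'a measure))"
  proof (rule integral_dominated_convergence[where w="\<lambda>x. (f x)\<^sup>2"])
    show "AE x in lborel. (\<lambda>N. (f x - g N x)\<^sup>2) \<longlonglongrightarrow> 0"
    proof (rule AE_I2)
      fix x
      obtain n0 :: nat where "\<bar>f x\<bar> \<le> n0" using real_arch_simple by blast
      then have "eventually (\<lambda>N. (f x - g N x)\<^sup>2 = 0) sequentially"
        unfolding g_def by (intro eventually_sequentiallyI[of n0]) (auto simp: max_def min_def abs_if split: if_splits)
      then show "(\<lambda>N. (f x - g N x)\<^sup>2) \<longlonglongrightarrow> 0" by (rule tendsto_eventually)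
    qed
  qed (use f2 sq in auto)
  from LIMSEQ_D[OF this, of "r/12"] r obtain N where N: "(LBINT x. (f x - g N x)\<^sup>2) < r / 12" by auto
  from LIMSEQ_D[OF translation_L1_seq[OF f h], of "r / (12 * (N + 1))"] r
  obtain M where M: "\<And>n. n \<ge> M \<Longrightarrow> (LBINT x. \<bar>f (x - h n) - f x\<bar>) < r / (12 * (real N + 1))" by (auto simp: add_ac)
  show "\<exists>no. \<forall>n\<ge>no. norm ((LBINT x. (f (x - h n) - f x)\<^sup>2) - 0) < r"
  proof (intro exI[of _ M] allI impI)
    fix n assume n: "n \<ge> M"
    have fs: "L1 (\<lambda>x. f (x - h n))" using f by (simp add: integrable_shift)
    have i2s: "L1 (\<lambda>x. (f (x - h n) - g N (x - h n))\<^sup>2)"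
      using i2[of N] integrable_shift(2)[of "\<lambda>x. (f x - g N x)\<^sup>2" "h n"] by simp
    have pt: "(f (x - h n) - f x)\<^sup>2 \<le> 3 * (f (x - h n) - g N (x - h n))\<^sup>2 + 3 * (f x - g N x)\<^sup>2
        + 6 * N * \<bar>f (x - h n) - f x\<bar>" for x
    proof -
      let ?a = "f (x - h n) - g N (x - h n)" and ?b = "g N x - f x" and ?c = "g N (x - h n) - g N x"
      have "?c\<^sup>2 = \<bar>?c\<bar> * \<bar>?c\<bar>" by (simp add: power2_eq_square)
      also have "\<dots> \<le> (2 * N) * \<bar>f (x - h n) - f x\<bar>"
        by (rule mult_mono) (use dg(2)[of N "x - h n" x] dg(3)[of N x] dg(3)[of N "x - h n"] in auto)
      finally have c: "?c\<^sup>2 \<le> 2 * N * \<bar>f (x - h n) - f x\<bar>" by simp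
      have "(?a + ?b + ?c)\<^sup>2 \<le> 3 * ?a\<^sup>2 + 3 * ?b\<^sup>2 + 3 * ?c\<^sup>2"
        using sum_squares_ge_zero[of "?a - ?b" "?a - ?c"] zero_le_square[of "?b - ?c"]
        by (simp add: power2_eq_square algebra_simps)
      moreover have "?a + ?b + ?c = f (x - h n) - f x" by simp
      ultimately show ?thesis using c by (simp add: power2_commute[of "g N x" "f x"])
    qed
    have "(LBINT x. (f (x - h n) - f x)\<^sup>2) \<le> (LBINT x. 3 * (f (x - h n) - g N (x - h n))\<^sup>2 + 3 * (f x - g N x)\<^sup>2
        + 6 * N * \<bar>f (x - h n) - f x\<bar>)"
    proof (rule integral_mono')
      show "L1 (\<lambda>x. 3 * (f (x - h n) - g N (x - h n))\<^sup>2 + 3 * (f x - g N x)\<^sup>2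
        + 6 * N * \<bar>f (x - h n) - f x\<bar>)"
        using i2s i2[of N] f fs by (intro Bochner_Integration.integrable_add integrable_mult_right integrable_abs Bochner_Integration.integrable_diff) auto
    qed (use pt in auto)
    also have "\<dots> = 3 * (LBINT x. (f (x - h n) - g N (x - h n))\<^sup>2) + 3 * (LBINT x. (f x - g N x)\<^sup>2)
        + 6 * N * (LBINT x. \<bar>f (x - h n) - f x\<bar>)"
      using i2s i2[of N] f fs
      by (subst Bochner_Integration.integral_add, (auto)[2], subst Bochner_Integration.integral_add) auto
    also have "(LBINT x. (f (x - h n) - g N (x - h n))\<^sup>2) = (LBINT x. (f x - g N x)\<^sup>2)"
      by (rule integral_shift(2)[of "\<lambda>x. (f x - g N x)\<^sup>2"]) simp
    also have "6 * N * (LBINT x. \<bar>f (x - h n) - f x\<bar>) \<le> 6 * N * (r / (12 * (real N + 1)))"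
      using M[OF n] by (intro mult_left_mono) auto
    also have "6 * N * (r / (12 * (real N + 1))) \<le> r / 2" using r by (simp add: field_simps)
    finally have "(LBINT x. (f (x - h n) - f x)\<^sup>2) < r" using N r by linarith
    moreover have "0 \<le> (LBINT x. (f (x - h n) - f x)\<^sup>2)" by simp
    ultimately show "norm ((LBINT x. (f (x - h n) - f x)\<^sup>2) - 0) < r" by simp
  qed
qed

text \<open>Dominated convergence speaks about sequences, while the later estimates need one radius
  that works for all small shifts. If every radius failed, the failures would form a sequence of
  shifts contradicting the hypothesis.\<close>

lemma seq_imp_modulus:
  fixes F :: "'a::euclidean_space \<Rightarrow> real"
  assumes lim: "\<And>h. h \<longlonglongrightarrow> 0 \<Longrightarrow> (\<lambda>n. F (h n)) \<longlonglongrightarrow> 0" and "e > 0"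
  shows "\<exists>d>0. \<forall>z. norm z \<le> d \<longrightarrow> F z \<le> e"
proof (rule ccontr)
  assume "\<not> ?thesis"
  then have "\<forall>n::nat. \<exists>z. norm z \<le> 1 / (Suc n) \<and> F z > e"
    by (metis divide_pos_pos less_numeral_extra(1) not_le of_nat_0_less_iff zero_less_Suc)
  then obtain h where h: "\<And>n. norm (h n) \<le> 1 / (Suc n)" "\<And>n. F (h n) > e" by metis
  have "h \<longlonglongrightarrow> 0"
    by (rule Lim_null_comparison[OF _ LIMSEQ_inverse_real_of_nat])
       (use h in \<open>auto simp: inverse_eq_divide intro!: always_eventually\<close>)
  from LIMSEQ_D[OF lim[OF this] \<open>e > 0\<close>] h(2) show False
    by (metis abs_of_pos assms(2) diff_zero less_asym order.strict_trans le_refl real_norm_def)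
qed

section \<open>Convolution\<close>

lemma translation_L1_modulus:
  fixes f :: "'a::euclidean_space \<Rightarrow> real"
  assumes "L1 f" "e > 0"
  shows "\<exists>d>0. \<forall>z. norm z \<le> d \<longrightarrow> (LBINT x. \<bar>f (x - z) - f x\<bar>) \<le> e"
  using seq_imp_modulus[of "\<lambda>z. LBINT x. \<bar>f (x - z) - f x\<bar>", OF translation_L1_seq] assms by blast

lemma translation_L2_modulus:
  fixes f :: "'a::euclidean_space \<Rightarrow> real"
  assumes "L1 f" "L1 (\<lambda>x. (f x)\<^sup>2)" "e > 0"
  shows "\<exists>d>0. \<forall>z. norm z \<le> d \<longrightarrow> (LBINT x. (f (x - z) - f x)\<^sup>2) \<le> e"
  using seq_imp_modulus[of "\<lambda>z. LBINT x. (f (x - z) - f x)\<^sup>2", OF translation_L2_seq] assms by blast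

definition conv :: "('a::euclidean_space \<Rightarrow> real) \<Rightarrow> ('a \<Rightarrow> real) \<Rightarrow> 'a \<Rightarrow> real" where
  "conv f m x = (LBINT y. f y * m (x - y))"

lemma conv_measurable[measurable]:
  assumes [measurable]: "f \<in> borel_measurable borel" "m \<in> borel_measurable borel"
  shows "conv f m \<in> borel_measurable borel"
  unfolding conv_def by (intro lborel.borel_measurable_lebesgue_integral) measurable

lemma conv_commute:
  assumes [measurable]: "f \<in> borel_measurable borel" "m \<in> borel_measurable borel"
  shows "conv f m x = (LBINT z. f (x - z) * m z)"
  using integral_shift(3)[of "\<lambda>y. f y * m (x - y)" x] unfolding conv_def by simp

lemma conv_integrable_bounded:
  fixes f m :: "'a::euclidean_space \<Rightarrow> real"
  assumes f: "L1 f" and [measurable]: "m \<in> borel_measurable borel" and B: "\<And>x. \<bar>m x\<bar> \<le> B"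
  shows "L1 (\<lambda>y. f y * m (x - y))"
proof (rule Bochner_Integration.integrable_bound[of _ "\<lambda>y. B * f y"])
  have "B \<ge> 0" using B[of 0] by linarith
  then show "AE y in lborel. norm (f y * m (x - y)) \<le> norm (B * f y)"
    using B by (auto simp: abs_mult mult.commute[of B] intro!: mult_left_mono)
qed (use f in auto)

lemma conv_bounded:
  fixes f m :: "'a::euclidean_space \<Rightarrow> real"
  assumes f: "L1 f" and [measurable]: "m \<in> borel_measurable borel" and B: "\<And>x. \<bar>m x\<bar> \<le> B"
  shows "\<bar>conv f m x\<bar> \<le> B * (LBINT y. \<bar>f y\<bar>)"
proof -
  have "\<bar>conv f m x\<bar> \<le> (LBINT y. \<bar>f y * m (x - y)\<bar>)" unfolding conv_def by (rule integral_abs_bound)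
  also have "\<dots> \<le> (LBINT y. B * \<bar>f y\<bar>)"
    using integrable_abs[OF conv_integrable_bounded[OF assms]] f B
    by (intro integral_mono) (auto simp: abs_mult mult.commute[of B] intro!: mult_left_mono)
  finally show ?thesis by simp
qed

lemma conv_joint_integrable:
  fixes f m :: "'a::euclidean_space \<Rightarrow> real"
  assumes f: "L1 f" and m: "L1 m"
  shows "integrable (lborel \<Otimes>\<^sub>M lborel) (\<lambda>(x, y). f y * m (x - y))"
proof -
  have [measurable]: "f \<in> borel_measurable borel" "m \<in> borel_measurable borel" using f m by auto
  have "integrable (lborel \<Otimes>\<^sub>M lborel) (\<lambda>(y, x). f y * m (x - y))"
  proof (rule lborel_pair.Fubini_integrable)
    have "(LBINT x. norm (f y * m (x - y))) = \<bar>f y\<bar> * (LBINT x. \<bar>m x\<bar>)" for y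
      using integral_shift(2)[of "\<lambda>x. \<bar>m x\<bar>" y] by (simp add: abs_mult)
    then show "L1 (\<lambda>y. LBINT x. norm (case (y, x) of (y, x) \<Rightarrow> f y * m (x - y)))"
      using f by auto
    show "AE y in lborel. L1 (\<lambda>x. case (y, x) of (y, x) \<Rightarrow> f y * m (x - y))"
      using m integrable_shift(2)[of m] by auto
  qed measurable
  from lborel_pair.integrable_product_swap[OF this] show ?thesis by (simp add: split_beta')
qed

lemma conv_integrable:
  fixes f m :: "'a::euclidean_space \<Rightarrow> real"
  assumes f: "L1 f" and m: "L1 m"
  shows "L1 (conv f m)"
  using lborel_pair.integrable_fst'[OF conv_joint_integrable[OF f m]] unfolding conv_def by simp

lemma conv_L2:
  fixes f m :: "'a::euclidean_space \<Rightarrow> real"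
  assumes f: "f \<in> borel_measurable borel" "L1 (\<lambda>x. (f x)\<^sup>2)" and m: "L1 m"
  shows "L1 (\<lambda>x. (conv f m x)\<^sup>2)"
    and "(LBINT x. (conv f m x)\<^sup>2) \<le> (LBINT x. \<bar>m x\<bar>)\<^sup>2 * (LBINT x. (f x)\<^sup>2)"
proof -
  have [measurable]: "f \<in> borel_measurable borel" "m \<in> borel_measurable borel" using f m by auto
  have pt: "ennreal \<bar>conv f m x\<bar> \<le> (LBNN y. ennreal \<bar>m (x - y)\<bar> * ennreal \<bar>f y\<bar>)" for x
  proof -
    \<comment> \<open>Where the convolution integral does not converge, its Bochner value is 0 and
      the bound is trivial.\<close>
    have "ennreal (norm (conv f m x)) \<le> (LBNN y. ennreal (norm (f y * m (x - y))))"
    proof (cases "L1 (\<lambda>y. f y * m (x - y))")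
      case True then show ?thesis unfolding conv_def by (rule integral_norm_bound_ennreal)
    qed (simp add: conv_def not_integrable_integral_eq)
    then show ?thesis by (simp add: abs_mult ennreal_mult mult.commute)
  qed
  have "(LBNN x. ennreal ((conv f m x)\<^sup>2)) = (LBNN x. (ennreal \<bar>conv f m x\<bar>)\<^sup>2)"
    by (simp add: ennreal_power)
  also have "\<dots> \<le> (LBNN x. (LBNN y. ennreal \<bar>m (x - y)\<bar> * ennreal \<bar>f y\<bar>)\<^sup>2)"
    by (intro nn_integral_mono power_mono pt) auto
  also have "\<dots> \<le> (LBNN x. ennreal \<bar>m x\<bar>)\<^sup>2 * (LBNN x. (ennreal \<bar>f x\<bar>)\<^sup>2)"
    by (rule young_L2) measurable
  also have "\<dots> = ennreal ((LBINT x. \<bar>m x\<bar>)\<^sup>2 * (LBINT x. (f x)\<^sup>2))"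
    using m f by (simp add: ennreal_power nn_integral_eq_integral ennreal_mult)
  finally have *: "(LBNN x. ennreal ((conv f m x)\<^sup>2)) \<le> ennreal ((LBINT x. \<bar>m x\<bar>)\<^sup>2 * (LBINT x. (f x)\<^sup>2))" .
  show i: "L1 (\<lambda>x. (conv f m x)\<^sup>2)"
  proof (rule integrableI_bounded)
    show "(LBNN x. ennreal (norm ((conv f m x)\<^sup>2))) < \<infinity>"
      using * by (simp add: order_le_less_trans)
  qed measurable
  show "(LBINT x. (conv f m x)\<^sup>2) \<le> (LBINT x. \<bar>m x\<bar>)\<^sup>2 * (LBINT x. (f x)\<^sup>2)"
    using * i by (subst (asm) nn_integral_eq_integral) (auto simp: ennreal_le_iff)
qed

text \<open>Unit mass, nonnegativity and shrinking supports, without a scaling law, so that the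
  mollifiers in time, in space and in space-time are all instances.\<close>

definition is_moll :: "(nat \<Rightarrow> 'a::euclidean_space \<Rightarrow> real) \<Rightarrow> bool" where
  "is_moll m \<longleftrightarrow> (\<forall>n. L1 (m n) \<and> (\<forall>z. 0 \<le> m n z) \<and> (LBINT z. m n z) = 1)
     \<and> (\<forall>d>0. \<forall>\<^sub>F n in sequentially. \<forall>z. m n z \<noteq> 0 \<longrightarrow> norm z \<le> d)"

text \<open>The error at x is an average of the increments f(x - z) - f(x) with weight
  \<open>m n z\<close>. Fubini turns its norm into an average of L^1 moduli of translation, and for
  large n only |z| \<le> d carries weight.\<close>

lemma conv_L1_approx:
  fixes f :: "'a::euclidean_space \<Rightarrow> real"
  assumes f: "L1 f" and m: "is_moll m"
  shows "(\<lambda>n. LBINT x. \<bar>conv f (m n) x - f x\<bar>) \<longlonglongrightarrow> 0"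
proof (rule LIMSEQ_I)
  fix r :: real assume r: "r > 0"
  obtain d where d: "d > 0" "\<And>z. norm z \<le> d \<Longrightarrow> (LBINT x. \<bar>f (x - z) - f x\<bar>) \<le> r / 2"
    using translation_L1_modulus[OF f, of "r/2"] r by auto
  from m d(1) obtain N where N: "\<And>n z. n \<ge> N \<Longrightarrow> m n z \<noteq> 0 \<Longrightarrow> norm z \<le> d"
    unfolding is_moll_def eventually_sequentially by meson
  have mi: "L1 (m n)" "m n z \<ge> 0" "(LBINT z. m n z) = 1" for n z using m unfolding is_moll_def by auto
  have [measurable]: "f \<in> borel_measurable borel" "m n \<in> borel_measurable borel" for n using f mi(1)[of n] by auto
  show "\<exists>no. \<forall>n\<ge>no. norm ((LBINT x. \<bar>conv f (m n) x - f x\<bar>) - 0) < r"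
  proof (intro exI[of _ N] allI impI)
    fix n assume n: "n \<ge> N"
    have I1: "integrable (lborel \<Otimes>\<^sub>M lborel) (\<lambda>(x, z). f (x - z) * m n z)"
    proof -
      have "integrable (lborel \<Otimes>\<^sub>M lborel) (\<lambda>(x, y). m n y * f (x - y))"
        by (rule conv_joint_integrable[OF mi(1) f])
      then show ?thesis by (simp add: mult.commute split_beta')
    qed
    have I2: "integrable (lborel \<Otimes>\<^sub>M lborel) (\<lambda>(x, z). f x * m n z)"
      using f mi(1) by (intro lborel_pair.Fubini_integrable) (auto simp: abs_mult)
    have I: "integrable (lborel \<Otimes>\<^sub>M lborel) (\<lambda>(x, z). \<bar>(f (x - z) - f x) * m n z\<bar>)"
      using integrable_abs[OF Bochner_Integration.integrable_diff[OF I1 I2]]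
      by (simp add: split_beta' algebra_simps)
    have pt: "AE x in lborel. \<bar>conv f (m n) x - f x\<bar> \<le> (LBINT z. \<bar>(f (x - z) - f x) * m n z\<bar>)"
      using lborel_pair.AE_integrable_fst'[OF I1]
    proof eventually_elim
      case (elim x)
      have i0: "L1 (\<lambda>z. f x * m n z)" using mi(1) by simp
      have "conv f (m n) x - f x = (LBINT z. (f (x - z) - f x) * m n z)"
        using Bochner_Integration.integral_diff[OF elim i0] mi(3)[of n]
        by (subst conv_commute) (simp_all add: left_diff_distrib)
      then show ?case using integral_abs_bound by simp
    qed
    have "(LBINT x. \<bar>conv f (m n) x - f x\<bar>) \<le> (LBINT x. (LBINT z. \<bar>(f (x - z) - f x) * m n z\<bar>))"
      using pt lborel_pair.integrable_fst'[OF I] conv_integrable[OF f mi(1)] f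
      by (intro integral_mono_AE) auto
    also have "\<dots> = (LBINT z. (LBINT x. \<bar>(f (x - z) - f x) * m n z\<bar>))"
      by (rule lborel_pair.Fubini_integral[symmetric, OF I])
    also have "\<dots> \<le> (LBINT z. (r / 2) * m n z)"
    proof (rule integral_mono)
      show "L1 (\<lambda>z. LBINT x. \<bar>(f (x - z) - f x) * m n z\<bar>)"
        by (rule lborel_pair.integrable_snd[OF I])
      fix z
      have "(LBINT x. \<bar>(f (x - z) - f x) * m n z\<bar>) = (LBINT x. \<bar>f (x - z) - f x\<bar>) * m n z"
        using mi(2) by (simp add: abs_mult)
      also have "\<dots> \<le> (r / 2) * m n z"
        using d(2)[of z] N[OF n, of z] mi(2)[of n z] by (cases "m n z = 0") (auto intro!: mult_right_mono)
      finally show "(LBINT x. \<bar>(f (x - z) - f x) * m n z\<bar>) \<le> (r / 2) * m n z" .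
    qed (use mi in auto)
    also have "\<dots> < r" using mi r by simp
    finally show "norm ((LBINT x. \<bar>conv f (m n) x - f x\<bar>) - 0) < r" by simp
  qed
qed

text \<open>As in L^1, with Cauchy--Schwarz against the probability density \<open>m n\<close> in
  the role of Jensen's inequality. The formula for the error is used almost everywhere, namely where
  the convolution integral converges.\<close>

lemma conv_L2_approx:
  fixes f :: "'a::euclidean_space \<Rightarrow> real"
  assumes f: "L1 f" and f2: "L1 (\<lambda>x. (f x)\<^sup>2)" and m: "is_moll m"
  shows "(\<lambda>n. LBINT x. (conv f (m n) x - f x)\<^sup>2) \<longlonglongrightarrow> 0"
proof (rule LIMSEQ_I)
  fix r :: real assume r: "r > 0"
  obtain d where d: "d > 0" "\<And>z. norm z \<le> d \<Longrightarrow> (LBINT x. (f (x - z) - f x)\<^sup>2) \<le> r / 2"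
    using translation_L2_modulus[OF f f2, of "r/2"] r by auto
  from m d(1) obtain N where N: "\<And>n z. n \<ge> N \<Longrightarrow> m n z \<noteq> 0 \<Longrightarrow> norm z \<le> d"
    unfolding is_moll_def eventually_sequentially by meson
  have mi: "L1 (m n)" "m n z \<ge> 0" "(LBINT z. m n z) = 1" for n z using m unfolding is_moll_def by auto
  have [measurable]: "f \<in> borel_measurable borel" "m n \<in> borel_measurable borel" for n using f mi(1)[of n] by auto
  have m1: "(LBNN z. ennreal (m n z)) = 1" for n
    using mi[of n] by (subst nn_integral_eq_integral) auto
  show "\<exists>no. \<forall>n\<ge>no. norm ((LBINT x. (conv f (m n) x - f x)\<^sup>2) - 0) < r"
  proof (intro exI[of _ N] allI impI)
    fix n assume n: "n \<ge> N"
    have I1: "AE x in lborel. L1 (\<lambda>z. f (x - z) * m n z)"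
    proof -
      have "integrable (lborel \<Otimes>\<^sub>M lborel) (\<lambda>(x, y). m n y * f (x - y))"
        by (rule conv_joint_integrable[OF mi(1) f])
      from lborel_pair.AE_integrable_fst'[OF this] show ?thesis by (simp add: mult.commute split_beta')
    qed
    have pt: "AE x in lborel. ennreal ((conv f (m n) x - f x)\<^sup>2) \<le> (LBNN z. ennreal (m n z * (f (x - z) - f x)\<^sup>2))"
      using I1
    proof eventually_elim
      case (elim x)
      have i0: "L1 (\<lambda>z. f x * m n z)" using mi(1) by simp
      from Bochner_Integration.integrable_diff[OF elim i0]
      have ii: "L1 (\<lambda>z. (f (x - z) - f x) * m n z)" by (simp add: left_diff_distrib)
      have "conv f (m n) x - f x = (LBINT z. (f (x - z) - f x) * m n z)"
        using Bochner_Integration.integral_diff[OF elim i0] mi(3)[of n]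
        by (subst conv_commute) (simp_all add: left_diff_distrib)
      then have "ennreal \<bar>conv f (m n) x - f x\<bar> \<le> (LBNN z. ennreal (norm ((f (x - z) - f x) * m n z)))"
        using integral_norm_bound_ennreal[OF ii] by simp
      also have "\<dots> = (LBNN z. ennreal (m n z) * ennreal \<bar>f (x - z) - f x\<bar>)"
        using mi(2) by (simp add: abs_mult ennreal_mult mult.commute)
      finally have "(ennreal \<bar>conv f (m n) x - f x\<bar>)\<^sup>2 \<le> (LBNN z. ennreal (m n z) * ennreal \<bar>f (x - z) - f x\<bar>)\<^sup>2"
        by (intro power_mono) auto
      also have "\<dots> = (\<integral>\<^sup>+z. ennreal \<bar>f (x - z) - f x\<bar> * 1 \<partial>density lborel (m n))\<^sup>2"
        by (simp add: nn_integral_density)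
      also have "\<dots> \<le> (\<integral>\<^sup>+z. (ennreal \<bar>f (x - z) - f x\<bar>)\<^sup>2 \<partial>density lborel (m n)) * (\<integral>\<^sup>+z. 1\<^sup>2 \<partial>density lborel (m n))"
        by (rule Cauchy_Schwarz_nn_integral) auto
      also have "\<dots> = (LBNN z. ennreal (m n z * (f (x - z) - f x)\<^sup>2))"
        using mi(2) m1 by (simp add: nn_integral_density emeasure_density ennreal_power ennreal_mult)
      finally show ?case by (simp add: ennreal_power)
    qed
    have "(LBNN x. ennreal ((conv f (m n) x - f x)\<^sup>2)) \<le> (LBNN x. (LBNN z. ennreal (m n z * (f (x - z) - f x)\<^sup>2)))"
      by (intro nn_integral_mono_AE pt)
    also have "\<dots> = (LBNN z. (LBNN x. ennreal (m n z * (f (x - z) - f x)\<^sup>2)))"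
      by (rule lborel_pair.Fubini') measurable
    also have "\<dots> \<le> (LBNN z. ennreal (r / 2) * ennreal (m n z))"
    proof (intro nn_integral_mono)
      fix z
      have i2: "L1 (\<lambda>x. (f (x - z) - f x)\<^sup>2)"
      proof (rule Bochner_Integration.integrable_bound[of _ "\<lambda>x. 2 * (f (x - z))\<^sup>2 + 2 * (f x)\<^sup>2"])
        show "L1 (\<lambda>x. 2 * (f (x - z))\<^sup>2 + 2 * (f x)\<^sup>2)"
          using f2 integrable_shift(2)[of "\<lambda>x. (f x)\<^sup>2" z] by auto
        have "(a - b)\<^sup>2 \<le> 2 * a\<^sup>2 + 2 * b\<^sup>2" for a b :: real
          using zero_le_power2[of "a + b"] by (simp add: power2_eq_square algebra_simps)
        then show "AE x in lborel. norm ((f (x - z) - f x)\<^sup>2) \<le> norm (2 * (f (x - z))\<^sup>2 + 2 * (f x)\<^sup>2)" by auto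
      qed measurable
      have "(LBNN x. ennreal (m n z * (f (x - z) - f x)\<^sup>2)) = ennreal (m n z * (LBINT x. (f (x - z) - f x)\<^sup>2))"
        using i2 mi(2) by (subst nn_integral_eq_integral) auto
      also have "m n z * (LBINT x. (f (x - z) - f x)\<^sup>2) \<le> (r / 2) * m n z"
        using d(2)[of z] N[OF n, of z] mi(2)[of n z] by (cases "m n z = 0") (auto simp: mult.commute[of "m n z"] intro!: mult_right_mono)
      finally show "(LBNN x. ennreal (m n z * (f (x - z) - f x)\<^sup>2)) \<le> ennreal (r / 2) * ennreal (m n z)"
        using r mi(2) by (simp add: ennreal_mult[symmetric] ennreal_leI)
    qed
    also have "\<dots> = ennreal (r / 2)" using m1 by (simp add: nn_integral_cmult)
    finally have le: "(LBNN x. ennreal ((conv f (m n) x - f x)\<^sup>2)) \<le> ennreal (r / 2)" .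
    have "(LBINT x. (conv f (m n) x - f x)\<^sup>2) \<le> r / 2"
    proof (subst integral_eq_nn_integral)
      show "enn2real (LBNN x. ennreal ((conv f (m n) x - f x)\<^sup>2)) \<le> r / 2"
        using le r by (intro enn2real_leI) auto
    qed auto
    then show "norm ((LBINT x. (conv f (m n) x - f x)\<^sup>2) - 0) < r" using r by simp
  qed
qed

text \<open>Differentiability along one direction, with the derivative named as a function. This is
  what the product rule, the chain rule and integration by parts consume, and it can be checked by
  one-variable calculus on explicit kernels.\<close>

definition dird :: "('a::euclidean_space \<Rightarrow> real) \<Rightarrow> 'a \<Rightarrow> ('a \<Rightarrow> real) \<Rightarrow> bool" where
  "dird f e f' \<longleftrightarrow> (\<forall>x. ((\<lambda>s. f (x + s *\<^sub>R e)) has_real_derivative f' x) (at 0))"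

lemma dird_at:
  assumes "dird f e f'"
  shows "((\<lambda>s. f (x + s *\<^sub>R e)) has_real_derivative f' (x + t *\<^sub>R e)) (at t)"
proof -
  have "((\<lambda>s. f ((x + t *\<^sub>R e) + s *\<^sub>R e)) has_real_derivative f' (x + t *\<^sub>R e)) (at 0)"
    using assms unfolding dird_def by blast
  then have "((\<lambda>s. f (x + (s + t) *\<^sub>R e)) has_real_derivative f' (x + t *\<^sub>R e)) (at 0)"
    by (simp add: algebra_simps)
  then show ?thesis using DERIV_shift[of "\<lambda>s. f (x + s *\<^sub>R e)" _ 0 t] by simp
qed

lemma dird_lipschitz:
  assumes d: "dird f e f'" and B: "\<And>x. \<bar>f' x\<bar> \<le> B"
  shows "\<bar>f (x + s *\<^sub>R e) - f x\<bar> \<le> B * \<bar>s\<bar>"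
  using field_differentiable_bound[of UNIV "\<lambda>s. f (x + s *\<^sub>R e)" "\<lambda>s. f' (x + s *\<^sub>R e)" B s 0] dird_at[OF d, of x] B
  by auto

text \<open>The integral of f(x + e) - f(x) vanishes by translation invariance. By the fundamental
  theorem on [0, 1] and Fubini it also equals the integral of f', because all translates of f' have
  the same integral. Integration by parts thus rests on integrability, with no pointwise decay and
  no boundary terms.\<close>

lemma integral_dird_zero:
  fixes f f' :: "'a::euclidean_space \<Rightarrow> real"
  assumes d: "dird f e f'" and f: "L1 f" and f': "L1 f'" and c: "continuous_on UNIV f'"
  shows "(LBINT x. f' x) = 0"
proof -
  have [measurable]: "f' \<in> borel_measurable borel" "f \<in> borel_measurable borel" using f f' by auto
  let ?g = "\<lambda>x s. indicator {0..1} s * f' (x + s *\<^sub>R e)"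
  have ftc: "f (x + e) - f x = (LBINT s. ?g x s)" for x
  proof -
    have "(LBINT s. f' (x + s *\<^sub>R e) * indicator {0..1} s) = f (x + 1 *\<^sub>R e) - f (x + 0 *\<^sub>R e)"
    proof (rule integral_FTC_Icc_real)
      fix s :: real
      show "((\<lambda>s. f (x + s *\<^sub>R e)) has_real_derivative f' (x + s *\<^sub>R e)) (at s)" by (rule dird_at[OF d])
      have "continuous_on UNIV (\<lambda>s. f' (x + s *\<^sub>R e))"
        by (intro continuous_on_compose2[OF c] continuous_intros) auto
      then show "isCont (\<lambda>s. f' (x + s *\<^sub>R e)) s" by (simp add: continuous_on_eq_continuous_at)
    qed auto
    then show ?thesis by (simp add: mult.commute)
  qed
  have shift: "(LBINT x. h (x + t)) = (LBINT x. h x)" if "h \<in> borel_measurable borel" for h :: "'a \<Rightarrow> real" and t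
    by (rule integral_shift(1)[OF that])
  have I: "integrable (lborel \<Otimes>\<^sub>M lborel) (\<lambda>(s, x). ?g x s)"
  proof (rule lborel_pair.Fubini_integrable)
    have "(LBINT x. norm (?g x s)) = indicator {0..1} s * (LBINT x. \<bar>f' x\<bar>)" for s
      using shift[of "\<lambda>x. \<bar>f' x\<bar>" "s *\<^sub>R e"] by (simp add: abs_mult)
    then show "L1 (\<lambda>s. LBINT x. norm (case (s, x) of (s, x) \<Rightarrow> ?g x s))" by simp
    show "AE s in lborel. L1 (\<lambda>x. case (s, x) of (s, x) \<Rightarrow> ?g x s)"
      using f' by (auto simp: integrable_shift)
  qed measurable
  have "0 = (LBINT x. f (x + e)) - (LBINT x. f x)" using shift[of f e] by simp
  also have "\<dots> = (LBINT x. f (x + e) - f x)"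
    using f by (subst Bochner_Integration.integral_diff) (auto simp: integrable_shift)
  also have "\<dots> = (LBINT x. (LBINT s. ?g x s))" by (simp add: ftc)
  also have "\<dots> = (LBINT s. (LBINT x. ?g x s))"
    by (rule lborel_pair.Fubini_integral[OF I])
  also have "\<dots> = (LBINT s. indicator {0..1::real} s * (LBINT x. f' x))"
    by (simp add: shift)
  also have "\<dots> = (LBINT x. f' x)" by (simp add: content_real)
  finally show ?thesis by simp
qed

lemma conv_continuous:
  fixes f m :: "'a::euclidean_space \<Rightarrow> real"
  assumes f: "L1 f" and c: "continuous_on UNIV m" and B: "\<And>x. \<bar>m x\<bar> \<le> B"
  shows "continuous_on UNIV (conv f m)"
proof (rule continuous_on_sequentiallyI)
  fix X :: "nat \<Rightarrow> 'a" and x assume X: "X \<longlonglongrightarrow> x"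
  have [measurable]: "f \<in> borel_measurable borel" "m \<in> borel_measurable borel"
    using f c by (auto simp: borel_measurable_continuous_onI)
  show "(\<lambda>n. conv f m (X n)) \<longlonglongrightarrow> conv f m x"
    unfolding conv_def
  proof (rule integral_dominated_convergence[where w="\<lambda>y. B * \<bar>f y\<bar>"])
    show "AE y in lborel. (\<lambda>n. f y * m (X n - y)) \<longlonglongrightarrow> f y * m (x - y)"
      using X c by (intro AE_I2 tendsto_intros continuous_on_tendsto_compose[OF c]) auto
    show "AE y in lborel. norm (f y * m (X n - y)) \<le> B * \<bar>f y\<bar>" for n
      using B by (auto simp: abs_mult mult.commute[of B] intro!: mult_left_mono)
  qed (use f in auto)
qed

lemma conv_dird:
  fixes f m :: "'a::euclidean_space \<Rightarrow> real"
  assumes f: "L1 f" and d: "dird m e m'"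
    and [measurable]: "m \<in> borel_measurable borel" "m' \<in> borel_measurable borel"
    and B: "\<And>x. \<bar>m x\<bar> \<le> B" and B': "\<And>x. \<bar>m' x\<bar> \<le> B'"
  shows "dird (conv f m) e (conv f m')"
  unfolding dird_def DERIV_def tendsto_at_iff_sequentially comp_def
proof (intro allI impI)
  fix x and X :: "nat \<Rightarrow> real" assume X0: "\<forall>i. X i \<in> UNIV - {0}" and X: "X \<longlonglongrightarrow> 0"
  have [measurable]: "f \<in> borel_measurable borel" using f by auto
  have eq: "(conv f m (x + (0 + X n) *\<^sub>R e) - conv f m (x + 0 *\<^sub>R e)) / X n
    = (LBINT y. f y * ((m (x - y + X n *\<^sub>R e) - m (x - y)) / X n))" for n
  proof -
    have "conv f m (x + X n *\<^sub>R e) - conv f m x = (LBINT y. f y * m (x + X n *\<^sub>R e - y) - f y * m (x - y))"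
      unfolding conv_def by (rule Bochner_Integration.integral_diff[symmetric]; rule conv_integrable_bounded[OF f _ B]) auto
    then show ?thesis by (simp add: field_simps flip: integral_divide_zero)
  qed
  show "(\<lambda>n. (conv f m (x + (0 + X n) *\<^sub>R e) - conv f m (x + 0 *\<^sub>R e)) / X n) \<longlonglongrightarrow> conv f m' x"
    unfolding eq unfolding conv_def
  proof (rule integral_dominated_convergence[where w="\<lambda>y. B' * \<bar>f y\<bar>"])
    show "AE y in lborel. (\<lambda>n. f y * ((m (x - y + X n *\<^sub>R e) - m (x - y)) / X n)) \<longlonglongrightarrow> f y * m' (x - y)"
    proof (intro AE_I2 tendsto_intros)
      fix y
      have "((\<lambda>s. (m (x - y + s *\<^sub>R e) - m (x - y)) / s) \<longlongrightarrow> m' (x - y)) (at 0)"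
        using d unfolding dird_def DERIV_def by (simp add: add.commute)
      then show "(\<lambda>n. (m (x - y + X n *\<^sub>R e) - m (x - y)) / X n) \<longlonglongrightarrow> m' (x - y)"
        using X0 X unfolding tendsto_at_iff_sequentially comp_def by blast
    qed
    show "AE y in lborel. norm (f y * ((m (x - y + X n *\<^sub>R e) - m (x - y)) / X n)) \<le> B' * \<bar>f y\<bar>" for n
    proof (rule AE_I2)
      fix y
      have "X n \<noteq> 0" using X0 by auto
      then have "\<bar>(m (x - y + X n *\<^sub>R e) - m (x - y)) / X n\<bar> \<le> B'"
        using dird_lipschitz[OF d B', of "x - y" "X n"] by (simp add: abs_divide field_simps)
      then have "\<bar>(m (x - y + X n *\<^sub>R e) - m (x - y)) / X n\<bar> * \<bar>f y\<bar> \<le> B' * \<bar>f y\<bar>"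
        by (rule mult_right_mono) auto
      then show "norm (f y * ((m (x - y + X n *\<^sub>R e) - m (x - y)) / X n)) \<le> B' * \<bar>f y\<bar>"
        by (simp only: real_norm_def abs_mult mult.commute)
    qed
  qed (use f in auto)
qed

section \<open>The regularised Biot--Savart kernel\<close>

lemma norm_sq_vec2: "(norm (x::real^2))\<^sup>2 = (x$1)\<^sup>2 + (x$2)\<^sup>2"
  unfolding power2_norm_eq_inner inner_vec_def sum_2 by (simp add: power2_eq_square)

abbreviation e1 :: "real^2" where "e1 \<equiv> axis 1 1"
abbreviation e2 :: "real^2" where "e2 \<equiv> axis 2 1"

lemma axis_simps[simp]: "e1 $ 1 = 1" "e1 $ 2 = 0" "e2 $ 1 = 0" "e2 $ 2 = 1"
  "(x + s *\<^sub>R e1) $ 1 = x $ 1 + s" "(x + s *\<^sub>R e1) $ 2 = x $ 2"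
  "(x + s *\<^sub>R e2) $ 1 = x $ 1" "(x + s *\<^sub>R e2) $ 2 = x $ 2 + s"
  by (simp_all add: axis_def)

text \<open>The pair \<open>k1, k2\<close> is $x^\perp / (|x|^2 + d)$, the regularised kernel without the factor $1/2\pi$; moreover
  $kA = \partial_1 k_1 = -\partial_2 k_2$, $kp = \partial_1 k_2$, $ks = \partial_2 k_1$ and $kM = \partial_1 ks = \partial_2 kA$.\<close>
definition q :: "real \<Rightarrow> real^2 \<Rightarrow> real" where "q d x = 1 / ((x$1)\<^sup>2 + (x$2)\<^sup>2 + d)"
definition k1 :: "real \<Rightarrow> real^2 \<Rightarrow> real" where "k1 d x = - (x$2) * q d x"
definition k2 :: "real \<Rightarrow> real^2 \<Rightarrow> real" where "k2 d x = x$1 * q d x"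
definition kA :: "real \<Rightarrow> real^2 \<Rightarrow> real" where "kA d x = 2 * x$1 * x$2 * (q d x)\<^sup>2"
definition kp :: "real \<Rightarrow> real^2 \<Rightarrow> real" where "kp d x = q d x - 2 * (x$1)\<^sup>2 * (q d x)\<^sup>2"
definition ks :: "real \<Rightarrow> real^2 \<Rightarrow> real" where "ks d x = - q d x + 2 * (x$2)\<^sup>2 * (q d x)\<^sup>2"
definition kM :: "real \<Rightarrow> real^2 \<Rightarrow> real" where "kM d x = 2 * x$1 * (q d x)\<^sup>2 - 8 * x$1 * (x$2)\<^sup>2 * (q d x)^3"

lemmas k_defs = k1_def k2_def kA_def kp_def ks_def kM_def

lemma qpos: "d > 0 \<Longrightarrow> q d x > 0" and qle: "d > 0 \<Longrightarrow> q d x \<le> 1 / d"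
  and qden: "d > 0 \<Longrightarrow> (x$1)\<^sup>2 + (x$2)\<^sup>2 + d \<noteq> 0"
  unfolding q_def by (auto simp: add_nonneg_pos intro!: divide_left_mono add_nonneg_pos)
     (metis add_nonneg_pos less_irrefl sum_power2_ge_zero)

lemma continuous_q: "d > 0 \<Longrightarrow> continuous_on UNIV (q d)"
  unfolding q_def by (intro continuous_intros ballI qden)

lemma continuous_k:
  assumes "d > 0"
  shows "continuous_on UNIV (k1 d)" "continuous_on UNIV (k2 d)" "continuous_on UNIV (kA d)"
    "continuous_on UNIV (kp d)" "continuous_on UNIV (ks d)" "continuous_on UNIV (kM d)"
  unfolding k_defs using continuous_q[OF assms] by (intro continuous_intros; simp)+

lemma measurable_k[measurable]:
  "q d \<in> borel_measurable borel" "k1 d \<in> borel_measurable borel" "k2 d \<in> borel_measurable borel"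
  "kA d \<in> borel_measurable borel" "kp d \<in> borel_measurable borel" "ks d \<in> borel_measurable borel"
  "kM d \<in> borel_measurable borel"
  unfolding k_defs q_def by measurable

lemma q_deriv:
  assumes "d > 0"
  shows "((\<lambda>s. q d (x + s *\<^sub>R e1)) has_real_derivative (- 2 * x$1 * (q d x)\<^sup>2)) (at 0)"
    "((\<lambda>s. q d (x + s *\<^sub>R e2)) has_real_derivative (- 2 * x$2 * (q d x)\<^sup>2)) (at 0)"
  using qden[OF assms, of x] unfolding q_def
  by (auto intro!: derivative_eq_intros simp: field_simps power2_eq_square)

lemma k_dird:
  assumes d: "d > 0"
  shows "dird (k1 d) e1 (kA d)" "dird (k1 d) e2 (ks d)" "dird (k2 d) e1 (kp d)" "dird (k2 d) e2 (\<lambda>x. - kA d x)"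
    "dird (ks d) e1 (kM d)" "dird (kA d) e2 (kM d)"
  unfolding dird_def k_defs
  by (auto intro!: derivative_eq_intros q_deriv[OF d] simp: algebra_simps power2_eq_square power3_eq_cube)

text \<open>Put t = sqrt (q d x), a = x1 t and b = x2 t. Then (a, b) lies in the unit disc, and each
  kernel is a polynomial in a, b times a power of t that records its decay: 1 for the kernel, 2 for
  first and 3 for second derivatives. The constant 10 is 2 + 8.\<close>

lemma k_bounds:
  assumes d: "d > 0"
  defines "s \<equiv> \<lambda>x. sqrt (q d x)"
  shows "\<bar>k1 d x\<bar> \<le> s x" "\<bar>k2 d x\<bar> \<le> s x" "\<bar>kA d x\<bar> \<le> (s x)^2" "\<bar>kp d x\<bar> \<le> (s x)^2" "\<bar>ks d x\<bar> \<le> (s x)^2"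
    "\<bar>kM d x\<bar> \<le> 10 * (s x)^3"
proof -
  define t where "t = s x"
  have t: "t \<ge> 0" "q d x = t\<^sup>2" using qpos[OF d, of x] by (auto simp: t_def s_def)
  have sum: "(x$1)\<^sup>2 * t\<^sup>2 + (x$2)\<^sup>2 * t\<^sup>2 \<le> 1"
  proof -
    have "((x$1)\<^sup>2 + (x$2)\<^sup>2 + d) * q d x = 1" using qden[OF d, of x] by (simp add: q_def)
    moreover have "d * q d x \<ge> 0" using d qpos[OF d, of x] by simp
    ultimately show ?thesis unfolding t(2)[symmetric] by (simp add: algebra_simps)
  qed
  then have x12: "(x$1 * t)\<^sup>2 \<le> 1" "(x$2 * t)\<^sup>2 \<le> 1"
    by (simp_all add: power_mult_distrib) (smt (verit) zero_le_mult_iff zero_le_power2)+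
  then have a: "\<bar>x$1 * t\<bar> \<le> 1" "\<bar>x$2 * t\<bar> \<le> 1" by (auto simp: abs_square_le_1)
  define a where "a = x$1 * t" define b where "b = x$2 * t"
  have ab: "\<bar>a\<bar> \<le> 1" "\<bar>b\<bar> \<le> 1" "a\<^sup>2 \<le> 1" "b\<^sup>2 \<le> 1" "a\<^sup>2 + b\<^sup>2 \<le> 1" using a x12 sum by (auto simp: a_def b_def power_mult_distrib)
  have e: "k1 d x = - b * t" "k2 d x = a * t" "kA d x = 2 * (a * b) * t^2" "kp d x = (1 - 2 * a\<^sup>2) * t^2"
    "ks d x = (2 * b\<^sup>2 - 1) * t^2" "kM d x = (2 * a - 8 * (a * b\<^sup>2)) * t^3"
    by (simp_all add: k_defs t(2) a_def b_def power_mult_distrib algebra_simps power2_eq_square power3_eq_cube)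
  have 2: "\<bar>2 * (a * b)\<bar> \<le> 1" using sum_squares_bound[of a b] sum_squares_bound[of a "-b"] ab(5) by (auto simp: abs_le_iff)
  have "\<bar>a * b\<^sup>2\<bar> \<le> 1 * 1" unfolding abs_mult by (rule mult_mono) (use ab in auto)
  then have 3: "\<bar>2 * a - 8 * (a * b\<^sup>2)\<bar> \<le> 10" using ab(1) by linarith
  have gen: "\<bar>c * t ^ n\<bar> \<le> C * t ^ n" if "\<bar>c\<bar> \<le> C" for c C n
    using that t(1) by (simp add: abs_mult mult_right_mono)
  show "\<bar>k1 d x\<bar> \<le> s x" "\<bar>k2 d x\<bar> \<le> s x" unfolding e t_def[symmetric] using gen[of _ 1 1] ab by auto
  show "\<bar>kA d x\<bar> \<le> (s x)^2" "\<bar>kp d x\<bar> \<le> (s x)^2" "\<bar>ks d x\<bar> \<le> (s x)^2"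
    unfolding e t_def[symmetric] using gen[of _ 1 2] 2 ab(3,4) zero_le_power2[of a] zero_le_power2[of b]
    by (metis mult_1, smt (verit), smt (verit))
  show "\<bar>kM d x\<bar> \<le> 10 * (s x)^3" unfolding e t_def[symmetric] using gen[OF 3] .
qed

lemma q_radial: "q d x = 1 / ((norm x)\<^sup>2 + d)" by (simp add: q_def norm_sq_vec2)

lemma nn_integral_radial_real:
  fixes F :: "real \<Rightarrow> real"
  assumes [measurable]: "F \<in> borel_measurable borel" and F: "\<And>r. 0 \<le> F r"
  shows "(LBNN x. ennreal (F (norm (x::real^2)))) = (LBNN r. ennreal (2 * pi * r * F r) * indicator {0..} r)"
  unfolding ennreal_mult''[OF F] by (rule nn_integral_radial) measurable

text \<open>This is the decay of a kernel times one of its first derivatives, the products that are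
  differentiated in the integrations by parts below. In the plane |x|^(-3) is integrable at infinity
  while |x|^(-2) is not. The primitive is -2 pi / sqrt (r^2 + d).\<close>

lemma sq3_integrable:
  assumes d: "d > 0"
  shows "L1 (\<lambda>x. (sqrt (q d x))^3)"
proof (rule integrableI_bounded)
  have "(LBNN x. ennreal (norm ((sqrt (q d x))^3))) = (LBNN x. ennreal ((\<lambda>r. (1 / sqrt (r\<^sup>2 + d))^3) (norm (x::real^2))))"
    using d by (intro nn_integral_cong) (simp add: q_radial real_sqrt_divide)
  also have "\<dots> = (LBNN r. ennreal (2 * pi * r * (1 / sqrt (r\<^sup>2 + d))^3) * indicator {0..} r)"
    by (rule nn_integral_radial_real) (use d in auto)
  also have "\<dots> = 0 - (- 2 * pi / sqrt (0\<^sup>2 + d))"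
  proof (rule nn_integral_FTC_atLeast)
    fix r :: real assume "0 \<le> r"
    have p: "r\<^sup>2 + d > 0" using d by (simp add: add_nonneg_pos)
    have sq: "sqrt (r\<^sup>2 + d) * sqrt (r\<^sup>2 + d) = r\<^sup>2 + d" using p by simp
    show "((\<lambda>r. - 2 * pi / sqrt (r\<^sup>2 + d)) has_real_derivative 2 * pi * r * (1 / sqrt (r\<^sup>2 + d))^3) (at r)"
      using p by (auto intro!: derivative_eq_intros simp: power3_eq_cube field_simps)
    show "0 \<le> 2 * pi * r * (1 / sqrt (r\<^sup>2 + d))^3" using \<open>0 \<le> r\<close> p by simp
  next
    have "filterlim (\<lambda>r::real. sqrt (r\<^sup>2 + d)) at_top at_top"
    proof (rule filterlim_at_top_mono[OF filterlim_ident])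
      show "\<forall>\<^sub>F r in at_top. r \<le> sqrt (r\<^sup>2 + d)"
        by (intro always_eventually allI real_le_rsqrt) (use d in auto)
    qed
    then show "((\<lambda>r. - 2 * pi / sqrt (r\<^sup>2 + d)) \<longlongrightarrow> 0) at_top"
      by (intro real_tendsto_divide_at_top[OF tendsto_const])
  qed measurable
  finally show "(LBNN x. ennreal (norm ((sqrt (q d x))^3))) < \<infinity>" by simp
qed measurable

text \<open>The curl of the regularised kernel: q is the reciprocal of |x|^2 + d, and substituting
  this leaves 2 d q^2. It is positive and concentrates at the origin as d tends to 0, an
  approximation of 2 pi times the Dirac mass.\<close>

lemma zeta_eq: "d > 0 \<Longrightarrow> kp d x - ks d x = 2 * d * (q d x)\<^sup>2"
proof -
  assume d: "d > 0"
  have "((x$1)\<^sup>2 + (x$2)\<^sup>2 + d) * q d x = 1" using qden[OF d, of x] by (simp add: q_def)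
  then have 1: "((x$1)\<^sup>2 + (x$2)\<^sup>2) * q d x = 1 - d * q d x" by (simp add: algebra_simps)
  have "kp d x - ks d x = 2 * q d x - 2 * (((x$1)\<^sup>2 + (x$2)\<^sup>2) * q d x) * q d x"
    by (simp add: kp_def ks_def power2_eq_square algebra_simps)
  then show ?thesis unfolding 1 by (simp add: power2_eq_square algebra_simps)
qed

text \<open>By positivity the norm is the integral itself, evaluated with the primitive -2 pi d /
  (r^2 + d). That d drops out reflects scale invariance, and it is what makes the gradient bound
  uniform in the regularisation.\<close>

lemma zeta_integral:
  assumes d: "d > 0"
  shows "L1 (\<lambda>x. kp d x - ks d x)" "(LBINT x. \<bar>kp d x - ks d x\<bar>) = 2 * pi"
proof -
  have abs: "\<bar>kp d x - ks d x\<bar> = 2 * d * (q d x)\<^sup>2" for x using d by (simp add: zeta_eq)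
  have "(LBNN x. ennreal \<bar>kp d x - ks d x\<bar>) = (LBNN x. ennreal ((\<lambda>r. 2 * d * (1 / (r\<^sup>2 + d))\<^sup>2) (norm (x::real^2))))"
    unfolding abs by (simp add: q_radial)
  also have "\<dots> = (LBNN r. ennreal (2 * pi * r * (2 * d * (1 / (r\<^sup>2 + d))\<^sup>2)) * indicator {0..} r)"
    by (rule nn_integral_radial_real) (use d in auto)
  also have "\<dots> = 0 - (- 2 * pi * d / (0\<^sup>2 + d))"
  proof (rule nn_integral_FTC_atLeast)
    fix r :: real assume "0 \<le> r"
    have p: "r\<^sup>2 + d > 0" using d by (simp add: add_nonneg_pos)
    show "((\<lambda>r. - 2 * pi * d / (r\<^sup>2 + d)) has_real_derivative 2 * pi * r * (2 * d * (1 / (r\<^sup>2 + d))\<^sup>2)) (at r)"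
      using p by (auto intro!: derivative_eq_intros simp: power2_eq_square field_simps)
    show "0 \<le> 2 * pi * r * (2 * d * (1 / (r\<^sup>2 + d))\<^sup>2)" using \<open>0 \<le> r\<close> p d by simp
  next
    have "filterlim (\<lambda>r::real. r\<^sup>2 + d) at_top at_top"
    proof (rule filterlim_at_top_mono[OF filterlim_ident])
      show "\<forall>\<^sub>F r in at_top. r \<le> r\<^sup>2 + d"
        using eventually_ge_at_top[of 1]
      proof eventually_elim
        case (elim r)
        then have "r * 1 \<le> r * r" by (intro mult_left_mono) auto
        then show ?case using d by (simp add: power2_eq_square)
      qed
    qed
    then show "((\<lambda>r. - 2 * pi * d / (r\<^sup>2 + d)) \<longlongrightarrow> 0) at_top"
      by (intro real_tendsto_divide_at_top[OF tendsto_const])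
  qed measurable
  finally have *: "(LBNN x. ennreal \<bar>kp d x - ks d x\<bar>) = ennreal (2 * pi)" using d by simp
  then show i: "L1 (\<lambda>x. kp d x - ks d x)" by (intro integrableI_bounded) auto
  show "(LBINT x. \<bar>kp d x - ks d x\<bar>) = 2 * pi"
    using * by (subst integral_eq_nn_integral) auto
qed

section \<open>Products of kernels centred at two points\<close>

lemma dird_mult:
  assumes "dird f e f'" "dird g e g'"
  shows "dird (\<lambda>x. f x * g x) e (\<lambda>x. f' x * g x + f x * g' x)"
  using assms unfolding dird_def
proof (intro allI)
  fix x
  assume a: "\<forall>x. ((\<lambda>s. f (x + s *\<^sub>R e)) has_real_derivative f' x) (at 0)" "\<forall>x. ((\<lambda>s. g (x + s *\<^sub>R e)) has_real_derivative g' x) (at 0)"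
  show "((\<lambda>s. f (x + s *\<^sub>R e) * g (x + s *\<^sub>R e)) has_real_derivative f' x * g x + f x * g' x) (at 0)"
    using DERIV_mult[OF a(1)[rule_format, of x] a(2)[rule_format, of x]] by (simp add: mult.commute)
qed

lemma dird_shift: "dird f e f' \<Longrightarrow> dird (\<lambda>x. f (x - c)) e (\<lambda>x. f' (x - c))"
proof -
  have e: "x + s *\<^sub>R e - c = (x - c) + s *\<^sub>R e" for x s by simp
  show "dird f e f' \<Longrightarrow> ?thesis" unfolding dird_def e by blast
qed

lemma sprod:
  fixes s t :: real assumes "s \<ge> 0" "t \<ge> 0"
  shows "s^i * t^j \<le> s^(i+j) + t^(i+j)"
proof (cases "s \<le> t")
  case True
  then have "s^i * t^j \<le> t^i * t^j" using assms by (intro mult_right_mono power_mono) auto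
  then show ?thesis using assms by (simp add: power_add add_increasing)
next
  case False
  then have "s^i * t^j \<le> s^i * s^j" using assms by (intro mult_left_mono power_mono) auto
  then show ?thesis using assms by (simp add: power_add add_increasing2)
qed

lemma sq_integrable:
  assumes d: "d > 0"
  shows "L1 (\<lambda>x. (sqrt (q d x))^3)" "L1 (\<lambda>x. (sqrt (q d x))^4)"
proof -
  show 1: "L1 (\<lambda>x. (sqrt (q d x))^3)" by (rule sq3_integrable[OF d])
  show "L1 (\<lambda>x. (sqrt (q d x))^4)"
  proof (rule Bochner_Integration.integrable_bound[OF integrable_mult_right[OF 1, of "sqrt (1 / d)"]])
    show "AE x in lborel. norm ((sqrt (q d x))^4) \<le> norm (sqrt (1 / d) * (sqrt (q d x))^3)"
    proof (rule AE_I2)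
      fix x
      have "(sqrt (q d x))^4 = sqrt (q d x) * (sqrt (q d x))^3" by (simp add: power_eq_if)
      also have "\<dots> \<le> sqrt (1 / d) * (sqrt (q d x))^3"
        using qle[OF d, of x] qpos[OF d, of x] by (intro mult_right_mono) auto
      finally show "norm ((sqrt (q d x))^4) \<le> norm (sqrt (1 / d) * (sqrt (q d x))^3)"
        using qpos[OF d, of x] d by (simp add: abs_mult)
    qed
  qed measurable
qed

text \<open>A product of two decays with different centres is at most the sum of the full decays at
  the two centres (\<open>sprod\<close>). The bound does not depend on y and z, so it can be
  integrated against w(y) w(z).\<close>

lemma kprod_integrable:
  fixes f g :: "real^2 \<Rightarrow> real"
  assumes d: "d > 0" and [measurable]: "f \<in> borel_measurable borel" "g \<in> borel_measurable borel"
    and f: "\<And>x. \<bar>f x\<bar> \<le> a * (sqrt (q d x))^i" and g: "\<And>x. \<bar>g x\<bar> \<le> b * (sqrt (q d x))^j"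
    and n: "i + j = 3 \<or> i + j = 4" and ab: "a \<ge> 0" "b \<ge> 0"
  shows "L1 (\<lambda>x. f (x - y) * g (x - z))"
    and "(LBINT x. \<bar>f (x - y) * g (x - z)\<bar>) \<le> a * b * (2 * (LBINT x. (sqrt (q d x))^(i+j)))"
proof -
  let ?s = "\<lambda>x. (sqrt (q d x))^(i+j)"
  have int: "L1 ?s" using n sq_integrable[OF d] by auto
  then have int': "L1 (\<lambda>x. ?s (x - y))" "L1 (\<lambda>x. ?s (x - z))"
    using integrable_shift(2)[of ?s] by auto
  have pt: "\<bar>f (x - y) * g (x - z)\<bar> \<le> a * b * (?s (x - y) + ?s (x - z))" for x
  proof -
    have "\<bar>f (x - y) * g (x - z)\<bar> \<le> (a * (sqrt (q d (x - y)))^i) * (b * (sqrt (q d (x - z)))^j)"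
      unfolding abs_mult by (intro mult_mono f g) (use ab qpos[OF d] in \<open>auto simp: less_imp_le\<close>)
    also have "\<dots> = a * b * ((sqrt (q d (x - y)))^i * (sqrt (q d (x - z)))^j)" by simp
    also have "\<dots> \<le> a * b * (?s (x - y) + ?s (x - z))"
      using ab qpos[OF d] by (intro mult_left_mono sprod) (auto simp: less_imp_le)
    finally show ?thesis .
  qed
  have bi: "L1 (\<lambda>x. a * b * (?s (x - y) + ?s (x - z)))" using int' by simp
  show i: "L1 (\<lambda>x. f (x - y) * g (x - z))"
  proof (rule Bochner_Integration.integrable_bound[OF bi])
    show "AE x in lborel. norm (f (x - y) * g (x - z)) \<le> norm (a * b * (?s (x - y) + ?s (x - z)))"
      unfolding real_norm_def by (intro AE_I2 order_trans[OF pt abs_ge_self])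
  qed measurable
  have "(LBINT x. \<bar>f (x - y) * g (x - z)\<bar>) \<le> (LBINT x. a * b * (?s (x - y) + ?s (x - z)))"
    using i pt bi by (intro integral_mono) auto
  also have "\<dots> = a * b * ((LBINT x. ?s (x - y)) + (LBINT x. ?s (x - z)))" using int' by simp
  also have "\<dots> = a * b * (2 * (LBINT x. ?s x))" using integral_shift(2)[of ?s] by simp
  finally show "(LBINT x. \<bar>f (x - y) * g (x - z)\<bar>) \<le> a * b * (2 * (LBINT x. ?s x))" .
qed

text \<open>The Jacobian determinant is a null Lagrangian. Hence the full gradient of the velocity is controlled in $L^2$ by its curl alone,
  whose kernel \<open>kp - ks\<close> has $L^1$ norm $2\pi$ for every \<open>d\<close>: no Calderon--Zygmund theory is needed.\<close>
lemma k_null_lagrangian: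
  assumes d: "d > 0"
  shows "(LBINT x. 2 * (kA d (x - y) * kA d (x - z)) + (kp d (x - y) * ks d (x - z) + ks d (x - y) * kp d (x - z))) = 0"
proof -
  note K = k_dird[OF d] and B = k_bounds[OF d] and C = continuous_k[OF d]
  have b: "\<bar>k2 d x\<bar> \<le> 1 * (sqrt (q d x))^1" "\<bar>kA d x\<bar> \<le> 1 * (sqrt (q d x))^2" "\<bar>kp d x\<bar> \<le> 1 * (sqrt (q d x))^2" "\<bar>ks d x\<bar> \<le> 1 * (sqrt (q d x))^2"
     "\<bar>kM d x\<bar> \<le> 10 * (sqrt (q d x))^3" for x using B[of x] by auto
  have sh: "continuous_on UNIV (\<lambda>x. f (x - c))" if "continuous_on UNIV f" for f :: "real^2 \<Rightarrow> real" and c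
    by (intro continuous_on_compose2[OF that] continuous_intros) auto
  note CC = C[THEN sh]
  have I: "L1 (\<lambda>x. k2 d (x - y) * ks d (x - z))" "L1 (\<lambda>x. kp d (x - y) * ks d (x - z))"
      "L1 (\<lambda>x. k2 d (x - y) * kM d (x - z))" "L1 (\<lambda>x. k2 d (x - y) * kA d (x - z))"
      "L1 (\<lambda>x. kA d (x - y) * kA d (x - z))" for y z
    by (rule kprod_integrable(1)[OF d _ _ b(1) b(4)] kprod_integrable(1)[OF d _ _ b(3) b(4)] kprod_integrable(1)[OF d _ _ b(1) b(5)]
         kprod_integrable(1)[OF d _ _ b(1) b(2)] kprod_integrable(1)[OF d _ _ b(2) b(2)]; simp)+
  \<comment> \<open>\<open>f1\<close> integrates the e1-derivative of \<open>k2\<close> times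
    \<open>ks\<close>, \<open>f2\<close> the e2-derivative of \<open>k2\<close> times
    \<open>kA\<close>. Both leave the integral of \<open>k2\<close> times \<open>kM\<close>, because
    \<open>kM\<close> is the mixed second derivative of \<open>k1\<close>.\<close>
  have f1: "(LBINT x. kp d (x - y) * ks d (x - z) + k2 d (x - y) * kM d (x - z)) = 0" for y z
    by (rule integral_dird_zero[OF dird_mult[OF dird_shift[OF K(3)] dird_shift[OF K(5)]]])
       (use I[of y z] CC in \<open>auto intro!: continuous_intros\<close>)
  have f2: "(LBINT x. - kA d (x - y) * kA d (x - z) + k2 d (x - y) * kM d (x - z)) = 0" for y z
    by (rule integral_dird_zero[OF dird_mult[OF dird_shift[OF K(4)] dird_shift[OF K(6)]]])
       (use I[of y z] CC in \<open>auto intro!: continuous_intros\<close>)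
  have J: "(LBINT x. kp d (x - y) * ks d (x - z)) = - (LBINT x. k2 d (x - y) * kM d (x - z))"
     "(LBINT x. kA d (x - y) * kA d (x - z)) = (LBINT x. k2 d (x - y) * kM d (x - z))" for y z
    using f1[of y z] f2[of y z] I[of y z] by simp_all
  \<comment> \<open>The product of two copies of \<open>kA\<close> is symmetric in y and z, which
    exchanges the roles of the two centres in the last identity.\<close>
  have sym: "(LBINT x. kA d (x - y) * kA d (x - z)) = (LBINT x. k2 d (x - z) * kM d (x - y))"
    using J(2)[of z y] by (simp add: mult.commute)
  have I2: "L1 (\<lambda>x. ks d (x - y) * kp d (x - z))" using I(2)[of z y] by (simp add: mult.commute)
  have "(LBINT x. ks d (x - y) * kp d (x - z)) = (LBINT x. kp d (x - z) * ks d (x - y))" by (simp add: mult.commute)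
  then show ?thesis using I[of y z] I2 J(1)[of z y] J[of y z] sym by simp
qed

section \<open>Square integrability of the velocity gradient\<close>

lemma integral_prod_split:
  fixes F :: "'a::euclidean_space \<Rightarrow> real" and G :: "'b::euclidean_space \<Rightarrow> real"
  assumes F: "L1 F" and G: "L1 G"
  shows "integrable (lborel \<Otimes>\<^sub>M lborel) (\<lambda>p. F (fst p) * G (snd p))"
    and "(\<integral>p. F (fst p) * G (snd p) \<partial>(lborel \<Otimes>\<^sub>M lborel)) = (LBINT x. F x) * (LBINT x. G x)"
proof -
  have [measurable]: "F \<in> borel_measurable borel" "G \<in> borel_measurable borel" using F G by auto
  show i: "integrable (lborel \<Otimes>\<^sub>M lborel) (\<lambda>p. F (fst p) * G (snd p))"
    by (rule lborel_pair.Fubini_integrable) (use F G in \<open>auto simp: abs_mult\<close>)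
  show "(\<integral>p. F (fst p) * G (snd p) \<partial>(lborel \<Otimes>\<^sub>M lborel)) = (LBINT x. F x) * (LBINT x. G x)"
    using lborel_pair.integral_fst'[OF i] by simp
qed

text \<open>Reduces quadratic identities for the velocity gradient to identities between
  correlations of kernels, which \<open>k_null_lagrangian\<close> supplies. Absolute convergence of
  the triple integral comes from the bound in \<open>kprod_integrable\<close>, uniform in both
  centres.\<close>

lemma conv_prod_integral:
  fixes w f g :: "real^2 \<Rightarrow> real"
  assumes w: "L1 w" and d: "d > 0"
    and [measurable]: "f \<in> borel_measurable borel" "g \<in> borel_measurable borel"
    and f: "\<And>x. \<bar>f x\<bar> \<le> (sqrt (q d x))\<^sup>2" and g: "\<And>x. \<bar>g x\<bar> \<le> (sqrt (q d x))\<^sup>2"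
  shows "L1 (\<lambda>x. conv w f x * conv w g x)"
    and "integrable (lborel \<Otimes>\<^sub>M lborel) (\<lambda>p. w (fst p) * w (snd p) * (LBINT x. f (x - fst p) * g (x - snd p)))"
    and "(LBINT x. conv w f x * conv w g x)
      = (\<integral>p. w (fst p) * w (snd p) * (LBINT x. f (x - fst p) * g (x - snd p)) \<partial>(lborel \<Otimes>\<^sub>M lborel))"
proof -
  have [measurable]: "w \<in> borel_measurable borel" using w by auto
  have f': "\<And>x. \<bar>f x\<bar> \<le> 1 * (sqrt (q d x))^2" and g': "\<And>x. \<bar>g x\<bar> \<le> 1 * (sqrt (q d x))^2" using f g by auto
  have fb: "\<bar>f x\<bar> \<le> 1 / d" "\<bar>g x\<bar> \<le> 1 / d" for x using f[of x] g[of x] qpos[OF d, of x] qle[OF d, of x] by auto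
  interpret P: pair_sigma_finite "lborel \<Otimes>\<^sub>M lborel :: ((real^2) \<times> (real^2)) measure" "lborel :: (real^2) measure"
    unfolding lborel_prod by (rule lborel_pair.pair_sigma_finite_axioms)
  define C where "C = 2 * (LBINT x. (sqrt (q d x))^4)"
  let ?H = "\<lambda>p x. w (fst p) * w (snd p) * (f (x - fst p) * g (x - snd p))"
  have kp: "L1 (\<lambda>x. f (x - y) * g (x - z))" "(LBINT x. \<bar>f (x - y) * g (x - z)\<bar>) \<le> C" for y z
    using kprod_integrable[OF d _ _ f' g', of y z] unfolding C_def by auto
  have C0: "0 \<le> C" by (rule order_trans[OF _ kp(2)[of 0 0]], intro Bochner_Integration.integral_nonneg abs_ge_zero)
  have I: "integrable ((lborel \<Otimes>\<^sub>M lborel) \<Otimes>\<^sub>M lborel) (\<lambda>(p, x). ?H p x)"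
  proof (rule P.Fubini_integrable)
    show "integrable (lborel \<Otimes>\<^sub>M lborel) (\<lambda>p. LBINT x. norm (case (p, x) of (p, x) \<Rightarrow> ?H p x))"
    proof (rule Bochner_Integration.integrable_bound[OF integrable_mult_right[OF integrable_abs[OF integral_prod_split(1)[OF w w]], of C]])
      show "AE p in lborel \<Otimes>\<^sub>M lborel. norm (LBINT x. norm (case (p, x) of (p, x) \<Rightarrow> ?H p x)) \<le> norm (C * \<bar>w (fst p) * w (snd p)\<bar>)"
      proof (rule AE_I2)
        fix p :: "(real^2) \<times> (real^2)"
        have "norm (LBINT x. norm (?H p x)) = \<bar>w (fst p) * w (snd p)\<bar> * (LBINT x. \<bar>f (x - fst p) * g (x - snd p)\<bar>)"
          by (simp add: abs_mult)
        also have "\<dots> \<le> \<bar>w (fst p) * w (snd p)\<bar> * C" by (intro mult_left_mono kp) auto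
        finally show "norm (LBINT x. norm (case (p, x) of (p, x) \<Rightarrow> ?H p x)) \<le> norm (C * \<bar>w (fst p) * w (snd p)\<bar>)"
          using C0 by (simp add: mult.commute abs_mult)
      qed
    qed measurable
    show "AE p in lborel \<Otimes>\<^sub>M lborel. L1 (\<lambda>x. case (p, x) of (p, x) \<Rightarrow> ?H p x)"
      using kp(1) by auto
  qed measurable
  have cc: "(\<integral>p. ?H p x \<partial>(lborel \<Otimes>\<^sub>M lborel)) = conv w f x * conv w g x" for x
  proof -
    have "(\<integral>p. ?H p x \<partial>(lborel \<Otimes>\<^sub>M lborel)) = (\<integral>p. (\<lambda>y. w y * f (x - y)) (fst p) * (\<lambda>y. w y * g (x - y)) (snd p) \<partial>(lborel \<Otimes>\<^sub>M lborel))"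
      by (intro Bochner_Integration.integral_cong) auto
    also have "\<dots> = conv w f x * conv w g x" unfolding conv_def
      by (rule integral_prod_split(2); rule conv_integrable_bounded[OF w _ fb(1)] conv_integrable_bounded[OF w _ fb(2)]; simp)
    finally show ?thesis .
  qed
  show "L1 (\<lambda>x. conv w f x * conv w g x)" using P.integrable_snd[OF I] unfolding cc .
  have ip: "(LBINT x. ?H p x) = w (fst p) * w (snd p) * (LBINT x. f (x - fst p) * g (x - snd p))" for p by simp
  show "integrable (lborel \<Otimes>\<^sub>M lborel) (\<lambda>p. w (fst p) * w (snd p) * (LBINT x. f (x - fst p) * g (x - snd p)))"
    using P.integrable_fst[OF I] by simp
  show "(LBINT x. conv w f x * conv w g x)
      = (\<integral>p. w (fst p) * w (snd p) * (LBINT x. f (x - fst p) * g (x - snd p)) \<partial>(lborel \<Otimes>\<^sub>M lborel))"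
    using P.Fubini_integral[OF I] unfolding cc ip .
qed

text \<open>With A, P, S the convolutions with \<open>kA\<close>, \<open>kp\<close>,
  \<open>ks\<close>, the integral of A^2 is minus that of P S. Hence (P - S)^2 has the same integral
  as P^2 + S^2 + 2 A^2, and Young's inequality bounds it with the square of 2 pi.\<close>

lemma conv_grad_L2:
  fixes w :: "real^2 \<Rightarrow> real"
  assumes w: "L1 w" and w2: "L1 (\<lambda>x. (w x)\<^sup>2)" and d: "d > 0"
  shows "L1 (\<lambda>x. (conv w (kA d) x)\<^sup>2)" "L1 (\<lambda>x. (conv w (kp d) x)\<^sup>2)" "L1 (\<lambda>x. (conv w (ks d) x)\<^sup>2)"
   and "(LBINT x. (conv w (kA d) x)\<^sup>2) \<le> 4 * pi\<^sup>2 * (LBINT x. (w x)\<^sup>2)"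
    "(LBINT x. (conv w (kp d) x)\<^sup>2) \<le> 4 * pi\<^sup>2 * (LBINT x. (w x)\<^sup>2)"
    "(LBINT x. (conv w (ks d) x)\<^sup>2) \<le> 4 * pi\<^sup>2 * (LBINT x. (w x)\<^sup>2)"
proof -
  note B = k_bounds[OF d]
  let ?P = "conv w (kp d)" and ?S = "conv w (ks d)" and ?A = "conv w (kA d)"
  note pAA = conv_prod_integral[OF w d _ _ B(3) B(3)] and pPP = conv_prod_integral[OF w d _ _ B(4) B(4)]
    and pSS = conv_prod_integral[OF w d _ _ B(5) B(5)] and pPS = conv_prod_integral[OF w d _ _ B(4) B(5)]
    and pSP = conv_prod_integral[OF w d _ _ B(5) B(4)]
  have i: "L1 (\<lambda>x. ?A x * ?A x)" "L1 (\<lambda>x. ?P x * ?P x)" "L1 (\<lambda>x. ?S x * ?S x)"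
     "L1 (\<lambda>x. ?P x * ?S x)"
    using pAA(1) pPP(1) pSS(1) pPS(1) by auto
  have ki: "L1 (\<lambda>x. kA d (x - y) * kA d (x - z))" "L1 (\<lambda>x. kp d (x - y) * ks d (x - z))"
     "L1 (\<lambda>x. ks d (x - y) * kp d (x - z))" for y z
    using kprod_integrable(1)[OF d, of "kA d" "kA d" 1 2 1 2 y z] kprod_integrable(1)[OF d, of "kp d" "ks d" 1 2 1 2 y z]
      kprod_integrable(1)[OF d, of "ks d" "kp d" 1 2 1 2 y z] B by auto
  let ?L = "lborel \<Otimes>\<^sub>M lborel :: ((real^2) \<times> (real^2)) measure"
  let ?W = "\<lambda>p. w (fst p) * w (snd p)"
  have "2 * (LBINT x. ?A x * ?A x) + ((LBINT x. ?P x * ?S x) + (LBINT x. ?S x * ?P x)) =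
     (\<integral>p. 2 * (?W p * (LBINT x. kA d (x - fst p) * kA d (x - snd p))) +
        (?W p * (LBINT x. kp d (x - fst p) * ks d (x - snd p)) + ?W p * (LBINT x. ks d (x - fst p) * kp d (x - snd p))) \<partial>?L)"
    using pAA(2,3) pPS(2,3) pSP(2,3) by simp
  also have "\<dots> = (\<integral>p. 0 \<partial>?L)"
  proof (intro Bochner_Integration.integral_cong refl)
    fix p
    have "2 * (LBINT x. kA d (x - fst p) * kA d (x - snd p)) +
        ((LBINT x. kp d (x - fst p) * ks d (x - snd p)) + (LBINT x. ks d (x - fst p) * kp d (x - snd p))) = 0"
      using k_null_lagrangian[OF d, of "fst p" "snd p"] ki[of "fst p" "snd p"] by simp
    from arg_cong[OF this, of "\<lambda>r. ?W p * r"]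
    show "2 * (?W p * (LBINT x. kA d (x - fst p) * kA d (x - snd p))) +
        (?W p * (LBINT x. kp d (x - fst p) * ks d (x - snd p)) + ?W p * (LBINT x. ks d (x - fst p) * kp d (x - snd p))) = 0"
      by (simp add: algebra_simps)
  qed
  finally have null: "(LBINT x. ?A x * ?A x) = - (LBINT x. ?P x * ?S x)" by (simp add: mult.commute)
  have zeta: "conv w (\<lambda>x. kp d x - ks d x) x = ?P x - ?S x" for x
  proof -
    have b: "\<bar>kp d x\<bar> \<le> 1 / d" "\<bar>ks d x\<bar> \<le> 1 / d" for x
      using B(4,5)[of x] qpos[OF d, of x] qle[OF d, of x] by auto
    have "?P x - ?S x = (LBINT y. w y * kp d (x - y) - w y * ks d (x - y))" unfolding conv_def
      by (rule Bochner_Integration.integral_diff[symmetric]; rule conv_integrable_bounded[OF w _ b(1)] conv_integrable_bounded[OF w _ b(2)]; simp)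
    then show ?thesis by (simp add: conv_def right_diff_distrib)
  qed
  have "(LBINT x. (?P x - ?S x)\<^sup>2) \<le> (2 * pi)\<^sup>2 * (LBINT x. (w x)\<^sup>2)"
    using conv_L2(2)[OF _ w2 zeta_integral(1)[OF d]] w unfolding zeta zeta_integral(2)[OF d] by auto
  moreover have "(LBINT x. (?P x - ?S x)\<^sup>2) = (LBINT x. ?P x * ?P x + ?S x * ?S x - 2 * (?P x * ?S x))"
    by (intro Bochner_Integration.integral_cong) (auto simp: power2_eq_square algebra_simps)
  moreover have "\<dots> = (LBINT x. ?P x * ?P x) + (LBINT x. ?S x * ?S x) - 2 * (LBINT x. ?P x * ?S x)"
    using i by simp
  ultimately have main: "(LBINT x. ?P x * ?P x) + (LBINT x. ?S x * ?S x) + 2 * (LBINT x. ?A x * ?A x) \<le> 4 * pi\<^sup>2 * (LBINT x. (w x)\<^sup>2)"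
    using null by (simp add: power_mult_distrib)
  have nn: "0 \<le> (LBINT x. ?P x * ?P x)" "0 \<le> (LBINT x. ?S x * ?S x)" "0 \<le> (LBINT x. ?A x * ?A x)" by simp_all
  show "L1 (\<lambda>x. (?A x)\<^sup>2)" "L1 (\<lambda>x. (?P x)\<^sup>2)" "L1 (\<lambda>x. (?S x)\<^sup>2)"
    using i by (auto simp: power2_eq_square)
  show "(LBINT x. (?A x)\<^sup>2) \<le> 4 * pi\<^sup>2 * (LBINT x. (w x)\<^sup>2)"
    "(LBINT x. (?P x)\<^sup>2) \<le> 4 * pi\<^sup>2 * (LBINT x. (w x)\<^sup>2)"
    "(LBINT x. (?S x)\<^sup>2) \<le> 4 * pi\<^sup>2 * (LBINT x. (w x)\<^sup>2)"
    using main nn unfolding power2_eq_square[of "conv w _ _"] by linarith+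
qed

text \<open>The fundamental theorem along the segment, Cauchy--Schwarz on [0, 1] and Tonelli: the
  elementary half of the characterisation of Sobolev functions by difference quotients.\<close>

lemma dird_diff_L2:
  fixes v g :: "'a::euclidean_space \<Rightarrow> real"
  assumes d: "dird v e g" and c: "continuous_on UNIV g" and g2: "L1 (\<lambda>x. (g x)\<^sup>2)"
  shows "(LBNN x. ennreal ((v (x + t *\<^sub>R e) - v x)\<^sup>2)) \<le> ennreal (t\<^sup>2 * (LBINT x. (g x)\<^sup>2))"
proof -
  have [measurable]: "g \<in> borel_measurable borel" using c by (rule borel_measurable_continuous_onI)
  have pt: "ennreal ((v (x + t *\<^sub>R e) - v x)\<^sup>2) \<le> (LBNN s. ennreal (indicator {0..1} s * (t\<^sup>2 * (g (x + (s * t) *\<^sub>R e))\<^sup>2)))" for x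
  proof -
    let ?h = "\<lambda>s. t * g (x + (s * t) *\<^sub>R e)"
    have cont: "continuous_on UNIV ?h"
      by (intro continuous_intros continuous_on_compose2[OF c]) auto
    have F: "((\<lambda>s. v (x + (s * t) *\<^sub>R e)) has_real_derivative ?h s) (at s)" for s
    proof -
      have "((\<lambda>s. s * t) has_real_derivative t) (at s)" by (auto intro!: derivative_eq_intros)
      from DERIV_chain2[OF dird_at[OF d, of x "s * t"] this] show ?thesis by (simp add: mult.commute)
    qed
    have "(LBINT s. ?h s * indicator {0..1} s) = v (x + (1 * t) *\<^sub>R e) - v (x + (0 * t) *\<^sub>R e)"
      by (rule integral_FTC_Icc_real) (use F cont in \<open>auto simp: continuous_on_eq_continuous_at\<close>)
    then have eq: "v (x + t *\<^sub>R e) - v x = (LBINT s. ?h s * indicator {0..1} s)" by simp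
    have "ennreal \<bar>v (x + t *\<^sub>R e) - v x\<bar> \<le> (LBNN s. ennreal \<bar>?h s * indicator {0..1} s\<bar>)"
    proof (cases "L1 (\<lambda>s. ?h s * indicator {0..1} s)")
      case True from integral_norm_bound_ennreal[OF True] show ?thesis unfolding eq by simp
    qed (simp add: eq not_integrable_integral_eq)
    also have "\<dots> = (LBNN s. ennreal \<bar>?h s * indicator {0..1} s\<bar> * indicator {0..1} s)"
      by (intro nn_integral_cong) (auto simp: indicator_def)
    finally have "(ennreal \<bar>v (x + t *\<^sub>R e) - v x\<bar>)\<^sup>2 \<le> (LBNN s. ennreal \<bar>?h s * indicator {0..1} s\<bar> * indicator {0..1} s)\<^sup>2"
      by (intro power_mono) auto
    also have "\<dots> \<le> (LBNN s. (ennreal \<bar>?h s * indicator {0..1} s\<bar>)\<^sup>2) * (LBNN s. (indicator {0..1::real} s)\<^sup>2)"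
      by (rule Cauchy_Schwarz_nn_integral) measurable
    also have "(LBNN s. (indicator {0..1::real} s)\<^sup>2) = (LBNN s. indicator {0..1::real} s)"
      by (intro nn_integral_cong) (auto simp: indicator_def)
    also have "\<dots> = 1" by simp
    also have "(LBNN s. (ennreal \<bar>?h s * indicator {0..1} s\<bar>)\<^sup>2) * 1 = (LBNN s. ennreal (indicator {0..1} s * (t\<^sup>2 * (g (x + (s * t) *\<^sub>R e))\<^sup>2)))"
      unfolding mult_1_right by (intro nn_integral_cong) (auto simp: indicator_def ennreal_power power_mult_distrib)
    finally show ?thesis by (simp add: ennreal_power)
  qed
  have "(LBNN x. ennreal ((v (x + t *\<^sub>R e) - v x)\<^sup>2))
     \<le> (LBNN x. (LBNN s. ennreal (indicator {0..1} s * (t\<^sup>2 * (g (x + (s * t) *\<^sub>R e))\<^sup>2))))"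
    by (intro nn_integral_mono pt)
  also have "\<dots> = (LBNN s. (LBNN x. ennreal (indicator {0..1} s * (t\<^sup>2 * (g (x + (s * t) *\<^sub>R e))\<^sup>2))))"
    by (rule lborel_pair.Fubini'[symmetric]) measurable
  also have "\<dots> = (LBNN s. ennreal (t\<^sup>2 * (LBINT x. (g x)\<^sup>2)) * indicator {0..1::real} s)"
  proof (intro nn_integral_cong)
    fix s :: real
    have "(LBNN x. ennreal (indicator {0..1} s * (t\<^sup>2 * (g (x + (s * t) *\<^sub>R e))\<^sup>2)))
        = (LBNN x. ennreal (indicator {0..1} s * (t\<^sup>2 * (g x)\<^sup>2)))"
      by (rule nn_integral_shift(1)) measurable
    also have "\<dots> = ennreal (LBINT x. indicator {0..1} s * (t\<^sup>2 * (g x)\<^sup>2))"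
      by (rule nn_integral_eq_integral) (use g2 in auto)
    also have "\<dots> = ennreal (t\<^sup>2 * (LBINT x. (g x)\<^sup>2)) * indicator {0..1} s"
      by (auto simp: indicator_def)
    finally show "(LBNN x. ennreal (indicator {0..1} s * (t\<^sup>2 * (g (x + (s * t) *\<^sub>R e))\<^sup>2)))
       = ennreal (t\<^sup>2 * (LBINT x. (g x)\<^sup>2)) * indicator {0..1} s" .
  qed
  also have "\<dots> = ennreal (t\<^sup>2 * (LBINT x. (g x)\<^sup>2))" by (simp add: nn_integral_cmult)
  finally show ?thesis .
qed

lemma vec2_split: "(h::real^2) = h$1 *\<^sub>R e1 + h$2 *\<^sub>R e2"
  by (simp add: vec_eq_iff forall_2 axis_def)

text \<open>The increment is split into two axis-parallel steps. The inequality (a + b)^2 \<le> 2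
  a^2 + 2 b^2 costs the factor 2, and translation invariance moves the base point of the second step
  back to x.\<close>

lemma two_dir_diff_L2:
  fixes v ga gb :: "real^2 \<Rightarrow> real"
  assumes "dird v e1 ga" "dird v e2 gb" and c: "continuous_on UNIV ga" "continuous_on UNIV gb"
    and g2: "L1 (\<lambda>x. (ga x)\<^sup>2)" "L1 (\<lambda>x. (gb x)\<^sup>2)"
    and Q: "(LBINT x. (ga x)\<^sup>2) \<le> Q" "(LBINT x. (gb x)\<^sup>2) \<le> Q" and [measurable]: "v \<in> borel_measurable borel"
  shows "(LBNN x. ennreal ((v (x + h) - v x)\<^sup>2)) \<le> ennreal (2 * Q * (norm h)\<^sup>2)"
proof -
  have Q0: "Q \<ge> 0" by (rule order_trans[OF _ Q(1)], intro Bochner_Integration.integral_nonneg zero_le_power2)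
  define k where "k = h$1 *\<^sub>R e1"
  have h: "h = k + h$2 *\<^sub>R e2" unfolding k_def by (rule vec2_split)
  have sq: "(a + b)\<^sup>2 \<le> 2 * a\<^sup>2 + 2 * b\<^sup>2" for a b :: real
    using zero_le_power2[of "a - b"] by (simp add: power2_eq_square algebra_simps)
  have "(LBNN x. ennreal ((v (x + h) - v x)\<^sup>2))
     \<le> (LBNN x. 2 * ennreal ((v ((x + k) + h$2 *\<^sub>R e2) - v (x + k))\<^sup>2) + 2 * ennreal ((v (x + k) - v x)\<^sup>2))"
  proof (intro nn_integral_mono)
    fix x
    have "v (x + h) - v x = (v ((x + k) + h$2 *\<^sub>R e2) - v (x + k)) + (v (x + k) - v x)"
      by (subst h) (simp add: add.assoc)
    then have "(v (x + h) - v x)\<^sup>2 \<le> 2 * (v ((x + k) + h$2 *\<^sub>R e2) - v (x + k))\<^sup>2 + 2 * (v (x + k) - v x)\<^sup>2"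
      by (metis sq)
    from ennreal_leI[OF this] show "ennreal ((v (x + h) - v x)\<^sup>2) \<le> 2 * ennreal ((v ((x + k) + h$2 *\<^sub>R e2) - v (x + k))\<^sup>2) + 2 * ennreal ((v (x + k) - v x)\<^sup>2)"
      by (simp add: ennreal_plus ennreal_mult)
  qed
  also have "\<dots> = 2 * (LBNN x. ennreal ((v ((x + k) + h$2 *\<^sub>R e2) - v (x + k))\<^sup>2)) + 2 * (LBNN x. ennreal ((v (x + k) - v x)\<^sup>2))"
    by (simp add: nn_integral_add nn_integral_cmult)
  also have "(LBNN x. ennreal ((v ((x + k) + h$2 *\<^sub>R e2) - v (x + k))\<^sup>2)) = (LBNN x. ennreal ((v (x + h$2 *\<^sub>R e2) - v x)\<^sup>2))"
    by (rule nn_integral_shift(1)[of "\<lambda>x. ennreal ((v (x + h$2 *\<^sub>R e2) - v x)\<^sup>2)"]) measurable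
  also have "\<dots> \<le> ennreal ((h$2)\<^sup>2 * Q)"
    by (rule order_trans[OF dird_diff_L2[OF assms(2) c(2) g2(2)]]) (intro ennreal_leI mult_left_mono Q, simp)
  also have "(LBNN x. ennreal ((v (x + k) - v x)\<^sup>2)) \<le> ennreal ((h$1)\<^sup>2 * Q)" unfolding k_def
    by (rule order_trans[OF dird_diff_L2[OF assms(1) c(1) g2(1)]]) (intro ennreal_leI mult_left_mono Q, simp)
  also have "2 * ennreal ((h$2)\<^sup>2 * Q) + 2 * ennreal ((h$1)\<^sup>2 * Q) = ennreal (2 * Q * (norm h)\<^sup>2)"
  proof -
    have 1: "2 * ennreal a + 2 * ennreal b = ennreal (2 * a + 2 * b)" if "a \<ge> 0" "b \<ge> 0" for a b
      using that by (simp add: ennreal_plus ennreal_mult)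
    have 2: "2 * Q * (norm h)\<^sup>2 = 2 * ((h$2)\<^sup>2 * Q) + 2 * ((h$1)\<^sup>2 * Q)" by (simp add: norm_sq_vec2 algebra_simps)
    show ?thesis unfolding 2 by (rule 1) (use Q0 in auto)
  qed
  finally show ?thesis by (simp add: add_mono mult_left_mono)
qed

lemma conv_k_diff_L2:
  fixes w :: "real^2 \<Rightarrow> real"
  assumes w: "L1 w" and w2: "L1 (\<lambda>x. (w x)\<^sup>2)" and d: "d > 0"
  defines "Q \<equiv> LBINT x. (w x)\<^sup>2"
  shows "(LBNN x. ennreal ((conv w (k1 d) (x + h) - conv w (k1 d) x)\<^sup>2)) \<le> ennreal (8 * pi\<^sup>2 * Q * (norm h)\<^sup>2)"
    "(LBNN x. ennreal ((conv w (k2 d) (x + h) - conv w (k2 d) x)\<^sup>2)) \<le> ennreal (8 * pi\<^sup>2 * Q * (norm h)\<^sup>2)"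
proof -
  have [measurable]: "w \<in> borel_measurable borel" using w by auto
  note B = k_bounds[OF d] and C = continuous_k[OF d] and G = conv_grad_L2[OF w w2 d]
  have s: "sqrt (q d x) \<le> sqrt (1 / d)" "(sqrt (q d x))\<^sup>2 \<le> 1 / d" for x
    using qpos[OF d, of x] qle[OF d, of x] by auto
  have b: "\<bar>k1 d x\<bar> \<le> sqrt (1/d)" "\<bar>k2 d x\<bar> \<le> sqrt (1/d)" "\<bar>kA d x\<bar> \<le> 1 / d" "\<bar>kp d x\<bar> \<le> 1 / d" "\<bar>ks d x\<bar> \<le> 1 / d" "\<bar>- kA d x\<bar> \<le> 1 / d" for x
    using B[of x] s[of x] by linarith+
  note D = k_dird[OF d]
  have mA: "conv w (\<lambda>x. - kA d x) = (\<lambda>x. - conv w (kA d) x)" by (auto simp: conv_def)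
  have "dird (conv w (k1 d)) e1 (conv w (kA d))" "dird (conv w (k1 d)) e2 (conv w (ks d))"
    "dird (conv w (k2 d)) e1 (conv w (kp d))" "dird (conv w (k2 d)) e2 (conv w (\<lambda>x. - kA d x))"
    by (rule conv_dird[OF w D(1) _ _ b(1) b(3)] conv_dird[OF w D(2) _ _ b(1) b(5)]
         conv_dird[OF w D(3) _ _ b(2) b(4)] conv_dird[OF w D(4) _ _ b(2) b(6)]; measurable)+
  note DD = this[unfolded mA]
  have CC: "continuous_on UNIV (conv w (kA d))" "continuous_on UNIV (conv w (ks d))" "continuous_on UNIV (conv w (kp d))"
    by (rule conv_continuous[OF w C(3) b(3)] conv_continuous[OF w C(5) b(5)] conv_continuous[OF w C(4) b(4)])+
  have e: "8 * pi\<^sup>2 * Q * (norm h)\<^sup>2 = 2 * (4 * pi\<^sup>2 * Q) * (norm h)\<^sup>2" by simp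
  show "(LBNN x. ennreal ((conv w (k1 d) (x + h) - conv w (k1 d) x)\<^sup>2)) \<le> ennreal (8 * pi\<^sup>2 * Q * (norm h)\<^sup>2)"
    unfolding e by (rule two_dir_diff_L2[OF DD(1,2) CC(1,2)]) (use G in \<open>auto simp: Q_def\<close>)
  show "(LBNN x. ennreal ((conv w (k2 d) (x + h) - conv w (k2 d) x)\<^sup>2)) \<le> ennreal (8 * pi\<^sup>2 * Q * (norm h)\<^sup>2)"
    unfolding e by (rule two_dir_diff_L2[OF DD(3,4) CC(3)]) (use G CC in \<open>auto simp: Q_def intro!: continuous_intros\<close>)
qed

section \<open>The velocity field\<close>

lemma borel_measurable_vec_component[measurable (raw)]:
  fixes f :: "'a \<Rightarrow> real^'n"
  assumes "f \<in> borel_measurable M" shows "(\<lambda>x. f x $ i) \<in> borel_measurable M"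
  by (rule borel_measurable_continuous_on[OF _ assms]) (intro continuous_intros)

text \<open>The kernel 1/|z| is not integrable at infinity. Cut off at radius 1 it has integral at
  most 2 pi and acts on L^2 by Young's inequality; the remainder is at most 1 and is paid for by the
  mass. \<open>Upot\<close> is the resulting majorant of the velocity.\<close>

definition nk :: "real^2 \<Rightarrow> real" where "nk z = (if norm z < 1 then 1 / norm z else 0)"
definition Upot :: "(real^2 \<Rightarrow> real) \<Rightarrow> real^2 \<Rightarrow> ennreal" where
  "Upot w x = (LBNN y. ennreal (\<bar>w y\<bar> / norm (x - y)))"
definition Npot :: "(real^2 \<Rightarrow> real) \<Rightarrow> real^2 \<Rightarrow> ennreal" where
  "Npot w x = (LBNN y. ennreal (nk (x - y)) * ennreal \<bar>w y\<bar>)"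

lemma nk_measurable[measurable]: "nk \<in> borel_measurable borel" unfolding nk_def by measurable

lemma Upot_measurable[measurable]:
  assumes [measurable]: "w \<in> borel_measurable borel" shows "Upot w \<in> borel_measurable borel"
  unfolding Upot_def by measurable

lemma Npot_measurable[measurable]:
  assumes [measurable]: "w \<in> borel_measurable borel" shows "Npot w \<in> borel_measurable borel"
  unfolding Npot_def by measurable

lemma nk_integral: "(LBNN x. ennreal (nk x)) \<le> ennreal (2 * pi)"
proof -
  let ?F = "\<lambda>r::real. if 0 \<le> r \<and> r < 1 then 1 / r else 0"
  have "(LBNN x. ennreal (nk x)) = (LBNN x. ennreal (?F (norm (x::real^2))))"
    by (intro nn_integral_cong) (simp add: nk_def)
  also have "\<dots> = (LBNN r. ennreal (2 * pi * r * ?F r) * indicator {0..} r)"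
    by (rule nn_integral_radial_real) auto
  also have "\<dots> \<le> (LBNN r. ennreal (2 * pi) * indicator {0..1::real} r)"
    by (intro nn_integral_mono) (auto simp: indicator_def)
  also have "\<dots> = ennreal (2 * pi)" by (simp add: nn_integral_cmult)
  finally show ?thesis .
qed

lemma Upot_le:
  assumes [measurable]: "w \<in> borel_measurable borel"
  shows "Upot w x \<le> Npot w x + (LBNN y. ennreal \<bar>w y\<bar>)"
proof -
  have "Upot w x \<le> (LBNN y. ennreal (nk (x - y)) * ennreal \<bar>w y\<bar> + ennreal \<bar>w y\<bar>)"
    unfolding Upot_def
  proof (intro nn_integral_mono)
    fix y
    have "\<bar>w y\<bar> / norm (x - y) \<le> nk (x - y) * \<bar>w y\<bar> + \<bar>w y\<bar>"
    proof (cases "norm (x - y) < 1")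
      case False
      then have "\<bar>w y\<bar> / norm (x - y) \<le> \<bar>w y\<bar> / 1" by (intro divide_left_mono) auto
      then show ?thesis using False by (simp add: nk_def)
    qed (simp add: nk_def)
    moreover have "nk (x - y) \<ge> 0" by (simp add: nk_def)
    ultimately show "ennreal (\<bar>w y\<bar> / norm (x - y)) \<le> ennreal (nk (x - y)) * ennreal \<bar>w y\<bar> + ennreal \<bar>w y\<bar>"
      by (simp add: ennreal_leI flip: ennreal_mult ennreal_plus)
  qed
  also have "\<dots> = Npot w x + (LBNN y. ennreal \<bar>w y\<bar>)"
    unfolding Npot_def by (rule nn_integral_add) measurable
  finally show ?thesis .
qed

lemma Npot_L2:
  assumes [measurable]: "w \<in> borel_measurable borel"
  shows "(LBNN x. (Npot w x)\<^sup>2) \<le> ennreal (4 * pi\<^sup>2) * (LBNN x. ennreal ((w x)\<^sup>2))"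
proof -
  have "(LBNN x. (Npot w x)\<^sup>2) \<le> (LBNN x. ennreal (nk x))\<^sup>2 * (LBNN x. (ennreal \<bar>w x\<bar>)\<^sup>2)"
    unfolding Npot_def by (rule young_L2) measurable
  also have "\<dots> \<le> (ennreal (2 * pi))\<^sup>2 * (LBNN x. (ennreal \<bar>w x\<bar>)\<^sup>2)"
    by (intro mult_right_mono power_mono nk_integral) auto
  also have "(ennreal (2 * pi))\<^sup>2 = ennreal (4 * pi\<^sup>2)" by (subst ennreal_power) (auto simp: power_mult_distrib)
  finally show ?thesis by (simp add: ennreal_power)
qed

lemma nn_w2: "L1 (\<lambda>x. (w x)\<^sup>2) \<Longrightarrow> (LBNN x. ennreal ((w x :: real)\<^sup>2)) = ennreal (LBINT x. (w x)\<^sup>2)"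
  by (rule nn_integral_eq_integral) auto

lemma nn_w1: "L1 w \<Longrightarrow> (LBNN x. ennreal \<bar>w x :: real\<bar>) = ennreal (LBINT x. \<bar>w x\<bar>)"
  by (rule nn_integral_eq_integral) auto

lemma Npot_L2':
  assumes w: "L1 w" and w2: "L1 (\<lambda>x. (w x)\<^sup>2)"
  shows "(LBNN x. (Npot w x)\<^sup>2) \<le> ennreal (4 * pi\<^sup>2 * (LBINT x. (w x)\<^sup>2))"
  using Npot_L2[of w] w unfolding nn_w2[OF w2] by (auto simp: ennreal_mult)

lemma Npot_finite:
  assumes w: "L1 w" and w2: "L1 (\<lambda>x. (w x)\<^sup>2)"
  shows "AE x in lborel. Npot w x < \<infinity>"
proof -
  have [measurable]: "w \<in> borel_measurable borel" using w by auto
  have "AE x in lborel. (Npot w x)\<^sup>2 \<noteq> \<infinity>"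
    using Npot_L2'[OF assms] by (intro nn_integral_PInf_AE) (auto simp: top_unique)
  then show ?thesis
    by eventually_elim (auto simp: power2_eq_square less_top ennreal_mult_eq_top_iff)
qed

lemma Upot_finite:
  assumes w: "L1 w" and w2: "L1 (\<lambda>x. (w x)\<^sup>2)"
  shows "AE x in lborel. Upot w x < \<infinity>"
  using Npot_finite[OF assms]
proof eventually_elim
  case (elim x)
  have "Upot w x \<le> Npot w x + (LBNN y. ennreal \<bar>w y\<bar>)" using w by (intro Upot_le) auto
  also have "\<dots> < \<infinity>" using elim nn_w1[OF w] by (simp add: ennreal_add_less_top)
  finally show ?case .
qed

section \<open>The Biot--Savart kernel as the limit of the regularised kernels\<close>

lemma perp_components[simp]: "perp x $ 1 = - (x$2)" "perp x $ 2 = x$1" by (auto simp: perp_def)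

lemma norm_perp[simp]: "norm (perp x) = norm x"
proof -
  have "(norm (perp x))\<^sup>2 = (norm x)\<^sup>2" unfolding norm_sq_vec2 by simp
  then show ?thesis by simp
qed

lemma norm_BS_K: "norm (BS_K x) = 1 / (2 * pi * norm x)"
  by (cases "x = 0") (auto simp: BS_K_def power2_eq_square field_simps)

lemma BS_K_minus: "BS_K (- x) = - BS_K x"
  unfolding BS_K_def by (simp add: vec_eq_iff forall_2)

lemma perp_measurable[measurable]: "perp \<in> borel_measurable borel"
proof -
  have "perp = (\<lambda>x. (- (x$2)) *\<^sub>R e1 + (x$1) *\<^sub>R e2)"
    by (auto simp: fun_eq_iff vec_eq_iff forall_2 axis_def)
  moreover have "(\<lambda>x::real^2. (- (x$2)) *\<^sub>R e1 + (x$1) *\<^sub>R e2) \<in> borel_measurable borel" by measurable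
  ultimately show ?thesis by simp
qed

lemma BS_K_measurable[measurable]: "BS_K \<in> borel_measurable borel"
  unfolding BS_K_def by measurable

lemma velocity_measurable[measurable]:
  assumes [measurable]: "w \<in> borel_measurable borel" shows "velocity w \<in> borel_measurable borel"
  unfolding velocity_def by (intro lborel.borel_measurable_lebesgue_integral) measurable

lemma BS_K_le: "norm (w y *\<^sub>R BS_K (x - y)) \<le> \<bar>w y\<bar> / norm (x - y)"
proof -
  have "norm (w y *\<^sub>R BS_K (x - y)) = (\<bar>w y\<bar> / norm (x - y)) / (2 * pi)" by (simp add: norm_BS_K)
  also have "\<dots> \<le> (\<bar>w y\<bar> / norm (x - y)) / 1" using pi_gt3 by (intro divide_left_mono) auto
  finally show ?thesis by simp
qed

lemma BS_K_integrable:
  assumes [measurable]: "w \<in> borel_measurable borel" and "Upot w x < \<infinity>"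
  shows "L1 (\<lambda>y. w y *\<^sub>R BS_K (x - y))"
proof (rule integrableI_bounded)
  have "(LBNN y. ennreal (norm (w y *\<^sub>R BS_K (x - y)))) \<le> Upot w x"
    unfolding Upot_def by (intro nn_integral_mono ennreal_leI BS_K_le)
  then show "(LBNN y. ennreal (norm (w y *\<^sub>R BS_K (x - y)))) < \<infinity>" using assms(2) by (rule le_less_trans)
qed measurable

lemma velocity_le_Upot:
  assumes [measurable]: "w \<in> borel_measurable borel"
  shows "ennreal (norm (velocity w x)) \<le> Upot w x"
proof (cases "L1 (\<lambda>y. w y *\<^sub>R BS_K (x - y))")
  case True
  have "ennreal (norm (velocity w x)) \<le> (LBNN y. ennreal (norm (w y *\<^sub>R BS_K (x - y))))"
    unfolding velocity_def by (rule integral_norm_bound_ennreal[OF True])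
  also have "\<dots> \<le> Upot w x" unfolding Upot_def by (intro nn_integral_mono ennreal_leI BS_K_le)
  finally show ?thesis .
qed (simp add: velocity_def not_integrable_integral_eq)

lemma velocity_component:
  assumes [measurable]: "w \<in> borel_measurable borel" and "Upot w x < \<infinity>"
  shows "velocity w x $ i = (LBINT y. w y * BS_K (x - y) $ i)"
  unfolding velocity_def
  using integral_bounded_linear[OF bounded_linear_vec_nth BS_K_integrable[OF assms], of i] by simp

lemma k_abs_le:
  assumes d: "d > 0"
  shows "\<bar>k1 d z\<bar> \<le> 1 / norm z" "\<bar>k2 d z\<bar> \<le> 1 / norm z"
proof -
  have *: "\<bar>c\<bar> * q d z \<le> 1 / norm z" if "\<bar>c\<bar> \<le> norm z" for c
  proof (cases "z = 0")
    case False
    have "\<bar>c\<bar> * q d z \<le> norm z * (1 / ((norm z)\<^sup>2))"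
      using that d False unfolding q_radial by (intro mult_mono divide_left_mono) (auto simp: add_pos_pos)
    then show ?thesis using False by (simp add: power2_eq_square)
  qed (use that in auto)
  show "\<bar>k1 d z\<bar> \<le> 1 / norm z" "\<bar>k2 d z\<bar> \<le> 1 / norm z"
    using *[of "z$2"] *[of "z$1"] qpos[OF d, of z] component_le_norm_cart[of z] by (auto simp: k1_def k2_def abs_mult)
qed

lemma k_tendsto:
  assumes z: "z \<noteq> 0"
  shows "(\<lambda>n. k1 (1 / Suc n) z) \<longlonglongrightarrow> 2 * pi * BS_K z $ 1" "(\<lambda>n. k2 (1 / Suc n) z) \<longlonglongrightarrow> 2 * pi * BS_K z $ 2"
proof -
  have "(\<lambda>n. q (1 / Suc n) z) \<longlonglongrightarrow> 1 / ((norm z)\<^sup>2 + 0)"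
    unfolding q_radial using z by (intro tendsto_intros lim_1_over_n LIMSEQ_Suc[OF lim_1_over_n]) auto
  then have q: "(\<lambda>n. q (1 / Suc n) z) \<longlonglongrightarrow> 1 / (norm z)\<^sup>2" by simp
  have "2 * pi * BS_K z $ 1 = - (z$2) * (1 / (norm z)\<^sup>2)" "2 * pi * BS_K z $ 2 = z$1 * (1 / (norm z)\<^sup>2)"
    by (simp_all add: BS_K_def)
  then show "(\<lambda>n. k1 (1 / Suc n) z) \<longlonglongrightarrow> 2 * pi * BS_K z $ 1" "(\<lambda>n. k2 (1 / Suc n) z) \<longlonglongrightarrow> 2 * pi * BS_K z $ 2"
    unfolding k1_def k2_def by (simp_all only:) (intro tendsto_intros q)+
qed

lemma Upot_dom:
  assumes [measurable]: "w \<in> borel_measurable borel" and U: "Upot w x < \<infinity>"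
  shows "L1 (\<lambda>y. \<bar>w y\<bar> / norm (x - y))" "(LBINT y. \<bar>w y\<bar> / norm (x - y)) = enn2real (Upot w x)"
proof -
  show i: "L1 (\<lambda>y. \<bar>w y\<bar> / norm (x - y))"
    using U unfolding Upot_def by (intro integrableI_bounded) auto
  show "(LBINT y. \<bar>w y\<bar> / norm (x - y)) = enn2real (Upot w x)"
    unfolding Upot_def by (rule integral_eq_nn_integral) auto
qed

lemma conv_le_Upot:
  assumes w[measurable]: "w \<in> borel_measurable borel" and U: "Upot w x < \<infinity>" and [measurable]: "k \<in> borel_measurable borel"
    and k: "\<And>z. \<bar>k z\<bar> \<le> 1 / norm z"
  shows "\<bar>conv w k x\<bar> \<le> enn2real (Upot w x)"
proof -
  have pt: "norm (w y * k (x - y)) \<le> \<bar>w y\<bar> / norm (x - y)" for y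
    using mult_left_mono[OF k[of "x - y"], of "\<bar>w y\<bar>"] by (simp add: abs_mult)
  have "norm (LBINT y. w y * k (x - y)) \<le> (LBINT y. \<bar>w y\<bar> / norm (x - y))"
  proof (rule Bochner_Integration.integral_norm_bound_integral[OF _ Upot_dom(1)[OF w U] pt])
    show "L1 (\<lambda>y. w y * k (x - y))"
      by (rule Bochner_Integration.integrable_bound[OF Upot_dom(1)[OF w U]]) (use pt in \<open>auto intro: order_trans\<close>)
  qed
  then show ?thesis unfolding conv_def Upot_dom(2)[OF w U] by simp
qed

text \<open>Dominated by the integrand of \<open>Upot\<close>. The kernels \<open>k1\<close> and
  \<open>k2\<close> lack the factor 1 / (2 pi), hence the 2 pi in the limit.\<close>

lemma conv_k_tendsto:
  assumes w[measurable]: "w \<in> borel_measurable borel" and U: "Upot w x < \<infinity>"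
  shows "(\<lambda>n. conv w (k1 (1 / Suc n)) x) \<longlonglongrightarrow> 2 * pi * velocity w x $ 1"
    "(\<lambda>n. conv w (k2 (1 / Suc n)) x) \<longlonglongrightarrow> 2 * pi * velocity w x $ 2"
proof -
  have ne: "AE y in lborel. x - y \<noteq> 0" using AE_lborel_singleton[of x] by eventually_elim auto
  have gen: "(\<lambda>n. conv w (k (1 / Suc n)) x) \<longlonglongrightarrow> 2 * pi * velocity w x $ i"
    if [measurable]: "\<And>d. k d \<in> borel_measurable borel" and b: "\<And>d z. d > 0 \<Longrightarrow> \<bar>k d z\<bar> \<le> 1 / norm z"
      and l: "\<And>z. z \<noteq> 0 \<Longrightarrow> (\<lambda>n. k (1 / Suc n) z) \<longlonglongrightarrow> 2 * pi * BS_K z $ i" for k i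
  proof -
    have "(\<lambda>n. conv w (k (1 / Suc n)) x) \<longlonglongrightarrow> (LBINT y. w y * (2 * pi * BS_K (x - y) $ i))"
      unfolding conv_def
    proof (rule integral_dominated_convergence[OF _ _ Upot_dom(1)[OF w U]])
      show "AE y in lborel. (\<lambda>n. w y * k (1 / Suc n) (x - y)) \<longlonglongrightarrow> w y * (2 * pi * BS_K (x - y) $ i)"
        using ne by eventually_elim (intro tendsto_intros l)
      show "AE y in lborel. norm (w y * k (1 / Suc n) (x - y)) \<le> \<bar>w y\<bar> / norm (x - y)" for n
        using mult_left_mono[OF b[of "1 / Suc n"], of "\<bar>w _\<bar>"] by (auto simp: abs_mult)
    qed measurable
    also have "(LBINT y. w y * (2 * pi * BS_K (x - y) $ i)) = 2 * pi * velocity w x $ i"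
      unfolding velocity_component[OF w U] by (simp add: mult.left_commute flip: integral_mult_right_zero)
    finally show ?thesis .
  qed
  show "(\<lambda>n. conv w (k1 (1 / Suc n)) x) \<longlonglongrightarrow> 2 * pi * velocity w x $ 1"
    by (rule gen) (use k_abs_le k_tendsto in auto)
  show "(\<lambda>n. conv w (k2 (1 / Suc n)) x) \<longlonglongrightarrow> 2 * pi * velocity w x $ 2"
    by (rule gen) (use k_abs_le k_tendsto in auto)
qed

lemma AE_lborel_shift:
  fixes h :: "'a::euclidean_space"
  assumes "AE x in lborel. P x" shows "AE x in lborel. P (x + h)"
proof -
  have "AE x in distr lborel borel ((+) h). P x" unfolding lborel_distr_plus by (rule assms)
  then have "AE x in lborel. P (h + x)" by (rule AE_distrD[rotated]) simp
  then show ?thesis by (simp add: add.commute)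
qed

text \<open>Fatou's lemma carries the bound of \<open>conv_k_diff_L2\<close>, which is uniform in d,
  to the limit. The velocity is that limit divided by 2 pi, so each component contributes 8 pi^2 /
  (4 pi^2) = 2. This estimate on increments is all that the sequel uses of the velocity
  gradient.\<close>

lemma velocity_diff_L2:
  assumes w: "L1 w" and w2: "L1 (\<lambda>x. (w x)\<^sup>2)"
  shows "(LBNN x. ennreal ((norm (velocity w (x + h) - velocity w x))\<^sup>2)) \<le> ennreal (4 * (LBINT x. (w x)\<^sup>2) * (norm h)\<^sup>2)"
proof -
  define Q where "Q = (LBINT x. (w x)\<^sup>2)"
  have Q0: "Q \<ge> 0" by (simp add: Q_def)
  have wm[measurable]: "w \<in> borel_measurable borel" using w by auto
  note D = conv_k_diff_L2[OF w w2, folded Q_def]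
  have gen: "(LBNN x. ennreal ((velocity w (x + h) $ i - velocity w x $ i)\<^sup>2)) \<le> ennreal (2 * Q * (norm h)\<^sup>2)"
    if [measurable]: "\<And>d. k d \<in> borel_measurable borel" and
     lim: "\<And>x. Upot w x < \<infinity> \<Longrightarrow> (\<lambda>n. conv w (k (1 / Suc n)) x) \<longlonglongrightarrow> 2 * pi * velocity w x $ i" and
     bd: "\<And>d. d > 0 \<Longrightarrow> (LBNN x. ennreal ((conv w (k d) (x + h) - conv w (k d) x)\<^sup>2)) \<le> ennreal (8 * pi\<^sup>2 * Q * (norm h)\<^sup>2)" for k i
  proof -
    let ?g = "\<lambda>n x. ennreal ((conv w (k (1 / Suc n)) (x + h) - conv w (k (1 / Suc n)) x)\<^sup>2)"
    have "AE x in lborel. Upot w (x + h) < \<infinity>" by (rule AE_lborel_shift[OF Upot_finite[OF w w2]])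
    then have ae: "AE x in lborel. ennreal (4 * pi\<^sup>2 * (velocity w (x + h) $ i - velocity w x $ i)\<^sup>2) = liminf (\<lambda>n. ?g n x)"
      using Upot_finite[OF w w2]
    proof eventually_elim
      case (elim x)
      have "(\<lambda>n. ?g n x) \<longlonglongrightarrow> ennreal ((2 * pi * velocity w (x + h) $ i - 2 * pi * velocity w x $ i)\<^sup>2)"
        by (intro tendsto_ennrealI tendsto_intros lim elim)
      from lim_imp_Liminf[OF _ this] show ?case
        by (simp add: power_mult_distrib flip: right_diff_distrib)
    qed
    have "ennreal (4 * pi\<^sup>2) * (LBNN x. ennreal ((velocity w (x + h) $ i - velocity w x $ i)\<^sup>2))
      = (LBNN x. ennreal (4 * pi\<^sup>2 * (velocity w (x + h) $ i - velocity w x $ i)\<^sup>2))"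
      by (subst nn_integral_cmult[symmetric]) (auto simp: ennreal_mult)
    also have "\<dots> = (LBNN x. liminf (\<lambda>n. ?g n x))"
      by (rule nn_integral_cong_AE[OF ae])
    also have "\<dots> \<le> liminf (\<lambda>n. LBNN x. ?g n x)"
      by (rule nn_integral_liminf) measurable
    also have "\<dots> \<le> liminf (\<lambda>n. ennreal (8 * pi\<^sup>2 * Q * (norm h)\<^sup>2))"
      by (intro Liminf_mono always_eventually allI bd) auto
    also have "\<dots> = ennreal (4 * pi\<^sup>2) * ennreal (2 * Q * (norm h)\<^sup>2)"
      using Q0 by (simp add: Liminf_const ennreal_mult[symmetric])
    finally show ?thesis
      by (subst (asm) ennreal_mult_le_mult_iff) auto
  qed
  have v: "(norm (velocity w (x + h) - velocity w x))\<^sup>2 = (velocity w (x + h) $ 1 - velocity w x $ 1)\<^sup>2 + (velocity w (x + h) $ 2 - velocity w x $ 2)\<^sup>2" for x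
    by (simp add: norm_sq_vec2)
  have "(LBNN x. ennreal ((norm (velocity w (x + h) - velocity w x))\<^sup>2)) =
     (LBNN x. ennreal ((velocity w (x + h) $ 1 - velocity w x $ 1)\<^sup>2)) + (LBNN x. ennreal ((velocity w (x + h) $ 2 - velocity w x $ 2)\<^sup>2))"
    unfolding v by (subst nn_integral_add[symmetric]) (auto intro!: nn_integral_cong simp: ennreal_plus)
  also have "\<dots> \<le> ennreal (2 * Q * (norm h)\<^sup>2) + ennreal (2 * Q * (norm h)\<^sup>2)"
    by (intro add_mono gen[of k1] gen[of k2] D conv_k_tendsto wm) auto
  also have "\<dots> = ennreal (4 * Q * (norm h)\<^sup>2)" using Q0 by (subst ennreal_plus[symmetric]) auto
  finally show ?thesis unfolding Q_def .
qed

lemma cont_supp_integrable: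
  fixes f :: "'a::euclidean_space \<Rightarrow> real"
  assumes c: "continuous_on UNIV f" and s: "\<And>x. norm x > R \<Longrightarrow> f x = 0"
  shows "L1 f" "\<exists>B\<ge>0. \<forall>x. \<bar>f x\<bar> \<le> B"
proof -
  have "L1 (\<lambda>x. indicator (cball 0 R) x *\<^sub>R f x)"
    by (rule borel_integrable_compact) (auto intro: continuous_on_subset[OF c])
  moreover have "(\<lambda>x. indicator (cball 0 R) x *\<^sub>R f x) = f" using s by (auto simp: fun_eq_iff indicator_def not_le)
  ultimately show "L1 f" by simp
  have "compact (f ` cball 0 R)" by (intro compact_continuous_image continuous_on_subset[OF c]) auto
  then obtain B where "\<forall>x\<in>cball 0 R. \<bar>f x\<bar> \<le> B"
    using compact_imp_bounded[of "f ` cball 0 R"] unfolding bounded_iff by auto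
  then have B: "\<bar>f x\<bar> \<le> B" if "x \<in> cball 0 R" for x using that by blast
  have "\<bar>f x\<bar> \<le> max B 0" for x using B[of x] s[of x] by (cases "norm x \<le> R") auto
  then show "\<exists>B\<ge>0. \<forall>x. \<bar>f x\<bar> \<le> B" by (intro exI[of _ "max B 0"]) auto
qed

text \<open>The inequality t \<le> t^2 + 1 trades the L^2 bound on the near part for integrability
  on a ball, and the far part is at most the mass.\<close>

lemma Upot_local_integrable:
  assumes w: "L1 w" and w2: "L1 (\<lambda>x. (w x)\<^sup>2)"
  shows "L1 (\<lambda>x. indicator (cball 0 R) x * enn2real (Upot w x))"
proof (rule integrableI_bounded)
  have [measurable]: "w \<in> borel_measurable borel" "cball (0::real^2) R \<in> sets borel" using w by auto
  define W where "W = (LBINT x. \<bar>w x\<bar>)"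
  have W: "(LBNN x. ennreal \<bar>w x\<bar>) = ennreal W" "W \<ge> 0" using nn_w1[OF w] by (auto simp: W_def)
  have 1: "ennreal (norm (indicator (cball 0 R) x * enn2real (Upot w x))) \<le> (Npot w x)\<^sup>2 + ennreal (1 + W) * indicator (cball 0 R) x" for x
  proof (cases "x \<in> cball 0 R")
    case True
    have "(t::ennreal) \<le> t\<^sup>2 + 1" for t
    proof (cases "t \<le> 1")
      case False then have "t * 1 \<le> t * t" by (intro mult_left_mono) auto
      then show ?thesis by (simp add: power2_eq_square add_increasing2)
    qed (simp add: add_increasing)
    from this[of "Npot w x"] have "Upot w x \<le> (Npot w x)\<^sup>2 + 1 + ennreal W"
      using Upot_le[of w x] unfolding W by (auto intro: order_trans add_right_mono)
    moreover have "ennreal (enn2real (Upot w x)) \<le> Upot w x" by (cases "Upot w x") auto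
    ultimately have "ennreal (enn2real (Upot w x)) \<le> (Npot w x)\<^sup>2 + (1 + ennreal W)" by (simp add: add.assoc)
    then show ?thesis using True W by (simp add: ennreal_plus)
  qed auto
  have "(LBNN x. ennreal (norm (indicator (cball 0 R) x * enn2real (Upot w x))))
     \<le> (LBNN x. (Npot w x)\<^sup>2 + ennreal (1 + W) * indicator (cball 0 R) x)"
    by (intro nn_integral_mono 1)
  also have "\<dots> = (LBNN x. (Npot w x)\<^sup>2) + (LBNN x. ennreal (1 + W) * indicator (cball 0 R) (x::real^2))"
    by (rule nn_integral_add) measurable
  also have "(LBNN x. ennreal (1 + W) * indicator (cball 0 R) (x::real^2)) = ennreal (1 + W) * emeasure lborel (cball 0 R :: (real^2) set)"
    by (rule nn_integral_cmult_indicator) simp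
  also have "(LBNN x. (Npot w x)\<^sup>2) + ennreal (1 + W) * emeasure lborel (cball 0 R :: (real^2) set) < \<infinity>"
    using Npot_L2'[OF w w2] emeasure_lborel_cball_finite[of "0::real^2" R]
    by (auto simp: ennreal_add_less_top ennreal_mult_less_top order_le_less_trans)
  finally show "(LBNN x. ennreal (norm (indicator (cball 0 R) x * enn2real (Upot w x)))) < \<infinity>" .
  show "(\<lambda>x. indicator (cball 0 R) x * enn2real (Upot w x)) \<in> borel_measurable lborel" by measurable
qed

lemma velocity_le_real:
  assumes "w \<in> borel_measurable borel" "Upot w x < \<infinity>"
  shows "norm (velocity w x) \<le> enn2real (Upot w x)"
  using velocity_le_Upot[OF assms(1), of x] assms(2) by (cases "Upot w x") (auto simp: ennreal_le_iff2)

lemma velocity_test_integrable: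
  assumes w: "L1 w" and w2: "L1 (\<lambda>x. (w x)\<^sup>2)"
    and [measurable]: "g \<in> borel_measurable borel" and B: "\<And>x. \<bar>g x\<bar> \<le> B" and s: "\<And>x. norm x > R \<Longrightarrow> g x = 0"
  shows "L1 (\<lambda>x. enn2real (Upot w x) * g x)" "L1 (\<lambda>x. velocity w x $ i * g x)"
proof -
  have [measurable]: "w \<in> borel_measurable borel" using w by auto
  have B0: "B \<ge> 0" using B[of 0] by linarith
  note I = integrable_mult_right[OF Upot_local_integrable[OF w w2, of R], of B]
  have g: "\<bar>g x\<bar> \<le> B * indicator (cball 0 R) x" for x using B[of x] s[of x] by (auto simp: indicator_def not_le)
  show "L1 (\<lambda>x. enn2real (Upot w x) * g x)"
  proof (rule Bochner_Integration.integrable_bound[OF I])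
    show "AE x in lborel. norm (enn2real (Upot w x) * g x) \<le> norm (B * (indicator (cball 0 R) x * enn2real (Upot w x)))"
    proof (rule AE_I2)
      fix x
      have "\<bar>g x\<bar> * enn2real (Upot w x) \<le> (B * indicator (cball 0 R) x) * enn2real (Upot w x)" by (intro mult_right_mono g) auto
      then show "norm (enn2real (Upot w x) * g x) \<le> norm (B * (indicator (cball 0 R) x * enn2real (Upot w x)))"
        using B0 by (simp add: abs_mult mult_ac)
    qed
  qed measurable
  show "L1 (\<lambda>x. velocity w x $ i * g x)"
  proof (rule Bochner_Integration.integrable_bound[OF I])
    show "AE x in lborel. norm (velocity w x $ i * g x) \<le> norm (B * (indicator (cball 0 R) x * enn2real (Upot w x)))"
      using Upot_finite[OF w w2]
    proof eventually_elim
      case (elim x)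
      have "\<bar>velocity w x $ i\<bar> \<le> enn2real (Upot w x)"
        using velocity_le_real[OF _ elim] component_le_norm_cart[of "velocity w x" i] by auto
      then have "\<bar>velocity w x $ i\<bar> * \<bar>g x\<bar> \<le> enn2real (Upot w x) * (B * indicator (cball 0 R) x)"
        by (intro mult_mono g) auto
      then show ?case using B0 by (simp add: abs_mult mult_ac)
    qed
  qed measurable
qed

text \<open>For the regularised kernel the e1-derivative of \<open>k1\<close> and the e2-derivative
  of \<open>k2\<close> are \<open>kA\<close> and \<open>- kA\<close>, so the two integrations by
  parts cancel exactly. The limit d to 0 is dominated by \<open>Upot\<close> times the derivatives
  of the test function; no derivative of the velocity itself is formed.\<close>

lemma velocity_div_free:
  assumes w: "L1 w" and w2: "L1 (\<lambda>x. (w x)\<^sup>2)"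
    and D: "dird f e1 f1" "dird f e2 f2"
    and c: "continuous_on UNIV f" "continuous_on UNIV f1" "continuous_on UNIV f2"
    and s: "\<And>x. norm x > R \<Longrightarrow> f x = 0" "\<And>x. norm x > R \<Longrightarrow> f1 x = 0" "\<And>x. norm x > R \<Longrightarrow> f2 x = 0"
  shows "(LBINT x. velocity w x $ 1 * f1 x + velocity w x $ 2 * f2 x) = 0"
proof -
  have wm[measurable]: "w \<in> borel_measurable borel" using w by auto
  have [measurable]: "f1 \<in> borel_measurable borel" "f2 \<in> borel_measurable borel" "f \<in> borel_measurable borel"
    using c by (auto simp: borel_measurable_continuous_onI)
  obtain B1 where B1: "\<And>x. \<bar>f1 x\<bar> \<le> B1" using cont_supp_integrable(2)[OF c(2) s(2)] by auto
  obtain B2 where B2: "\<And>x. \<bar>f2 x\<bar> \<le> B2" using cont_supp_integrable(2)[OF c(3) s(3)] by auto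
  have reg: "(LBINT x. conv w (k1 d) x * f1 x + conv w (k2 d) x * f2 x) = 0" if d: "d > 0" for d
  proof -
    note C = continuous_k[OF d] and K = k_dird[OF d] and B = k_bounds[OF d]
    have sb: "sqrt (q d x) \<le> sqrt (1 / d)" for x using qpos[OF d, of x] qle[OF d, of x] by auto
    have b: "\<bar>k1 d x\<bar> \<le> sqrt (1/d)" "\<bar>k2 d x\<bar> \<le> sqrt (1/d)" for x using B[of x] sb[of x] by linarith+
    have sh: "continuous_on UNIV (\<lambda>x. g (x - c))" if "continuous_on UNIV g" for g :: "real^2 \<Rightarrow> real" and c
      by (intro continuous_on_compose2[OF that] continuous_intros) auto
    have int: "L1 (\<lambda>x. k (x - y) * g x)" if "continuous_on UNIV k" "continuous_on UNIV g" "\<And>x. norm x > R \<Longrightarrow> g x = 0" for k g :: "real^2 \<Rightarrow> real" and y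
      by (rule cont_supp_integrable(1)[of _ R]) (use that sh[of k] in \<open>auto intro!: continuous_intros\<close>)
    have z1: "(LBINT x. kA d (x - y) * f x + k1 d (x - y) * f1 x) = 0" for y
      by (rule integral_dird_zero[OF dird_mult[OF dird_shift[OF K(1)] D(1)]])
         (use int c s C sh in \<open>auto intro!: continuous_intros\<close>)
    have z2: "(LBINT x. - kA d (x - y) * f x + k2 d (x - y) * f2 x) = 0" for y
      by (rule integral_dird_zero[OF dird_mult[OF dird_shift[OF K(4)] D(2)]])
         (use int c s C sh in \<open>auto intro!: continuous_intros\<close>)
    have zero: "(LBINT x. k1 d (x - y) * f1 x) + (LBINT x. k2 d (x - y) * f2 x) = 0" for y
      using z1[of y] z2[of y] int[OF C(3) c(1) s(1), of y] int[OF C(1) c(2) s(2), of y] int[OF C(2) c(3) s(3), of y] by simp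
    have F: "integrable (lborel \<Otimes>\<^sub>M lborel) (\<lambda>(y, x). w y * k (x - y) * g x)"
      "L1 (\<lambda>x. conv w k x * g x)" "L1 (\<lambda>y. w y * (LBINT x. k (x - y) * g x))"
      "(LBINT x. conv w k x * g x) = (LBINT y. w y * (LBINT x. k (x - y) * g x))"
      if [measurable]: "k \<in> borel_measurable borel" "g \<in> borel_measurable borel" and kb: "\<And>x. \<bar>k x\<bar> \<le> B" and gi: "L1 g" for k g :: "real^2 \<Rightarrow> real" and B
    proof -
      have B0: "B \<ge> 0" using kb[of 0] by linarith
      show I: "integrable (lborel \<Otimes>\<^sub>M lborel) (\<lambda>(y, x). w y * k (x - y) * g x)"
      proof (rule Bochner_Integration.integrable_bound[OF integrable_mult_right[OF integral_prod_split(1)[OF w gi], of B]])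
        show "AE p in lborel \<Otimes>\<^sub>M lborel. norm (case p of (y, x) \<Rightarrow> w y * k (x - y) * g x) \<le> norm (B * (w (fst p) * g (snd p)))"
        proof (rule AE_I2)
          fix p :: "(real^2) \<times> (real^2)"
          obtain y x where p: "p = (y, x)" by (cases p)
          have "\<bar>k (x - y)\<bar> * (\<bar>w y\<bar> * \<bar>g x\<bar>) \<le> B * (\<bar>w y\<bar> * \<bar>g x\<bar>)" by (intro mult_right_mono kb) auto
          then show "norm (case p of (y, x) \<Rightarrow> w y * k (x - y) * g x) \<le> norm (B * (w (fst p) * g (snd p)))"
            using B0 by (simp add: p abs_mult mult_ac)
        qed
      qed measurable
      have e1: "(LBINT y. w y * k (x - y) * g x) = conv w k x * g x" for x by (simp add: conv_def)
      have e2: "(LBINT x. w y * k (x - y) * g x) = w y * (LBINT x. k (x - y) * g x)" for y by (simp add: mult.assoc)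
      show "L1 (\<lambda>x. conv w k x * g x)" using lborel_pair.integrable_snd[OF I] unfolding e1 .
      show "L1 (\<lambda>y. w y * (LBINT x. k (x - y) * g x))" using lborel_pair.integrable_fst[OF I] unfolding e2 .
      show "(LBINT x. conv w k x * g x) = (LBINT y. w y * (LBINT x. k (x - y) * g x))"
        using lborel_pair.Fubini_integral[OF I] unfolding e1 e2 .
    qed
    note F1 = F(2-)[of "k1 d" f1, OF _ _ b(1) cont_supp_integrable(1)[OF c(2) s(2)]]
    note F2 = F(2-)[of "k2 d" f2, OF _ _ b(2) cont_supp_integrable(1)[OF c(3) s(3)]]
    have "(LBINT x. conv w (k1 d) x * f1 x + conv w (k2 d) x * f2 x)
      = (LBINT y. w y * (LBINT x. k1 d (x - y) * f1 x)) + (LBINT y. w y * (LBINT x. k2 d (x - y) * f2 x))"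
      using F1 F2 by simp
    also have "\<dots> = (LBINT y. w y * (LBINT x. k1 d (x - y) * f1 x) + w y * (LBINT x. k2 d (x - y) * f2 x))"
      using F1 F2 by simp
    also have "\<dots> = 0" unfolding distrib_left[symmetric] zero by simp
    finally show ?thesis .
  qed
  have "(\<lambda>n. LBINT x. conv w (k1 (1 / Suc n)) x * f1 x + conv w (k2 (1 / Suc n)) x * f2 x) \<longlonglongrightarrow>
     (LBINT x. (2 * pi * velocity w x $ 1) * f1 x + (2 * pi * velocity w x $ 2) * f2 x)"
  proof (rule integral_dominated_convergence[where w="\<lambda>x. enn2real (Upot w x) * \<bar>f1 x\<bar> + enn2real (Upot w x) * \<bar>f2 x\<bar>"])
    show "L1 (\<lambda>x. enn2real (Upot w x) * \<bar>f1 x\<bar> + enn2real (Upot w x) * \<bar>f2 x\<bar>)"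
      by (intro Bochner_Integration.integrable_add velocity_test_integrable(1)[OF w w2, of _ B1 R] velocity_test_integrable(1)[OF w w2, of _ B2 R])
         (use B1 B2 s in auto)
    show "AE x in lborel. (\<lambda>n. conv w (k1 (1 / Suc n)) x * f1 x + conv w (k2 (1 / Suc n)) x * f2 x)
       \<longlonglongrightarrow> (2 * pi * velocity w x $ 1) * f1 x + (2 * pi * velocity w x $ 2) * f2 x"
      using Upot_finite[OF w w2] by eventually_elim (intro tendsto_intros conv_k_tendsto wm)
    show "AE x in lborel. norm (conv w (k1 (1 / Suc n)) x * f1 x + conv w (k2 (1 / Suc n)) x * f2 x)
       \<le> enn2real (Upot w x) * \<bar>f1 x\<bar> + enn2real (Upot w x) * \<bar>f2 x\<bar>" for n
      using Upot_finite[OF w w2]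
    proof eventually_elim
      case (elim x)
      have "\<bar>conv w (k1 (1 / Suc n)) x\<bar> * \<bar>f1 x\<bar> \<le> enn2real (Upot w x) * \<bar>f1 x\<bar>"
        "\<bar>conv w (k2 (1 / Suc n)) x\<bar> * \<bar>f2 x\<bar> \<le> enn2real (Upot w x) * \<bar>f2 x\<bar>"
        by (intro mult_right_mono conv_le_Upot wm elim k_abs_le; simp)+
      then show ?case unfolding abs_mult[symmetric] by (simp add: abs_triangle_ineq[THEN order_trans])
    qed
  qed measurable
  then have "(LBINT x. (2 * pi * velocity w x $ 1) * f1 x + (2 * pi * velocity w x $ 2) * f2 x) = 0"
    using LIMSEQ_unique[OF _ tendsto_const] by (simp add: reg)
  moreover have "(LBINT x. (2 * pi * velocity w x $ 1) * f1 x + (2 * pi * velocity w x $ 2) * f2 x)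
     = 2 * pi * (LBINT x. velocity w x $ 1 * f1 x + velocity w x $ 2 * f2 x)"
    by (simp add: distrib_left mult.assoc flip: integral_mult_right_zero)
  ultimately show ?thesis by simp
qed

section \<open>Mollifiers\<close>

lemma Ck_antimono: "Ck (Suc k) f \<Longrightarrow> Ck k f"
proof (induction k arbitrary: f)
  case 0
  then show ?case by (auto intro: differentiable_imp_continuous_on)
next
  case (Suc k)
  then show ?case by (metis Ck.simps(2))
qed

lemma Ck_const: "Ck k (\<lambda>x. c)"
proof (induction k arbitrary: c)
  case (Suc k)
  then show ?case by simp
qed simp

lemma Ck_add: "Ck k f \<Longrightarrow> Ck k g \<Longrightarrow> Ck k (\<lambda>x. f x + g x)"
proof (induction k arbitrary: f g)
  case (Suc k)
  have d: "f differentiable at x" "g differentiable at x" for x using Suc.prems by (auto simp: differentiable_on_def)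
  have "frechet_derivative (\<lambda>x. f x + g x) (at x) = (\<lambda>h. frechet_derivative f (at x) h + frechet_derivative g (at x) h)" for x
    using d by (intro frechet_derivative_at[symmetric] has_derivative_add) (auto simp: frechet_derivative_works[symmetric])
  then show ?case using Suc d by (auto simp: differentiable_on_def intro!: differentiable_add)
qed (auto intro: continuous_intros)

lemma Ck_mult: "Ck k f \<Longrightarrow> Ck k g \<Longrightarrow> Ck k (\<lambda>x. f x * g x)"
proof (induction k arbitrary: f g)
  case (Suc k)
  have d: "f differentiable at x" "g differentiable at x" for x using Suc.prems by (auto simp: differentiable_on_def)
  have e: "frechet_derivative (\<lambda>x. f x * g x) (at x) = (\<lambda>h. f x * frechet_derivative g (at x) h + frechet_derivative f (at x) h * g x)" for x
    using d by (intro frechet_derivative_at[symmetric] has_derivative_mult) (auto simp: frechet_derivative_works[symmetric])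
  have "Ck k f" "Ck k g" using Suc.prems Ck_antimono by blast+
  then show ?case using Suc d unfolding Ck.simps(2) e
    by (auto simp: differentiable_on_def intro!: differentiable_mult Ck_add)
qed (auto intro: continuous_intros)

text \<open>The whole tower D of successive derivatives is given, so that the induction on k can
  treat all n at once; differentiating along b only brings in the constant factor
  \<open>l b\<close>.\<close>

lemma Ck_affine:
  fixes D :: "nat \<Rightarrow> real \<Rightarrow> real"
  assumes D: "\<And>n t. (D n has_real_derivative D (Suc n) t) (at t)" and l: "bounded_linear l"
  shows "Ck k (\<lambda>x. D n (a + l x))"
proof (induction k arbitrary: n)
  case 0
  have "isCont (D n) t" for t using D DERIV_isCont by blast
  then have "continuous_on UNIV (D n)" by (simp add: continuous_at_imp_continuous_on)
  moreover have "continuous_on UNIV (\<lambda>x. a + l x)" by (intro continuous_intros linear_continuous_on l)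
  ultimately show ?case by (auto intro: continuous_on_compose2)
next
  case (Suc k)
  have d: "((\<lambda>x. D n (a + l x)) has_derivative (\<lambda>h. l h * D (Suc n) (a + l x))) (at x)" for x
  proof (rule DERIV_compose_FDERIV[OF D])
    show "((\<lambda>x. a + l x) has_derivative l) (at x)"
      using bounded_linear_imp_has_derivative[OF l] by (auto intro!: derivative_eq_intros)
  qed
  have e: "frechet_derivative (\<lambda>x. D n (a + l x)) (at x) = (\<lambda>h. l h * D (Suc n) (a + l x))" for x
    using frechet_derivative_at[OF d] by simp
  show ?case unfolding Ck.simps(2) e
    using d Suc by (auto simp: differentiable_on_def differentiable_def intro!: Ck_mult Ck_const)
qed

text \<open>The derivative of p(1/t) exp(-1/t) is (p - p')(1/t) exp(-1/t) / t^2. The recursion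
  records this, with \<open>monom 1 2\<close> for the factor 1/t^2, so that \<open>edec n\<close> is
  the n-th derivative of exp(-1/t) continued by 0.\<close>

fun epoly :: "nat \<Rightarrow> real poly" where
  "epoly 0 = 1"
| "epoly (Suc n) = monom 1 2 * (epoly n - pderiv (epoly n))"

definition edec :: "nat \<Rightarrow> real \<Rightarrow> real" where
  "edec n t = (if t > 0 then poly (epoly n) (1 / t) * exp (- (1 / t)) else 0)"

text \<open>The additional power s^k makes the induction over the coefficients close: passing from p
  to \<open>pCons a p\<close> multiplies p by s.\<close>

lemma poly_exp_decay: "((\<lambda>s. s ^ k * poly p s / exp s) \<longlongrightarrow> (0::real)) at_top"
proof (induction p arbitrary: k)
  case (pCons a p)
  have "((\<lambda>s. a * (s ^ k / exp s) + s ^ (Suc k) * poly p s / exp s) \<longlongrightarrow> a * 0 + 0) at_top"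
    by (intro tendsto_intros tendsto_power_div_exp_0 pCons)
  moreover have "(\<lambda>s. a * (s ^ k / exp s) + s ^ (Suc k) * poly p s / exp s) = (\<lambda>s. s ^ k * poly (pCons a p) s / exp s)"
    by (auto simp: fun_eq_iff field_simps)
  ultimately show ?case by simp
qed simp

lemma edec_deriv: "(edec n has_real_derivative edec (Suc n) t) (at t)"
proof -
  consider "t > 0" | "t < 0" | "t = 0" by linarith
  then show ?thesis
  proof cases
    case 1
    have "((\<lambda>t. poly (epoly n) (1 / t) * exp (- (1 / t))) has_real_derivative edec (Suc n) t) (at t)"
      using 1 by (auto intro!: derivative_eq_intros DERIV_chain2[OF poly_DERIV]
        simp: edec_def poly_monom power2_eq_square field_simps)
    then show ?thesis
      by (rule DERIV_cong_ev[THEN iffD1, rotated -1])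
         (use 1 in \<open>auto simp: edec_def intro!: eventually_mono[OF eventually_nhds_in_open[of "{0<..}"]]\<close>)
  next
    case 2
    have "((\<lambda>t. 0) has_real_derivative edec (Suc n) t) (at t)" using 2 by (simp add: edec_def)
    then show ?thesis
      by (rule DERIV_cong_ev[THEN iffD1, rotated -1])
         (use 2 in \<open>auto simp: edec_def intro!: eventually_mono[OF eventually_nhds_in_open[of "{..<0}"]]\<close>)
  next
    case 3
    have r: "((\<lambda>h. (edec n (0 + h) - edec n 0) / h) \<longlongrightarrow> 0) (at_right 0)"
    proof -
      \<comment> \<open>With s = 1/h the difference quotient at 0 becomes s p(s) / exp s.\<close>
      have "((\<lambda>h. (inverse h) ^ 1 * poly (epoly n) (inverse h) / exp (inverse h)) \<longlongrightarrow> 0) (at_right 0)"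
        by (rule filterlim_compose[OF poly_exp_decay filterlim_inverse_at_top_right])
      then show ?thesis
        by (rule Lim_transform_eventually)
           (auto simp: edec_def eventually_at_filter field_simps exp_minus inverse_eq_divide)
    qed
    have l: "((\<lambda>h. (edec n (0 + h) - edec n 0) / h) \<longlongrightarrow> 0) (at_left 0)"
      by (rule Lim_transform_eventually[OF tendsto_const])
         (auto simp: edec_def eventually_at_filter)
    show ?thesis using filterlim_split_at[OF l r] 3 unfolding DERIV_def by (simp add: edec_def)
  qed
qed

lemma edec_cont: "continuous_on S (edec n)"
  using edec_deriv DERIV_isCont by (blast intro: continuous_at_imp_continuous_on)

lemma edec_zero: "t \<le> 0 \<Longrightarrow> edec n t = 0" by (simp add: edec_def)
lemma edec_0: "edec 0 t \<ge> 0" "t > 0 \<Longrightarrow> edec 0 t > 0" by (auto simp: edec_def)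

text \<open>On (-1, 1) this is exp(-2 / (1 - t^2)), the standard bump. As a product of two one-sided
  factors it is smooth without a separate argument at the end points. \<open>b1\<close> and
  \<open>b2\<close> are its first two derivatives, as many as the Laplacian requires.\<close>

definition b0 :: "real \<Rightarrow> real" where "b0 t = edec 0 (1 + t) * edec 0 (1 - t)"
definition b1 :: "real \<Rightarrow> real" where "b1 t = edec 1 (1 + t) * edec 0 (1 - t) - edec 0 (1 + t) * edec 1 (1 - t)"
definition b2 :: "real \<Rightarrow> real" where
  "b2 t = edec 2 (1 + t) * edec 0 (1 - t) - 2 * (edec 1 (1 + t) * edec 1 (1 - t)) + edec 0 (1 + t) * edec 2 (1 - t)"

lemma edec_chain: "((\<lambda>t. edec n (1 + t)) has_real_derivative edec (Suc n) (1 + t)) (at t)"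
  "((\<lambda>t. edec n (1 - t)) has_real_derivative - edec (Suc n) (1 - t)) (at t)"
proof -
  have "((\<lambda>t. 1 + t) has_real_derivative 1) (at t)" "((\<lambda>t. 1 - t) has_real_derivative -1) (at t)"
    by (auto intro!: derivative_eq_intros)
  from DERIV_chain2[OF edec_deriv[of n "1 + t"] this(1)] DERIV_chain2[OF edec_deriv[of n "1 - t"] this(2)]
  show "((\<lambda>t. edec n (1 + t)) has_real_derivative edec (Suc n) (1 + t)) (at t)"
    "((\<lambda>t. edec n (1 - t)) has_real_derivative - edec (Suc n) (1 - t)) (at t)" by simp_all
qed

lemma b_deriv: "(b0 has_real_derivative b1 t) (at t)" "(b1 has_real_derivative b2 t) (at t)"
proof -
  have e: "b0 = (\<lambda>t. edec 0 (1 + t) * edec 0 (1 - t))"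
    "b1 = (\<lambda>t. edec 1 (1 + t) * edec 0 (1 - t) - edec 0 (1 + t) * edec 1 (1 - t))"
    by (auto simp: b0_def b1_def)
  show "(b0 has_real_derivative b1 t) (at t)" unfolding e
    by (rule DERIV_cong[OF DERIV_mult[OF edec_chain(1)[of 0] edec_chain(2)[of 0]]]) simp
  show "(b1 has_real_derivative b2 t) (at t)" unfolding e
    by (rule DERIV_cong[OF DERIV_diff[OF DERIV_mult[OF edec_chain(1)[of 1] edec_chain(2)[of 0]] DERIV_mult[OF edec_chain(1)[of 0] edec_chain(2)[of 1]]]])
       (simp add: b2_def numeral_2_eq_2)
qed

lemma b_cont[continuous_intros]: "continuous_on S b0" "continuous_on S b1" "continuous_on S b2"
  unfolding b0_def b1_def b2_def
  by (intro continuous_intros continuous_on_compose2[OF edec_cont[of UNIV]]; simp)+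

lemma b_measurable[measurable]: "b0 \<in> borel_measurable borel" "b1 \<in> borel_measurable borel" "b2 \<in> borel_measurable borel"
  by (auto intro!: borel_measurable_continuous_onI continuous_intros)

lemma b_supp: "\<bar>t\<bar> \<ge> 1 \<Longrightarrow> b0 t = 0" "\<bar>t\<bar> \<ge> 1 \<Longrightarrow> b1 t = 0" "\<bar>t\<bar> \<ge> 1 \<Longrightarrow> b2 t = 0"
proof -
  have "edec n (1 + t) = 0 \<or> edec m (1 - t) = 0" if "\<bar>t\<bar> \<ge> 1" for n m
    using that edec_zero[of "1 + t" n] edec_zero[of "1 - t" m] by linarith
  then show "\<bar>t\<bar> \<ge> 1 \<Longrightarrow> b0 t = 0" "\<bar>t\<bar> \<ge> 1 \<Longrightarrow> b1 t = 0" "\<bar>t\<bar> \<ge> 1 \<Longrightarrow> b2 t = 0"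
    unfolding b0_def b1_def b2_def by (metis mult_eq_0_iff diff_0_right mult_zero_left mult_zero_right add_0)+
qed

lemma b0_nonneg: "b0 t \<ge> 0" by (simp add: b0_def edec_0)
lemma b0_pos: "b0 0 > 0" by (simp add: b0_def edec_0)

lemma integral_pos_of_cont:
  fixes f :: "'a::euclidean_space \<Rightarrow> real"
  assumes c: "continuous_on UNIV f" and i: "L1 f" and nn: "\<And>x. f x \<ge> 0" and p: "f 0 > 0"
  shows "(LBINT x. f x) > 0"
proof -
  have "isCont f 0" using c by (simp add: continuous_on_eq_continuous_at)
  from continuous_at_eps_delta[THEN iffD1, OF this, rule_format, of "f 0 / 2"] p
  obtain d where d: "d > 0" "\<And>x. norm x < d \<Longrightarrow> \<bar>f x - f 0\<bar> < f 0 / 2" by (auto simp: dist_norm)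
  have lb: "indicator (ball 0 d) x * (f 0 / 2) \<le> f x" for x
    using d(2)[of x] nn[of x] p by (auto simp: indicator_def abs_if split: if_splits)
  have "0 < measure lborel (ball (0::'a) d) * (f 0 / 2)" using content_ball_pos[OF d(1), of "0::'a"] p by simp
  also have "\<dots> = (\<integral>x. indicator (ball 0 d) x * (f 0 / 2) \<partial>(lborel::'a measure))" by simp
  also have "\<dots> \<le> (LBINT x. f x)"
    using i lb emeasure_lborel_ball_finite[of "0::'a" d] by (intro integral_mono) (auto intro!: integrable_mult_left)
  finally show ?thesis .
qed

definition c1 :: real where "c1 = (LBINT t. b0 t)"
definition c2 :: real where "c2 = (LBINT x. b0 ((x::real^2)$1) * b0 (x$2))"

lemma norm_le_vec2: "norm (x::real^2) \<le> \<bar>x$1\<bar> + \<bar>x$2\<bar>"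
  using norm_le_l1_cart[of x] by (simp add: sum_2)

text \<open>The product lives in the square |x1| < 1, |x2| < 1. There |x| \<le> |x1| + |x2| < 2,
  which is the origin of the radius 2 here and of 2 e below.\<close>

lemma bb_supp:
  assumes "\<And>t. \<bar>t\<bar> \<ge> 1 \<Longrightarrow> f t = 0" "\<And>t. \<bar>t\<bar> \<ge> 1 \<Longrightarrow> g t = (0::real)" "norm (x::real^2) > 2"
  shows "f (x$1) * g (x$2) = (0::real)"
  using assms(1)[of "x$1"] assms(2)[of "x$2"] norm_le_vec2[of x] assms(3) by (cases "\<bar>x$1\<bar> \<ge> 1") auto

lemma bb_int:
  assumes "\<And>t. \<bar>t\<bar> \<ge> 1 \<Longrightarrow> f t = 0" "\<And>t. \<bar>t\<bar> \<ge> 1 \<Longrightarrow> g t = (0::real)" "continuous_on UNIV f" "continuous_on UNIV g"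
  shows "L1 (\<lambda>x::real^2. f (x$1) * g (x$2))"
proof (rule cont_supp_integrable(1)[where R=2])
  show "continuous_on UNIV (\<lambda>x::real^2. f (x$1) * g (x$2))"
    by (intro continuous_intros continuous_on_compose2[OF assms(3)] continuous_on_compose2[OF assms(4)]) auto
qed (use bb_supp[of f g] assms in auto)

lemma c1_pos: "c1 > 0" unfolding c1_def
  by (intro integral_pos_of_cont cont_supp_integrable(1)[where R=1] continuous_intros b0_nonneg b0_pos b_supp) auto

lemma c2_pos: "c2 > 0" unfolding c2_def
  by (rule integral_pos_of_cont)
     (auto intro!: bb_int continuous_intros b0_nonneg b_supp b0_pos mult_nonneg_nonneg mult_pos_pos
       continuous_on_compose2[OF b_cont(1)[of UNIV]])

lemma integral_scale:
  fixes F :: "'a::euclidean_space \<Rightarrow> real"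
  assumes [measurable]: "F \<in> borel_measurable borel" and e: "e > 0"
  shows "(LBINT x. F ((1/e) *\<^sub>R x)) = e ^ DIM('a) * (LBINT x. F x)"
  using integral_affine[of "\<lambda>x. F ((1/e) *\<^sub>R x)" e 0] e by simp

text \<open>Tensor products in place of radial mollifiers: partial derivatives reduce to derivatives
  of \<open>b0\<close>, and smoothness to \<open>Ck_affine\<close>. The powers of e normalise the
  mass to 1 and contribute one further factor 1/e per derivative.\<close>

definition rho :: "real \<Rightarrow> real \<Rightarrow> real" where "rho e t = b0 (t / e) / (e * c1)"
definition rho1 :: "real \<Rightarrow> real \<Rightarrow> real" where "rho1 e t = b1 (t / e) / (e\<^sup>2 * c1)"
definition eta :: "real \<Rightarrow> real^2 \<Rightarrow> real" where "eta e x = b0 (x$1 / e) * b0 (x$2 / e) / (e\<^sup>2 * c2)"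
definition eta1 :: "real \<Rightarrow> real^2 \<Rightarrow> real" where "eta1 e x = b1 (x$1 / e) * b0 (x$2 / e) / (e^3 * c2)"
definition eta2 :: "real \<Rightarrow> real^2 \<Rightarrow> real" where "eta2 e x = b0 (x$1 / e) * b1 (x$2 / e) / (e^3 * c2)"
definition eta11 :: "real \<Rightarrow> real^2 \<Rightarrow> real" where "eta11 e x = b2 (x$1 / e) * b0 (x$2 / e) / (e^4 * c2)"
definition eta22 :: "real \<Rightarrow> real^2 \<Rightarrow> real" where "eta22 e x = b0 (x$1 / e) * b2 (x$2 / e) / (e^4 * c2)"

lemmas eta_defs = eta_def eta1_def eta2_def eta11_def eta22_def

lemma rho_cont:
  assumes "e > 0" shows "continuous_on UNIV (rho e)" "continuous_on UNIV (rho1 e)"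
  unfolding rho_def rho1_def using assms c1_pos
  by (intro continuous_intros continuous_on_compose2[OF b_cont(1)[of UNIV]] continuous_on_compose2[OF b_cont(2)[of UNIV]]; simp)+

lemma eta_cont:
  assumes "e > 0" shows "continuous_on UNIV (eta e)" "continuous_on UNIV (eta1 e)" "continuous_on UNIV (eta2 e)"
    "continuous_on UNIV (eta11 e)" "continuous_on UNIV (eta22 e)"
  unfolding eta_defs using assms c2_pos
  by (intro continuous_intros continuous_on_compose2[OF b_cont(1)[of UNIV]] continuous_on_compose2[OF b_cont(2)[of UNIV]]
     continuous_on_compose2[OF b_cont(3)[of UNIV]]; simp)+

lemma moll_measurable[measurable]: "rho e \<in> borel_measurable borel" "rho1 e \<in> borel_measurable borel"
  "eta e \<in> borel_measurable borel" "eta1 e \<in> borel_measurable borel" "eta2 e \<in> borel_measurable borel"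
  "eta11 e \<in> borel_measurable borel" "eta22 e \<in> borel_measurable borel"
  unfolding rho_def rho1_def eta_defs by measurable

lemma rho_supp: assumes "e > 0" "\<bar>t\<bar> \<ge> e" shows "rho e t = 0" "rho1 e t = 0"
proof -
  have "\<bar>t / e\<bar> \<ge> 1" using assms by simp
  then show "rho e t = 0" "rho1 e t = 0" unfolding rho_def rho1_def using b_supp[of "t/e"] by simp_all
qed

lemma eta_supp:
  assumes "e > 0" "norm x > 2 * e"
  shows "eta e x = 0" "eta1 e x = 0" "eta2 e x = 0" "eta11 e x = 0" "eta22 e x = 0"
proof -
  have "norm ((1/e) *\<^sub>R x) > 2" using assms by (simp add: field_simps)
  note B = bb_supp[OF _ _ this]
  have [simp]: "((1/e) *\<^sub>R x) $ i = x $ i / e" for i by simp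
  show "eta e x = 0" "eta1 e x = 0" "eta2 e x = 0" "eta11 e x = 0" "eta22 e x = 0"
    unfolding eta_defs using B[of b0 b0] B[of b1 b0] B[of b0 b1] B[of b2 b0] B[of b0 b2] b_supp by auto
qed

lemma rho_deriv: "e > 0 \<Longrightarrow> (rho e has_real_derivative rho1 e t) (at t)"
  unfolding rho_def rho1_def using c1_pos
  by (auto intro!: derivative_eq_intros DERIV_chain2[OF b_deriv(1)] simp: power2_eq_square field_simps)

lemma eta_dird:
  assumes e: "e > 0"
  shows "dird (eta e) e1 (eta1 e)" "dird (eta e) e2 (eta2 e)" "dird (eta1 e) e1 (eta11 e)" "dird (eta2 e) e2 (eta22 e)"
  unfolding dird_def eta_defs axis_simps using e c2_pos
  by (auto intro!: derivative_eq_intros DERIV_chain2[OF b_deriv(1)] DERIV_chain2[OF b_deriv(2)] simp: power2_eq_square power3_eq_cube power4_eq_xxxx field_simps)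

lemma rho_int: assumes "e > 0" shows "L1 (rho e)" "L1 (rho1 e)"
  by (rule cont_supp_integrable(1)[where R=e]; use rho_cont rho_supp assms in auto)+

lemma eta_int: assumes "e > 0" shows "L1 (eta e)" "L1 (eta1 e)" "L1 (eta2 e)"
    "L1 (eta11 e)" "L1 (eta22 e)"
  by (rule cont_supp_integrable(1)[where R="2*e"]; use eta_cont eta_supp assms in auto)+

lemma rho_nonneg: "e > 0 \<Longrightarrow> rho e t \<ge> 0" unfolding rho_def using c1_pos b0_nonneg by simp
lemma eta_nonneg: "e > 0 \<Longrightarrow> eta e x \<ge> 0" unfolding eta_def using c2_pos b0_nonneg by simp

lemma rho_one: "e > 0 \<Longrightarrow> (LBINT t. rho e t) = 1"
  using integral_scale[of b0 e] c1_pos unfolding rho_def c1_def[symmetric] by simp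

lemma eta_one: "e > 0 \<Longrightarrow> (LBINT x. eta e x) = 1"
  using integral_scale[of "\<lambda>x::real^2. b0 (x$1) * b0 (x$2)" e] c2_pos unfolding eta_def c2_def[symmetric] by simp

text \<open>The scale-free L^1 norm of the gradient of the mollifier, taken componentwise. At scale
  e it becomes \<open>Ceta / e\<close>, and this 1/e is what the increment of the velocity has to
  compensate in the commutator.\<close>

definition Ceta :: real where
  "Ceta = ((LBINT x. \<bar>b1 ((x::real^2)$1) * b0 (x$2)\<bar>) + (LBINT x. \<bar>b0 ((x::real^2)$1) * b1 (x$2)\<bar>)) / c2"

lemma eta_grad_int:
  assumes e: "e > 0"
  shows "(LBINT x. \<bar>eta1 e x\<bar>) + (LBINT x. \<bar>eta2 e x\<bar>) = Ceta / e"
proof -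
  have a: "\<bar>eta1 e x\<bar> = \<bar>b1 (((1/e) *\<^sub>R x)$1) * b0 (((1/e) *\<^sub>R x)$2)\<bar> / (e^3 * c2)"
    "\<bar>eta2 e x\<bar> = \<bar>b0 (((1/e) *\<^sub>R x)$1) * b1 (((1/e) *\<^sub>R x)$2)\<bar> / (e^3 * c2)" for x
    unfolding eta_defs using e c2_pos by (simp_all add: abs_mult)
  show ?thesis unfolding a Ceta_def
    using integral_scale[of "\<lambda>x::real^2. \<bar>b1 (x$1) * b0 (x$2)\<bar>" e] integral_scale[of "\<lambda>x::real^2. \<bar>b0 (x$1) * b1 (x$2)\<bar>" e] e c2_pos
    by (simp add: field_simps power2_eq_square power3_eq_cube)
qed

lemma Ceta_nonneg: "Ceta \<ge> 0" unfolding Ceta_def using c2_pos by simp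

lemma is_moll_rho:
  assumes "\<And>n. E n > 0" "E \<longlonglongrightarrow> 0" shows "is_moll (\<lambda>n. rho (E n))"
  unfolding is_moll_def
proof (intro conjI allI impI)
  fix d :: real assume "d > 0"
  with assms(2) have "eventually (\<lambda>n. E n < d) sequentially" by (simp add: order_tendstoD(2))
  then show "eventually (\<lambda>n. \<forall>z. rho (E n) z \<noteq> 0 \<longrightarrow> norm z \<le> d) sequentially"
  proof eventually_elim
    case (elim n) then show ?case using rho_supp(1)[OF assms(1)[of n]] by (metis linorder_not_le less_le_trans less_imp_le real_norm_def)
  qed
qed (use assms in \<open>auto intro: rho_int rho_nonneg rho_one\<close>)

lemma is_moll_eta:
  assumes "\<And>n. E n > 0" "E \<longlonglongrightarrow> 0" shows "is_moll (\<lambda>n. eta (E n))"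
  unfolding is_moll_def
proof (intro conjI allI impI)
  fix d :: real assume "d > 0"
  then have "eventually (\<lambda>n. E n < d / 2) sequentially" using order_tendstoD(2)[OF assms(2), of "d / 2"] by simp
  then show "eventually (\<lambda>n. \<forall>z. eta (E n) z \<noteq> 0 \<longrightarrow> norm z \<le> d) sequentially"
  proof eventually_elim
    case (elim n)
    show ?case
    proof (intro allI impI)
      fix z assume "eta (E n) z \<noteq> 0"
      then have "\<not> norm z > 2 * E n" using eta_supp(1)[OF assms(1)[of n]] by blast
      then show "norm z \<le> d" using elim by linarith
    qed
  qed
qed (use assms in \<open>auto intro: eta_int eta_nonneg eta_one\<close>)

lemma is_moll_prod:
  assumes "\<And>n. E n > 0" "E \<longlonglongrightarrow> 0"
  shows "is_moll (\<lambda>n z. rho (E n) (fst z) * eta (E n) (snd z))"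
  unfolding is_moll_def
proof (intro conjI allI impI)
  fix d :: real assume "d > 0"
  then have "eventually (\<lambda>n. E n < d / 3) sequentially" using order_tendstoD(2)[OF assms(2), of "d / 3"] by simp
  then show "eventually (\<lambda>n. \<forall>z. rho (E n) (fst z) * eta (E n) (snd z) \<noteq> 0 \<longrightarrow> norm z \<le> d) sequentially"
  proof eventually_elim
    case (elim n)
    show ?case
    proof (intro allI impI)
      fix z :: "real \<times> (real^2)" assume z: "rho (E n) (fst z) * eta (E n) (snd z) \<noteq> 0"
      then have "\<not> norm (snd z) > 2 * E n" using eta_supp(1)[OF assms(1)[of n]] by auto
      moreover have "\<not> \<bar>fst z\<bar> \<ge> E n" using z rho_supp(1)[OF assms(1)[of n]] by auto
      moreover have "norm z \<le> norm (fst z) + norm (snd z)" using norm_Pair_le[of "fst z" "snd z"] by simp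
      ultimately show "norm z \<le> d" using elim by simp
    qed
  qed
next
  fix n
  show "L1 (\<lambda>z. rho (E n) (fst z) * eta (E n) (snd z))" "(LBINT z. rho (E n) (fst z) * eta (E n) (snd z)) = 1"
    using integral_prod_split[OF rho_int(1)[OF assms(1)[of n]] eta_int(1)[OF assms(1)[of n]]] assms(1)[of n]
    by (simp_all add: lborel_prod rho_one eta_one)
qed (use assms in \<open>auto intro!: mult_nonneg_nonneg rho_nonneg eta_nonneg\<close>)

text \<open>Reflected and centred at (t0, x0), so that testing with it evaluates a space-time
  convolution at that point. The two scales are independent because time is mollified, and the limit
  in time taken, while the spatial scale is held fixed.\<close>

definition tphi :: "real \<Rightarrow> real \<Rightarrow> real \<Rightarrow> real^2 \<Rightarrow> real \<times> (real^2) \<Rightarrow> real" where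
  "tphi d e t0 x0 z = rho d (t0 - fst z) * eta e (x0 - snd z)"

lemma tphi_smooth:
  assumes "d > 0" "e > 0"
  shows "smooth_fun (tphi d e t0 x0)"
  unfolding smooth_fun_def
proof
  fix k
  have G: "Ck k (\<lambda>z. edec 0 (1 + c * (a - l z)))" if l: "bounded_linear (l :: real \<times> (real^2) \<Rightarrow> real)" for a c :: real and l
  proof -
    have "bounded_linear (\<lambda>z. (- c) * l z)" by (rule bounded_linear_const_mult[OF l])
    from Ck_affine[where D=edec and k=k and n=0 and a="1 + c * a", OF edec_deriv this] show ?thesis by (simp add: algebra_simps)
  qed
  have l: "bounded_linear (fst :: real \<times> (real^2) \<Rightarrow> real)" "bounded_linear (\<lambda>z :: real \<times> (real^2). snd z $ i)" for i
    by (auto intro: bounded_linear_fst bounded_linear_compose[OF bounded_linear_vec_nth bounded_linear_snd])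
  \<comment> \<open>Each bump is written out as two factors \<open>edec 0\<close> of an affine
    function, the form that \<open>Ck_affine\<close> covers.\<close>
  have "tphi d e t0 x0 = (\<lambda>z. 1 / (d * c1) * (1 / (e\<^sup>2 * c2)) *
     ((edec 0 (1 + (1/d) * (t0 - fst z)) * edec 0 (1 + (-1/d) * (t0 - fst z))) *
     ((edec 0 (1 + (1/e) * (x0$1 - snd z$1)) * edec 0 (1 + (-1/e) * (x0$1 - snd z$1))) *
     (edec 0 (1 + (1/e) * (x0$2 - snd z$2)) * edec 0 (1 + (-1/e) * (x0$2 - snd z$2))))))"
    by (auto simp: fun_eq_iff tphi_def rho_def eta_def b0_def)
  then show "Ck k (tphi d e t0 x0)" by (simp only:) (intro Ck_mult Ck_const G l)
qed

lemma tphi_support: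
  assumes "d > 0" "e > 0"
  shows "tsupport (tphi d e t0 x0) \<subseteq> cball t0 d \<times> cball x0 (2 * e)"
  unfolding tsupport_def
proof (rule closure_minimal)
  show "closed (cball t0 d \<times> cball x0 (2 * e))" by (intro closed_Times) auto
  show "{z. tphi d e t0 x0 z \<noteq> 0} \<subseteq> cball t0 d \<times> cball x0 (2 * e)"
  proof
    fix z assume "z \<in> {z. tphi d e t0 x0 z \<noteq> 0}"
    then have "rho d (t0 - fst z) \<noteq> 0" "eta e (x0 - snd z) \<noteq> 0" by (auto simp: tphi_def)
    then have "\<not> \<bar>t0 - fst z\<bar> \<ge> d" "\<not> norm (x0 - snd z) > 2 * e"
      using rho_supp(1)[OF assms(1)] eta_supp(1)[OF assms(2)] by blast+
    then show "z \<in> cball t0 d \<times> cball x0 (2 * e)" by (auto simp: mem_Times_iff dist_norm)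
  qed
qed

lemma tphi_test:
  assumes "d > 0" "e > 0" "cball t0 d \<subseteq> I"
  shows "test_fun (I \<times> UNIV) (tphi d e t0 x0)"
  unfolding test_fun_def
proof (intro conjI)
  have "compact (cball t0 d \<times> cball x0 (2 * e))" by (intro compact_Times) auto
  then show "compact (tsupport (tphi d e t0 x0))"
    using compact_Int_closed[of "cball t0 d \<times> cball x0 (2 * e)" "tsupport (tphi d e t0 x0)"] tphi_support[OF assms(1,2), of t0 x0]
    by (simp add: tsupport_def Int_absorb1)
  show "tsupport (tphi d e t0 x0) \<subseteq> I \<times> UNIV" using tphi_support[OF assms(1,2), of t0 x0] assms(3) by auto
qed (rule tphi_smooth[OF assms(1,2)])

lemma prod_frechet:
  fixes A B C A' B' C' :: "real \<Rightarrow> real" and tt :: real and xx :: "real^2"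
  assumes A: "\<And>t. (A has_real_derivative A' t) (at t)" and B: "\<And>t. (B has_real_derivative B' t) (at t)"
   and C: "\<And>t. (C has_real_derivative C' t) (at t)"
  defines "F \<equiv> \<lambda>z::real \<times> (real^2). A (tt - fst z) * (B (xx$1 - snd z$1) * C (xx$2 - snd z$2))"
  shows "frechet_derivative F (at z) = (\<lambda>h. - A' (tt - fst z) * fst h * (B (xx$1 - snd z$1) * C (xx$2 - snd z$2))
      - A (tt - fst z) * (B' (xx$1 - snd z$1) * snd h $ 1 * C (xx$2 - snd z$2) + B (xx$1 - snd z$1) * (C' (xx$2 - snd z$2) * snd h $ 2)))"
proof -
  have v: "((\<lambda>z::real \<times> (real^2). snd z $ i) has_derivative (\<lambda>h. snd h $ i)) (at z)" for i
    by (rule bounded_linear_imp_has_derivative) (rule bounded_linear_compose[OF bounded_linear_vec_nth bounded_linear_snd])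
  show ?thesis unfolding F_def
    by (rule frechet_derivative_at[symmetric])
       (auto intro!: derivative_eq_intros DERIV_compose_FDERIV[OF A] DERIV_compose_FDERIV[OF B] DERIV_compose_FDERIV[OF C] v simp: algebra_simps fun_eq_iff)
qed

lemma scaled_deriv:
  assumes "\<And>t. (f has_real_derivative f' t) (at t)" "e > 0"
  shows "((\<lambda>t. f (t / e)) has_real_derivative f' (t / e) / e) (at t)"
proof -
  have "((\<lambda>t. t / e) has_real_derivative 1 / e) (at t)" using assms(2) by (auto intro!: derivative_eq_intros)
  from DERIV_chain2[OF assms(1)[of "t / e"] this] show ?thesis using assms(2) by simp
qed

lemma tphi_derivs:
  assumes d: "d > 0" and e: "e > 0"
  shows "dt (tphi d e t0 x0) t x = - rho1 d (t0 - t) * eta e (x0 - x)"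
    "gradx (tphi d e t0 x0) t x $ 1 = - rho d (t0 - t) * eta1 e (x0 - x)"
    "gradx (tphi d e t0 x0) t x $ 2 = - rho d (t0 - t) * eta2 e (x0 - x)"
    "lapx (tphi d e t0 x0) t x = rho d (t0 - t) * (eta11 e (x0 - x) + eta22 e (x0 - x))"
proof -
  note S0 = scaled_deriv[OF b_deriv(1) e] and S1 = scaled_deriv[OF b_deriv(2) e]
  let ?k = "1 / (e\<^sup>2 * c2)"
  have RK: "((\<lambda>t. rho d t * c) has_real_derivative rho1 d t * c) (at t)" for c t
    by (auto intro!: derivative_eq_intros rho_deriv d)
  have eq0: "tphi d e t0 x0 = (\<lambda>z. rho d (t0 - fst z) * ?k * (b0 ((x0$1 - snd z$1) / e) * b0 ((x0$2 - snd z$2) / e)))"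
    by (auto simp: fun_eq_iff tphi_def eta_def)
  note F0 = prod_frechet[where A="\<lambda>t. rho d t * (?k)" and A'="\<lambda>t. rho1 d t * (?k)" and tt=t0 and xx=x0 and B="\<lambda>t. b0 (t / e)" and B'="\<lambda>t. b1 (t / e) / e" and C="\<lambda>t. b0 (t / e)" and C'="\<lambda>t. b1 (t / e) / e", OF RK S0 S0, folded eq0]
  have ax[simp]: "axis 1 1 $ (1::2) = (1::real)" "axis 1 1 $ (2::2) = (0::real)" "axis 2 1 $ (1::2) = (0::real)" "axis 2 1 $ (2::2) = (1::real)"
    by (auto simp: axis_def)
  show "dt (tphi d e t0 x0) t x = - rho1 d (t0 - t) * eta e (x0 - x)"
    unfolding dt_def F0 by (simp add: eta_def)
  have g1: "dx 1 (tphi d e t0 x0) t x = - rho d (t0 - t) * eta1 e (x0 - x)" for t x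
    unfolding dx_def F0 using e c2_pos by (simp add: eta1_def power2_eq_square power3_eq_cube)
  have g2: "dx 2 (tphi d e t0 x0) t x = - rho d (t0 - t) * eta2 e (x0 - x)" for t x
    unfolding dx_def F0 using e c2_pos by (simp add: eta2_def power2_eq_square power3_eq_cube)
  show "gradx (tphi d e t0 x0) t x $ 1 = - rho d (t0 - t) * eta1 e (x0 - x)"
    "gradx (tphi d e t0 x0) t x $ 2 = - rho d (t0 - t) * eta2 e (x0 - x)" by (simp_all add: gradx_def g1 g2)
  let ?k3 = "- (1 / (e^3 * c2))"
  have eq1: "(\<lambda>z. dx 1 (tphi d e t0 x0) (fst z) (snd z)) = (\<lambda>z. rho d (t0 - fst z) * ?k3 * (b1 ((x0$1 - snd z$1) / e) * b0 ((x0$2 - snd z$2) / e)))"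
    by (auto simp: fun_eq_iff g1 eta1_def)
  have eq2: "(\<lambda>z. dx 2 (tphi d e t0 x0) (fst z) (snd z)) = (\<lambda>z. rho d (t0 - fst z) * ?k3 * (b0 ((x0$1 - snd z$1) / e) * b1 ((x0$2 - snd z$2) / e)))"
    by (auto simp: fun_eq_iff g2 eta2_def)
  note F1 = prod_frechet[where A="\<lambda>t. rho d t * (?k3)" and A'="\<lambda>t. rho1 d t * (?k3)" and tt=t0 and xx=x0 and B="\<lambda>t. b1 (t / e)" and B'="\<lambda>t. b2 (t / e) / e" and C="\<lambda>t. b0 (t / e)" and C'="\<lambda>t. b1 (t / e) / e", OF RK S1 S0, folded eq1] and F2 = prod_frechet[where A="\<lambda>t. rho d t * (?k3)" and A'="\<lambda>t. rho1 d t * (?k3)" and tt=t0 and xx=x0 and B="\<lambda>t. b0 (t / e)" and B'="\<lambda>t. b1 (t / e) / e" and C="\<lambda>t. b1 (t / e)" and C'="\<lambda>t. b2 (t / e) / e", OF RK S0 S1, folded eq2]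
  have "dx 1 (\<lambda>z. dx 1 (tphi d e t0 x0) (fst z) (snd z)) t x = rho d (t0 - t) * eta11 e (x0 - x)"
    unfolding dx_def[of 1 "\<lambda>z. dx 1 (tphi d e t0 x0) (fst z) (snd z)"] F1 using e c2_pos by (simp add: eta11_def power3_eq_cube power4_eq_xxxx)
  moreover have "dx 2 (\<lambda>z. dx 2 (tphi d e t0 x0) (fst z) (snd z)) t x = rho d (t0 - t) * eta22 e (x0 - x)"
    unfolding dx_def[of 2 "\<lambda>z. dx 2 (tphi d e t0 x0) (fst z) (snd z)"] F2 using e c2_pos by (simp add: eta22_def power3_eq_cube power4_eq_xxxx)
  ultimately show "lapx (tphi d e t0 x0) t x = rho d (t0 - t) * (eta11 e (x0 - x) + eta22 e (x0 - x))"
    unfolding lapx_def by (simp add: sum_2 distrib_left)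
qed

section \<open>The commutator\<close>

text \<open>\<open>De e w\<close> is the divergence of the flux $uw$ mollified at scale \<open>e\<close>, and \<open>rr e w\<close> the DiPerna--Lions commutator.\<close>
definition fl :: "2 \<Rightarrow> (real^2 \<Rightarrow> real) \<Rightarrow> real^2 \<Rightarrow> real" where "fl i w x = w x * velocity w x $ i"
definition De :: "real \<Rightarrow> (real^2 \<Rightarrow> real) \<Rightarrow> real^2 \<Rightarrow> real" where
  "De e w x = conv (fl 1 w) (eta1 e) x + conv (fl 2 w) (eta2 e) x"
definition rr :: "real \<Rightarrow> (real^2 \<Rightarrow> real) \<Rightarrow> real^2 \<Rightarrow> real" where
  "rr e w x = De e w x - (velocity w x $ 1 * conv w (eta1 e) x + velocity w x $ 2 * conv w (eta2 e) x)"

lemma fl_measurable[measurable]: assumes [measurable]: "w \<in> borel_measurable borel" shows "fl i w \<in> borel_measurable borel"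
  unfolding fl_def by measurable

lemma De_measurable[measurable]: assumes [measurable]: "w \<in> borel_measurable borel" shows "De e w \<in> borel_measurable borel"
  unfolding De_def by measurable

lemma rr_measurable[measurable]: assumes [measurable]: "w \<in> borel_measurable borel" shows "rr e w \<in> borel_measurable borel"
  unfolding rr_def by measurable

lemma eta_bound:
  assumes e: "e > 0"
  obtains B where "\<And>x. \<bar>eta e x\<bar> \<le> B" "\<And>x. \<bar>eta1 e x\<bar> \<le> B" "\<And>x. \<bar>eta2 e x\<bar> \<le> B" "\<And>x. \<bar>eta11 e x\<bar> \<le> B" "\<And>x. \<bar>eta22 e x\<bar> \<le> B"
proof -
  have "\<exists>B\<ge>0. \<forall>x. \<bar>f x\<bar> \<le> B" if "f \<in> {eta e, eta1 e, eta2 e, eta11 e, eta22 e}" for f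
    by (rule cont_supp_integrable(2)[where R="2*e"]) (use that eta_cont[OF e] eta_supp[OF e] in auto)
  then obtain B0 B1 B2 B3 B4 where *: "B0 \<ge> 0" "B1 \<ge> 0" "B2 \<ge> 0" "B3 \<ge> 0" "B4 \<ge> 0"
    "\<forall>x. \<bar>eta e x\<bar> \<le> B0" "\<forall>x. \<bar>eta1 e x\<bar> \<le> B1" "\<forall>x. \<bar>eta2 e x\<bar> \<le> B2" "\<forall>x. \<bar>eta11 e x\<bar> \<le> B3" "\<forall>x. \<bar>eta22 e x\<bar> \<le> B4"
    by (metis insertI1 insertI2)
  show ?thesis
    by (rule that[of "B0 + B1 + B2 + B3 + B4"]; rule order_trans[OF *(6)[rule_format]] order_trans[OF *(7)[rule_format]]
        order_trans[OF *(8)[rule_format]] order_trans[OF *(9)[rule_format]] order_trans[OF *(10)[rule_format]]; use *(1-5) in linarith)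
qed

lemma Npot_real:
  assumes w: "L1 w" and w2: "L1 (\<lambda>x. (w x)\<^sup>2)"
  shows "L1 (\<lambda>x. (enn2real (Npot w x))\<^sup>2)"
   "(LBINT x. (enn2real (Npot w x))\<^sup>2) \<le> 4 * pi\<^sup>2 * (LBINT x. (w x)\<^sup>2)"
   "AE x in lborel. enn2real (Upot w x) \<le> enn2real (Npot w x) + (LBINT x. \<bar>w x\<bar>)"
proof -
  have [measurable]: "w \<in> borel_measurable borel" using w by auto
  have "(LBNN x. ennreal ((enn2real (Npot w x))\<^sup>2)) \<le> (LBNN x. (Npot w x)\<^sup>2)"
  proof (intro nn_integral_mono)
    fix x show "ennreal ((enn2real (Npot w x))\<^sup>2) \<le> (Npot w x)\<^sup>2"
      by (cases "Npot w x") (auto simp: ennreal_power)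
  qed
  also note Npot_L2'[OF w w2]
  finally have *: "(LBNN x. ennreal ((enn2real (Npot w x))\<^sup>2)) \<le> ennreal (4 * pi\<^sup>2 * (LBINT x. (w x)\<^sup>2))" .
  show i: "L1 (\<lambda>x. (enn2real (Npot w x))\<^sup>2)"
    using * by (intro integrableI_bounded) (auto simp: order_le_less_trans)
  show "(LBINT x. (enn2real (Npot w x))\<^sup>2) \<le> 4 * pi\<^sup>2 * (LBINT x. (w x)\<^sup>2)"
    using * i by (subst (asm) nn_integral_eq_integral) (auto simp: ennreal_le_iff)
  show "AE x in lborel. enn2real (Upot w x) \<le> enn2real (Npot w x) + (LBINT x. \<bar>w x\<bar>)"
    using Npot_finite[OF w w2]
  proof eventually_elim
    case (elim x)
    have "Upot w x \<le> Npot w x + ennreal (LBINT x. \<bar>w x\<bar>)" using Upot_le[of w x] nn_w1[OF w] by simp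
    also have "\<dots> = ennreal (enn2real (Npot w x) + (LBINT x. \<bar>w x\<bar>))"
      using elim by (cases "Npot w x") (auto simp: ennreal_plus)
    finally show ?case by (intro enn2real_leI) (auto intro: add_nonneg_nonneg)
  qed
qed

lemma amgm: "s > 0 \<Longrightarrow> 0 \<le> a \<Longrightarrow> 0 \<le> b \<Longrightarrow> a * b \<le> (s * a\<^sup>2 + b\<^sup>2 / s) / 2" for a b s :: real
proof -
  assume s: "s > 0"
  have "0 \<le> (s * a - b)\<^sup>2 / s" using s by simp
  also have "(s * a - b)\<^sup>2 / s = s * a\<^sup>2 + b\<^sup>2 / s - 2 * (a * b)" using s by (simp add: power2_eq_square field_simps)
  finally show ?thesis by simp
qed

text \<open>Hoelder's inequality in additive form: a bound s a + C / s for every s > 0 forces the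
  left side to vanish with a (\<open>vanish_seq\<close>), and at s = 1 it is affine in the mass. The
  ball is there because the far part of the potential is merely bounded by \<open>W\<close>.\<close>

lemma Upot_weighted:
  fixes R :: real
  assumes w: "L1 w" and w2: "L1 (\<lambda>x. (w x)\<^sup>2)"
    and [measurable]: "g \<in> borel_measurable borel" and g2: "L1 (\<lambda>x. (g x)\<^sup>2)"
  defines "Q \<equiv> LBINT x. (w x)\<^sup>2" and "W \<equiv> LBINT x. \<bar>w x\<bar>"
    and "V \<equiv> measure lborel (cball (0::real^2) R)"
  shows "L1 (\<lambda>x. indicator (cball 0 R) x * (\<bar>g x\<bar> * enn2real (Upot w x)))"
    and "s > 0 \<Longrightarrow> (LBINT x. indicator (cball 0 R) x * (\<bar>g x\<bar> * enn2real (Upot w x))) \<le> s * ((1/2 + W) * (LBINT x. (g x)\<^sup>2)) + (2 * pi\<^sup>2 * Q + W * V) / s"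
proof -
  have [measurable]: "w \<in> borel_measurable borel" "cball (0::real^2) R \<in> sets borel" using w by auto
  have W0: "W \<ge> 0" by (simp add: W_def)
  note N = Npot_real[OF w w2]
  let ?I = "indicator (cball 0 R) :: real^2 \<Rightarrow> real"
  let ?b = "\<lambda>s x. s * ((1/2 + W) * (g x)\<^sup>2) + ((enn2real (Npot w x))\<^sup>2 / 2 + W * ?I x) / s"
  have pt: "AE x in lborel. ?I x * (\<bar>g x\<bar> * enn2real (Upot w x)) \<le> ?b s x" if s: "s > 0" for s
    using N(3)
  proof eventually_elim
    case (elim x)
    have 1: "\<bar>g x\<bar> * enn2real (Npot w x) \<le> (s * (g x)\<^sup>2 + (enn2real (Npot w x))\<^sup>2 / s) / 2"
      using amgm[OF s, of "\<bar>g x\<bar>" "enn2real (Npot w x)"] by simp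
    have "\<bar>g x\<bar> * 1 \<le> (s * (g x)\<^sup>2 + 1\<^sup>2 / s) / 2" using amgm[OF s, of "\<bar>g x\<bar>" 1] by simp
    also have "\<dots> \<le> s * (g x)\<^sup>2 + 1 / s" using s by (simp add: field_simps)
    finally have 2: "W * \<bar>g x\<bar> \<le> W * (s * (g x)\<^sup>2 + 1 / s)" using W0 by (intro mult_left_mono) auto
    show ?case
    proof (cases "x \<in> cball 0 R")
      case True
      have "\<bar>g x\<bar> * enn2real (Upot w x) \<le> \<bar>g x\<bar> * (enn2real (Npot w x) + W)"
        using elim by (intro mult_left_mono) (auto simp: W_def)
      also have "\<dots> \<le> (s * (g x)\<^sup>2 + (enn2real (Npot w x))\<^sup>2 / s) / 2 + W * (s * (g x)\<^sup>2 + 1 / s)"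
      proof -
        have "\<bar>g x\<bar> * (enn2real (Npot w x) + W) = \<bar>g x\<bar> * enn2real (Npot w x) + W * \<bar>g x\<bar>" by (simp add: algebra_simps)
        then show ?thesis using 1 2 by linarith
      qed
      also have "\<dots> = s * ((1/2 + W) * (g x)\<^sup>2) + ((enn2real (Npot w x))\<^sup>2 / 2 + W) / s"
        using s by (simp add: field_simps)
      finally show ?thesis using True by simp
    qed (use s W0 in auto)
  qed
  have hI: "L1 ?I"
    using emeasure_lborel_cball_finite[of "0::real^2" R] by (intro integrable_real_indicator) auto
  have bi: "L1 (?b s)" for s
    using g2 N(1) hI by (intro Bochner_Integration.integrable_add integrable_mult_right integrable_divide) auto
  show i: "L1 (\<lambda>x. ?I x * (\<bar>g x\<bar> * enn2real (Upot w x)))"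
    by (rule Bochner_Integration.integrable_bound[OF bi[of 1]])
       (use pt[of 1] in \<open>auto elim!: eventually_mono\<close>)
  assume s: "s > 0"
  have "(LBINT x. ?I x * (\<bar>g x\<bar> * enn2real (Upot w x))) \<le> (LBINT x. ?b s x)"
    by (rule integral_mono_AE[OF i bi pt[OF s]])
  also have "\<dots> = s * ((1/2 + W) * (LBINT x. (g x)\<^sup>2)) + ((LBINT x. (enn2real (Npot w x))\<^sup>2) / 2 + W * V) / s"
    using g2 N(1) hI unfolding V_def by simp
  also have "\<dots> \<le> s * ((1/2 + W) * (LBINT x. (g x)\<^sup>2)) + (2 * pi\<^sup>2 * Q + W * V) / s"
    using N(2) s unfolding Q_def by (intro add_left_mono divide_right_mono) auto
  finally show "(LBINT x. ?I x * (\<bar>g x\<bar> * enn2real (Upot w x))) \<le> s * ((1/2 + W) * (LBINT x. (g x)\<^sup>2)) + (2 * pi\<^sup>2 * Q + W * V) / s" .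
qed

text \<open>Here the weight w is itself integrable, so the bounded far part can be integrated over
  the whole plane, where it contributes the square of the mass. The near part N is handled by |w| N
  \<le> (w^2 + N^2) / 2.\<close>

lemma Upot_w_integrable:
  assumes w: "L1 w" and w2: "L1 (\<lambda>x. (w x)\<^sup>2)"
  defines "Q \<equiv> LBINT x. (w x)\<^sup>2" and "W \<equiv> LBINT x. \<bar>w x\<bar>"
  shows "L1 (\<lambda>x. \<bar>w x\<bar> * enn2real (Upot w x))"
    "(LBINT x. \<bar>w x\<bar> * enn2real (Upot w x)) \<le> (1/2 + 2 * pi\<^sup>2) * Q + W\<^sup>2"
proof -
  have [measurable]: "w \<in> borel_measurable borel" using w by auto
  note N = Npot_real[OF w w2]
  let ?b = "\<lambda>x. (1/2) * (w x)\<^sup>2 + (1/2) * (enn2real (Npot w x))\<^sup>2 + W * \<bar>w x\<bar>"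
  have pt: "AE x in lborel. \<bar>w x\<bar> * enn2real (Upot w x) \<le> ?b x"
    using N(3)
  proof eventually_elim
    case (elim x)
    have "\<bar>w x\<bar> * enn2real (Upot w x) \<le> \<bar>w x\<bar> * (enn2real (Npot w x) + W)"
      using elim by (intro mult_left_mono) (auto simp: W_def)
    also have "\<dots> \<le> ?b x" using amgm[of 1 "\<bar>w x\<bar>" "enn2real (Npot w x)"] by (simp add: distrib_left mult.commute)
    finally show ?case .
  qed
  have bi: "L1 ?b" using w w2 N(1) by (intro Bochner_Integration.integrable_add integrable_mult_right) auto
  show i: "L1 (\<lambda>x. \<bar>w x\<bar> * enn2real (Upot w x))"
    by (rule Bochner_Integration.integrable_bound[OF bi]) (use pt in \<open>auto elim!: eventually_mono\<close>)
  have "(LBINT x. \<bar>w x\<bar> * enn2real (Upot w x)) \<le> (LBINT x. ?b x)" by (rule integral_mono_AE[OF i bi pt])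
  also have "\<dots> = (1/2) * Q + (1/2) * (LBINT x. (enn2real (Npot w x))\<^sup>2) + W * W"
    using w w2 N(1) unfolding Q_def W_def by simp
  finally show "(LBINT x. \<bar>w x\<bar> * enn2real (Upot w x)) \<le> (1/2 + 2 * pi\<^sup>2) * Q + W\<^sup>2"
    using N(2) unfolding Q_def by (simp add: power2_eq_square algebra_simps)
qed

lemma fl_integrable:
  assumes w: "L1 w" and w2: "L1 (\<lambda>x. (w x)\<^sup>2)"
  shows "L1 (fl i w)"
proof (rule Bochner_Integration.integrable_bound[OF Upot_w_integrable(1)[OF w w2]])
  have [measurable]: "w \<in> borel_measurable borel" using w by auto
  show "fl i w \<in> borel_measurable lborel" by simp
  show "AE x in lborel. norm (fl i w x) \<le> norm (\<bar>w x\<bar> * enn2real (Upot w x))"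
    using Upot_finite[OF w w2]
  proof eventually_elim
    case (elim x)
    have "\<bar>velocity w x $ i\<bar> \<le> enn2real (Upot w x)"
      using velocity_le_real[OF _ elim] component_le_norm_cart[of "velocity w x" i] by auto
    then show ?case by (simp add: fl_def abs_mult mult_left_mono)
  qed
qed

lemma dird_reflect: "dird f e f' \<Longrightarrow> dird (\<lambda>y. f (x - y)) e (\<lambda>y. - f' (x - y))"
  unfolding dird_def
proof
  fix y assume d: "\<forall>x. ((\<lambda>s. f (x + s *\<^sub>R e)) has_real_derivative f' x) (at 0)"
  have "((\<lambda>s::real. - s) has_real_derivative -1) (at 0)" by (auto intro!: derivative_eq_intros)
  from DERIV_chain2[OF _ this, of "\<lambda>s. f ((x - y) + s *\<^sub>R e)" "f' (x - y)"] d
  have "((\<lambda>s. f ((x - y) + (- s) *\<^sub>R e)) has_real_derivative - f' (x - y)) (at 0)" by simp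
  moreover have "x - (y + s *\<^sub>R e) = (x - y) + (- s) *\<^sub>R e" for s by (simp add: algebra_simps)
  ultimately show "((\<lambda>s. f (x - (y + s *\<^sub>R e))) has_real_derivative - f' (x - y)) (at 0)" by (simp only:)
qed

text \<open>Expanding the product of the two increments gives four terms. Two of them form the
  commutator; the one with w(x) u(y) vanishes because u is divergence free, and the one with w(x)
  u(x) because the gradient of the mollifier has integral 0.\<close>

lemma commutator_form:
  assumes w: "L1 w" and w2: "L1 (\<lambda>x. (w x)\<^sup>2)" and e: "e > 0"
  defines "u \<equiv> velocity w"
  defines "H \<equiv> \<lambda>x y. (w y - w x) * ((u y $ 1 - u x $ 1) * eta1 e (x - y) + (u y $ 2 - u x $ 2) * eta2 e (x - y))"
  shows "L1 (H x)" "rr e w x = (LBINT y. H x y)"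
proof -
  have [measurable]: "w \<in> borel_measurable borel" using w by auto
  obtain B where B: "\<And>x. \<bar>eta1 e x\<bar> \<le> B" "\<And>x. \<bar>eta2 e x\<bar> \<le> B" using eta_bound[OF e] by metis
  have cs: "continuous_on UNIV (\<lambda>y. f (x - y))" if "continuous_on UNIV f" for f :: "real^2 \<Rightarrow> real"
    by (intro continuous_on_compose2[OF that] continuous_intros) auto
  have far: "norm (x - y) > 2 * e" if "norm y > norm x + 2 * e" for y
    using that norm_triangle_ineq2[of y x] by (simp add: norm_minus_commute)
  have vi: "L1 (\<lambda>y. u y $ 1 * eta1 e (x - y))" "L1 (\<lambda>y. u y $ 2 * eta2 e (x - y))"
    unfolding u_def by (rule velocity_test_integrable(2)[OF w w2, of _ B "norm x + 2 * e"]; use B eta_supp[OF e far] in auto)+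
  have fi: "L1 (\<lambda>y. fl 1 w y * eta1 e (x - y))" "L1 (\<lambda>y. fl 2 w y * eta2 e (x - y))"
    by (rule conv_integrable_bounded[OF fl_integrable[OF w w2] _ B(1)] conv_integrable_bounded[OF fl_integrable[OF w w2] _ B(2)]; simp)+
  have wi: "L1 (\<lambda>y. w y * eta1 e (x - y))" "L1 (\<lambda>y. w y * eta2 e (x - y))"
    by (rule conv_integrable_bounded[OF w _ B(1)] conv_integrable_bounded[OF w _ B(2)]; simp)+
  have ei: "L1 (\<lambda>y. eta1 e (x - y))" "L1 (\<lambda>y. eta2 e (x - y))"
    using eta_int[OF e] by (auto simp: integrable_shift)
  have e0: "(LBINT y. eta1 e (x - y)) = 0" "(LBINT y. eta2 e (x - y)) = 0"
    using integral_dird_zero[OF eta_dird(1)[OF e] eta_int(1,2)[OF e] eta_cont(2)[OF e]]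
      integral_dird_zero[OF eta_dird(2)[OF e] eta_int(1,3)[OF e] eta_cont(3)[OF e]]
      integral_shift(3)[of "eta1 e" x] integral_shift(3)[of "eta2 e" x] by auto
  have div: "(LBINT y. u y $ 1 * eta1 e (x - y)) + (LBINT y. u y $ 2 * eta2 e (x - y)) = 0"
  proof -
    have "(LBINT y. u y $ 1 * (- eta1 e (x - y)) + u y $ 2 * (- eta2 e (x - y))) = 0" unfolding u_def
      by (rule velocity_div_free[OF w w2 dird_reflect[OF eta_dird(1)[OF e]] dird_reflect[OF eta_dird(2)[OF e]], where R="norm x + 2 * e"])
         (use eta_cont[OF e] cs eta_supp[OF e far] in \<open>auto intro!: continuous_intros\<close>)
    then show ?thesis using vi by simp
  qed
  have Heq: "H x = (\<lambda>y. (fl 1 w y * eta1 e (x - y) + fl 2 w y * eta2 e (x - y))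
     - (u x $ 1 * (w y * eta1 e (x - y)) + u x $ 2 * (w y * eta2 e (x - y)))
     - w x * (u y $ 1 * eta1 e (x - y) + u y $ 2 * eta2 e (x - y))
     + (w x * u x $ 1 * eta1 e (x - y) + w x * u x $ 2 * eta2 e (x - y)))"
    by (auto simp: fun_eq_iff H_def fl_def u_def algebra_simps)
  show "L1 (H x)" unfolding Heq
    using vi fi wi ei by (intro Bochner_Integration.integrable_add Bochner_Integration.integrable_diff integrable_mult_right) auto
  have "(LBINT y. H x y) = ((LBINT y. fl 1 w y * eta1 e (x - y)) + (LBINT y. fl 2 w y * eta2 e (x - y)))
     - (u x $ 1 * (LBINT y. w y * eta1 e (x - y)) + u x $ 2 * (LBINT y. w y * eta2 e (x - y)))
     - w x * ((LBINT y. u y $ 1 * eta1 e (x - y)) + (LBINT y. u y $ 2 * eta2 e (x - y)))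
     + (w x * u x $ 1 * (LBINT y. eta1 e (x - y)) + w x * u x $ 2 * (LBINT y. eta2 e (x - y)))"
    unfolding Heq using vi fi wi ei
    by simp
  then show "rr e w x = (LBINT y. H x y)"
    unfolding div e0 by (simp add: rr_def De_def conv_def u_def)
qed

text \<open>The gradient of the mollifier has mass \<open>Ceta / e\<close>, and over |z| \<le> 2 e
  the velocity increment has squared L^2 norm at most 16 Q e^2. The powers of e cancel, so smallness
  can only come from \<open>om\<close>, the L^2 modulus of continuity of w.\<close>

lemma commutator_bound:
  assumes w: "L1 w" and w2: "L1 (\<lambda>x. (w x)\<^sup>2)" and e: "e > 0" and s: "s > 0"
    and om: "\<And>z. norm z \<le> 2 * e \<Longrightarrow> (LBINT x. (w (x - z) - w x)\<^sup>2) \<le> om"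
  defines "Q \<equiv> LBINT x. (w x)\<^sup>2"
  shows "L1 (rr e w)" "(LBINT x. \<bar>rr e w x\<bar>) \<le> s * (Ceta * om / 2) + 8 * Ceta * Q / s"
proof -
  have [measurable]: "w \<in> borel_measurable borel" using w by auto
  have Q0: "Q \<ge> 0" by (simp add: Q_def)
  have om0: "om \<ge> 0" using om[of 0] e by simp
  define G where "G z = \<bar>eta1 e z\<bar> + \<bar>eta2 e z\<bar>" for z
  have [measurable]: "G \<in> borel_measurable borel" unfolding G_def by measurable
  have G0: "G z \<ge> 0" for z by (simp add: G_def)
  let ?u = "velocity w"
  let ?P = "\<lambda>x z. \<bar>w (x - z) - w x\<bar> * norm (?u (x - z) - ?u x) * G z"
  have pt: "ennreal \<bar>rr e w x\<bar> \<le> (LBNN z. ennreal (?P x z))" for x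
  proof -
    have "ennreal \<bar>rr e w x\<bar> \<le> (LBNN y. ennreal (norm ((w y - w x) * ((?u y $ 1 - ?u x $ 1) * eta1 e (x - y) + (?u y $ 2 - ?u x $ 2) * eta2 e (x - y)))))"
      using integral_norm_bound_ennreal[OF commutator_form(1)[OF w w2 e, of x]] unfolding commutator_form(2)[OF w w2 e] by simp
    also have "\<dots> \<le> (LBNN y. ennreal (\<bar>w y - w x\<bar> * norm (?u y - ?u x) * G (x - y)))"
    proof (intro nn_integral_mono ennreal_leI)
      fix y
      let ?n = "norm (?u y - ?u x)"
      have "\<bar>(?u y $ 1 - ?u x $ 1) * eta1 e (x - y) + (?u y $ 2 - ?u x $ 2) * eta2 e (x - y)\<bar>
        \<le> \<bar>?u y $ 1 - ?u x $ 1\<bar> * \<bar>eta1 e (x - y)\<bar> + \<bar>?u y $ 2 - ?u x $ 2\<bar> * \<bar>eta2 e (x - y)\<bar>"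
        unfolding abs_mult[symmetric] by (rule abs_triangle_ineq)
      also have "\<dots> \<le> ?n * \<bar>eta1 e (x - y)\<bar> + ?n * \<bar>eta2 e (x - y)\<bar>"
        using component_le_norm_cart[of "?u y - ?u x"] by (intro add_mono mult_right_mono) auto
      finally have "\<bar>(?u y $ 1 - ?u x $ 1) * eta1 e (x - y) + (?u y $ 2 - ?u x $ 2) * eta2 e (x - y)\<bar> \<le> ?n * G (x - y)"
        by (simp add: G_def distrib_left)
      from mult_left_mono[OF this, of "\<bar>w y - w x\<bar>"]
      show "norm ((w y - w x) * ((?u y $ 1 - ?u x $ 1) * eta1 e (x - y) + (?u y $ 2 - ?u x $ 2) * eta2 e (x - y))) \<le> \<bar>w y - w x\<bar> * ?n * G (x - y)"
        by (simp add: abs_mult mult.assoc)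
    qed
    also have "\<dots> = (LBNN z. ennreal (?P x z))"
      using nn_integral_shift(3)[of "\<lambda>y. ennreal (\<bar>w y - w x\<bar> * norm (?u y - ?u x) * G (x - y))" x] by simp
    finally show ?thesis .
  qed
  have inner: "(LBNN x. ennreal (?P x z)) \<le> ennreal (e * (s * om / 2 + 8 * Q / s) * G z)" for z
  proof (cases "norm z \<le> 2 * e")
    case False
    then have "G z = 0" using eta_supp[OF e, of z] by (simp add: G_def)
    then show ?thesis by simp
  next
    case True
    let ?a = "\<lambda>x. w (x - z) - w x" and ?b = "\<lambda>x. norm (?u (x - z) - ?u x)"
    have a2: "L1 (\<lambda>x. (?a x)\<^sup>2)"
    proof (rule Bochner_Integration.integrable_bound[of _ "\<lambda>x. 2 * (w (x - z))\<^sup>2 + 2 * (w x)\<^sup>2"])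
      show "L1 (\<lambda>x. 2 * (w (x - z))\<^sup>2 + 2 * (w x)\<^sup>2)"
        using w2 integrable_shift(2)[of "\<lambda>x. (w x)\<^sup>2" z] by auto
      have "(a - b)\<^sup>2 \<le> 2 * a\<^sup>2 + 2 * b\<^sup>2" for a b :: real
        using zero_le_power2[of "a + b"] by (simp add: power2_eq_square algebra_simps)
      then show "AE x in lborel. norm ((?a x)\<^sup>2) \<le> norm (2 * (w (x - z))\<^sup>2 + 2 * (w x)\<^sup>2)" by auto
    qed measurable
    have "(LBNN x. ennreal ((?a x)\<^sup>2)) = ennreal (LBINT x. (?a x)\<^sup>2)" using a2 by (rule nn_integral_eq_integral) auto
    also have "\<dots> \<le> ennreal om" using om[OF True] by (rule ennreal_leI)
    finally have A: "(LBNN x. ennreal ((?a x)\<^sup>2)) \<le> ennreal om" .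
    have B: "(LBNN x. ennreal ((?b x)\<^sup>2)) \<le> ennreal (16 * Q * e\<^sup>2)"
    proof -
      have "(LBNN x. ennreal ((?b x)\<^sup>2)) \<le> ennreal (4 * Q * (norm z)\<^sup>2)"
        using velocity_diff_L2[OF w w2, of "-z"] by (simp add: Q_def)
      also have "4 * Q * (norm z)\<^sup>2 \<le> 4 * Q * (2 * e)\<^sup>2" using Q0 True by (intro mult_left_mono power_mono) auto
      finally show ?thesis by (simp add: power_mult_distrib ennreal_leI mult.assoc)
    qed
    have "(LBNN x. ennreal (?P x z)) \<le> (LBNN x. ennreal (G z * (e * s / 2)) * ennreal ((?a x)\<^sup>2) + ennreal (G z / (2 * e * s)) * ennreal ((?b x)\<^sup>2))"
    proof (intro nn_integral_mono)
      fix x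
      \<comment> \<open>The weight e s makes both terms proportional to e after integration: e s om
        / 2 and 16 Q e^2 / (2 e s) = 8 Q e / s.\<close>
      have "\<bar>?a x\<bar> * ?b x \<le> (e * s * (?a x)\<^sup>2 + (?b x)\<^sup>2 / (e * s)) / 2" using amgm[of "e * s" "\<bar>?a x\<bar>" "?b x"] e s by simp
      from mult_right_mono[OF this G0[of z]]
      have "?P x z \<le> (e * s * (?a x)\<^sup>2 + (?b x)\<^sup>2 / (e * s)) / 2 * G z" .
      also have "\<dots> = G z * (e * s / 2) * (?a x)\<^sup>2 + G z / (2 * e * s) * (?b x)\<^sup>2"
      proof -
        have "(e * s * A + B / (e * s)) / 2 * g = g * (e * s / 2) * A + g / (2 * e * s) * B" for A B g
          using e s by (simp add: field_simps)
        then show ?thesis .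
      qed
      finally have "?P x z \<le> G z * (e * s / 2) * (?a x)\<^sup>2 + G z / (2 * e * s) * (?b x)\<^sup>2" .
      then show "ennreal (?P x z) \<le> ennreal (G z * (e * s / 2)) * ennreal ((?a x)\<^sup>2) + ennreal (G z / (2 * e * s)) * ennreal ((?b x)\<^sup>2)"
        using G0[of z] e s by (simp add: ennreal_leI flip: ennreal_mult ennreal_plus)
    qed
    also have "\<dots> = ennreal (G z * (e * s / 2)) * (LBNN x. ennreal ((?a x)\<^sup>2)) + ennreal (G z / (2 * e * s)) * (LBNN x. ennreal ((?b x)\<^sup>2))"
      by (subst nn_integral_add) (auto simp: nn_integral_cmult)
    also have "\<dots> \<le> ennreal (G z * (e * s / 2)) * ennreal om + ennreal (G z / (2 * e * s)) * ennreal (16 * Q * e\<^sup>2)"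
      by (intro add_mono mult_left_mono A B) auto
    also have "\<dots> = ennreal (e * (s * om / 2 + 8 * Q / s) * G z)"
      using G0[of z] e s om0 Q0 by (simp add: ennreal_mult[symmetric] ennreal_plus[symmetric] field_simps power2_eq_square del: ennreal_plus)
    finally show ?thesis .
  qed
  have Gi: "L1 G" "(LBINT z. G z) = Ceta / e"
    using eta_int[OF e] eta_grad_int[OF e] by (auto simp: G_def[abs_def])
  have c0: "0 \<le> e * (s * om / 2 + 8 * Q / s)" using e s om0 Q0 by simp
  have "(LBNN x. ennreal \<bar>rr e w x\<bar>) \<le> (LBNN x. (LBNN z. ennreal (?P x z)))"
    by (intro nn_integral_mono pt)
  also have "\<dots> = (LBNN z. (LBNN x. ennreal (?P x z)))"
    by (rule lborel_pair.Fubini') measurable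
  also have "\<dots> \<le> (LBNN z. ennreal (e * (s * om / 2 + 8 * Q / s) * G z))" by (intro nn_integral_mono inner)
  also have "\<dots> = ennreal (LBINT z. e * (s * om / 2 + 8 * Q / s) * G z)"
    by (rule nn_integral_eq_integral) (use Gi c0 G0 in auto)
  also have "(LBINT z. e * (s * om / 2 + 8 * Q / s) * G z) = s * (Ceta * om / 2) + 8 * Ceta * Q / s"
    unfolding integral_mult_right_zero Gi(2) using e s by (simp add: field_simps)
  finally have *: "(LBNN x. ennreal \<bar>rr e w x\<bar>) \<le> ennreal (s * (Ceta * om / 2) + 8 * Ceta * Q / s)" .
  show i: "L1 (rr e w)" using * by (intro integrableI_bounded) (auto simp: order_le_less_trans)
  have "0 \<le> s * (Ceta * om / 2) + 8 * Ceta * Q / s" using s om0 Q0 Ceta_nonneg by simp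
  then show "(LBINT x. \<bar>rr e w x\<bar>) \<le> s * (Ceta * om / 2) + 8 * Ceta * Q / s"
    using * i by (subst (asm) nn_integral_eq_integral) (auto simp: ennreal_le_iff)
qed

lemma vanish_seq:
  fixes a b :: "nat \<Rightarrow> real"
  assumes nn: "\<And>n. 0 \<le> a n" and le: "\<And>n s. s > 0 \<Longrightarrow> a n \<le> s * b n + C / s" and b: "b \<longlonglongrightarrow> 0"
  shows "a \<longlonglongrightarrow> 0"
proof (rule LIMSEQ_I)
  fix r :: real assume r: "r > 0"
  \<comment> \<open>Chosen so that C / s \<le> r / 2; the summand 1 keeps s positive when C =
    0.\<close>
  define s where "s = 2 * (\<bar>C\<bar> + 1) / r"
  have s: "s > 0" using r by (simp add: s_def add_nonneg_pos)
  have "C / s \<le> \<bar>C\<bar> / s" using s by (intro divide_right_mono) auto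
  also have "\<dots> \<le> r / 2" using r by (simp add: s_def field_simps)
  finally have c: "C / s \<le> r / 2" .
  from LIMSEQ_D[OF b, of "r / (2 * s)"] r s obtain N where N: "\<And>n. n \<ge> N \<Longrightarrow> \<bar>b n\<bar> < r / (2 * s)" by auto
  have "norm (a n - 0) < r" if "n \<ge> N" for n
  proof -
    have "s * b n < s * (r / (2 * s))" using N[OF that] s by (intro mult_strict_left_mono) auto
    then have "s * b n < r / 2" using s by simp
    then show ?thesis using le[OF s, of n] c unfolding diff_0_right real_norm_def abs_of_nonneg[OF nn] by linarith
  qed
  then show "\<exists>no. \<forall>n\<ge>no. norm (a n - 0) < r" by blast
qed

text \<open>The crude modulus om = 4 Q with s = 1 gives 2 + 8 = 10 times \<open>Ceta\<close> Q.
  Being uniform in e, this enters the majorant for the limit e to 0 under the time integral.\<close>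

lemma commutator_bounded:
  assumes w: "L1 w" and w2: "L1 (\<lambda>x. (w x)\<^sup>2)" and e: "e > 0"
  shows "L1 (rr e w)" "(LBINT x. \<bar>rr e w x\<bar>) \<le> 10 * Ceta * (LBINT x. (w x)\<^sup>2)"
proof -
  have [measurable]: "w \<in> borel_measurable borel" using w by auto
  define Q where "Q = (LBINT x. (w x)\<^sup>2)"
  have "(LBINT x. (w (x - z) - w x)\<^sup>2) \<le> 4 * Q" for z
  proof -
    have i: "L1 (\<lambda>x. (w (x - z))\<^sup>2)" using w2 integrable_shift(2)[of "\<lambda>x. (w x)\<^sup>2" z] by auto
    have sq: "(a - b)\<^sup>2 \<le> 2 * a\<^sup>2 + 2 * b\<^sup>2" for a b :: real
      using zero_le_power2[of "a + b"] by (simp add: power2_eq_square algebra_simps)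
    have "(LBINT x. (w (x - z) - w x)\<^sup>2) \<le> (LBINT x. 2 * (w (x - z))\<^sup>2 + 2 * (w x)\<^sup>2)"
      by (rule integral_mono') (use i w2 sq in auto)
    also have "\<dots> = 4 * Q" using i w2 integral_shift(2)[of "\<lambda>x. (w x)\<^sup>2" z] by (simp add: Q_def)
    finally show ?thesis .
  qed
  from commutator_bound[OF w w2 e zero_less_one this, folded Q_def]
  show "L1 (rr e w)" "(LBINT x. \<bar>rr e w x\<bar>) \<le> 10 * Ceta * (LBINT x. (w x)\<^sup>2)"
    by (simp_all add: Q_def[symmetric] mult_ac)
qed

text \<open>The order of choices matters: s makes 8 \<open>Ceta\<close> Q / s small, then
  \<open>om\<close> is fixed in terms of s, and only then does continuity of translations in L^2 say
  how small \<open>E n\<close> must be.\<close>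

lemma commutator_tendsto:
  assumes w: "L1 w" and w2: "L1 (\<lambda>x. (w x)\<^sup>2)" and E: "\<And>n. E n > 0" "E \<longlonglongrightarrow> 0"
  shows "(\<lambda>n. LBINT x. \<bar>rr (E n) w x\<bar>) \<longlonglongrightarrow> 0"
proof (rule LIMSEQ_I)
  fix r :: real assume r: "r > 0"
  define Q where "Q = (LBINT x. (w x)\<^sup>2)"
  define C where "C = 8 * Ceta * Q"
  have C0: "C \<ge> 0" using Ceta_nonneg by (simp add: C_def Q_def)
  define s where "s = 2 * (C + 1) / r"
  have s: "s > 0" using r C0 by (simp add: s_def)
  have Cs: "C / s < r / 2" using r C0 by (simp add: s_def field_simps)
  define om where "om = r / (s * (Ceta + 1))"
  have om: "om > 0" using r s Ceta_nonneg by (simp add: om_def)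
  have so: "s * (Ceta * om / 2) \<le> r / 2"
  proof -
    have "s * (K * (r / (s * c)) / 2) = r / 2 * (K / c)" for K c using s by (simp add: mult.commute)
    then have "s * (Ceta * om / 2) = r / 2 * (Ceta / (Ceta + 1))" unfolding om_def .
    also have "\<dots> \<le> r / 2 * 1" using r Ceta_nonneg by (intro mult_left_mono) auto
    finally show ?thesis by simp
  qed
  obtain d where d: "d > 0" "\<And>z. norm z \<le> d \<Longrightarrow> (LBINT x. (w (x - z) - w x)\<^sup>2) \<le> om"
    using translation_L2_modulus[OF w w2 om] by auto
  from LIMSEQ_D[OF E(2), of "d / 2"] d obtain N where N: "\<And>n. n \<ge> N \<Longrightarrow> \<bar>E n\<bar> < d / 2" by auto
  have "norm ((LBINT x. \<bar>rr (E n) w x\<bar>) - 0) < r" if "n \<ge> N" for n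
  proof -
    have "(LBINT x. (w (x - z) - w x)\<^sup>2) \<le> om" if "norm z \<le> 2 * E n" for z
      using that N[OF \<open>n \<ge> N\<close>] E(1)[of n] by (intro d(2)) auto
    from commutator_bound(2)[OF w w2 E(1)[of n] s this] so Cs
    show ?thesis by (simp add: C_def Q_def)
  qed
  then show "\<exists>no. \<forall>n\<ge>no. norm ((LBINT x. \<bar>rr (E n) w x\<bar>) - 0) < r" by blast
qed

section \<open>Renormalisation in space\<close>

text \<open>Bounded slope and the value 0 at 0 give |beta(s)| \<le> L |s|, so that beta(w) is
  integrable along with w. The second derivative is evaluated on mollified functions under a
  compactly supported test function, where continuity suffices for integrability.\<close>

definition nice_beta :: "real \<Rightarrow> (real \<Rightarrow> real) \<Rightarrow> (real \<Rightarrow> real) \<Rightarrow> (real \<Rightarrow> real) \<Rightarrow> bool" where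
  "nice_beta L \<beta> \<beta>' \<beta>'' \<longleftrightarrow> (\<forall>s. (\<beta> has_real_derivative \<beta>' s) (at s)) \<and> (\<forall>s. (\<beta>' has_real_derivative \<beta>'' s) (at s))
     \<and> continuous_on UNIV \<beta>'' \<and> (\<forall>s. \<bar>\<beta>' s\<bar> \<le> L) \<and> \<beta> 0 = 0"

text \<open>Derivatives are carried as explicit functions: \<open>p1, p2, p11, p22\<close> are the first and the pure second partial derivatives of \<open>p\<close>.\<close>
definition nice_test :: "real \<Rightarrow> (real^2 \<Rightarrow> real) \<Rightarrow> (real^2 \<Rightarrow> real) \<Rightarrow> (real^2 \<Rightarrow> real) \<Rightarrow> (real^2 \<Rightarrow> real) \<Rightarrow> (real^2 \<Rightarrow> real) \<Rightarrow> bool" where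
  "nice_test R p p1 p2 p11 p22 \<longleftrightarrow> dird p e1 p1 \<and> dird p e2 p2 \<and> dird p1 e1 p11 \<and> dird p2 e2 p22
     \<and> continuous_on UNIV p \<and> continuous_on UNIV p1 \<and> continuous_on UNIV p2 \<and> continuous_on UNIV p11 \<and> continuous_on UNIV p22
     \<and> (\<forall>x. norm x > R \<longrightarrow> p x = 0 \<and> p1 x = 0 \<and> p2 x = 0 \<and> p11 x = 0 \<and> p22 x = 0)"

lemma nice_beta_cont:
  assumes "nice_beta L \<beta> \<beta>' \<beta>''"
  shows "continuous_on UNIV \<beta>" "continuous_on UNIV \<beta>'" "continuous_on UNIV \<beta>''"
  using assms DERIV_isCont unfolding nice_beta_def by (blast intro: continuous_at_imp_continuous_on)+

lemma nice_beta_lip: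
  assumes b: "nice_beta L \<beta> \<beta>' \<beta>''"
  shows "\<bar>\<beta> s - \<beta> t\<bar> \<le> L * \<bar>s - t\<bar>" "\<bar>\<beta> s\<bar> \<le> L * \<bar>s\<bar>" "L \<ge> 0"
proof -
  show 1: "\<bar>\<beta> s - \<beta> t\<bar> \<le> L * \<bar>s - t\<bar>" for s t
    using field_differentiable_bound[of UNIV \<beta> \<beta>' L s t] b unfolding nice_beta_def by auto
  show "\<bar>\<beta> s\<bar> \<le> L * \<bar>s\<bar>" using 1[of s 0] b unfolding nice_beta_def by simp
  show "L \<ge> 0" using b unfolding nice_beta_def by (metis abs_ge_zero order_trans)
qed

lemma nice_beta_measurable:
  assumes "nice_beta L \<beta> \<beta>' \<beta>''"
  shows "\<beta> \<in> borel_measurable borel" "\<beta>' \<in> borel_measurable borel" "\<beta>'' \<in> borel_measurable borel"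
  using nice_beta_cont[OF assms] by (auto intro: borel_measurable_continuous_onI)

lemma dird_compose:
  assumes f: "dird f e f'" and b: "\<And>s. (\<beta> has_real_derivative \<beta>' s) (at s)"
  shows "dird (\<lambda>x. \<beta> (f x)) e (\<lambda>x. \<beta>' (f x) * f' x)"
  unfolding dird_def
proof
  fix x
  have "((\<lambda>s. f (x + s *\<^sub>R e)) has_real_derivative f' x) (at 0)" using f unfolding dird_def by blast
  from DERIV_chain2[OF b this] show "((\<lambda>s. \<beta> (f (x + s *\<^sub>R e))) has_real_derivative \<beta>' (f x) * f' x) (at 0)" by simp
qed

lemma mollified_regular:
  assumes w: "L1 w" and e: "e > 0"
  shows "dird (conv w (eta e)) e1 (conv w (eta1 e))" "dird (conv w (eta e)) e2 (conv w (eta2 e))"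
    "dird (conv w (eta1 e)) e1 (conv w (eta11 e))" "dird (conv w (eta2 e)) e2 (conv w (eta22 e))"
    "continuous_on UNIV (conv w (eta e))" "continuous_on UNIV (conv w (eta1 e))" "continuous_on UNIV (conv w (eta2 e))"
    "continuous_on UNIV (conv w (eta11 e))" "continuous_on UNIV (conv w (eta22 e))"
proof -
  obtain B where B: "\<And>x. \<bar>eta e x\<bar> \<le> B" "\<And>x. \<bar>eta1 e x\<bar> \<le> B" "\<And>x. \<bar>eta2 e x\<bar> \<le> B" "\<And>x. \<bar>eta11 e x\<bar> \<le> B" "\<And>x. \<bar>eta22 e x\<bar> \<le> B"
    using eta_bound[OF e] by metis
  note D = eta_dird[OF e] and C = eta_cont[OF e]
  show "dird (conv w (eta e)) e1 (conv w (eta1 e))" by (rule conv_dird[OF w D(1) _ _ B(1,2)]) auto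
  show "dird (conv w (eta e)) e2 (conv w (eta2 e))" by (rule conv_dird[OF w D(2) _ _ B(1,3)]) auto
  show "dird (conv w (eta1 e)) e1 (conv w (eta11 e))" by (rule conv_dird[OF w D(3) _ _ B(2,4)]) auto
  show "dird (conv w (eta2 e)) e2 (conv w (eta22 e))" by (rule conv_dird[OF w D(4) _ _ B(3,5)]) auto
  show "continuous_on UNIV (conv w (eta e))" "continuous_on UNIV (conv w (eta1 e))" "continuous_on UNIV (conv w (eta2 e))"
    "continuous_on UNIV (conv w (eta11 e))" "continuous_on UNIV (conv w (eta22 e))"
    by (rule conv_continuous[OF w C(1) B(1)] conv_continuous[OF w C(2) B(2)] conv_continuous[OF w C(3) B(3)]
      conv_continuous[OF w C(4) B(4)] conv_continuous[OF w C(5) B(5)])+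
qed

lemma mollified_bounds:
  assumes w: "L1 w" and e: "e > 0"
  shows "L1 (conv w (eta e))" "(LBINT x. \<bar>conv w (eta e) x\<bar>) \<le> (LBINT x. \<bar>w x\<bar>)"
    "L1 (\<lambda>x. (w x)\<^sup>2) \<Longrightarrow> L1 (\<lambda>x. (conv w (eta e) x)\<^sup>2)"
    "L1 (\<lambda>x. (w x)\<^sup>2) \<Longrightarrow> (LBINT x. (conv w (eta e) x)\<^sup>2) \<le> (LBINT x. (w x)\<^sup>2)"
proof -
  have [measurable]: "w \<in> borel_measurable borel" using w by auto
  have one: "(LBINT x. \<bar>eta e x\<bar>) = 1" using eta_one[OF e] eta_nonneg[OF e] by simp
  show i: "L1 (conv w (eta e))" by (rule conv_integrable[OF w eta_int(1)[OF e]])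
  show "L1 (\<lambda>x. (w x)\<^sup>2) \<Longrightarrow> L1 (\<lambda>x. (conv w (eta e) x)\<^sup>2)"
    "L1 (\<lambda>x. (w x)\<^sup>2) \<Longrightarrow> (LBINT x. (conv w (eta e) x)\<^sup>2) \<le> (LBINT x. (w x)\<^sup>2)"
    using conv_L2[of w "eta e"] eta_int(1)[OF e] one by auto
  have J: "integrable (lborel \<Otimes>\<^sub>M lborel) (\<lambda>(x, y). \<bar>w y\<bar> * eta e (x - y))"
    by (rule conv_joint_integrable) (use w eta_int[OF e] in auto)
  have "(LBINT x. \<bar>conv w (eta e) x\<bar>) \<le> (LBINT x. conv (\<lambda>y. \<bar>w y\<bar>) (eta e) x)"
  proof (rule integral_mono)
    show "L1 (conv (\<lambda>y. \<bar>w y\<bar>) (eta e))" by (rule conv_integrable) (use w eta_int[OF e] in auto)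
    show "\<bar>conv w (eta e) x\<bar> \<le> conv (\<lambda>y. \<bar>w y\<bar>) (eta e) x" for x
      unfolding conv_def using integral_abs_bound[of lborel "\<lambda>y. w y * eta e (x - y)"] eta_nonneg[OF e] by (simp add: abs_mult)
  qed (use i in auto)
  also have "\<dots> = (LBINT y. (LBINT x. \<bar>w y\<bar> * eta e (x - y)))"
    unfolding conv_def by (rule lborel_pair.Fubini_integral[OF J, symmetric])
  also have "\<dots> = (LBINT y. \<bar>w y\<bar>)" using integral_shift(2)[of "eta e"] eta_one[OF e] by simp
  finally show "(LBINT x. \<bar>conv w (eta e) x\<bar>) \<le> (LBINT x. \<bar>w x\<bar>)" .
qed

text \<open>One time slice: w is the vorticity at a fixed time. The results are bounds uniform in
  the mollification scale and limits as the scale tends to 0, the two ingredients for dominated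
  convergence in time.\<close>

locale renorm_data =
  fixes w :: "real^2 \<Rightarrow> real" and \<beta> \<beta>' \<beta>'' :: "real \<Rightarrow> real" and L R B :: real and p p1 p2 p11 p22 :: "real^2 \<Rightarrow> real"
  assumes w: "L1 w" and w2: "L1 (\<lambda>x. (w x)\<^sup>2)"
    and b: "nice_beta L \<beta> \<beta>' \<beta>''" and p: "nice_test R p p1 p2 p11 p22"
    and B: "\<And>x. \<bar>p x\<bar> \<le> B" "\<And>x. \<bar>p1 x\<bar> \<le> B" "\<And>x. \<bar>p2 x\<bar> \<le> B" "\<And>x. \<bar>p11 x\<bar> \<le> B" "\<And>x. \<bar>p22 x\<bar> \<le> B"
begin

lemma meas[measurable]: "w \<in> borel_measurable borel" "p \<in> borel_measurable borel" "p1 \<in> borel_measurable borel" "p2 \<in> borel_measurable borel"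
   "p11 \<in> borel_measurable borel" "p22 \<in> borel_measurable borel" "\<beta> \<in> borel_measurable borel" "\<beta>' \<in> borel_measurable borel" "\<beta>'' \<in> borel_measurable borel"
  using w p nice_beta_measurable[OF b] by (auto simp: nice_test_def borel_measurable_continuous_onI)

lemma P: "dird p e1 p1" "dird p e2 p2" "dird p1 e1 p11" "dird p2 e2 p22"
   "continuous_on UNIV p" "continuous_on UNIV p1" "continuous_on UNIV p2" "continuous_on UNIV p11" "continuous_on UNIV p22"
   "\<And>x. norm x > R \<Longrightarrow> p x = 0" "\<And>x. norm x > R \<Longrightarrow> p1 x = 0" "\<And>x. norm x > R \<Longrightarrow> p2 x = 0" "\<And>x. norm x > R \<Longrightarrow> p11 x = 0" "\<And>x. norm x > R \<Longrightarrow> p22 x = 0"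
  using p by (auto simp: nice_test_def)

lemma BD: "\<And>s. (\<beta> has_real_derivative \<beta>' s) (at s)" "\<And>s. (\<beta>' has_real_derivative \<beta>'' s) (at s)" "\<And>s. \<bar>\<beta>' s\<bar> \<le> L"
  using b by (auto simp: nice_beta_def)

lemma B0: "B \<ge> 0" using B(1)[of 0] by linarith

lemma beta_cont_comp: "continuous_on UNIV f \<Longrightarrow> continuous_on UNIV (\<lambda>x::real^2. \<beta> (f x))"
  "continuous_on UNIV f \<Longrightarrow> continuous_on UNIV (\<lambda>x::real^2. \<beta>' (f x))"
  "continuous_on UNIV f \<Longrightarrow> continuous_on UNIV (\<lambda>x::real^2. \<beta>'' (f x))"
  using nice_beta_cont[OF b] by (auto intro: continuous_on_compose2)

lemma flux_bound: "\<bar>velocity w x $ 1 * p1 x + velocity w x $ 2 * p2 x\<bar> \<le> 2 * B * (indicator (cball 0 R) x * enn2real (Upot w x))"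
  if U: "Upot w x < \<infinity>"
proof (cases "norm x \<le> R")
  case True
  have v: "\<bar>velocity w x $ i\<bar> \<le> enn2real (Upot w x)" for i
    using velocity_le_real[OF _ U] component_le_norm_cart[of "velocity w x" i] by auto
  have "\<bar>velocity w x $ 1 * p1 x + velocity w x $ 2 * p2 x\<bar> \<le> \<bar>velocity w x $ 1\<bar> * \<bar>p1 x\<bar> + \<bar>velocity w x $ 2\<bar> * \<bar>p2 x\<bar>"
    unfolding abs_mult[symmetric] by (rule abs_triangle_ineq)
  also have "\<dots> \<le> enn2real (Upot w x) * B + enn2real (Upot w x) * B"
    by (intro add_mono mult_mono v B) auto
  finally show ?thesis using True by simp
qed (simp add: P)

text \<open>The pair g, h covers two uses: h = beta(m) with g = m, the mollified vorticity, and h =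
  beta(m) - beta(w) with g = m - w, whose L^2 norm becomes small.\<close>

lemma flux_integrable:
  assumes [measurable]: "g \<in> borel_measurable borel" and g2: "L1 (\<lambda>x. (g x)\<^sup>2)" and h: "\<And>x. \<bar>h x\<bar> \<le> L * \<bar>g x\<bar>"
    and [measurable]: "h \<in> borel_measurable borel"
  shows "L1 (\<lambda>x. h x * (velocity w x $ 1 * p1 x + velocity w x $ 2 * p2 x))"
   "s > 0 \<Longrightarrow> \<bar>LBINT x. h x * (velocity w x $ 1 * p1 x + velocity w x $ 2 * p2 x)\<bar>
     \<le> 2 * B * L * (s * ((1/2 + (LBINT x. \<bar>w x\<bar>)) * (LBINT x. (g x)\<^sup>2)) +
       (2 * pi\<^sup>2 * (LBINT x. (w x)\<^sup>2) + (LBINT x. \<bar>w x\<bar>) * measure lborel (cball (0::real^2) R)) / s)"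
proof -
  note U = Upot_weighted[OF w w2 assms(1) g2, where R=R]
  let ?F = "\<lambda>x. h x * (velocity w x $ 1 * p1 x + velocity w x $ 2 * p2 x)"
  let ?G = "\<lambda>x. 2 * B * L * (indicator (cball 0 R) x * (\<bar>g x\<bar> * enn2real (Upot w x)))"
  have pt: "AE x in lborel. norm (?F x) \<le> ?G x"
    using Upot_finite[OF w w2]
  proof eventually_elim
    case (elim x)
    have "norm (?F x) \<le> (L * \<bar>g x\<bar>) * (2 * B * (indicator (cball 0 R) x * enn2real (Upot w x)))"
      unfolding real_norm_def abs_mult[of "h x"] by (intro mult_mono h flux_bound elim) (use order_trans[OF abs_ge_zero h] in auto)
    then show ?case by (simp add: mult_ac)
  qed
  have gi: "L1 ?G" using U(1) by simp
  show i: "L1 ?F"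
    by (rule Bochner_Integration.integrable_bound[OF gi]) (use pt in \<open>auto elim!: eventually_mono\<close>)
  assume s: "s > 0"
  have "\<bar>LBINT x. ?F x\<bar> \<le> (LBINT x. \<bar>?F x\<bar>)" by (rule integral_abs_bound)
  also have "\<dots> \<le> (LBINT x. ?G x)" using pt i gi by (intro integral_mono_AE) auto
  also have "\<dots> = 2 * B * L * (LBINT x. indicator (cball 0 R) x * (\<bar>g x\<bar> * enn2real (Upot w x)))" by simp
  also have "\<dots> \<le> 2 * B * L * (s * ((1/2 + (LBINT x. \<bar>w x\<bar>)) * (LBINT x. (g x)\<^sup>2)) +
       (2 * pi\<^sup>2 * (LBINT x. (w x)\<^sup>2) + (LBINT x. \<bar>w x\<bar>) * measure lborel (cball (0::real^2) R)) / s)"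
    using B0 nice_beta_lip(3)[OF b] by (intro mult_left_mono U(2)[OF s]) auto
  finally show "\<bar>LBINT x. ?F x\<bar> \<le> 2 * B * L * (s * ((1/2 + (LBINT x. \<bar>w x\<bar>)) * (LBINT x. (g x)\<^sup>2)) +
       (2 * pi\<^sup>2 * (LBINT x. (w x)\<^sup>2) + (LBINT x. \<bar>w x\<bar>) * measure lborel (cball (0::real^2) R)) / s)" .
qed

text \<open>\<open>De\<close> is the commutator plus the velocity times the gradient of the
  mollified vorticity m. Writing p beta'(m) grad m = grad (p beta(m)) - beta(m) grad p moves the
  derivative to the test function, and the full gradient integrates to 0 against the divergence-free
  velocity.\<close>

lemma transport_identity:
  assumes e: "e > 0"
  shows "L1 (\<lambda>x. p x * \<beta>' (conv w (eta e) x) * De e w x)"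
    "(LBINT x. p x * \<beta>' (conv w (eta e) x) * De e w x) = (LBINT x. p x * \<beta>' (conv w (eta e) x) * rr e w x)
       - (LBINT x. \<beta> (conv w (eta e) x) * (velocity w x $ 1 * p1 x + velocity w x $ 2 * p2 x))"
    "\<bar>LBINT x. p x * \<beta>' (conv w (eta e) x) * rr e w x\<bar> \<le> B * L * (LBINT x. \<bar>rr e w x\<bar>)"
proof -
  let ?m = "conv w (eta e)"
  note M = mollified_regular[OF w e]
  let ?f1 = "\<lambda>x. p1 x * \<beta> (?m x) + p x * (\<beta>' (?m x) * conv w (eta1 e) x)"
  let ?f2 = "\<lambda>x. p2 x * \<beta> (?m x) + p x * (\<beta>' (?m x) * conv w (eta2 e) x)"
  have d: "dird (\<lambda>x. p x * \<beta> (?m x)) e1 ?f1" "dird (\<lambda>x. p x * \<beta> (?m x)) e2 ?f2"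
    by (rule dird_mult[OF P(1) dird_compose[OF M(1) BD(1)]] dird_mult[OF P(2) dird_compose[OF M(2) BD(1)]])+
  have c: "continuous_on UNIV (\<lambda>x. p x * \<beta> (?m x))" "continuous_on UNIV ?f1" "continuous_on UNIV ?f2"
    by (intro P M beta_cont_comp(1,2)[OF M(5)] continuous_intros)+
  have div: "(LBINT x. velocity w x $ 1 * ?f1 x + velocity w x $ 2 * ?f2 x) = 0"
    by (rule velocity_div_free[OF w w2 d c, of R]) (auto simp: P)
  have vi: "L1 (\<lambda>x. velocity w x $ i * g x)" if g: "continuous_on UNIV g" "\<And>x. norm x > R \<Longrightarrow> g x = 0" for g i
  proof -
    obtain C where "\<forall>x. \<bar>g x\<bar> \<le> C" using cont_supp_integrable(2)[OF g] by auto
    then show ?thesis using g by (intro velocity_test_integrable(2)[OF w w2, of g C R]) (auto simp: borel_measurable_continuous_onI)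
  qed
  have i1: "L1 (\<lambda>x. velocity w x $ 1 * ?f1 x)" "L1 (\<lambda>x. velocity w x $ 2 * ?f2 x)"
    by (rule vi, rule c, simp add: P)+
  have wm2: "L1 (\<lambda>x. (?m x)\<^sup>2)" using mollified_bounds(3)[OF w e w2] .
  have ib: "L1 (\<lambda>x. \<beta> (?m x) * (velocity w x $ 1 * p1 x + velocity w x $ 2 * p2 x))"
    by (rule flux_integrable(1)[OF _ wm2]) (auto intro: nice_beta_lip(2)[OF b])
  note R = commutator_bounded[OF w w2 e]
  have rb: "\<bar>p x * \<beta>' (?m x) * rr e w x\<bar> \<le> B * L * \<bar>rr e w x\<bar>" for x
    unfolding abs_mult using B0 by (intro mult_right_mono mult_mono B BD) auto
  have ir: "L1 (\<lambda>x. p x * \<beta>' (?m x) * rr e w x)"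
    by (rule Bochner_Integration.integrable_bound[OF integrable_mult_right[OF integrable_abs[OF R(1)], of "B * L"]])
       (use rb in \<open>auto intro!: AE_I2 intro: order_trans[OF _ abs_ge_self]\<close>)
  show "\<bar>LBINT x. p x * \<beta>' (?m x) * rr e w x\<bar> \<le> B * L * (LBINT x. \<bar>rr e w x\<bar>)"
  proof -
    have "\<bar>LBINT x. p x * \<beta>' (?m x) * rr e w x\<bar> \<le> (LBINT x. \<bar>p x * \<beta>' (?m x) * rr e w x\<bar>)" by (rule integral_abs_bound)
    also have "\<dots> \<le> (LBINT x. B * L * \<bar>rr e w x\<bar>)" using rb ir R by (intro integral_mono) auto
    finally show ?thesis by simp
  qed
  have eq: "(\<lambda>x. p x * \<beta>' (?m x) * De e w x) = (\<lambda>x. p x * \<beta>' (?m x) * rr e w x + ((velocity w x $ 1 * ?f1 x + velocity w x $ 2 * ?f2 x)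
      - \<beta> (?m x) * (velocity w x $ 1 * p1 x + velocity w x $ 2 * p2 x)))"
    by (auto simp: fun_eq_iff rr_def algebra_simps)
  have i2: "L1 (\<lambda>x. velocity w x $ 1 * ?f1 x + velocity w x $ 2 * ?f2 x)" using i1 by (rule Bochner_Integration.integrable_add)
  show "L1 (\<lambda>x. p x * \<beta>' (?m x) * De e w x)" unfolding eq
    by (intro Bochner_Integration.integrable_add Bochner_Integration.integrable_diff ir i2 ib)
  have "(LBINT x. p x * \<beta>' (?m x) * De e w x) = (LBINT x. p x * \<beta>' (?m x) * rr e w x) +
    ((LBINT x. velocity w x $ 1 * ?f1 x + velocity w x $ 2 * ?f2 x) - (LBINT x. \<beta> (?m x) * (velocity w x $ 1 * p1 x + velocity w x $ 2 * p2 x)))"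
    unfolding eq Bochner_Integration.integral_add[OF ir Bochner_Integration.integrable_diff[OF i2 ib]] Bochner_Integration.integral_diff[OF i2 ib] ..
  then show "(LBINT x. p x * \<beta>' (?m x) * De e w x) = (LBINT x. p x * \<beta>' (?m x) * rr e w x)
       - (LBINT x. \<beta> (?m x) * (velocity w x $ 1 * p1 x + velocity w x $ 2 * p2 x))" unfolding div by simp
qed

text \<open>Mollification does not increase the L^2 norm, so with s = 1 the flux estimate is uniform
  in e; the result is affine in the mass.\<close>

lemma transport_bound:
  assumes e: "e > 0"
  shows "\<bar>LBINT x. p x * \<beta>' (conv w (eta e) x) * De e w x\<bar>
   \<le> B * L * (10 * Ceta * (LBINT x. (w x)\<^sup>2)) + 2 * B * L * ((1/2 + (LBINT x. \<bar>w x\<bar>)) * (LBINT x. (w x)\<^sup>2) +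
       (2 * pi\<^sup>2 * (LBINT x. (w x)\<^sup>2) + (LBINT x. \<bar>w x\<bar>) * measure lborel (cball (0::real^2) R)))"
proof -
  let ?m = "conv w (eta e)"
  have L0: "L \<ge> 0" by (rule nice_beta_lip(3)[OF b])
  note m2 = mollified_bounds(3,4)[OF w e w2]
  have "\<bar>LBINT x. \<beta> (?m x) * (velocity w x $ 1 * p1 x + velocity w x $ 2 * p2 x)\<bar> \<le> 2 * B * L * (1 * ((1/2 + (LBINT x. \<bar>w x\<bar>)) * (LBINT x. (?m x)\<^sup>2)) +
       (2 * pi\<^sup>2 * (LBINT x. (w x)\<^sup>2) + (LBINT x. \<bar>w x\<bar>) * measure lborel (cball (0::real^2) R)) / 1)"
    by (rule flux_integrable(2)[OF _ m2(1)]) (auto intro: nice_beta_lip(2)[OF b])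
  also have "\<dots> \<le> 2 * B * L * (1 * ((1/2 + (LBINT x. \<bar>w x\<bar>)) * (LBINT x. (w x)\<^sup>2)) +
       (2 * pi\<^sup>2 * (LBINT x. (w x)\<^sup>2) + (LBINT x. \<bar>w x\<bar>) * measure lborel (cball (0::real^2) R)) / 1)"
    using B0 L0 m2(2) by (intro mult_left_mono add_right_mono) auto
  finally have 1: "\<bar>LBINT x. \<beta> (?m x) * (velocity w x $ 1 * p1 x + velocity w x $ 2 * p2 x)\<bar> \<le> 2 * B * L * ((1/2 + (LBINT x. \<bar>w x\<bar>)) * (LBINT x. (w x)\<^sup>2) +
       (2 * pi\<^sup>2 * (LBINT x. (w x)\<^sup>2) + (LBINT x. \<bar>w x\<bar>) * measure lborel (cball (0::real^2) R)))" by simp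
  have "B * L * (LBINT x. \<bar>rr e w x\<bar>) \<le> B * L * (10 * Ceta * (LBINT x. (w x)\<^sup>2))"
    using B0 L0 by (intro mult_left_mono commutator_bounded[OF w w2 e]) auto
  with 1 transport_identity(2,3)[OF e] show ?thesis by linarith
qed

text \<open>Two errors occur. The commutator vanishes by \<open>commutator_tendsto\<close>; the flux
  of beta(m) - beta(w) is controlled by the L^2 distance of m and w, through the Lipschitz bound and
  \<open>vanish_seq\<close>.\<close>

lemma transport_tendsto:
  assumes E: "\<And>n. E n > 0" "E \<longlonglongrightarrow> 0"
  shows "(\<lambda>n. LBINT x. p x * \<beta>' (conv w (eta (E n)) x) * De (E n) w x) \<longlonglongrightarrow>
     - (LBINT x. \<beta> (w x) * (velocity w x $ 1 * p1 x + velocity w x $ 2 * p2 x))"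
proof -
  let ?F = "\<lambda>x. velocity w x $ 1 * p1 x + velocity w x $ 2 * p2 x"
  let ?m = "\<lambda>n. conv w (eta (E n))"
  have L0: "L \<ge> 0" by (rule nice_beta_lip(3)[OF b])
  have "(\<lambda>n. B * L * (LBINT x. \<bar>rr (E n) w x\<bar>)) \<longlonglongrightarrow> B * L * 0"
    by (intro tendsto_intros commutator_tendsto[OF w w2 E])
  then have c0: "(\<lambda>n. B * L * (LBINT x. \<bar>rr (E n) w x\<bar>)) \<longlonglongrightarrow> 0" by simp
  have 1: "(\<lambda>n. LBINT x. p x * \<beta>' (?m n x) * rr (E n) w x) \<longlonglongrightarrow> 0"
  proof (rule Lim_null_comparison[OF always_eventually, rotated])
    show "\<forall>n. norm (LBINT x. p x * \<beta>' (?m n x) * rr (E n) w x) \<le> B * L * (LBINT x. \<bar>rr (E n) w x\<bar>)"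
      unfolding real_norm_def by (intro allI transport_identity(3) E(1))
  qed (rule c0)
  have m2: "L1 (\<lambda>x. (?m n x - w x)\<^sup>2)" for n
  proof (rule Bochner_Integration.integrable_bound[of _ "\<lambda>x. 2 * (?m n x)\<^sup>2 + 2 * (w x)\<^sup>2"])
    have "(a - b)\<^sup>2 \<le> 2 * a\<^sup>2 + 2 * b\<^sup>2" for a b :: real
      using zero_le_power2[of "a + b"] by (simp add: power2_eq_square algebra_simps)
    then show "AE x in lborel. norm ((?m n x - w x)\<^sup>2) \<le> norm (2 * (?m n x)\<^sup>2 + 2 * (w x)\<^sup>2)" by auto
  qed (use w2 mollified_bounds(3)[OF w E(1) w2] in auto)
  have "(\<lambda>n. \<bar>LBINT x. (\<beta> (?m n x) - \<beta> (w x)) * ?F x\<bar>) \<longlonglongrightarrow> 0"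
  proof (rule vanish_seq)
    fix n and s :: real assume s: "s > 0"
    have lip: "\<bar>\<beta> (?m n x) - \<beta> (w x)\<bar> \<le> L * \<bar>?m n x - w x\<bar>" for x by (rule nice_beta_lip(1)[OF b])
    have "\<bar>LBINT x. (\<beta> (?m n x) - \<beta> (w x)) * ?F x\<bar> \<le>
      2 * B * L * (s * ((1/2 + (LBINT x. \<bar>w x\<bar>)) * (LBINT x. (?m n x - w x)\<^sup>2)) +
       (2 * pi\<^sup>2 * (LBINT x. (w x)\<^sup>2) + (LBINT x. \<bar>w x\<bar>) * measure lborel (cball (0::real^2) R)) / s)"
      by (rule flux_integrable(2)[OF _ m2 lip _ s]) measurable
    then show "\<bar>LBINT x. (\<beta> (?m n x) - \<beta> (w x)) * ?F x\<bar> \<le> s * (2 * B * L * ((1/2 + (LBINT x. \<bar>w x\<bar>)) * (LBINT x. (?m n x - w x)\<^sup>2)))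
       + (2 * B * L * (2 * pi\<^sup>2 * (LBINT x. (w x)\<^sup>2) + (LBINT x. \<bar>w x\<bar>) * measure lborel (cball (0::real^2) R))) / s"
      by (simp only: distrib_left times_divide_eq_right mult.left_commute[of s])
  next
    have "(\<lambda>n. 2 * B * L * ((1/2 + (LBINT x. \<bar>w x\<bar>)) * (LBINT x. (?m n x - w x)\<^sup>2))) \<longlonglongrightarrow> 2 * B * L * ((1/2 + (LBINT x. \<bar>w x\<bar>)) * 0)"
      by (intro tendsto_intros conv_L2_approx w w2 is_moll_eta E)
    then show "(\<lambda>n. 2 * B * L * ((1/2 + (LBINT x. \<bar>w x\<bar>)) * (LBINT x. (?m n x - w x)\<^sup>2))) \<longlonglongrightarrow> 0" by simp
  qed auto
  then have 2: "(\<lambda>n. LBINT x. (\<beta> (?m n x) - \<beta> (w x)) * ?F x) \<longlonglongrightarrow> 0" by (rule tendsto_rabs_zero_cancel)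
  have ib: "L1 (\<lambda>x. \<beta> (?m n x) * ?F x)" for n
    by (rule flux_integrable(1)[OF _ mollified_bounds(3)[OF w E(1) w2]]) (auto intro: nice_beta_lip(2)[OF b])
  have ib0: "L1 (\<lambda>x. \<beta> (w x) * ?F x)"
    by (rule flux_integrable(1)[OF _ w2]) (auto intro: nice_beta_lip(2)[OF b])
  have eq: "(LBINT x. p x * \<beta>' (?m n x) * De (E n) w x) = (LBINT x. p x * \<beta>' (?m n x) * rr (E n) w x)
     - (LBINT x. (\<beta> (?m n x) - \<beta> (w x)) * ?F x) - (LBINT x. \<beta> (w x) * ?F x)" for n
    unfolding transport_identity(2)[OF E(1)] left_diff_distrib Bochner_Integration.integral_diff[OF ib ib0] by simp
  have "(\<lambda>n. (LBINT x. p x * \<beta>' (?m n x) * rr (E n) w x) - (LBINT x. (\<beta> (?m n x) - \<beta> (w x)) * ?F x) - (LBINT x. \<beta> (w x) * ?F x))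
     \<longlonglongrightarrow> 0 - 0 - (LBINT x. \<beta> (w x) * ?F x)"
    by (intro tendsto_intros 1 2)
  then show ?thesis unfolding eq by simp
qed

text \<open>Two integrations by parts put the second derivatives on the test function and leave the
  term - p beta''(m) |grad m|^2, which has a sign for convex beta and p \<ge> 0 and is
  dropped.\<close>

lemma laplace_ineq:
  assumes e: "e > 0" and p0: "\<And>x. p x \<ge> 0" and b0: "\<And>s. \<beta>'' s \<ge> 0"
  shows "(LBINT x. p x * \<beta>' (conv w (eta e) x) * (conv w (eta11 e) x + conv w (eta22 e) x))
     \<le> (LBINT x. \<beta> (conv w (eta e) x) * (p11 x + p22 x))"
proof -
  let ?m = "conv w (eta e)"
  note M = mollified_regular[OF w e]
  have int: "L1 g" if "continuous_on UNIV g" "\<And>x. norm x > R \<Longrightarrow> g x = 0" for g :: "real^2 \<Rightarrow> real"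
    by (rule cont_supp_integrable(1)[OF that])
  have gen: "(LBINT x. p x * \<beta>' (?m x) * mm x) \<le> (LBINT x. \<beta> (?m x) * pp x)"
    if d: "dird p ee pj" "dird pj ee pp" "dird ?m ee mi" "dird mi ee mm" and c: "continuous_on UNIV pj" "continuous_on UNIV pp" "continuous_on UNIV mi" "continuous_on UNIV mm"
     and z: "\<And>x. norm x > R \<Longrightarrow> pj x = 0" "\<And>x. norm x > R \<Longrightarrow> pp x = 0" for ee pj pp mi mm
  proof -
    note CC = c P(5) M(5) beta_cont_comp[OF M(5)]
    have d1: "dird (\<lambda>x. p x * (\<beta>' (?m x) * mi x)) ee (\<lambda>x. pj x * (\<beta>' (?m x) * mi x) + p x * ((\<beta>'' (?m x) * mi x) * mi x + \<beta>' (?m x) * mm x))"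
      by (intro dird_mult dird_compose d BD)
    have d2: "dird (\<lambda>x. pj x * \<beta> (?m x)) ee (\<lambda>x. pp x * \<beta> (?m x) + pj x * (\<beta>' (?m x) * mi x))"
      by (intro dird_mult dird_compose d BD)
    have I: "L1 (\<lambda>x. pj x * (\<beta>' (?m x) * mi x))" "L1 (\<lambda>x. p x * ((\<beta>'' (?m x) * mi x) * mi x))"
      "L1 (\<lambda>x. p x * (\<beta>' (?m x) * mm x))" "L1 (\<lambda>x. pp x * \<beta> (?m x))"
      "L1 (\<lambda>x. p x * (\<beta>' (?m x) * mi x))" "L1 (\<lambda>x. pj x * \<beta> (?m x))"
      by (rule int, intro CC continuous_intros, simp add: z P(10))+
    have z1: "(LBINT x. pj x * (\<beta>' (?m x) * mi x) + p x * ((\<beta>'' (?m x) * mi x) * mi x + \<beta>' (?m x) * mm x)) = 0"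
      by (rule integral_dird_zero[OF d1 I(5)], unfold distrib_left)
         (intro Bochner_Integration.integrable_add I CC continuous_intros)+
    have z2: "(LBINT x. pp x * \<beta> (?m x) + pj x * (\<beta>' (?m x) * mi x)) = 0"
      by (rule integral_dird_zero[OF d2 I(6)])
         (intro Bochner_Integration.integrable_add I CC continuous_intros)+
    have "0 \<le> (LBINT x. p x * ((\<beta>'' (?m x) * mi x) * mi x))"
      using p0 b0 by (intro Bochner_Integration.integral_nonneg) (simp add: mult.assoc)
    then have "(LBINT x. p x * (\<beta>' (?m x) * mm x)) \<le> (LBINT x. pp x * \<beta> (?m x))"
      using z1 z2 I by (simp add: distrib_left)
    then show ?thesis by (simp add: mult_ac)
  qed
  have 1: "(LBINT x. p x * \<beta>' (?m x) * conv w (eta11 e) x) \<le> (LBINT x. \<beta> (?m x) * p11 x)"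
    by (rule gen[OF P(1) P(3) M(1) M(3)]) (use P M in auto)
  have 2: "(LBINT x. p x * \<beta>' (?m x) * conv w (eta22 e) x) \<le> (LBINT x. \<beta> (?m x) * p22 x)"
    by (rule gen[OF P(2) P(4) M(2) M(4)]) (use P M in auto)
  have I: "L1 (\<lambda>x. p x * \<beta>' (?m x) * conv w (eta11 e) x)" "L1 (\<lambda>x. p x * \<beta>' (?m x) * conv w (eta22 e) x)"
    "L1 (\<lambda>x. \<beta> (?m x) * p11 x)" "L1 (\<lambda>x. \<beta> (?m x) * p22 x)"
    by (rule int, intro P M beta_cont_comp(1,2)[OF M(5)] continuous_intros, simp add: P)+
  show ?thesis using 1 2 I by (simp add: distrib_left)
qed

lemma beta_pair_bound:
  assumes e: "e > 0" and [measurable]: "g \<in> borel_measurable borel" and G: "\<And>x. \<bar>g x\<bar> \<le> G"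
  shows "L1 (\<lambda>x. \<beta> (conv w (eta e) x) * g x)" "\<bar>LBINT x. \<beta> (conv w (eta e) x) * g x\<bar> \<le> L * G * (LBINT x. \<bar>w x\<bar>)"
proof -
  have L0: "L \<ge> 0" by (rule nice_beta_lip(3)[OF b])
  have G0: "G \<ge> 0" using G[of 0] by linarith
  let ?m = "conv w (eta e)"
  note M = mollified_bounds[OF w e]
  have pt: "\<bar>\<beta> (?m x) * g x\<bar> \<le> L * G * \<bar>?m x\<bar>" for x
  proof -
    have "\<bar>\<beta> (?m x) * g x\<bar> \<le> (L * \<bar>?m x\<bar>) * G" unfolding abs_mult by (intro mult_mono nice_beta_lip(2)[OF b] G) (use L0 in auto)
    then show ?thesis by (simp add: mult_ac)
  qed
  show i: "L1 (\<lambda>x. \<beta> (?m x) * g x)"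
    by (rule Bochner_Integration.integrable_bound[OF integrable_mult_right[OF integrable_abs[OF M(1)], of "L * G"]])
       (use pt in \<open>auto intro!: AE_I2 intro: order_trans[OF _ abs_ge_self]\<close>)
  have "\<bar>LBINT x. \<beta> (?m x) * g x\<bar> \<le> (LBINT x. \<bar>\<beta> (?m x) * g x\<bar>)" by (rule integral_abs_bound)
  also have "\<dots> \<le> (LBINT x. L * G * \<bar>?m x\<bar>)" using i pt M by (intro integral_mono) auto
  also have "\<dots> \<le> L * G * (LBINT x. \<bar>w x\<bar>)" using M(2) L0 G0 by (simp add: mult_left_mono)
  finally show "\<bar>LBINT x. \<beta> (?m x) * g x\<bar> \<le> L * G * (LBINT x. \<bar>w x\<bar>)" .
qed

lemma beta_pair_tendsto:
  assumes E: "\<And>n. E n > 0" "E \<longlonglongrightarrow> 0" and [measurable]: "g \<in> borel_measurable borel" and G: "\<And>x. \<bar>g x\<bar> \<le> G"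
  shows "(\<lambda>n. LBINT x. \<beta> (conv w (eta (E n)) x) * g x) \<longlonglongrightarrow> (LBINT x. \<beta> (w x) * g x)"
proof -
  have L0: "L \<ge> 0" by (rule nice_beta_lip(3)[OF b])
  let ?m = "\<lambda>n. conv w (eta (E n))"
  have i: "L1 (\<lambda>x. \<beta> (?m n x) * g x)" for n by (rule beta_pair_bound(1)[OF E(1) _ G]) auto
  have pt: "\<bar>h * g x\<bar> \<le> L * G * \<bar>k\<bar>" if "\<bar>h\<bar> \<le> L * \<bar>k\<bar>" for h k x
  proof -
    have "\<bar>h * g x\<bar> \<le> (L * \<bar>k\<bar>) * G" unfolding abs_mult by (intro mult_mono that G) (use L0 in auto)
    then show ?thesis by (simp add: mult_ac)
  qed
  have pt0: "\<bar>\<beta> (w x) * g x\<bar> \<le> L * G * \<bar>w x\<bar>" for x by (rule pt[OF nice_beta_lip(2)[OF b]])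
  have i0: "L1 (\<lambda>x. \<beta> (w x) * g x)"
    by (rule Bochner_Integration.integrable_bound[OF integrable_mult_right[OF integrable_abs[OF w], of "L * G"]])
       (use pt0 in \<open>auto intro!: AE_I2 intro: order_trans[OF _ abs_ge_self]\<close>)
  have "(\<lambda>n. (LBINT x. \<beta> (?m n x) * g x) - (LBINT x. \<beta> (w x) * g x)) \<longlonglongrightarrow> 0"
  proof (rule Lim_null_comparison[OF always_eventually])
    have "(\<lambda>n. L * G * (LBINT x. \<bar>?m n x - w x\<bar>)) \<longlonglongrightarrow> L * G * 0"
      by (intro tendsto_intros conv_L1_approx w is_moll_eta E)
    then show "(\<lambda>n. L * G * (LBINT x. \<bar>?m n x - w x\<bar>)) \<longlonglongrightarrow> 0" by simp
    show "\<forall>n. norm ((LBINT x. \<beta> (?m n x) * g x) - (LBINT x. \<beta> (w x) * g x)) \<le> L * G * (LBINT x. \<bar>?m n x - w x\<bar>)"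
    proof
      fix n
      have "norm ((LBINT x. \<beta> (?m n x) * g x) - (LBINT x. \<beta> (w x) * g x)) = \<bar>LBINT x. (\<beta> (?m n x) - \<beta> (w x)) * g x\<bar>"
        using i[of n] i0 by (simp add: left_diff_distrib)
      also have "\<dots> \<le> (LBINT x. \<bar>(\<beta> (?m n x) - \<beta> (w x)) * g x\<bar>)" by (rule integral_abs_bound)
      also have "\<dots> \<le> (LBINT x. L * G * \<bar>?m n x - w x\<bar>)"
      proof (rule integral_mono)
        show "L1 (\<lambda>x. \<bar>(\<beta> (?m n x) - \<beta> (w x)) * g x\<bar>)"
          unfolding left_diff_distrib using i[of n] i0 by (intro integrable_abs Bochner_Integration.integrable_diff)
        show "L1 (\<lambda>x. L * G * \<bar>?m n x - w x\<bar>)"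
          using w mollified_bounds(1)[OF w E(1)[of n]] by simp
        show "\<bar>(\<beta> (?m n x) - \<beta> (w x)) * g x\<bar> \<le> L * G * \<bar>?m n x - w x\<bar>" for x
          by (rule pt) (rule nice_beta_lip(1)[OF b])
      qed
      finally show "norm ((LBINT x. \<beta> (?m n x) * g x) - (LBINT x. \<beta> (w x) * g x)) \<le> L * G * (LBINT x. \<bar>?m n x - w x\<bar>)" by simp
    qed
  qed
  then show ?thesis by (simp add: LIM_zero_iff)
qed

end

section \<open>Renormalisation in time\<close>

lemma dird_real_iff: "dird f (1::real) f' \<longleftrightarrow> (\<forall>x. (f has_real_derivative f' x) (at x))"
proof -
  have "((\<lambda>s. f (x + s *\<^sub>R 1)) has_real_derivative f' x) (at 0) \<longleftrightarrow> (f has_real_derivative f' x) (at x)" for x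
    using DERIV_shift[of f "f' x" 0 x] by (simp add: add.commute)
  then show ?thesis unfolding dird_def by simp
qed

lemma rho_bound:
  assumes d: "d > 0"
  obtains B where "\<And>x. \<bar>rho d x\<bar> \<le> B" "\<And>x. \<bar>rho1 d x\<bar> \<le> B"
proof -
  obtain A where A: "\<forall>x. \<bar>rho d x\<bar> \<le> A" using cont_supp_integrable(2)[OF rho_cont(1)[OF d], of d] rho_supp[OF d] by auto
  obtain C where C: "\<forall>x. \<bar>rho1 d x\<bar> \<le> C" using cont_supp_integrable(2)[OF rho_cont(2)[OF d], of d] rho_supp[OF d] by auto
  show ?thesis by (rule that[of "max A C"]) (use A C in \<open>auto simp: le_max_iff_disj\<close>)
qed

lemma conv_rho:
  assumes G: "L1 G" and d: "d > 0"
  shows "(conv G (rho d) has_real_derivative conv G (rho1 d) t) (at t)" "continuous_on UNIV (conv G (rho1 d))"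
proof -
  obtain B where B: "\<And>x. \<bar>rho d x\<bar> \<le> B" "\<And>x. \<bar>rho1 d x\<bar> \<le> B" using rho_bound[OF d] by metis
  have "dird (conv G (rho d)) 1 (conv G (rho1 d))"
    by (rule conv_dird[OF G _ _ _ B]) (auto simp: dird_real_iff rho_deriv d)
  then show "(conv G (rho d) has_real_derivative conv G (rho1 d) t) (at t)" by (simp add: dird_real_iff)
  show "continuous_on UNIV (conv G (rho1 d))" by (rule conv_continuous[OF G rho_cont(2)[OF d] B(2)])
qed

text \<open>The initial value enters by continuing \<open>g\<close> to negative times by the constant \<open>g0\<close>.\<close>
lemma time_renorm:
  fixes g f \<theta> \<theta>' :: "real \<Rightarrow> real" and g0 T T2 :: real
  assumes T: "0 < T2" "T2 < T"
    and g: "L1 (\<lambda>t. indicator {0<..<T} t * g t)" and f: "L1 (\<lambda>t. indicator {0<..<T} t * f t)"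
    and weak: "\<And>d t0. d > 0 \<Longrightarrow> t0 + d < T \<Longrightarrow>
      (LBINT t. indicator {0<..<T} t * (f t * rho d (t0 - t) - g t * rho1 d (t0 - t))) + g0 * rho d t0 = 0"
    and b: "nice_beta L \<beta> \<beta>' \<beta>''"
    and th: "\<And>t. (\<theta> has_real_derivative \<theta>' t) (at t)" "continuous_on UNIV \<theta>'"
    and th0: "\<And>t. t \<ge> T2 \<Longrightarrow> \<theta> t = 0" "\<And>t. t \<ge> T2 \<Longrightarrow> \<theta>' t = 0"
  shows "(LBINT t. indicator {0<..<T} t * (\<beta> (g t) * \<theta>' t + \<beta>' (g t) * f t * \<theta> t)) + \<beta> g0 * \<theta> 0 = 0"
proof -
  \<comment> \<open>The constant continuation reaches back to -2, while the argument starts at -1,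
    so that kernels of width d < 1 do not see the artificial edge. \<open>F\<close> is continued by
    0, the derivative of a constant.\<close>
  define G where "G s = indicator {-2..0} s * g0 + indicator {0<..<T} s * g s" for s
  define F where "F s = indicator {0<..<T} s * f s" for s
  have Gi: "L1 G" unfolding G_def using g by (intro Bochner_Integration.integrable_add) auto
  have Fi: "L1 F" unfolding F_def using f .
  have [measurable]: "G \<in> borel_measurable borel" "F \<in> borel_measurable borel" using Gi Fi by auto
  have [measurable]: "\<beta> \<in> borel_measurable borel" "\<beta>' \<in> borel_measurable borel" using nice_beta_measurable[OF b] by auto
  have thc: "continuous_on UNIV \<theta>" using th(1) DERIV_isCont by (blast intro: continuous_at_imp_continuous_on)
  have [measurable]: "\<theta> \<in> borel_measurable borel" "\<theta>' \<in> borel_measurable borel" using thc th(2) by (auto intro: borel_measurable_continuous_onI)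
  note bc = nice_beta_cont[OF b]
  have L0: "L \<ge> 0" by (rule nice_beta_lip(3)[OF b])
  have bL: "\<bar>\<beta>' s\<bar> \<le> L" for s using b by (auto simp: nice_beta_def)
  let ?I = "indicator {-1..T2} :: real \<Rightarrow> real"
  \<comment> \<open>The equation mollified in time, across time 0: the continued part contributes -
    g0 times \<open>rho d t\<close>, which is exactly the initial term in
    \<open>weak\<close>.\<close>
  have key: "conv G (rho1 d) t = conv F (rho d) t" if d: "d > 0" "d < 1" "T2 + d < T" and t: "-1 \<le> t" "t \<le> T2" for d t
  proof -
    obtain B where B: "\<And>x. \<bar>rho d x\<bar> \<le> B" "\<And>x. \<bar>rho1 d x\<bar> \<le> B" using rho_bound[OF d(1)] by metis
    have ig: "L1 (\<lambda>s. (indicator {0<..<T} s * g s) * rho1 d (t - s))" by (rule conv_integrable_bounded[OF g _ B(2)]) simp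
    have if': "L1 (\<lambda>s. (indicator {0<..<T} s * f s) * rho d (t - s))" by (rule conv_integrable_bounded[OF f _ B(1)]) simp
    have i0: "L1 (\<lambda>s. (indicator {-2..0::real} s * g0) * rho1 d (t - s))" by (rule conv_integrable_bounded[OF _ _ B(2)]) auto
    have fd: "((\<lambda>s. - rho d (t - s)) has_real_derivative rho1 d (t - s)) (at s)" for s
    proof -
      have "((\<lambda>s. t - s) has_real_derivative -1) (at s)" by (auto intro!: derivative_eq_intros)
      from DERIV_minus[OF DERIV_chain2[OF rho_deriv[OF d(1), of "t - s"] this]] show ?thesis by simp
    qed
    have cont: "isCont (\<lambda>s. rho1 d (t - s)) s" for s
    proof -
      have "continuous_on UNIV (\<lambda>s. rho1 d (t - s))"
        by (intro continuous_on_compose2[OF rho_cont(2)[OF d(1)]] continuous_intros) auto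
      then show ?thesis by (simp add: continuous_on_eq_continuous_at)
    qed
    have "(LBINT s. rho1 d (t - s) * indicator {-2..0} s) = - rho d (t - 0) - - rho d (t - (-2))"
      by (rule integral_FTC_Icc_real) (use fd cont in auto)
    also have "rho d (t - (-2)) = 0" using rho_supp(1)[OF d(1)] d(2) t by simp
    finally have c: "(LBINT s. rho1 d (t - s) * indicator {-2..0} s) = - rho d t" by simp
    have "conv G (rho1 d) t = (LBINT s. (indicator {-2..0} s * g0) * rho1 d (t - s)) + (LBINT s. (indicator {0<..<T} s * g s) * rho1 d (t - s))"
      unfolding conv_def G_def distrib_right by (rule Bochner_Integration.integral_add[OF i0 ig])
    also have "(LBINT s. (indicator {-2..0} s * g0) * rho1 d (t - s)) = g0 * (LBINT s. rho1 d (t - s) * indicator {-2..0} s)"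
      by (subst integral_mult_right_zero[symmetric]) (simp add: mult_ac)
    finally have 1: "conv G (rho1 d) t = - g0 * rho d t + (LBINT s. (indicator {0<..<T} s * g s) * rho1 d (t - s))" unfolding c by simp
    have "(LBINT s. indicator {0<..<T} s * (f s * rho d (t - s) - g s * rho1 d (t - s))) =
       (LBINT s. (indicator {0<..<T} s * f s) * rho d (t - s) - (indicator {0<..<T} s * g s) * rho1 d (t - s))"
      by (simp add: algebra_simps)
    also have "\<dots> = (LBINT s. (indicator {0<..<T} s * f s) * rho d (t - s)) - (LBINT s. (indicator {0<..<T} s * g s) * rho1 d (t - s))"
      by (rule Bochner_Integration.integral_diff[OF if' ig])
    finally show ?thesis using weak[OF d(1), of t] 1 d(3) t unfolding conv_def[of F] F_def by simp
  qed
  \<comment> \<open>Within distance d < 1 of -1 the function \<open>G\<close> is the constant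
    \<open>g0\<close>, and the mollifier has unit mass.\<close>
  have start: "conv G (rho d) (-1) = g0" if d: "d > 0" "d < 1" for d
  proof -
    have "conv G (rho d) (-1) = (LBINT s. g0 * rho d (-1 - s))" unfolding conv_def
    proof (intro Bochner_Integration.integral_cong refl)
      fix s show "G s * rho d (-1 - s) = g0 * rho d (-1 - s)"
      proof (cases "\<bar>-1 - s\<bar> \<ge> d")
        case False
        then show ?thesis using d by (auto simp: G_def indicator_def)
      qed (simp add: rho_supp(1)[OF d(1)])
    qed
    also have "\<dots> = g0" using integral_shift(3)[of "rho d" "-1"] rho_one[OF d(1)] by simp
    finally show ?thesis .
  qed
  have reg: "(LBINT t. ?I t * (\<beta>' (conv G (rho d) t) * conv F (rho d) t * \<theta> t + \<beta> (conv G (rho d) t) * \<theta>' t)) = - \<beta> g0 * \<theta> (-1)"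
    if d: "d > 0" "d < 1" "T2 + d < T" for d
  proof -
    note cr = conv_rho[OF Gi d(1)]
    have c0: "continuous_on UNIV (conv G (rho d))" using cr(1) DERIV_isCont by (blast intro: continuous_at_imp_continuous_on)
    let ?h = "\<lambda>t. \<beta>' (conv G (rho d) t) * conv G (rho1 d) t * \<theta> t + \<theta>' t * \<beta> (conv G (rho d) t)"
    have "((\<lambda>t. \<beta> (conv G (rho d) t) * \<theta> t) has_real_derivative ?h t) (at t)" for t
      by (rule DERIV_mult[OF DERIV_chain2[OF _ cr(1)] th(1)]) (use b in \<open>auto simp: nice_beta_def\<close>)
    moreover have "continuous_on UNIV ?h"
      by (intro continuous_intros cr(2) thc th(2) continuous_on_compose2[OF bc(1) c0] continuous_on_compose2[OF bc(2) c0]) auto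
    ultimately have "(LBINT t. ?h t * ?I t) = \<beta> (conv G (rho d) T2) * \<theta> T2 - \<beta> (conv G (rho d) (-1)) * \<theta> (-1)"
      using T by (intro integral_FTC_Icc_real) (auto simp: continuous_on_eq_continuous_at)
    also have "\<dots> = - \<beta> g0 * \<theta> (-1)" using th0 start[OF d(1,2)] by simp
    also have "(LBINT t. ?h t * ?I t) = (LBINT t. ?I t * (\<beta>' (conv G (rho d) t) * conv F (rho d) t * \<theta> t + \<beta> (conv G (rho d) t) * \<theta>' t))"
      using key[OF d] by (intro Bochner_Integration.integral_cong) (auto simp: indicator_def)
    finally show ?thesis by simp
  qed
  define e0 where "e0 = min 1 (T - T2)"
  \<comment> \<open>The denominator n + 2 makes \<open>E n\<close> strictly smaller than
    \<open>e0\<close> for every n, including n = 0.\<close>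
  define E where "E n = e0 / (real n + 2)" for n
  have e0: "e0 > 0" "e0 \<le> 1" "e0 \<le> T - T2" using T by (auto simp: e0_def)
  have E: "E n > 0" "E n < 1" "T2 + E n < T" for n
  proof -
    have "e0 * 1 < e0 * (real n + 2)" using e0(1) by (intro mult_strict_left_mono) auto
    then have "E n < e0" by (simp add: E_def divide_less_eq)
    then show "E n > 0" "E n < 1" "T2 + E n < T" using e0 by (auto simp: E_def)
  qed
  have El: "E \<longlonglongrightarrow> 0" unfolding E_def using tendsto_mult[OF tendsto_const[of e0] LIMSEQ_ignore_initial_segment[OF lim_inverse_n, of 2]] by (simp add: inverse_eq_divide add.commute)
  have mo: "is_moll (\<lambda>n. rho (E n))" by (rule is_moll_rho[OF E(1) El])
  have Gn: "L1 (\<lambda>t. conv G (rho (E n)) t - G t)" for n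
    using conv_integrable[OF Gi rho_int(1)[OF E(1)]] Gi by simp
  \<comment> \<open>Convergence almost everywhere along a subsequence is needed for beta'(G_n),
    since no Lipschitz bound on beta' is available; the other differences are controlled in
    L^1.\<close>
  obtain r where r: "strict_mono r" and ae0: "AE t in lborel. (\<lambda>n. conv G (rho (E (r n))) t - G t) \<longlonglongrightarrow> 0"
    using tendsto_L1_AE_subseq[of lborel "\<lambda>n t. conv G (rho (E n)) t - G t", OF Gn] conv_L1_approx[OF Gi mo] by auto
  define D where "D n = E (r n)" for n
  have D: "D n > 0" "D n < 1" "T2 + D n < T" for n using E by (auto simp: D_def)
  have Dl: "D \<longlonglongrightarrow> 0" using LIMSEQ_subseq_LIMSEQ[OF El r] by (simp add: D_def[abs_def] o_def)
  have moD: "is_moll (\<lambda>n. rho (D n))" by (rule is_moll_rho[OF D(1) Dl])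
  have ae: "AE t in lborel. (\<lambda>n. conv G (rho (D n)) t) \<longlonglongrightarrow> G t"
    using ae0 by eventually_elim (simp add: D_def LIM_zero_iff)
  obtain B where Bt: "\<And>t. t \<in> {-1..T2} \<Longrightarrow> \<bar>\<theta> t\<bar> \<le> B" "\<And>t. t \<in> {-1..T2} \<Longrightarrow> \<bar>\<theta>' t\<bar> \<le> B" and B0: "B \<ge> 0"
  proof -
    have "\<exists>C\<ge>0. \<forall>t\<in>{-1..T2}. \<bar>h t\<bar> \<le> C" if "continuous_on UNIV h" for h :: "real \<Rightarrow> real"
    proof -
      have "compact (h ` {-1..T2})" by (intro compact_continuous_image continuous_on_subset[OF that]) auto
      then obtain C where "\<forall>t\<in>{-1..T2}. \<bar>h t\<bar> \<le> C"
        using compact_imp_bounded[of "h ` {-1..T2}"] unfolding bounded_iff by auto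
      then show ?thesis by (intro exI[of _ "max C 0"]) (auto simp: le_max_iff_disj)
    qed
    from this[OF thc] this[OF th(2)] obtain C1 C2 where *: "C1 \<ge> 0" "\<forall>t\<in>{-1..T2}. \<bar>\<theta> t\<bar> \<le> C1" "C2 \<ge> 0" "\<forall>t\<in>{-1..T2}. \<bar>\<theta>' t\<bar> \<le> C2" by auto
    show ?thesis by (rule that[of "max C1 C2"]) (use * in \<open>auto simp: le_max_iff_disj\<close>)
  qed
  let ?Gn = "\<lambda>n. conv G (rho (D n))" and ?Fn = "\<lambda>n. conv F (rho (D n))"
  let ?X = "\<lambda>n t. ?I t * (\<beta>' (?Gn n t) * ?Fn n t * \<theta> t + \<beta> (?Gn n t) * \<theta>' t)"
  let ?Y = "\<lambda>t. ?I t * (\<beta>' (G t) * F t * \<theta> t + \<beta> (G t) * \<theta>' t)"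
  have FI: "L1 (?Fn n)" "L1 (?Gn n)" for n
    using conv_integrable[OF Fi rho_int(1)[OF D(1)]] conv_integrable[OF Gi rho_int(1)[OF D(1)]] by auto
  have bd: "\<bar>?I t * (\<beta>' x * y * \<theta> t + \<beta> x * \<theta>' t)\<bar> \<le> L * B * \<bar>y\<bar> + L * B * \<bar>x\<bar>" for t x y
  proof (cases "t \<in> {-1..T2}")
    case True
    have "\<bar>\<beta>' x * y * \<theta> t + \<beta> x * \<theta>' t\<bar> \<le> \<bar>\<beta>' x\<bar> * \<bar>y\<bar> * \<bar>\<theta> t\<bar> + \<bar>\<beta> x\<bar> * \<bar>\<theta>' t\<bar>"
      unfolding abs_mult[symmetric] by (rule abs_triangle_ineq)
    also have "\<dots> \<le> L * \<bar>y\<bar> * B + (L * \<bar>x\<bar>) * B"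
      using Bt[OF True] bL nice_beta_lip(2)[OF b] L0 by (intro add_mono mult_mono) auto
    finally show ?thesis using True by (simp add: mult_ac)
  qed (use L0 B0 in auto)
  have Xi: "L1 (?X n)" for n
    by (rule Bochner_Integration.integrable_bound[of _ "\<lambda>t. L * B * \<bar>?Fn n t\<bar> + L * B * \<bar>?Gn n t\<bar>"])
       (use FI bd in \<open>auto intro!: AE_I2 intro: order_trans[OF _ abs_ge_self]\<close>)
  have Yi: "L1 ?Y"
    by (rule Bochner_Integration.integrable_bound[of _ "\<lambda>t. L * B * \<bar>F t\<bar> + L * B * \<bar>G t\<bar>"])
       (use Fi Gi bd in \<open>auto intro!: AE_I2 intro: order_trans[OF _ abs_ge_self]\<close>)
  let ?Z = "\<lambda>n t. B * (L * \<bar>?Fn n t - F t\<bar> + \<bar>\<beta>' (?Gn n t) - \<beta>' (G t)\<bar> * \<bar>F t\<bar> + L * \<bar>?Gn n t - G t\<bar>)"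
  have z2: "\<bar>\<bar>\<beta>' (?Gn n t) - \<beta>' (G t)\<bar> * \<bar>F t\<bar>\<bar> \<le> 2 * L * \<bar>F t\<bar>" for n t
  proof -
    have "\<bar>\<beta>' (?Gn n t) - \<beta>' (G t)\<bar> \<le> 2 * L" using bL[of "?Gn n t"] bL[of "G t"] by linarith
    then show ?thesis by (simp add: abs_mult mult_right_mono)
  qed
  have I2: "L1 (\<lambda>t. \<bar>\<beta>' (?Gn n t) - \<beta>' (G t)\<bar> * \<bar>F t\<bar>)" for n
    by (rule Bochner_Integration.integrable_bound[of _ "\<lambda>t. 2 * L * \<bar>F t\<bar>"])
       (use Fi z2 in \<open>auto intro!: AE_I2 intro: order_trans[OF _ abs_ge_self]\<close>)
  have I1: "L1 (\<lambda>t. \<bar>?Fn n t - F t\<bar>)" "L1 (\<lambda>t. \<bar>?Gn n t - G t\<bar>)" for n using FI Fi Gi by auto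
  have pt: "\<bar>?X n t - ?Y t\<bar> \<le> ?Z n t" for n t
  proof (cases "t \<in> {-1..T2}")
    case True
    have "\<bar>?X n t - ?Y t\<bar> = \<bar>(\<beta>' (?Gn n t) * (?Fn n t - F t)) * \<theta> t + ((\<beta>' (?Gn n t) - \<beta>' (G t)) * F t) * \<theta> t + (\<beta> (?Gn n t) - \<beta> (G t)) * \<theta>' t\<bar>"
      using True by (simp add: algebra_simps)
    also have "\<dots> \<le> \<bar>\<beta>' (?Gn n t)\<bar> * \<bar>?Fn n t - F t\<bar> * \<bar>\<theta> t\<bar> + \<bar>\<beta>' (?Gn n t) - \<beta>' (G t)\<bar> * \<bar>F t\<bar> * \<bar>\<theta> t\<bar> + \<bar>\<beta> (?Gn n t) - \<beta> (G t)\<bar> * \<bar>\<theta>' t\<bar>"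
      unfolding abs_mult[symmetric] by (intro order_trans[OF abs_triangle_ineq] add_right_mono abs_triangle_ineq)
    also have "\<dots> \<le> L * \<bar>?Fn n t - F t\<bar> * B + \<bar>\<beta>' (?Gn n t) - \<beta>' (G t)\<bar> * \<bar>F t\<bar> * B + (L * \<bar>?Gn n t - G t\<bar>) * B"
      using Bt[OF True] bL nice_beta_lip(1)[OF b] L0 by (intro add_mono mult_mono) auto
    also have "\<dots> = ?Z n t" by (simp add: algebra_simps)
    finally show ?thesis .
  qed (use L0 B0 in auto)
  have Zl: "(\<lambda>n. LBINT t. ?Z n t) \<longlonglongrightarrow> 0"
  proof -
    have "(\<lambda>n. LBINT t. \<bar>\<beta>' (?Gn n t) - \<beta>' (G t)\<bar> * \<bar>F t\<bar>) \<longlonglongrightarrow> (\<integral>t. 0 \<partial>(lborel :: real measure))"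
    proof (rule integral_dominated_convergence[where w="\<lambda>t. 2 * L * \<bar>F t\<bar>"])
      show "AE t in lborel. (\<lambda>n. \<bar>\<beta>' (?Gn n t) - \<beta>' (G t)\<bar> * \<bar>F t\<bar>) \<longlonglongrightarrow> 0"
        using ae
      proof eventually_elim
        case (elim t)
        have "(\<lambda>n. \<bar>\<beta>' (?Gn n t) - \<beta>' (G t)\<bar> * \<bar>F t\<bar>) \<longlonglongrightarrow> \<bar>\<beta>' (G t) - \<beta>' (G t)\<bar> * \<bar>F t\<bar>"
          by (intro tendsto_intros continuous_on_tendsto_compose[OF bc(2) elim]) auto
        then show ?case by simp
      qed
    qed (use Fi z2 in auto)
    then have 2: "(\<lambda>n. LBINT t. \<bar>\<beta>' (?Gn n t) - \<beta>' (G t)\<bar> * \<bar>F t\<bar>) \<longlonglongrightarrow> 0" by simp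
    have lim: "(\<lambda>n. B * (L * (LBINT t. \<bar>?Fn n t - F t\<bar>) + (LBINT t. \<bar>\<beta>' (?Gn n t) - \<beta>' (G t)\<bar> * \<bar>F t\<bar>) + L * (LBINT t. \<bar>?Gn n t - G t\<bar>)))
       \<longlonglongrightarrow> B * (L * 0 + 0 + L * 0)"
      by (intro tendsto_intros 2 conv_L1_approx moD Fi Gi)
    have eqZ: "(LBINT t. ?Z n t) = B * (L * (LBINT t. \<bar>?Fn n t - F t\<bar>) + (LBINT t. \<bar>\<beta>' (?Gn n t) - \<beta>' (G t)\<bar> * \<bar>F t\<bar>) + L * (LBINT t. \<bar>?Gn n t - G t\<bar>))" for n
      using I1[of n] I2[of n] by simp
    show ?thesis unfolding eqZ using lim by (simp only: mult_zero_right add_0)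
  qed
  have "(\<lambda>n. (LBINT t. ?X n t) - (LBINT t. ?Y t)) \<longlonglongrightarrow> 0"
  proof (rule Lim_null_comparison[OF always_eventually Zl])
    show "\<forall>n. norm ((LBINT t. ?X n t) - (LBINT t. ?Y t)) \<le> (LBINT t. ?Z n t)"
    proof
      fix n
      have "norm ((LBINT t. ?X n t) - (LBINT t. ?Y t)) = \<bar>LBINT t. ?X n t - ?Y t\<bar>"
        unfolding Bochner_Integration.integral_diff[OF Xi Yi] by simp
      also have "\<dots> \<le> (LBINT t. \<bar>?X n t - ?Y t\<bar>)" by (rule integral_abs_bound)
      also have "\<dots> \<le> (LBINT t. ?Z n t)"
        by (rule integral_mono[OF integrable_abs[OF Bochner_Integration.integrable_diff[OF Xi Yi]] _ pt])
           (intro integrable_mult_right Bochner_Integration.integrable_add I1 I2)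
      finally show "norm ((LBINT t. ?X n t) - (LBINT t. ?Y t)) \<le> (LBINT t. ?Z n t)" .
    qed
  qed
  then have "(\<lambda>n. - \<beta> g0 * \<theta> (-1) - (LBINT t. ?Y t)) \<longlonglongrightarrow> 0" unfolding reg[OF D] .
  then have Y: "(LBINT t. ?Y t) = - \<beta> g0 * \<theta> (-1)" using LIMSEQ_unique[OF tendsto_const] by fastforce
  \<comment> \<open>\<open>?Y1\<close> is the part of the identity on [-1, 0], where
    \<open>G\<close> is constant. Its integral exchanges theta(-1) for theta(0).\<close>
  let ?Y1 = "\<lambda>t. \<beta> g0 * (\<theta>' t * indicator {-1..0} t)" and ?Y2 = "\<lambda>t. indicator {0<..<T} t * (\<beta> (g t) * \<theta>' t + \<beta>' (g t) * f t * \<theta> t)"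
  have b00: "\<beta> 0 = 0" using b by (simp add: nice_beta_def)
  have split: "?Y t = ?Y1 t + ?Y2 t" for t
    using T th0[of t] by (cases "t < -1"; cases "t \<le> 0"; cases "t < T2"; cases "t < T") (auto simp: G_def F_def indicator_def b00)
  have "has_bochner_integral lborel (\<lambda>t. \<theta>' t * indicator {-1..0} t) (\<theta> 0 - \<theta> (-1))"
    by (rule has_bochner_integral_FTC_Icc_real) (use th in \<open>auto simp: continuous_on_eq_continuous_at\<close>)
  then have Y1: "L1 ?Y1" "(LBINT t. ?Y1 t) = \<beta> g0 * (\<theta> 0 - \<theta> (-1))"
    by (auto simp: has_bochner_integral_iff)
  have "?Y2 = (\<lambda>t. ?Y t - ?Y1 t)" using split by (auto simp: fun_eq_iff)
  then have "(LBINT t. ?Y2 t) = (LBINT t. ?Y t) - (LBINT t. ?Y1 t)"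
    using Bochner_Integration.integral_diff[OF Yi Y1(1)] by simp
  then show ?thesis unfolding Y Y1(2) by (simp add: algebra_simps)
qed

section \<open>Weak solutions\<close>

text \<open>A pointwise bound at fixed scale e, affine in the mass. It makes
  \<open>De e (w t) x\<close> integrable in t for each x, so that the one-dimensional result in time
  can be applied at every point x separately.\<close>

lemma De_bound:
  assumes w: "L1 w" and w2: "L1 (\<lambda>x. (w x)\<^sup>2)" and e: "e > 0"
    and C: "\<And>x. \<bar>eta1 e x\<bar> \<le> C" "\<And>x. \<bar>eta2 e x\<bar> \<le> C" and R: "norm x + 2 * e \<le> R"
  shows "\<bar>De e w x\<bar> \<le> 2 * C * ((1/2 + (LBINT x. \<bar>w x\<bar>)) * (LBINT x. (w x)\<^sup>2) +
       (2 * pi\<^sup>2 * (LBINT x. (w x)\<^sup>2) + (LBINT x. \<bar>w x\<bar>) * measure lborel (cball (0::real^2) R)))" (is "_ \<le> 2 * C * ?B")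
proof -
  have [measurable]: "w \<in> borel_measurable borel" using w by auto
  have C0: "C \<ge> 0" using C(1)[of 0] by linarith
  note U1 = Upot_weighted(1)[OF w w2 _ w2, where R=R] and U2 = Upot_weighted(2)[OF w w2 _ w2, where R=R and s=1, simplified]
  have gen: "\<bar>conv (fl i w) m x\<bar> \<le> C * ?B"
    if [measurable]: "m \<in> borel_measurable borel" and m: "\<And>x. \<bar>m x\<bar> \<le> C" and z: "\<And>x. norm x > 2 * e \<Longrightarrow> m x = 0" for i m
  proof -
    have i1: "L1 (\<lambda>y. fl i w y * m (x - y))"
      by (rule conv_integrable_bounded[OF fl_integrable[OF w w2] _ m]) simp
    have "\<bar>conv (fl i w) m x\<bar> \<le> (LBINT y. \<bar>fl i w y * m (x - y)\<bar>)" unfolding conv_def by (rule integral_abs_bound)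
    also have "\<dots> \<le> (LBINT y. C * (indicator (cball 0 R) y * (\<bar>w y\<bar> * enn2real (Upot w y))))"
    proof (rule integral_mono_AE)
      show "AE y in lborel. \<bar>fl i w y * m (x - y)\<bar> \<le> C * (indicator (cball 0 R) y * (\<bar>w y\<bar> * enn2real (Upot w y)))"
        using Upot_finite[OF w w2]
      proof eventually_elim
        case (elim y)
        show ?case
        proof (cases "norm y \<le> R")
          case True
          have "\<bar>velocity w y $ i\<bar> \<le> enn2real (Upot w y)"
            using velocity_le_real[OF _ elim] component_le_norm_cart[of "velocity w y" i] by auto
          then have "(\<bar>w y\<bar> * \<bar>velocity w y $ i\<bar>) * \<bar>m (x - y)\<bar> \<le> (\<bar>w y\<bar> * enn2real (Upot w y)) * C"
            by (intro mult_mono m) auto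
          then show ?thesis using True by (simp add: fl_def abs_mult mult_ac)
        next
          case False
          then have "norm (x - y) > 2 * e" using R norm_triangle_ineq2[of y x] by (simp add: norm_minus_commute)
          then show ?thesis using z False by simp
        qed
      qed
    qed (use i1 U1 in auto)
    also have "\<dots> = C * (LBINT y. indicator (cball 0 R) y * (\<bar>w y\<bar> * enn2real (Upot w y)))" by simp
    also have "\<dots> \<le> C * ?B" using U2 C0 by (intro mult_left_mono) auto
    finally show ?thesis .
  qed
  have "\<bar>conv (fl 1 w) (eta1 e) x\<bar> \<le> C * ?B" "\<bar>conv (fl 2 w) (eta2 e) x\<bar> \<le> C * ?B"
    by (rule gen; use C eta_supp[OF e] in simp)+
  then show ?thesis unfolding De_def by linarith
qed

text \<open>The spatial conditions are confined to [0, T], since the weight used for the mass bound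
  grows at negative times; the derivative in t is required for all t, because the argument in time
  passes through negative times. Vanishing from \<open>T2\<close> on keeps away from the final
  time.\<close>

definition nice_st :: "real \<Rightarrow> real \<Rightarrow> real \<Rightarrow> real \<Rightarrow> (real \<Rightarrow> real^2 \<Rightarrow> real) \<Rightarrow> (real \<Rightarrow> real^2 \<Rightarrow> real) \<Rightarrow> (real \<Rightarrow> real^2 \<Rightarrow> real)
  \<Rightarrow> (real \<Rightarrow> real^2 \<Rightarrow> real) \<Rightarrow> (real \<Rightarrow> real^2 \<Rightarrow> real) \<Rightarrow> (real \<Rightarrow> real^2 \<Rightarrow> real) \<Rightarrow> bool" where
  "nice_st R B T T2 p pt p1 p2 p11 p22 \<longleftrightarrow>
     (\<forall>t\<in>{0..T}. nice_test R (p t) (p1 t) (p2 t) (p11 t) (p22 t))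
   \<and> (\<forall>t x. ((\<lambda>t. p t x) has_real_derivative pt t x) (at t)) \<and> (\<forall>x. continuous_on UNIV (\<lambda>t. pt t x))
   \<and> (\<forall>t x. T2 \<le> t \<longrightarrow> p t x = 0 \<and> pt t x = 0) \<and> (\<forall>t\<in>{0..T}. \<forall>x. norm x > R \<longrightarrow> pt t x = 0)
   \<and> (\<forall>t\<in>{0..T}. \<forall>x. \<bar>p t x\<bar> \<le> B \<and> \<bar>pt t x\<bar> \<le> B \<and> \<bar>p1 t x\<bar> \<le> B \<and> \<bar>p2 t x\<bar> \<le> B \<and> \<bar>p11 t x\<bar> \<le> B \<and> \<bar>p22 t x\<bar> \<le> B)
   \<and> (\<forall>f\<in>{p, pt, p1, p2, p11, p22}. (\<lambda>z. f (fst z) (snd z)) \<in> borel_measurable (borel :: (real \<times> (real^2)) measure))"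

lemma joint_measurable_comp:
  fixes w :: "real \<Rightarrow> real^2 \<Rightarrow> real"
  assumes w: "(\<lambda>z. w (fst z) (snd z)) \<in> borel_measurable (borel :: (real \<times> (real^2)) measure)"
    and [measurable]: "f \<in> borel_measurable N" "g \<in> borel_measurable N"
  shows "(\<lambda>z. w (f z) (g z)) \<in> borel_measurable N"
proof -
  have "(\<lambda>z. (f z, g z)) \<in> N \<rightarrow>\<^sub>M borel" unfolding borel_prod[symmetric] by measurable
  from measurable_compose[OF this w] show ?thesis by simp
qed

text \<open>One setting for the viscous approximations and for the inviscid limit. The squared L^2
  norm is bounded in time by \<open>M\<close>, whereas the mass is assumed integrable over
  space-time, which is what is established for the limit.\<close>

locale weak_solution =
  fixes \<nu> T M :: real and w :: "real \<Rightarrow> real^2 \<Rightarrow> real" and w0 :: "real^2 \<Rightarrow> real"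
  assumes T: "T > 0" and nu: "\<nu> \<ge> 0"
    and wm: "(\<lambda>z. w (fst z) (snd z)) \<in> borel_measurable (borel :: (real \<times> (real^2)) measure)"
    and w1: "integrable (lborel \<Otimes>\<^sub>M lborel) (\<lambda>z. indicator {0<..<T} (fst z) * w (fst z) (snd z))"
    and w2: "AE t in lborel. t \<in> {0<..<T} \<longrightarrow> L1 (\<lambda>x. (w t x)\<^sup>2) \<and> (LBINT x. (w t x)\<^sup>2) \<le> M"
    and w01: "L1 w0" and w02: "L1 (\<lambda>x. (w0 x)\<^sup>2)"
    and weak: "vort_weak \<nu> T w0 w"
begin

lemma jm[measurable (raw)]: "f \<in> borel_measurable N \<Longrightarrow> g \<in> borel_measurable N \<Longrightarrow> (\<lambda>z. w (f z) (g z)) \<in> borel_measurable N"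
  by (rule joint_measurable_comp[OF wm])

lemma jm_conv[measurable (raw)]:
  assumes [measurable]: "f \<in> borel_measurable N" "g \<in> borel_measurable N" "m \<in> borel_measurable borel"
  shows "(\<lambda>z. conv (w (f z)) m (g z)) \<in> borel_measurable N"
  unfolding conv_def by (intro lborel.borel_measurable_lebesgue_integral) measurable

lemma jm_velocity[measurable (raw)]:
  assumes [measurable]: "f \<in> borel_measurable N" "g \<in> borel_measurable N"
  shows "(\<lambda>z. velocity (w (f z)) (g z)) \<in> borel_measurable N"
  unfolding velocity_def by (intro lborel.borel_measurable_lebesgue_integral) measurable

lemma jm_De[measurable (raw)]:
  assumes [measurable]: "f \<in> borel_measurable N" "g \<in> borel_measurable N"
  shows "(\<lambda>z. De e (w (f z)) (g z)) \<in> borel_measurable N"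
  unfolding De_def conv_def fl_def by (intro borel_measurable_add lborel.borel_measurable_lebesgue_integral) measurable

definition W :: "real \<Rightarrow> real" where "W t = (LBINT x. \<bar>w t x\<bar>)"

definition good :: "real \<Rightarrow> bool" where
  "good t \<longleftrightarrow> L1 (w t) \<and> L1 (\<lambda>x. (w t x)\<^sup>2) \<and> (LBINT x. (w t x)\<^sup>2) \<le> M"

lemma ae_good: "AE t in lborel. t \<in> {0<..<T} \<longrightarrow> good t"
  using lborel_pair.AE_integrable_fst'[OF w1] w2
  by eventually_elim (auto simp: good_def indicator_def)

lemma W_nonneg: "W t \<ge> 0" by (simp add: W_def)

lemma W_integrable: "L1 (\<lambda>t. indicator {0<..<T} t * W t)"
  using lborel_pair.integrable_fst'[OF integrable_abs[OF w1]] by (simp add: W_def abs_mult)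

lemma W_measurable[measurable]: "W \<in> borel_measurable borel"
  unfolding W_def by (intro lborel.borel_measurable_lebesgue_integral) measurable

lemma dom_integrable: "L1 (\<lambda>t. indicator {0<..<T} t * (K * (1 + W t)))"
proof -
  have i: "L1 (indicator {0<..<T} :: real \<Rightarrow> real)" using T by (intro integrable_real_indicator) auto
  have "L1 (\<lambda>t. K * indicator {0<..<T} t + K * (indicator {0<..<T} t * W t))"
    by (intro Bochner_Integration.integrable_add integrable_mult_right W_integrable i)
  then show ?thesis by (simp add: algebra_simps)
qed

lemma M_nonneg: "M \<ge> 0"
proof (rule ccontr)
  assume neg: "\<not> M \<ge> 0"
  have ng: "\<not> good t" for t
  proof
    assume "good t"
    then have "(LBINT x. (w t x)\<^sup>2) < 0" using neg by (simp add: good_def)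
    moreover have "0 \<le> (LBINT x. (w t x)\<^sup>2)" by simp
    ultimately show False by linarith
  qed
  have "AE t in lborel. t \<notin> {0<..<T}" using ae_good by eventually_elim (use ng in auto)
  then have "{0<..<T} \<in> null_sets lborel" using AE_iff_null_sets[of "{0<..<T}" "lborel :: real measure"] by simp
  then show False using T by (simp add: null_sets_def)
qed

text \<open>Linear growth in the mass is essential here: W is integrable in time, and its square
  need not be. It is inherited from \<open>De_bound\<close>, where the mass only ever multiplies
  quantities bounded in time.\<close>

lemma good_bounds:
  assumes e: "e > 0"
  shows "\<exists>K\<ge>0. \<forall>t. good t \<longrightarrow> (\<forall>x. norm x \<le> R \<longrightarrow> \<bar>conv (w t) (eta e) x\<bar> \<le> K * (1 + W t)
     \<and> \<bar>- De e (w t) x + \<nu> * (conv (w t) (eta11 e) x + conv (w t) (eta22 e) x)\<bar> \<le> K * (1 + W t))"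
proof -
  obtain C where C: "\<And>x. \<bar>eta e x\<bar> \<le> C" "\<And>x. \<bar>eta1 e x\<bar> \<le> C" "\<And>x. \<bar>eta2 e x\<bar> \<le> C" "\<And>x. \<bar>eta11 e x\<bar> \<le> C" "\<And>x. \<bar>eta22 e x\<bar> \<le> C"
    using eta_bound[OF e] by metis
  have C0: "C \<ge> 0" using C(1)[of 0] by linarith
  define V where "V = measure lborel (cball (0::real^2) (R + 2 * e))"
  have V0: "V \<ge> 0" by (simp add: V_def)
  define K1 where "K1 = 2 * C * (2 * M + 2 * pi\<^sup>2 * M + V)"
  define K where "K = C + K1 + \<nu> * (2 * C)"
  have K1: "K1 \<ge> 0" using C0 M_nonneg V0 by (simp add: K1_def)
  have K0: "K \<ge> 0" "C \<le> K" "K1 + \<nu> * (2 * C) \<le> K" using C0 K1 nu by (auto simp: K_def)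
  show ?thesis
  proof (intro exI[of _ K] conjI allI impI K0)
    fix t and x :: "real^2" assume g: "good t" and x: "norm x \<le> R"
    have gi: "L1 (w t)" and g2: "L1 (\<lambda>x. (w t x)\<^sup>2)" and gM: "(LBINT x. (w t x)\<^sup>2) \<le> M"
      using g by (auto simp: good_def)
    have Q0: "0 \<le> (LBINT x. (w t x)\<^sup>2)" by simp
    note W0 = W_nonneg[of t]
    have cb: "\<bar>conv (w t) (eta e) x\<bar> \<le> C * W t" "\<bar>conv (w t) (eta11 e) x\<bar> \<le> C * W t" "\<bar>conv (w t) (eta22 e) x\<bar> \<le> C * W t"
      unfolding W_def by (rule conv_bounded[OF gi _ C(1)] conv_bounded[OF gi _ C(4)] conv_bounded[OF gi _ C(5)]; simp)+
    have CW: "C * W t \<le> C * (1 + W t)" using C0 by (intro mult_left_mono) auto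
    have "C * (1 + W t) \<le> K * (1 + W t)" using K0 W0 by (intro mult_right_mono) auto
    then show "\<bar>conv (w t) (eta e) x\<bar> \<le> K * (1 + W t)" using cb(1) CW by linarith
    have "\<bar>De e (w t) x\<bar> \<le> 2 * C * ((1/2 + W t) * (LBINT x. (w t x)\<^sup>2) + (2 * pi\<^sup>2 * (LBINT x. (w t x)\<^sup>2) + W t * V))"
      unfolding W_def V_def by (rule De_bound[OF gi g2 e C(2,3)]) (use x in auto)
    also have "\<dots> \<le> 2 * C * ((1 + W t) * M + (2 * pi\<^sup>2 * M * (1 + W t) + (1 + W t) * V))"
    proof (intro mult_left_mono add_mono)
      show "(1/2 + W t) * (LBINT x. (w t x)\<^sup>2) \<le> (1 + W t) * M" using W0 gM Q0 by (intro mult_mono) auto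
      have "2 * pi\<^sup>2 * (LBINT x. (w t x)\<^sup>2) \<le> 2 * pi\<^sup>2 * M * 1" using gM by simp
      also have "\<dots> \<le> 2 * pi\<^sup>2 * M * (1 + W t)" using W0 M_nonneg by (intro mult_left_mono) auto
      finally show "2 * pi\<^sup>2 * (LBINT x. (w t x)\<^sup>2) \<le> 2 * pi\<^sup>2 * M * (1 + W t)" .
      show "W t * V \<le> (1 + W t) * V" using V0 by (intro mult_right_mono) auto
    qed (use C0 in auto)
    also have "\<dots> \<le> K1 * (1 + W t)"
    proof -
      have "2 * C * ((1 + W t) * M + (2 * pi\<^sup>2 * M * (1 + W t) + (1 + W t) * V)) = (2 * C * (M + 2 * pi\<^sup>2 * M + V)) * (1 + W t)" by (simp add: algebra_simps)
      also have "\<dots> \<le> K1 * (1 + W t)" unfolding K1_def using C0 M_nonneg W0 by (intro mult_right_mono mult_left_mono) auto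
      finally show ?thesis .
    qed
    finally have D: "\<bar>De e (w t) x\<bar> \<le> K1 * (1 + W t)" .
    have "\<bar>\<nu> * (conv (w t) (eta11 e) x + conv (w t) (eta22 e) x)\<bar> \<le> \<nu> * (2 * C * (1 + W t))"
      unfolding abs_mult abs_of_nonneg[OF nu] using cb(2,3) CW by (intro mult_left_mono nu) linarith
    then have "\<bar>- De e (w t) x + \<nu> * (conv (w t) (eta11 e) x + conv (w t) (eta22 e) x)\<bar> \<le> K1 * (1 + W t) + \<nu> * (2 * C * (1 + W t))"
      using D by linarith
    also have "\<dots> = (K1 + \<nu> * (2 * C)) * (1 + W t)" by (simp add: algebra_simps)
    also have "\<dots> \<le> K * (1 + W t)" using K0 W0 by (intro mult_right_mono) auto
    finally show "\<bar>- De e (w t) x + \<nu> * (conv (w t) (eta11 e) x + conv (w t) (eta22 e) x)\<bar> \<le> K * (1 + W t)" .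
  qed
qed

text \<open>The weak formulation tested with \<open>tphi\<close>. For fixed x the mollified
  vorticity, as a function of time alone, has the expression multiplied by \<open>rho\<close> as its
  weak derivative and the mollified datum as its initial value.\<close>

lemma weak_mollified:
  assumes e: "e > 0" and d: "d > 0" "t0 + d < T"
  shows "(LBINT t. indicator {0<..<T} t * ((- De e (w t) x + \<nu> * (conv (w t) (eta11 e) x + conv (w t) (eta22 e) x)) * rho d (t0 - t)
      - conv (w t) (eta e) x * rho1 d (t0 - t))) + conv w0 (eta e) x * rho d t0 = 0"
proof -
  let ?p = "tphi d e t0 x"
  obtain C where C: "\<And>x. \<bar>eta e x\<bar> \<le> C" "\<And>x. \<bar>eta1 e x\<bar> \<le> C" "\<And>x. \<bar>eta2 e x\<bar> \<le> C" "\<And>x. \<bar>eta11 e x\<bar> \<le> C" "\<And>x. \<bar>eta22 e x\<bar> \<le> C"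
    using eta_bound[OF e] by metis
  have "test_fun ({..<T} \<times> UNIV) ?p" by (rule tphi_test[OF d(1) e]) (use d in \<open>auto simp: dist_real_def\<close>)
  then have "(LINT t:{0<..<T}|lborel. LINT y|lborel. w t y * (dt ?p t y + velocity (w t) y \<bullet> gradx ?p t y + \<nu> * lapx ?p t y))
        + (LINT y|lborel. w0 y * ?p (0, y)) = 0" using weak unfolding vort_weak_def by blast
  moreover have "(LINT y|lborel. w0 y * ?p (0, y)) = conv w0 (eta e) x * rho d t0"
    by (simp add: tphi_def conv_def mult_ac flip: integral_mult_right_zero)
  moreover have "(LINT t:{0<..<T}|lborel. LINT y|lborel. w t y * (dt ?p t y + velocity (w t) y \<bullet> gradx ?p t y + \<nu> * lapx ?p t y))
    = (LBINT t. indicator {0<..<T} t * ((- De e (w t) x + \<nu> * (conv (w t) (eta11 e) x + conv (w t) (eta22 e) x)) * rho d (t0 - t)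
      - conv (w t) (eta e) x * rho1 d (t0 - t)))"
    unfolding set_lebesgue_integral_def tphi_derivs[OF d(1) e] inner_vec_def sum_2 inner_real_def real_scaleR_def
  proof (rule integral_cong_AE)
    show "AE t in lborel. indicator {0<..<T} t * (LBINT y. w t y * (- rho1 d (t0 - t) * eta e (x - y) +
         (velocity (w t) y $ 1 * (- rho d (t0 - t) * eta1 e (x - y)) + velocity (w t) y $ 2 * (- rho d (t0 - t) * eta2 e (x - y))) +
         \<nu> * (rho d (t0 - t) * (eta11 e (x - y) + eta22 e (x - y))))) =
        indicator {0<..<T} t * ((- De e (w t) x + \<nu> * (conv (w t) (eta11 e) x + conv (w t) (eta22 e) x)) * rho d (t0 - t)
      - conv (w t) (eta e) x * rho1 d (t0 - t))"
      using ae_good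
    proof eventually_elim
      case (elim t)
      show ?case
      proof (cases "t \<in> {0<..<T}")
        case True
        then have g: "good t" using elim by simp
        then have gi: "L1 (w t)" and g2: "L1 (\<lambda>x. (w t x)\<^sup>2)" by (auto simp: good_def)
        have I: "L1 (\<lambda>y. w t y * eta e (x - y))" "L1 (\<lambda>y. fl 1 (w t) y * eta1 e (x - y))" "L1 (\<lambda>y. fl 2 (w t) y * eta2 e (x - y))"
          "L1 (\<lambda>y. w t y * eta11 e (x - y))" "L1 (\<lambda>y. w t y * eta22 e (x - y))"
          by (rule conv_integrable_bounded[OF gi _ C(1)] conv_integrable_bounded[OF fl_integrable[OF gi g2] _ C(2)] conv_integrable_bounded[OF fl_integrable[OF gi g2] _ C(3)]
             conv_integrable_bounded[OF gi _ C(4)] conv_integrable_bounded[OF gi _ C(5)]; simp)+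
        have "(LBINT y. w t y * (- rho1 d (t0 - t) * eta e (x - y) +
         (velocity (w t) y $ 1 * (- rho d (t0 - t) * eta1 e (x - y)) + velocity (w t) y $ 2 * (- rho d (t0 - t) * eta2 e (x - y))) +
         \<nu> * (rho d (t0 - t) * (eta11 e (x - y) + eta22 e (x - y)))))
         = (LBINT y. (- rho1 d (t0 - t)) * (w t y * eta e (x - y)) + ((- rho d (t0 - t)) * (fl 1 (w t) y * eta1 e (x - y) + fl 2 (w t) y * eta2 e (x - y))
           + (\<nu> * rho d (t0 - t)) * (w t y * eta11 e (x - y) + w t y * eta22 e (x - y))))"
          by (intro Bochner_Integration.integral_cong refl) (simp add: fl_def algebra_simps)
        also have "\<dots> = (- rho1 d (t0 - t)) * conv (w t) (eta e) x + ((- rho d (t0 - t)) * De e (w t) x + (\<nu> * rho d (t0 - t)) * (conv (w t) (eta11 e) x + conv (w t) (eta22 e) x))"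
          using I unfolding De_def conv_def by simp
        finally show ?thesis using True by (simp add: algebra_simps)
      qed simp
    qed
    show "(\<lambda>t. indicator {0<..<T} t * (LBINT y. w t y * (- rho1 d (t0 - t) * eta e (x - y) +
         (velocity (w t) y $ 1 * (- rho d (t0 - t) * eta1 e (x - y)) + velocity (w t) y $ 2 * (- rho d (t0 - t) * eta2 e (x - y))) +
         \<nu> * (rho d (t0 - t) * (eta11 e (x - y) + eta22 e (x - y)))))) \<in> borel_measurable lborel"
      by (intro borel_measurable_times lborel.borel_measurable_lebesgue_integral) measurable
  qed measurable
  ultimately show ?thesis by simp
qed

text \<open>\<open>time_renorm\<close> is applied for each fixed x to the mollified vorticity as a
  function of time, weighted by p(t, x), and the outcome is integrated over x. The majorant K (1 + W
  t) on the ball of radius R justifies Fubini.\<close>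

lemma mollified_renorm:
  assumes e: "e > 0" and b: "nice_beta L \<beta> \<beta>' \<beta>''" and T2: "0 < T2" "T2 < T"
    and p: "nice_st R B T T2 p pt p1 p2 p11 p22"
  defines "f \<equiv> \<lambda>t x. - De e (w t) x + \<nu> * (conv (w t) (eta11 e) x + conv (w t) (eta22 e) x)"
  shows "(LBINT t. indicator {0<..<T} t * (LBINT x. \<beta> (conv (w t) (eta e) x) * pt t x + \<beta>' (conv (w t) (eta e) x) * f t x * p t x))
     + (LBINT x. \<beta> (conv w0 (eta e) x) * p 0 x) = 0"
    and "L1 (\<lambda>t. indicator {0<..<T} t * (LBINT x. \<beta> (conv (w t) (eta e) x) * pt t x + \<beta>' (conv (w t) (eta e) x) * f t x * p t x))"
proof -
  have pm: "\<And>f. f \<in> {p, pt, p1, p2, p11, p22} \<Longrightarrow> (\<lambda>z. f (fst z) (snd z)) \<in> borel_measurable (borel :: (real \<times> (real^2)) measure)"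
    using p by (auto simp: nice_st_def)
  have [measurable (raw)]: "\<And>f g N. f \<in> borel_measurable N \<Longrightarrow> g \<in> borel_measurable N \<Longrightarrow> (\<lambda>z. p (f z) (g z)) \<in> borel_measurable N"
    "\<And>f g N. f \<in> borel_measurable N \<Longrightarrow> g \<in> borel_measurable N \<Longrightarrow> (\<lambda>z. pt (f z) (g z)) \<in> borel_measurable N"
    by (rule joint_measurable_comp[OF pm]; simp)+
  have [measurable]: "\<beta> \<in> borel_measurable borel" "\<beta>' \<in> borel_measurable borel" using nice_beta_measurable[OF b] by auto
  have L0: "L \<ge> 0" by (rule nice_beta_lip(3)[OF b])
  have bL: "\<bar>\<beta>' s\<bar> \<le> L" for s using b by (auto simp: nice_beta_def)
  have pb: "\<bar>p t x\<bar> \<le> B" "\<bar>pt t x\<bar> \<le> B" if "t \<in> {0..T}" for t x using p that by (auto simp: nice_st_def)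
  have B0: "B \<ge> 0" using pb(1)[of 0] T by force
  have ps: "p t x = 0" "pt t x = 0" if "t \<in> {0..T}" "norm x > R" for t x
    using p that by (auto simp: nice_st_def nice_test_def)
  obtain K where K: "K \<ge> 0" "\<And>t x. good t \<Longrightarrow> norm x \<le> R \<Longrightarrow> \<bar>conv (w t) (eta e) x\<bar> \<le> K * (1 + W t)"
      "\<And>t x. good t \<Longrightarrow> norm x \<le> R \<Longrightarrow> \<bar>f t x\<bar> \<le> K * (1 + W t)"
    using good_bounds[OF e, of R] unfolding f_def by blast
  let ?k = "\<lambda>t x. \<beta> (conv (w t) (eta e) x) * pt t x + \<beta>' (conv (w t) (eta e) x) * f t x * p t x"
  have fm[measurable (raw)]: "(\<lambda>z. f (h z) (g z)) \<in> borel_measurable N"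
    if [measurable]: "h \<in> borel_measurable N" "g \<in> borel_measurable N" for h g N
    unfolding f_def by measurable
  have kb: "\<bar>?k t x\<bar> \<le> 2 * L * B * K * (1 + W t) * indicator (cball 0 R) x" if g: "good t" and t: "t \<in> {0<..<T}" for t x
  proof (cases "norm x \<le> R")
    case True
    have t': "t \<in> {0..T}" using t by auto
    have "\<bar>?k t x\<bar> \<le> \<bar>\<beta> (conv (w t) (eta e) x)\<bar> * \<bar>pt t x\<bar> + \<bar>\<beta>' (conv (w t) (eta e) x)\<bar> * \<bar>f t x\<bar> * \<bar>p t x\<bar>"
      unfolding abs_mult[symmetric] by (rule abs_triangle_ineq)
    also have "\<dots> \<le> (L * (K * (1 + W t))) * B + L * (K * (1 + W t)) * B"
      using L0 B0 K W_nonneg[of t] g True t'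
      by (intro add_mono mult_mono pb order_trans[OF nice_beta_lip(2)[OF b]] mult_left_mono bL K) auto
    finally show ?thesis using True by (simp add: algebra_simps)
  qed (use ps[of t x] t in auto)
  have hI: "L1 (indicator (cball 0 R) :: real^2 \<Rightarrow> real)"
    using emeasure_lborel_cball_finite[of "0::real^2" R] by (intro integrable_real_indicator) auto
  define V where "V = measure lborel (cball (0::real^2) R)"
  let ?C = "2 * L * B * K"
  have [measurable]: "cball (0::real^2) R \<in> sets borel" by simp
  have kx: "L1 (?k t)" "(LBINT x. \<bar>?k t x\<bar>) \<le> ?C * V * (1 + W t)" if g: "good t" and t: "t \<in> {0<..<T}" for t
  proof -
    have bi: "L1 (\<lambda>x::real^2. ?C * (1 + W t) * indicator (cball 0 R) x)" by (rule integrable_mult_right[OF hI])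
    show i: "L1 (?k t)"
      by (rule Bochner_Integration.integrable_bound[OF bi]) (use kb[OF g t] in \<open>auto intro!: AE_I2 intro: order_trans[OF _ abs_ge_self]\<close>)
    have "(LBINT x. \<bar>?k t x\<bar>) \<le> (LBINT x. ?C * (1 + W t) * indicator (cball 0 R) (x::real^2))"
      by (rule integral_mono[OF integrable_abs[OF i] bi kb[OF g t]])
    also have "\<dots> = ?C * (1 + W t) * V" unfolding integral_mult_right_zero by (simp add: V_def)
    also have "\<dots> = ?C * V * (1 + W t)" by (simp only: mult_ac)
    finally show "(LBINT x. \<bar>?k t x\<bar>) \<le> ?C * V * (1 + W t)" .
  qed
  have J: "integrable (lborel \<Otimes>\<^sub>M lborel) (\<lambda>(t, x). indicator {0<..<T} t * ?k t x)"
  proof (rule lborel_pair.Fubini_integrable)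
    show "AE t in lborel. L1 (\<lambda>x. case (t, x) of (t, x) \<Rightarrow> indicator {0<..<T} t * ?k t x)"
      using ae_good by eventually_elim (use kx(1) in \<open>auto simp: indicator_def\<close>)
    show "L1 (\<lambda>t. LBINT x. norm (case (t, x) of (t, x) \<Rightarrow> indicator {0<..<T} t * ?k t x))"
    proof (rule Bochner_Integration.integrable_bound[OF dom_integrable[of "?C * V"]])
      show "AE t in lborel. norm (LBINT x. norm (case (t, x) of (t, x) \<Rightarrow> indicator {0<..<T} t * ?k t x)) \<le> norm (indicator {0<..<T} t * (?C * V * (1 + W t)))"
        using ae_good
      proof eventually_elim
        case (elim t)
        show ?case
        proof (cases "t \<in> {0<..<T}")
          case True
          have n: "norm (LBINT x. norm (case (t, x) of (t, x) \<Rightarrow> indicator {0<..<T} t * ?k t x)) = (LBINT x. \<bar>?k t x\<bar>)" using True by simp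
          have "(LBINT x. \<bar>?k t x\<bar>) \<le> ?C * V * (1 + W t)" by (rule kx(2)) (use True elim in auto)
          also have "\<dots> = indicator {0<..<T} t * (?C * V * (1 + W t))" using True by simp
          also have "\<dots> \<le> \<bar>indicator {0<..<T} t * (?C * V * (1 + W t))\<bar>" by (rule abs_ge_self)
          finally show ?thesis unfolding n unfolding real_norm_def .
        qed simp
      qed
    qed measurable
  qed measurable
  have tr: "(LBINT t. indicator {0<..<T} t * ?k t x) = - \<beta> (conv w0 (eta e) x) * p 0 x" for x
  proof (cases "norm x \<le> R")
    case False
    then have "(\<lambda>t. indicator {0<..<T} t * ?k t x) = (\<lambda>t. 0)" using ps by (auto simp: fun_eq_iff indicator_def)
    then show ?thesis using ps[of 0 x] False T by simp
  next
    case True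
    have gb: "L1 (\<lambda>t. indicator {0<..<T} t * h t)" if [measurable]: "h \<in> borel_measurable borel" and h: "\<And>t. good t \<Longrightarrow> \<bar>h t\<bar> \<le> K * (1 + W t)" for h
    proof (rule Bochner_Integration.integrable_bound[OF dom_integrable[of K]])
      show "AE t in lborel. norm (indicator {0<..<T} t * h t) \<le> norm (indicator {0<..<T} t * (K * (1 + W t)))"
        using ae_good
      proof eventually_elim
        case (elim t)
        then show ?case using h[of t] by (cases "t \<in> {0<..<T}") (auto intro: order_trans[OF _ abs_ge_self])
      qed
    qed measurable
    have "(LBINT t. indicator {0<..<T} t * (\<beta> (conv (w t) (eta e) x) * pt t x + \<beta>' (conv (w t) (eta e) x) * f t x * p t x)) + \<beta> (conv w0 (eta e) x) * p 0 x = 0"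
    proof (rule time_renorm[OF T2])
      show "L1 (\<lambda>t. indicator {0<..<T} t * conv (w t) (eta e) x)" by (rule gb) (use K(2) True in auto)
      show "L1 (\<lambda>t. indicator {0<..<T} t * f t x)" by (rule gb) (use K(3) True in auto)
      show "(LBINT t. indicator {0<..<T} t * (f t x * rho d (t0 - t) - conv (w t) (eta e) x * rho1 d (t0 - t))) + conv w0 (eta e) x * rho d t0 = 0"
        if "d > 0" "t0 + d < T" for d t0 using weak_mollified[OF e that, of x] unfolding f_def .
    qed (use b p in \<open>auto simp: nice_st_def\<close>)
    then show ?thesis by simp
  qed
  show "L1 (\<lambda>t. indicator {0<..<T} t * (LBINT x. ?k t x))"
    using lborel_pair.integrable_fst[OF J] by simp
  have "(LBINT t. indicator {0<..<T} t * (LBINT x. ?k t x)) = (LBINT t. (LBINT x. indicator {0<..<T} t * ?k t x))" by simp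
  also have "\<dots> = (LBINT x. (LBINT t. indicator {0<..<T} t * ?k t x))"
    by (rule lborel_pair.Fubini_integral[OF J, symmetric])
  also have "\<dots> = - (LBINT x. \<beta> (conv w0 (eta e) x) * p 0 x)" unfolding tr by simp
  finally show "(LBINT t. indicator {0<..<T} t * (LBINT x. ?k t x)) + (LBINT x. \<beta> (conv w0 (eta e) x) * p 0 x) = 0" by simp
qed

text \<open>The limit e to 0 in \<open>mollified_renorm\<close>, dominated by K (1 + W t). The
  inequality stems from the Laplacian alone; without viscosity no sign is required of beta'' or p,
  and replacing beta by its negative turns the inequality into an equality.\<close>

theorem renormalized_inequality:
  assumes b: "nice_beta L \<beta> \<beta>' \<beta>''" and T2: "0 < T2" "T2 < T"
    and p: "nice_st R B T T2 p pt p1 p2 p11 p22"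
    and pos: "\<nu> = 0 \<or> ((\<forall>s. \<beta>'' s \<ge> 0) \<and> (\<forall>t\<in>{0..T}. \<forall>x. p t x \<ge> 0))"
  shows "0 \<le> (LBINT t. indicator {0<..<T} t * ((LBINT x. \<beta> (w t x) * pt t x)
      + (LBINT x. \<beta> (w t x) * (velocity (w t) x $ 1 * p1 t x + velocity (w t) x $ 2 * p2 t x))
      + \<nu> * (LBINT x. \<beta> (w t x) * (p11 t x + p22 t x)))) + (LBINT x. \<beta> (w0 x) * p 0 x)"
proof -
  have pm: "\<And>f. f \<in> {p, pt, p1, p2, p11, p22} \<Longrightarrow> (\<lambda>z. f (fst z) (snd z)) \<in> borel_measurable (borel :: (real \<times> (real^2)) measure)"
    using p by (auto simp: nice_st_def)
  have [measurable (raw)]: "\<And>f g N. f \<in> borel_measurable N \<Longrightarrow> g \<in> borel_measurable N \<Longrightarrow> (\<lambda>z. p (f z) (g z)) \<in> borel_measurable N"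
    "\<And>f g N. f \<in> borel_measurable N \<Longrightarrow> g \<in> borel_measurable N \<Longrightarrow> (\<lambda>z. pt (f z) (g z)) \<in> borel_measurable N"
    "\<And>f g N. f \<in> borel_measurable N \<Longrightarrow> g \<in> borel_measurable N \<Longrightarrow> (\<lambda>z. p1 (f z) (g z)) \<in> borel_measurable N"
    "\<And>f g N. f \<in> borel_measurable N \<Longrightarrow> g \<in> borel_measurable N \<Longrightarrow> (\<lambda>z. p2 (f z) (g z)) \<in> borel_measurable N"
    "\<And>f g N. f \<in> borel_measurable N \<Longrightarrow> g \<in> borel_measurable N \<Longrightarrow> (\<lambda>z. p11 (f z) (g z)) \<in> borel_measurable N"
    "\<And>f g N. f \<in> borel_measurable N \<Longrightarrow> g \<in> borel_measurable N \<Longrightarrow> (\<lambda>z. p22 (f z) (g z)) \<in> borel_measurable N"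
    by (rule joint_measurable_comp[OF pm]; simp)+
  have [measurable]: "\<beta> \<in> borel_measurable borel" "\<beta>' \<in> borel_measurable borel" using nice_beta_measurable[OF b] by auto
  have L0: "L \<ge> 0" by (rule nice_beta_lip(3)[OF b])
  have pb: "\<bar>p t x\<bar> \<le> B" "\<bar>pt t x\<bar> \<le> B" "\<bar>p1 t x\<bar> \<le> B" "\<bar>p2 t x\<bar> \<le> B" "\<bar>p11 t x\<bar> \<le> B" "\<bar>p22 t x\<bar> \<le> B" if "t \<in> {0..T}" for t x
    using p that by (auto simp: nice_st_def)
  have B0: "B \<ge> 0" using pb(1)[of 0] T by force
  have RD: "renorm_data (w t) \<beta> \<beta>' \<beta>'' L R B (p t) (p1 t) (p2 t) (p11 t) (p22 t)" if "good t" "t \<in> {0..T}" for t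
    by unfold_locales (use that b p in \<open>auto simp: good_def nice_st_def\<close>)
  have RD0: "renorm_data w0 \<beta> \<beta>' \<beta>'' L R B (p 0) (p1 0) (p2 0) (p11 0) (p22 0)"
    by unfold_locales (use w01 w02 b p T in \<open>auto simp: nice_st_def\<close>)
  define E where "E n = 1 / (real n + 1)" for n
  have E: "E n > 0" for n by (simp add: E_def)
  have El: "E \<longlonglongrightarrow> 0" unfolding E_def using LIMSEQ_inverse_real_of_nat by (simp add: inverse_eq_divide add.commute)
  let ?A = "\<lambda>n t. LBINT x. \<beta> (conv (w t) (eta (E n)) x) * pt t x"
  let ?J = "\<lambda>n t. LBINT x. p t x * \<beta>' (conv (w t) (eta (E n)) x) * De (E n) (w t) x"
  let ?P = "\<lambda>n t. LBINT x. \<beta> (conv (w t) (eta (E n)) x) * (p11 t x + p22 t x)"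
  let ?R = "\<lambda>n t. indicator {0<..<T} t * (?A n t - ?J n t + \<nu> * ?P n t)"
  let ?S = "\<lambda>t. indicator {0<..<T} t * ((LBINT x. \<beta> (w t x) * pt t x)
      + (LBINT x. \<beta> (w t x) * (velocity (w t) x $ 1 * p1 t x + velocity (w t) x $ 2 * p2 t x))
      + \<nu> * (LBINT x. \<beta> (w t x) * (p11 t x + p22 t x)))"
  define V where "V = measure lborel (cball (0::real^2) R)"
  have V0: "V \<ge> 0" by (simp add: V_def)
  \<comment> \<open>The sum of the bounds for the time derivative, the transport term and the
    viscous term, with the common factor 1 + W t taken out.\<close>
  define K where "K = L * B + (B * L * (10 * Ceta * M) + 2 * B * L * (M + 2 * pi\<^sup>2 * M + V)) + \<nu> * (L * (2 * B))"
  have pp: "\<bar>p11 t x + p22 t x\<bar> \<le> 2 * B" if "t \<in> {0..T}" for t x using pb(5,6)[OF that, of x] by linarith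
  have Rb: "\<bar>?R n t\<bar> \<le> indicator {0<..<T} t * (K * (1 + W t))" if g: "t \<in> {0<..<T} \<longrightarrow> good t" for n t
  proof (cases "t \<in> {0<..<T}")
    case True
    then have gt: "good t" and t: "t \<in> {0..T}" using g by auto
    note rd = RD[OF gt t]
    have gM: "(LBINT x. (w t x)\<^sup>2) \<le> M" using gt by (simp add: good_def)
    have Q0: "0 \<le> (LBINT x. (w t x)\<^sup>2)" by simp
    note W0 = W_nonneg[of t]
    have W1: "W t \<le> 1 + W t" by simp
    have "\<bar>?A n t\<bar> \<le> L * B * W t" unfolding W_def
      by (rule renorm_data.beta_pair_bound(2)[OF rd E[of n] _ pb(2)[OF t]]) simp
    also have "\<dots> \<le> L * B * (1 + W t)" using L0 B0 by (intro mult_left_mono) auto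
    finally have a: "\<bar>?A n t\<bar> \<le> L * B * (1 + W t)" .
    have "\<bar>?P n t\<bar> \<le> L * (2 * B) * W t" unfolding W_def
      by (rule renorm_data.beta_pair_bound(2)[OF rd E[of n] _ pp[OF t]]) simp
    also have "\<dots> \<le> L * (2 * B) * (1 + W t)" using L0 B0 by (intro mult_left_mono) auto
    finally have c: "\<bar>?P n t\<bar> \<le> L * (2 * B) * (1 + W t)" .
    have "\<bar>?J n t\<bar> \<le> B * L * (10 * Ceta * (LBINT x. (w t x)\<^sup>2)) + 2 * B * L * ((1/2 + W t) * (LBINT x. (w t x)\<^sup>2) +
       (2 * pi\<^sup>2 * (LBINT x. (w t x)\<^sup>2) + W t * V))"
      using renorm_data.transport_bound[OF rd E[of n]] unfolding W_def[symmetric] V_def .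
    also have "\<dots> \<le> B * L * (10 * Ceta * (M * (1 + W t))) + 2 * B * L * ((1 + W t) * M + (2 * pi\<^sup>2 * (M * (1 + W t)) + (1 + W t) * V))"
    proof -
      have MW: "(LBINT x. (w t x)\<^sup>2) \<le> M * (1 + W t)"
        using gM mult_left_mono[of 1 "1 + W t" M] M_nonneg W0 by simp
      show ?thesis using B0 L0 Ceta_nonneg V0 W0 gM Q0 MW
        by (intro add_mono mult_left_mono mult_mono[of "1/2 + W t"] mult_right_mono) auto
    qed
    also have "\<dots> = (B * L * (10 * Ceta * M) + 2 * B * L * (M + 2 * pi\<^sup>2 * M + V)) * (1 + W t)" by (simp add: algebra_simps)
    finally have j: "\<bar>?J n t\<bar> \<le> (B * L * (10 * Ceta * M) + 2 * B * L * (M + 2 * pi\<^sup>2 * M + V)) * (1 + W t)" .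
    have "\<bar>\<nu> * ?P n t\<bar> \<le> \<nu> * (L * (2 * B) * (1 + W t))" unfolding abs_mult abs_of_nonneg[OF nu] by (intro mult_left_mono c nu)
    with a j have "\<bar>?A n t - ?J n t + \<nu> * ?P n t\<bar> \<le> L * B * (1 + W t) + (B * L * (10 * Ceta * M) + 2 * B * L * (M + 2 * pi\<^sup>2 * M + V)) * (1 + W t) + \<nu> * (L * (2 * B) * (1 + W t))"
      by linarith
    also have "\<dots> = K * (1 + W t)" unfolding K_def by (simp add: algebra_simps)
    finally show ?thesis using True by simp
  qed simp
  have Rm: "?R n \<in> borel_measurable lborel" for n
    by (intro borel_measurable_times borel_measurable_add borel_measurable_diff lborel.borel_measurable_lebesgue_integral) measurable
  have Ri: "L1 (?R n)" for n
  proof (rule Bochner_Integration.integrable_bound[OF dom_integrable[of K] Rm])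
    show "AE t in lborel. norm (?R n t) \<le> norm (indicator {0<..<T} t * (K * (1 + W t)))"
      using ae_good by eventually_elim (use Rb in \<open>auto intro: order_trans[OF _ abs_ge_self] simp del: abs_mult\<close>)
  qed
  have step: "0 \<le> (LBINT t. ?R n t) + (LBINT x. \<beta> (conv w0 (eta (E n)) x) * p 0 x)" for n
  proof -
    let ?f = "\<lambda>t x. - De (E n) (w t) x + \<nu> * (conv (w t) (eta11 (E n)) x + conv (w t) (eta22 (E n)) x)"
    let ?k = "\<lambda>t x. \<beta> (conv (w t) (eta (E n)) x) * pt t x + \<beta>' (conv (w t) (eta (E n)) x) * ?f t x * p t x"
    note mr = mollified_renorm[OF E[of n] b T2 p]
    have "(LBINT t. indicator {0<..<T} t * (LBINT x. ?k t x)) \<le> (LBINT t. ?R n t)"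
    proof (rule integral_mono_AE[OF mr(2) Ri])
      show "AE t in lborel. indicator {0<..<T} t * (LBINT x. ?k t x) \<le> ?R n t"
        using ae_good
      proof eventually_elim
        case (elim t)
        show ?case
        proof (cases "t \<in> {0<..<T}")
          case True
          then have gt: "good t" and t: "t \<in> {0..T}" using elim by auto
          note rd = RD[OF gt t]
          have wi: "L1 (w t)" using gt by (simp add: good_def)
          let ?l = "\<lambda>x. p t x * \<beta>' (conv (w t) (eta (E n)) x) * (conv (w t) (eta11 (E n)) x + conv (w t) (eta22 (E n)) x)"
          note M' = mollified_regular[OF wi E[of n]]
          have li: "L1 ?l"
            by (rule cont_supp_integrable(1)[where R=R], intro continuous_intros M' renorm_data.beta_cont_comp(2)[OF rd] renorm_data.P[OF rd])
               (simp add: renorm_data.P[OF rd])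
          have ai: "L1 (\<lambda>x. \<beta> (conv (w t) (eta (E n)) x) * pt t x)"
            by (rule renorm_data.beta_pair_bound(1)[OF rd E _ pb(2)[OF t]]) simp
          note ji = renorm_data.transport_identity(1)[OF rd E[of n]]
          have "(LBINT x. ?k t x) = (LBINT x. \<beta> (conv (w t) (eta (E n)) x) * pt t x - p t x * \<beta>' (conv (w t) (eta (E n)) x) * De (E n) (w t) x + \<nu> * ?l x)"
            by (intro Bochner_Integration.integral_cong refl) (simp add: algebra_simps)
          also have "\<dots> = ?A n t - ?J n t + \<nu> * (LBINT x. ?l x)"
            using ai ji li by simp
          also have "\<dots> \<le> ?A n t - ?J n t + \<nu> * ?P n t"
          proof (cases "\<nu> = 0")
            case False
            then have "(LBINT x. ?l x) \<le> ?P n t"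
              using pos t by (intro renorm_data.laplace_ineq[OF rd E]) auto
            then show ?thesis using nu by (simp add: mult_left_mono)
          qed simp
          finally show ?thesis using True by simp
        qed simp
      qed
    qed
    then show ?thesis using mr(1) by linarith
  qed
  have lim1: "(\<lambda>n. LBINT t. ?R n t) \<longlonglongrightarrow> (LBINT t. ?S t)"
  proof (rule integral_dominated_convergence[OF _ Rm dom_integrable[of K]])
    show "?S \<in> borel_measurable lborel"
      by (intro borel_measurable_times borel_measurable_add lborel.borel_measurable_lebesgue_integral) measurable
    show "AE t in lborel. (\<lambda>n. ?R n t) \<longlonglongrightarrow> ?S t"
      using ae_good
    proof eventually_elim
      case (elim t)
      show ?case
      proof (cases "t \<in> {0<..<T}")
        case True
        then have gt: "good t" and t: "t \<in> {0..T}" using elim by auto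
        note rd = RD[OF gt t]
        have "(\<lambda>n. ?A n t - ?J n t + \<nu> * ?P n t) \<longlonglongrightarrow> (LBINT x. \<beta> (w t x) * pt t x)
          - (- (LBINT x. \<beta> (w t x) * (velocity (w t) x $ 1 * p1 t x + velocity (w t) x $ 2 * p2 t x)))
          + \<nu> * (LBINT x. \<beta> (w t x) * (p11 t x + p22 t x))"
          by (intro tendsto_intros renorm_data.transport_tendsto[OF rd E El] renorm_data.beta_pair_tendsto[OF rd E El _ pb(2)[OF t]]
             renorm_data.beta_pair_tendsto[OF rd E El _ pp[OF t]]) measurable
        then show ?thesis using True by simp
      qed simp
    qed
    show "AE t in lborel. norm (?R n t) \<le> indicator {0<..<T} t * (K * (1 + W t))" for n
      using ae_good by eventually_elim (use Rb in \<open>auto simp del: abs_mult\<close>)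
  qed
  have lim2: "(\<lambda>n. LBINT x. \<beta> (conv w0 (eta (E n)) x) * p 0 x) \<longlonglongrightarrow> (LBINT x. \<beta> (w0 x) * p 0 x)"
    by (rule renorm_data.beta_pair_tendsto[OF RD0 E El _ pb(1)]) (use T in auto)
  show ?thesis
    by (rule LIMSEQ_le_const[OF tendsto_add[OF lim1 lim2]]) (use step in auto)
qed

end

section \<open>Decay of the mass\<close>

lemma max_pow_deriv: "((\<lambda>s::real. (max 0 s) ^ Suc (Suc k)) has_real_derivative (real k + 2) * (max 0 s) ^ Suc k) (at s)"
proof -
  consider "s > 0" | "s < 0" | "s = 0" by linarith
  then show ?thesis
  proof cases
    case 1
    have "((\<lambda>s::real. s ^ Suc (Suc k)) has_real_derivative (real k + 2) * (max 0 s) ^ Suc k) (at s)"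
      by (rule DERIV_cong[OF DERIV_pow]) (use 1 in \<open>simp add: max_def\<close>)
    then show ?thesis
      by (rule DERIV_cong_ev[THEN iffD1, rotated -1])
         (use 1 in \<open>auto simp: max_def intro!: eventually_mono[OF eventually_nhds_in_open[of "{0<..}"]]\<close>)
  next
    case 2
    have "((\<lambda>s::real. 0) has_real_derivative (real k + 2) * (max 0 s) ^ Suc k) (at s)" using 2 by (simp add: max_def)
    then show ?thesis
      by (rule DERIV_cong_ev[THEN iffD1, rotated -1])
         (use 2 in \<open>auto simp: max_def intro!: eventually_mono[OF eventually_nhds_in_open[of "{..<0}"]]\<close>)
  next
    case 3
    have "((\<lambda>h::real. ((max 0 (0 + h)) ^ Suc (Suc k) - (max 0 0) ^ Suc (Suc k)) / h) \<longlongrightarrow> 0) (at 0)"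
    proof (rule Lim_null_comparison)
      show "\<forall>\<^sub>F h in at 0. norm (((max 0 (0 + h)) ^ Suc (Suc k) - (max 0 0) ^ Suc (Suc k)) / h) \<le> \<bar>h\<bar> ^ Suc k"
        by (auto simp: eventually_at_filter max_def power_abs mult_nonpos_nonneg intro!: always_eventually)
      have "((\<lambda>h::real. \<bar>h\<bar> ^ Suc k) \<longlongrightarrow> \<bar>0\<bar> ^ Suc k) (at 0)" by (intro tendsto_intros)
      then show "((\<lambda>h::real. \<bar>h\<bar> ^ Suc k) \<longlongrightarrow> 0) (at 0)" by simp
    qed
    then show ?thesis using 3 unfolding DERIV_def by simp
  qed
qed

lemma max_pow2_deriv: "((\<lambda>s::real. (max 0 s)\<^sup>2) has_real_derivative 2 * max 0 s) (at s)"
  using max_pow_deriv[of 0 s] by (simp add: numeral_2_eq_2)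

lemma max_pow3_deriv: "((\<lambda>s::real. (max 0 s) ^ 3) has_real_derivative 3 * (max 0 s)\<^sup>2) (at s)"
  using max_pow_deriv[of 1 s] by (simp add: numeral_2_eq_2 numeral_3_eq_3)

text \<open>The cube of the positive part is just smooth enough ($C^2$) for the Laplacian of the cutoff to be continuous.\<close>
definition cutm :: "real \<Rightarrow> real^2 \<Rightarrow> real" where "cutm R x = max 0 (1 - ((x$1)\<^sup>2 + (x$2)\<^sup>2) / R\<^sup>2)"
definition cutf :: "real \<Rightarrow> real^2 \<Rightarrow> real" where "cutf R x = (cutm R x) ^ 3"
definition cutd :: "real \<Rightarrow> 2 \<Rightarrow> real^2 \<Rightarrow> real" where "cutd R i x = - 6 * (cutm R x)\<^sup>2 * (x$i / R\<^sup>2)"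
definition cutdd :: "real \<Rightarrow> 2 \<Rightarrow> real^2 \<Rightarrow> real" where "cutdd R i x = 24 * cutm R x * (x$i / R\<^sup>2)\<^sup>2 - 6 * (cutm R x)\<^sup>2 / R\<^sup>2"

lemma cut_arg_dird:
  "dird (\<lambda>x. 1 - ((x$1)\<^sup>2 + (x$2)\<^sup>2) / R\<^sup>2) e1 (\<lambda>x. - 2 * (x$1 / R\<^sup>2))"
  "dird (\<lambda>x. 1 - ((x$1)\<^sup>2 + (x$2)\<^sup>2) / R\<^sup>2) e2 (\<lambda>x. - 2 * (x$2 / R\<^sup>2))"
  unfolding dird_def axis_simps divide_inverse by (auto intro!: derivative_eq_intros)

lemma cut_dird:
  shows "dird (cutf R) e1 (cutd R 1)" "dird (cutf R) e2 (cutd R 2)" "dird (cutd R 1) e1 (cutdd R 1)" "dird (cutd R 2) e2 (cutdd R 2)"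
proof -
  note D3 = dird_compose[OF cut_arg_dird(1) max_pow3_deriv] dird_compose[OF cut_arg_dird(2) max_pow3_deriv]
  note D2 = dird_compose[OF cut_arg_dird(1) max_pow2_deriv] dird_compose[OF cut_arg_dird(2) max_pow2_deriv]
  have l: "dird (\<lambda>x::real^2. - 6 * (x$1 / R\<^sup>2)) e1 (\<lambda>x. - 6 / R\<^sup>2)" "dird (\<lambda>x::real^2. - 6 * (x$2 / R\<^sup>2)) e2 (\<lambda>x. - 6 / R\<^sup>2)"
    unfolding dird_def axis_simps divide_inverse by (auto intro!: derivative_eq_intros)
  have e: "cutf R = (\<lambda>x. (max 0 (1 - ((x$1)\<^sup>2 + (x$2)\<^sup>2) / R\<^sup>2)) ^ 3)" by (auto simp: cutf_def cutm_def)
  have ed: "cutd R i = (\<lambda>x. 3 * (max 0 (1 - ((x$1)\<^sup>2 + (x$2)\<^sup>2) / R\<^sup>2))\<^sup>2 * (- 2 * (x$i / R\<^sup>2)))"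
     "cutd R i = (\<lambda>x. (max 0 (1 - ((x$1)\<^sup>2 + (x$2)\<^sup>2) / R\<^sup>2))\<^sup>2 * (- 6 * (x$i / R\<^sup>2)))" for i
    by (auto simp: cutd_def cutm_def)
  have edd: "cutdd R i = (\<lambda>x. (2 * max 0 (1 - ((x$1)\<^sup>2 + (x$2)\<^sup>2) / R\<^sup>2) * (- 2 * (x$i / R\<^sup>2))) * (- 6 * (x$i / R\<^sup>2))
     + (max 0 (1 - ((x$1)\<^sup>2 + (x$2)\<^sup>2) / R\<^sup>2))\<^sup>2 * (- 6 / R\<^sup>2))" for i
    by (simp add: fun_eq_iff cutdd_def cutm_def power2_eq_square mult_ac)
  show "dird (cutf R) e1 (cutd R 1)" "dird (cutf R) e2 (cutd R 2)" unfolding e ed(1) by (rule D3)+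
  show "dird (cutd R 1) e1 (cutdd R 1)" unfolding ed(2) edd by (rule dird_mult[OF D2(1) l(1)])
  show "dird (cutd R 2) e2 (cutdd R 2)" unfolding ed(2) edd by (rule dird_mult[OF D2(2) l(2)])
qed

lemma cut_cont: "R > 0 \<Longrightarrow> continuous_on UNIV (cutf R)" "R > 0 \<Longrightarrow> continuous_on UNIV (cutd R i)" "R > 0 \<Longrightarrow> continuous_on UNIV (cutdd R i)"
  unfolding cutf_def cutd_def cutdd_def cutm_def by (intro continuous_intros; simp)+

lemma cutm_bounds:
  assumes R: "R > 0"
  shows "0 \<le> cutm R x" "cutm R x \<le> 1" "norm x > R \<Longrightarrow> cutm R x = 0"
proof -
  show "0 \<le> cutm R x" "cutm R x \<le> 1" by (auto simp: cutm_def)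
  assume "norm x > R"
  then have "(norm x)\<^sup>2 > R\<^sup>2" using R by (intro power_strict_mono) auto
  then show "cutm R x = 0" using R unfolding norm_sq_vec2 cutm_def by (simp add: max_def)
qed

text \<open>On the support |x_i| \<le> R, so each derivative gains a factor 1/R; the constant 30 is
  24 + 6. This decay removes the flux and the viscous term in the limit of large radius.\<close>

lemma cut_bounds:
  assumes R: "R > 0"
  shows "0 \<le> cutf R x" "cutf R x \<le> 1" "\<bar>cutd R i x\<bar> \<le> 6 / R" "\<bar>cutdd R i x\<bar> \<le> 30 / R\<^sup>2"
    "norm x > R \<Longrightarrow> cutf R x = 0" "norm x > R \<Longrightarrow> cutd R i x = 0" "norm x > R \<Longrightarrow> cutdd R i x = 0"
proof -
  note m = cutm_bounds[OF R, of x]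
  show "0 \<le> cutf R x" "cutf R x \<le> 1" unfolding cutf_def using m by (auto intro: power_le_one)
  show "norm x > R \<Longrightarrow> cutf R x = 0" "norm x > R \<Longrightarrow> cutd R i x = 0" "norm x > R \<Longrightarrow> cutdd R i x = 0"
    using m(3) by (auto simp: cutf_def cutd_def cutdd_def)
  have m2: "(cutm R x)\<^sup>2 \<le> 1" using m by (simp add: power_le_one)
  have *: "\<bar>cutd R i x\<bar> \<le> 6 / R \<and> \<bar>cutdd R i x\<bar> \<le> 30 / R\<^sup>2"
  proof (cases "norm x > R")
    case True
    then show ?thesis using m(3) R by (auto simp: cutd_def cutdd_def)
  next
    case False
    then have "\<bar>x$i\<bar> \<le> R" using component_le_norm_cart[of x i] by linarith
    then have "\<bar>x$i\<bar> / R\<^sup>2 \<le> R / R\<^sup>2" by (intro divide_right_mono) auto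
    then have c: "\<bar>x$i / R\<^sup>2\<bar> \<le> 1 / R" using R by (simp add: power2_eq_square)
    have "\<bar>cutd R i x\<bar> = 6 * (cutm R x)\<^sup>2 * \<bar>x$i / R\<^sup>2\<bar>" by (simp add: cutd_def abs_mult)
    also have "\<dots> \<le> 6 * 1 * (1 / R)" using m2 c by (intro mult_mono) auto
    finally have 1: "\<bar>cutd R i x\<bar> \<le> 6 / R" by simp
    have c2: "(x$i / R\<^sup>2)\<^sup>2 \<le> 1 / R\<^sup>2"
      using power_mono[OF c, of 2] by (simp add: power_divide)
    have "24 * cutm R x * (x$i / R\<^sup>2)\<^sup>2 \<le> 24 * 1 * (1 / R\<^sup>2)" using m c2 by (intro mult_mono) auto
    moreover have "6 * (cutm R x)\<^sup>2 / R\<^sup>2 \<le> 6 * 1 / R\<^sup>2" using m2 by (intro divide_right_mono mult_left_mono) auto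
    moreover have "0 \<le> 24 * cutm R x * (x$i / R\<^sup>2)\<^sup>2" "0 \<le> 6 * (cutm R x)\<^sup>2 / R\<^sup>2" using m by simp_all
    moreover have "30 / R\<^sup>2 = 24 * 1 * (1 / R\<^sup>2) + 6 * 1 / R\<^sup>2" by simp
    ultimately have "\<bar>cutdd R i x\<bar> \<le> 30 / R\<^sup>2" unfolding cutdd_def by linarith
    with 1 show ?thesis by blast
  qed
  then show "\<bar>cutd R i x\<bar> \<le> 6 / R" "\<bar>cutdd R i x\<bar> \<le> 30 / R\<^sup>2" by auto
qed

text \<open>A smooth convex substitute for the modulus, shifted to vanish at 0. Its slope is at most
  1 for every \<mu>, so |s| itself is a majorant while \<mu> tends to 0.\<close>

definition bsq :: "real \<Rightarrow> real \<Rightarrow> real" where "bsq \<mu> s = sqrt (\<mu>\<^sup>2 + s\<^sup>2) - \<mu>"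

lemma bsq_nice:
  assumes m: "\<mu> > 0"
  shows "nice_beta 1 (bsq \<mu>) (\<lambda>s. s / sqrt (\<mu>\<^sup>2 + s\<^sup>2)) (\<lambda>s. \<mu>\<^sup>2 / ((\<mu>\<^sup>2 + s\<^sup>2) * sqrt (\<mu>\<^sup>2 + s\<^sup>2)))"
proof -
  have p: "\<mu>\<^sup>2 + s\<^sup>2 > 0" for s using m by (simp add: add_pos_nonneg)
  have n: "sqrt (\<mu>\<^sup>2 + s\<^sup>2) \<noteq> 0" for s using m by simp
  have sq: "sqrt (\<mu>\<^sup>2 + s\<^sup>2) * sqrt (\<mu>\<^sup>2 + s\<^sup>2) = \<mu>\<^sup>2 + s\<^sup>2" for s using p[of s] by simp
  have d0: "(bsq \<mu> has_real_derivative s / sqrt (\<mu>\<^sup>2 + s\<^sup>2)) (at s)" for s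
    unfolding bsq_def using p[of s] m by (auto intro!: derivative_eq_intros simp: field_simps)
  have ds: "((\<lambda>s. sqrt (\<mu>\<^sup>2 + s\<^sup>2)) has_real_derivative s / sqrt (\<mu>\<^sup>2 + s\<^sup>2)) (at s)" for s
    using p[of s] m by (auto intro!: derivative_eq_intros simp: field_simps)
  have d1: "((\<lambda>s. s / sqrt (\<mu>\<^sup>2 + s\<^sup>2)) has_real_derivative \<mu>\<^sup>2 / ((\<mu>\<^sup>2 + s\<^sup>2) * sqrt (\<mu>\<^sup>2 + s\<^sup>2))) (at s)" for s
  proof -
    let ?q = "sqrt (\<mu>\<^sup>2 + s\<^sup>2)"
    have "((\<lambda>s. s / sqrt (\<mu>\<^sup>2 + s\<^sup>2)) has_real_derivative (1 * ?q - s * (s / ?q)) / (?q * ?q)) (at s)"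
      by (rule DERIV_divide[OF DERIV_ident ds n])
    moreover have "(1 * ?q - s * (s / ?q)) / (?q * ?q) = \<mu>\<^sup>2 / ((\<mu>\<^sup>2 + s\<^sup>2) * ?q)"
    proof -
      have "1 * q - s * (s / q) = (q * q - s\<^sup>2) / q" if "q \<noteq> 0" for q :: real
        using that by (simp add: field_simps power2_eq_square)
      from this[OF n] have "1 * ?q - s * (s / ?q) = (?q * ?q - s\<^sup>2) / ?q" .
      also have "\<dots> = \<mu>\<^sup>2 / ?q" unfolding sq by simp
      finally show ?thesis unfolding sq by (simp add: mult.commute)
    qed
    ultimately show ?thesis by simp
  qed
  have "\<bar>s\<bar> \<le> sqrt (\<mu>\<^sup>2 + s\<^sup>2)" for s by (rule real_le_rsqrt) simp
  then have "\<bar>s / sqrt (\<mu>\<^sup>2 + s\<^sup>2)\<bar> \<le> 1" for s using p[of s] by (simp add: abs_divide)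
  moreover have "continuous_on UNIV (\<lambda>s. \<mu>\<^sup>2 / ((\<mu>\<^sup>2 + s\<^sup>2) * sqrt (\<mu>\<^sup>2 + s\<^sup>2)))"
    using p n by (intro continuous_intros ballI) (metis less_irrefl mult_eq_0_iff)
  ultimately show ?thesis unfolding nice_beta_def using d0 d1 m by (simp add: bsq_def)
qed

lemma bsq_tendsto: "(\<lambda>n. bsq (1 / (real n + 1)) s) \<longlonglongrightarrow> \<bar>s\<bar>"
proof -
  have l: "(\<lambda>n. 1 / (real n + 1)) \<longlonglongrightarrow> 0" using LIMSEQ_inverse_real_of_nat by (simp add: inverse_eq_divide add.commute)
  have "(\<lambda>n. bsq (1 / (real n + 1)) s) \<longlonglongrightarrow> sqrt (0\<^sup>2 + s\<^sup>2) - 0" unfolding bsq_def by (intro tendsto_intros l)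
  then show ?thesis by simp
qed

lemma cut_tendsto: "(\<lambda>n. cutf (real n + 1) x) \<longlonglongrightarrow> 1"
proof -
  have "(\<lambda>n. 1 / (real n + 1)) \<longlonglongrightarrow> 0" using LIMSEQ_inverse_real_of_nat by (simp add: inverse_eq_divide add.commute)
  then have "(\<lambda>n. (max 0 (1 - ((x$1)\<^sup>2 + (x$2)\<^sup>2) * (1 / (real n + 1))\<^sup>2)) ^ 3) \<longlonglongrightarrow> (max 0 (1 - ((x$1)\<^sup>2 + (x$2)\<^sup>2) * 0\<^sup>2)) ^ 3"
    by (intro tendsto_intros)
  then show ?thesis by (simp add: cutf_def cutm_def power_divide)
qed

text \<open>A generous common bound, independent of n: the spatial factors are at most 30 T2^2
  because the radius is at least 1, and the time derivative is at most 2 T2.\<close>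

lemma test_cut_nice:
  fixes n :: nat
  assumes T2: "0 < T2" "T2 < T"
  defines "R \<equiv> real n + 1" and "th \<equiv> \<lambda>t. (max 0 (T2 - t))\<^sup>2"
  shows "nice_st R (60 * (T2\<^sup>2 + T2)) T T2 (\<lambda>t x. th t * cutf R x) (\<lambda>t x. - 2 * max 0 (T2 - t) * cutf R x) (\<lambda>t x. th t * cutd R 1 x) (\<lambda>t x. th t * cutd R 2 x)
     (\<lambda>t x. th t * cutdd R 1 x) (\<lambda>t x. th t * cutdd R 2 x)"
  unfolding nice_st_def
proof (intro conjI ballI allI impI)
  have R: "R > 0" "R \<ge> 1" by (auto simp: R_def)
  note C = cut_cont[OF R(1)] and CB = cut_bounds[OF R(1)]
  have sc: "dird (\<lambda>x. c * f x) e (\<lambda>x. c * f' x)" if "dird f e f'" for c e and f f' :: "real^2 \<Rightarrow> real"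
    using that unfolding dird_def by (auto intro: DERIV_cmult)
  show "nice_test R (\<lambda>x. th t * cutf R x) (\<lambda>x. th t * cutd R 1 x) (\<lambda>x. th t * cutd R 2 x) (\<lambda>x. th t * cutdd R 1 x) (\<lambda>x. th t * cutdd R 2 x)" for t
    unfolding nice_test_def using CB(5-7) by (intro conjI sc cut_dird continuous_intros C) auto
  show "((\<lambda>t. th t * cutf R x) has_real_derivative - 2 * max 0 (T2 - t) * cutf R x) (at t)" for t x
  proof -
    have "((\<lambda>t. T2 - t) has_real_derivative -1) (at t)" by (auto intro!: derivative_eq_intros)
    from DERIV_cmult_right[OF DERIV_chain2[OF max_pow2_deriv this], of "cutf R x"] show ?thesis unfolding th_def by simp
  qed
  show "continuous_on UNIV (\<lambda>t. - 2 * max 0 (T2 - t) * cutf R x)" for x by (intro continuous_intros)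
  show "th t * cutf R x = 0" "- 2 * max 0 (T2 - t) * cutf R x = 0" if "T2 \<le> t" for t x using that by (auto simp: th_def max_def)
  show "- 2 * max 0 (T2 - t) * cutf R x = 0" if "norm x > R" for t x using CB(5)[OF that] by simp
next
  fix t x assume t: "t \<in> {0..T}"
  have R: "R > 0" "R \<ge> 1" by (auto simp: R_def)
  note CB = cut_bounds[OF R(1)]
  have m: "0 \<le> max 0 (T2 - t)" "max 0 (T2 - t) \<le> T2" using t T2 by auto
  have th: "0 \<le> th t" "th t \<le> T2\<^sup>2" unfolding th_def using m by (auto intro: power_mono)
  have gen: "\<bar>th t * c\<bar> \<le> 60 * (T2\<^sup>2 + T2)" if "\<bar>c\<bar> \<le> 30" for c
  proof -
    have "\<bar>th t * c\<bar> \<le> T2\<^sup>2 * 30" unfolding abs_mult using th that by (intro mult_mono) auto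
    also have "\<dots> \<le> 60 * (T2\<^sup>2 + T2)" using T2 by simp
    finally show ?thesis .
  qed
  have "1 * 1 \<le> R * R" using R by (intro mult_mono) auto
  then have r: "6 / R \<le> 30" "30 / R\<^sup>2 \<le> 30" using R by (auto simp: divide_le_eq power2_eq_square)
  show "\<bar>th t * cutf R x\<bar> \<le> 60 * (T2\<^sup>2 + T2)" using CB(1,2)[of x] by (intro gen) auto
  show "\<bar>th t * cutd R 1 x\<bar> \<le> 60 * (T2\<^sup>2 + T2)" by (intro gen order_trans[OF CB(3)] r)
  show "\<bar>th t * cutd R 2 x\<bar> \<le> 60 * (T2\<^sup>2 + T2)" by (intro gen order_trans[OF CB(3)] r)
  show "\<bar>th t * cutdd R 1 x\<bar> \<le> 60 * (T2\<^sup>2 + T2)" by (intro gen order_trans[OF CB(4)] r)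
  show "\<bar>th t * cutdd R 2 x\<bar> \<le> 60 * (T2\<^sup>2 + T2)" by (intro gen order_trans[OF CB(4)] r)
  have "\<bar>- 2 * max 0 (T2 - t) * cutf R x\<bar> = 2 * max 0 (T2 - t) * cutf R x" using m CB(1)[of x] by (simp add: abs_mult)
  also have "\<dots> \<le> 2 * T2 * 1" using m CB(1,2)[of x] by (intro mult_mono) auto
  also have "\<dots> \<le> 60 * (T2\<^sup>2 + T2)" using T2 by simp
  finally show "\<bar>- 2 * max 0 (T2 - t) * cutf R x\<bar> \<le> 60 * (T2\<^sup>2 + T2)" .
next
  have [measurable]: "cutf R \<in> borel_measurable borel" "cutd R i \<in> borel_measurable borel" "cutdd R i \<in> borel_measurable borel" for i
    using cut_cont[of R] by (auto simp: R_def intro: borel_measurable_continuous_onI)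
  fix f assume "f \<in> {\<lambda>t x. th t * cutf R x, \<lambda>t x. - 2 * max 0 (T2 - t) * cutf R x, \<lambda>t x. th t * cutd R 1 x, \<lambda>t x. th t * cutd R 2 x, \<lambda>t x. th t * cutdd R 1 x, \<lambda>t x. th t * cutdd R 2 x}"
  then show "(\<lambda>z. f (fst z) (snd z)) \<in> borel_measurable borel"
    unfolding th_def borel_prod[symmetric] by (elim insertE emptyE; simp only:; measurable)
qed

context weak_solution begin

text \<open>Testing a smoothed modulus with the weight $((T_2 - t)_+)^2$ bounds the space-time mass before \<open>T2\<close> by the initial mass, uniformly in the viscosity.\<close>
lemma L1_decay:
  assumes T2: "0 < T2" "T2 < T" and Wb: "AE t in lborel. t \<in> {0<..<T} \<longrightarrow> W t \<le> M"
  shows "(LBINT t. indicator {0<..<T} t * (2 * max 0 (T2 - t) * W t)) \<le> T2\<^sup>2 * (LBINT x. \<bar>w0 x\<bar>)"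
proof -
  \<comment> \<open>A single index n governs both limits: the cutoff radius n + 1 and the smoothing
    parameter 1 / (n + 1).\<close>
  let ?R = "\<lambda>n. real n + 1" and ?b = "\<lambda>n. bsq (1 / (real n + 1))"
  let ?th = "\<lambda>t. (max 0 (T2 - t))\<^sup>2" and ?m = "\<lambda>t. max 0 (T2 - t)"
  let ?v1 = "\<lambda>t x. velocity (w t) x $ 1" and ?v2 = "\<lambda>t x. velocity (w t) x $ 2"
  have R0: "?R n > 0" "?R n \<ge> 1" for n by auto
  have mu: "1 / (real n + 1) > 0" for n by simp
  note bn = bsq_nice[OF mu]
  note bl = nice_beta_lip[OF bn, simplified]
  have [measurable]: "?b n \<in> borel_measurable borel" for n by (rule nice_beta_measurable[OF bn])
  have [measurable]: "cutf (?R n) \<in> borel_measurable borel" "cutd (?R n) i \<in> borel_measurable borel" "cutdd (?R n) i \<in> borel_measurable borel" for i n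
    using cut_cont[of "?R n"] by (auto intro: borel_measurable_continuous_onI)
  have CB: "0 \<le> cutf (?R n) x" "cutf (?R n) x \<le> 1" "\<bar>cutd (?R n) i x\<bar> \<le> 6 / ?R n" "\<bar>cutdd (?R n) i x\<bar> \<le> 30 / (?R n)\<^sup>2" for n x i
    using cut_bounds[OF R0(1)] by auto
  let ?A = "\<lambda>n t. LBINT x. ?b n (w t x) * (- 2 * ?m t * cutf (?R n) x)"
  let ?F = "\<lambda>n t. LBINT x. ?b n (w t x) * (?v1 t x * (?th t * cutd (?R n) 1 x) + ?v2 t x * (?th t * cutd (?R n) 2 x))"
  let ?D = "\<lambda>n t. LBINT x. ?b n (w t x) * (?th t * cutdd (?R n) 1 x + ?th t * cutdd (?R n) 2 x)"
  let ?S = "\<lambda>n t. indicator {0<..<T} t * (?A n t + ?F n t + \<nu> * ?D n t)"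
  have step: "0 \<le> (LBINT t. ?S n t) + (LBINT x. ?b n (w0 x) * (?th 0 * cutf (?R n) x))" for n
    by (rule renormalized_inequality[OF bn T2 test_cut_nice[OF T2]]) (use CB in \<open>auto intro!: disjI2\<close>)
  \<comment> \<open>A bound for the flux over the whole plane. It is quadratic in the mass, which is
    where the bound \<open>Wb\<close> on the mass enters; as the flux term also carries a factor
    1/R, it disappears in the limit, and \<open>M\<close> is absent from the final estimate.\<close>
  define X where "X = (1/2 + 2 * pi\<^sup>2) * M + M\<^sup>2"
  have X0: "X \<ge> 0" using M_nonneg by (simp add: X_def)
  have bounds: "\<bar>?A n t\<bar> \<le> 2 * T2 * M" "\<bar>?F n t\<bar> \<le> T2\<^sup>2 * 12 * X * (1 / ?R n)" "\<bar>?D n t\<bar> \<le> T2\<^sup>2 * 60 * M * (1 / ?R n)"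
     "(\<lambda>n. ?A n t) \<longlonglongrightarrow> - 2 * ?m t * W t"
    if g: "good t" and t: "t \<in> {0<..<T}" and WM: "W t \<le> M" for n t
  proof -
    have wi: "L1 (w t)" and w2: "L1 (\<lambda>x. (w t x)\<^sup>2)" and gM: "(LBINT x. (w t x)\<^sup>2) \<le> M" using g by (auto simp: good_def)
    have m: "0 \<le> ?m t" "?m t \<le> T2" using t T2 by auto
    have th: "0 \<le> ?th t" "?th t \<le> T2\<^sup>2" using m by (auto intro: power_mono)
    have gen: "\<bar>LBINT x. ?b n (w t x) * h x\<bar> \<le> c * W t" if c: "\<And>x. \<bar>h x\<bar> \<le> c" and [measurable]: "h \<in> borel_measurable borel" for h c n
    proof -
      have pt: "norm (?b n (w t x) * h x) \<le> c * \<bar>w t x\<bar>" for x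
        unfolding real_norm_def abs_mult mult.commute[of c] by (intro mult_mono bl c) auto
      have ci: "L1 (\<lambda>x. c * \<bar>w t x\<bar>)" using wi by simp
      have i: "L1 (\<lambda>x. ?b n (w t x) * h x)"
        by (rule Bochner_Integration.integrable_bound[OF ci]) (use pt in \<open>auto intro!: AE_I2 intro: order_trans[OF _ abs_ge_self]\<close>)
      have "norm (LBINT x. ?b n (w t x) * h x) \<le> (LBINT x. c * \<bar>w t x\<bar>)"
        by (rule Bochner_Integration.integral_norm_bound_integral[OF i ci pt])
      then show ?thesis by (simp add: W_def)
    qed
    have "\<bar>?A n t\<bar> \<le> 2 * T2 * W t"
    proof (rule gen)
      fix x
      have "\<bar>- 2 * ?m t * cutf (?R n) x\<bar> = 2 * ?m t * cutf (?R n) x" using m CB(1)[where x=x and n=n] by (simp add: abs_mult)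
      also have "\<dots> \<le> 2 * T2 * 1" using m CB(1,2)[where x=x and n=n] by (intro mult_mono) auto
      finally show "\<bar>- 2 * ?m t * cutf (?R n) x\<bar> \<le> 2 * T2" by simp
    qed measurable
    also have "\<dots> \<le> 2 * T2 * M" using T2 WM by simp
    finally show "\<bar>?A n t\<bar> \<le> 2 * T2 * M" .
    have Ri: "1 / (?R n)\<^sup>2 \<le> 1 / ?R n"
    proof -
      have "?R n * 1 \<le> ?R n * ?R n" by (intro mult_left_mono) auto
      then show ?thesis by (intro divide_left_mono) (auto simp: power2_eq_square intro!: mult_pos_pos add_nonneg_pos)
    qed
    have "\<bar>?D n t\<bar> \<le> (T2\<^sup>2 * (60 / (?R n)\<^sup>2)) * W t"
    proof (rule gen)
      fix x
      have "\<bar>cutdd (?R n) 1 x + cutdd (?R n) 2 x\<bar> \<le> 60 / (?R n)\<^sup>2"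
        using CB(4)[where x=x and n=n and i=1] CB(4)[where x=x and n=n and i=2] by (simp add: abs_le_iff)
      then have "?th t * \<bar>cutdd (?R n) 1 x + cutdd (?R n) 2 x\<bar> \<le> T2\<^sup>2 * (60 / (?R n)\<^sup>2)" using th by (intro mult_mono) auto
      then show "\<bar>?th t * cutdd (?R n) 1 x + ?th t * cutdd (?R n) 2 x\<bar> \<le> T2\<^sup>2 * (60 / (?R n)\<^sup>2)"
        using th by (simp add: abs_mult flip: distrib_left)
    qed measurable
    also have "\<dots> = T2\<^sup>2 * 60 * (1 / (?R n)\<^sup>2) * W t" by simp
    also have "\<dots> \<le> T2\<^sup>2 * 60 * (1 / ?R n) * M"
      using Ri WM W_nonneg[of t] by (intro mult_mono mult_left_mono) auto
    also have "\<dots> = T2\<^sup>2 * 60 * M * (1 / ?R n)" by simp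
    finally show "\<bar>?D n t\<bar> \<le> T2\<^sup>2 * 60 * M * (1 / ?R n)" .
    have U: "L1 (\<lambda>x. \<bar>w t x\<bar> * enn2real (Upot (w t) x))" "(LBINT x. \<bar>w t x\<bar> * enn2real (Upot (w t) x)) \<le> X"
    proof -
      show "L1 (\<lambda>x. \<bar>w t x\<bar> * enn2real (Upot (w t) x))" by (rule Upot_w_integrable(1)[OF wi w2])
      have "(LBINT x. \<bar>w t x\<bar> * enn2real (Upot (w t) x)) \<le> (1/2 + 2 * pi\<^sup>2) * (LBINT x. (w t x)\<^sup>2) + (W t)\<^sup>2"
        unfolding W_def by (rule Upot_w_integrable(2)[OF wi w2])
      also have "\<dots> \<le> X" unfolding X_def using gM WM W_nonneg[of t] by (intro add_mono mult_left_mono power_mono) auto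
      finally show "(LBINT x. \<bar>w t x\<bar> * enn2real (Upot (w t) x)) \<le> X" .
    qed
    let ?c = "T2\<^sup>2 * 12 * (1 / ?R n)"
    have ae: "AE x in lborel. norm (?b n (w t x) * (?v1 t x * (?th t * cutd (?R n) 1 x) + ?v2 t x * (?th t * cutd (?R n) 2 x))) \<le> ?c * (\<bar>w t x\<bar> * enn2real (Upot (w t) x))"
      using Upot_finite[OF wi w2]
    proof eventually_elim
      case (elim x)
      let ?U = "enn2real (Upot (w t) x)"
      have v: "\<bar>velocity (w t) x $ i\<bar> \<le> ?U" for i
        using velocity_le_real[OF _ elim] component_le_norm_cart[of "velocity (w t) x" i] by auto
      have c: "\<bar>?th t * cutd (?R n) i x\<bar> \<le> T2\<^sup>2 * (6 / ?R n)" for i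
        unfolding abs_mult using th CB(3)[where x=x and n=n and i=i] by (intro mult_mono) auto
      have "\<bar>?v1 t x * (?th t * cutd (?R n) 1 x) + ?v2 t x * (?th t * cutd (?R n) 2 x)\<bar> \<le> \<bar>?v1 t x\<bar> * \<bar>?th t * cutd (?R n) 1 x\<bar> + \<bar>?v2 t x\<bar> * \<bar>?th t * cutd (?R n) 2 x\<bar>"
        unfolding abs_mult[of "?v1 t x", symmetric] abs_mult[of "?v2 t x", symmetric] by (rule abs_triangle_ineq)
      also have "\<dots> \<le> ?U * (T2\<^sup>2 * (6 / ?R n)) + ?U * (T2\<^sup>2 * (6 / ?R n))" by (intro add_mono mult_mono v c) auto
      also have "\<dots> = ?c * ?U" by simp
      finally have "\<bar>?b n (w t x)\<bar> * \<bar>?v1 t x * (?th t * cutd (?R n) 1 x) + ?v2 t x * (?th t * cutd (?R n) 2 x)\<bar> \<le> \<bar>w t x\<bar> * (?c * ?U)"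
        by (intro mult_mono bl) auto
      then show ?case unfolding real_norm_def abs_mult[of "?b n (w t x)"] by (simp only: mult.left_commute)
    qed
    have ci: "L1 (\<lambda>x. ?c * (\<bar>w t x\<bar> * enn2real (Upot (w t) x)))" using U(1) by (rule integrable_mult_right)
    let ?f = "\<lambda>x. ?b n (w t x) * (?v1 t x * (?th t * cutd (?R n) 1 x) + ?v2 t x * (?th t * cutd (?R n) 2 x))"
    have fi: "L1 ?f"
      by (rule Bochner_Integration.integrable_bound[OF ci]) (use ae in \<open>auto elim!: eventually_mono intro: order_trans[OF _ abs_ge_self]\<close>)
    have "norm (?F n t) \<le> (LBINT x. norm (?f x))" by (rule integral_norm_bound)
    also have "\<dots> \<le> (LBINT x. ?c * (\<bar>w t x\<bar> * enn2real (Upot (w t) x)))"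
      by (rule integral_mono_AE[OF integrable_norm[OF fi] ci ae])
    also have "\<dots> \<le> ?c * X" unfolding integral_mult_right_zero by (intro mult_left_mono U(2)) auto
    finally show "\<bar>?F n t\<bar> \<le> T2\<^sup>2 * 12 * X * (1 / ?R n)" by (simp add: mult_ac)
    have "(\<lambda>n. LBINT x. ?b n (w t x) * (- 2 * ?m t * cutf (?R n) x)) \<longlonglongrightarrow> (LBINT x. \<bar>w t x\<bar> * (- 2 * ?m t * 1))"
    proof (rule integral_dominated_convergence[where w="\<lambda>x. 2 * ?m t * \<bar>w t x\<bar>"])
      show "AE x in lborel. (\<lambda>n. ?b n (w t x) * (- 2 * ?m t * cutf (?R n) x)) \<longlonglongrightarrow> \<bar>w t x\<bar> * (- 2 * ?m t * 1)"
        by (intro AE_I2 tendsto_intros bsq_tendsto cut_tendsto)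
      show "AE x in lborel. norm (?b n (w t x) * (- 2 * ?m t * cutf (?R n) x)) \<le> 2 * ?m t * \<bar>w t x\<bar>" for n
      proof (rule AE_I2)
        fix x
        have "norm (?b n (w t x) * (- 2 * ?m t * cutf (?R n) x)) = \<bar>?b n (w t x)\<bar> * (2 * ?m t * cutf (?R n) x)"
          using m CB(1)[where x=x and n=n] by (simp add: abs_mult)
        also have "\<dots> \<le> \<bar>w t x\<bar> * (2 * ?m t * 1)" using m CB(1,2)[where x=x and n=n] by (intro mult_mono bl mult_left_mono) auto
        finally show "norm (?b n (w t x) * (- 2 * ?m t * cutf (?R n) x)) \<le> 2 * ?m t * \<bar>w t x\<bar>" by (simp add: mult_ac)
      qed
    qed (use wi in auto)
    then show "(\<lambda>n. ?A n t) \<longlonglongrightarrow> - 2 * ?m t * W t" by (simp add: W_def mult_ac)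
  qed
  have inv: "(\<lambda>n. 1 / ?R n) \<longlonglongrightarrow> 0" using LIMSEQ_inverse_real_of_nat by (simp add: inverse_eq_divide add.commute)
  have lim1: "(\<lambda>n. LBINT t. ?S n t) \<longlonglongrightarrow> (LBINT t. indicator {0<..<T} t * (- 2 * ?m t * W t))"
  proof (rule integral_dominated_convergence[where w="\<lambda>t. indicator {0<..<T} t * (2 * T2 * M + T2\<^sup>2 * 12 * X + \<nu> * (T2\<^sup>2 * 60 * M))"])
    show "?S n \<in> borel_measurable lborel" for n
      by (intro borel_measurable_times borel_measurable_add lborel.borel_measurable_lebesgue_integral) measurable
    have "L1 (indicator {0<..<T} :: real \<Rightarrow> real)" using T by (intro integrable_real_indicator) auto
    then show "L1 (\<lambda>t. indicator {0<..<T} t * (2 * T2 * M + T2\<^sup>2 * 12 * X + \<nu> * (T2\<^sup>2 * 60 * M)))" by (rule integrable_mult_left)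
    show "AE t in lborel. (\<lambda>n. ?S n t) \<longlonglongrightarrow> indicator {0<..<T} t * (- 2 * ?m t * W t)"
      using ae_good Wb
    proof eventually_elim
      case (elim t)
      show ?case
      proof (cases "t \<in> {0<..<T}")
        case True
        then have h: "good t" "W t \<le> M" using elim by auto
        note b = bounds[OF h(1) True h(2)]
        have "(\<lambda>n. T2\<^sup>2 * 12 * X * (1 / ?R n)) \<longlonglongrightarrow> T2\<^sup>2 * 12 * X * 0" "(\<lambda>n. T2\<^sup>2 * 60 * M * (1 / ?R n)) \<longlonglongrightarrow> T2\<^sup>2 * 60 * M * 0"
          by (intro tendsto_intros inv)+
        then have z: "(\<lambda>n. T2\<^sup>2 * 12 * X * (1 / ?R n)) \<longlonglongrightarrow> 0" "(\<lambda>n. T2\<^sup>2 * 60 * M * (1 / ?R n)) \<longlonglongrightarrow> 0" by simp_all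
        have F0: "(\<lambda>n. ?F n t) \<longlonglongrightarrow> 0"
          by (rule Lim_null_comparison[OF always_eventually z(1)]) (unfold real_norm_def, intro allI b(2))
        have D0: "(\<lambda>n. ?D n t) \<longlonglongrightarrow> 0"
          by (rule Lim_null_comparison[OF always_eventually z(2)]) (unfold real_norm_def, intro allI b(3))
        have "(\<lambda>n. indicator {0<..<T} t * (?A n t + ?F n t + \<nu> * ?D n t)) \<longlonglongrightarrow> indicator {0<..<T} t * (- 2 * ?m t * W t + 0 + \<nu> * 0)"
          by (intro tendsto_intros b(4) F0 D0)
        then show ?thesis by simp
      qed simp
    qed
    show "AE t in lborel. norm (?S n t) \<le> indicator {0<..<T} t * (2 * T2 * M + T2\<^sup>2 * 12 * X + \<nu> * (T2\<^sup>2 * 60 * M))" for n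
      using ae_good Wb
    proof eventually_elim
      case (elim t)
      show ?case
      proof (cases "t \<in> {0<..<T}")
        case True
        then have h: "good t" "W t \<le> M" using elim by auto
        note b = bounds(1-3)[OF h(1) True h(2), of n]
        have r1: "1 / ?R n \<le> 1" by simp
        have "T2\<^sup>2 * 12 * X * (1 / ?R n) \<le> T2\<^sup>2 * 12 * X * 1" "T2\<^sup>2 * 60 * M * (1 / ?R n) \<le> T2\<^sup>2 * 60 * M * 1"
          using X0 M_nonneg by (intro mult_left_mono r1; simp)+
        then have F: "\<bar>?F n t\<bar> \<le> T2\<^sup>2 * 12 * X" and D: "\<bar>?D n t\<bar> \<le> T2\<^sup>2 * 60 * M" using b(2,3) by linarith+
        have "\<bar>\<nu> * ?D n t\<bar> \<le> \<nu> * (T2\<^sup>2 * 60 * M)" unfolding abs_mult abs_of_nonneg[OF nu] by (intro mult_left_mono D nu)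
        then have "\<bar>?A n t + ?F n t + \<nu> * ?D n t\<bar> \<le> 2 * T2 * M + T2\<^sup>2 * 12 * X + \<nu> * (T2\<^sup>2 * 60 * M)" using b(1) F by linarith
        then show ?thesis using True by simp
      qed simp
    qed
  qed measurable
  have lim2: "(\<lambda>n. LBINT x. ?b n (w0 x) * (?th 0 * cutf (?R n) x)) \<longlonglongrightarrow> (LBINT x. \<bar>w0 x\<bar> * (?th 0 * 1))"
  proof (rule integral_dominated_convergence[where w="\<lambda>x. ?th 0 * \<bar>w0 x\<bar>"])
    show "AE x in lborel. (\<lambda>n. ?b n (w0 x) * (?th 0 * cutf (?R n) x)) \<longlonglongrightarrow> \<bar>w0 x\<bar> * (?th 0 * 1)"
      by (intro AE_I2 tendsto_intros bsq_tendsto cut_tendsto)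
    show "AE x in lborel. norm (?b n (w0 x) * (?th 0 * cutf (?R n) x)) \<le> ?th 0 * \<bar>w0 x\<bar>" for n
    proof (rule AE_I2)
      fix x
      have "norm (?b n (w0 x) * (?th 0 * cutf (?R n) x)) = \<bar>?b n (w0 x)\<bar> * (?th 0 * cutf (?R n) x)"
        using CB(1)[where x=x and n=n] by (simp add: abs_mult)
      also have "\<dots> \<le> \<bar>w0 x\<bar> * (?th 0 * 1)" using CB(1,2)[where x=x and n=n] by (intro mult_mono bl mult_left_mono) auto
      finally show "norm (?b n (w0 x) * (?th 0 * cutf (?R n) x)) \<le> ?th 0 * \<bar>w0 x\<bar>" by (simp add: mult_ac)
    qed
  qed (use w01 in auto)
  have "0 \<le> (LBINT t. indicator {0<..<T} t * (- 2 * ?m t * W t)) + (LBINT x. \<bar>w0 x\<bar> * (?th 0 * 1))"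
    by (rule LIMSEQ_le_const[OF tendsto_add[OF lim1 lim2]]) (use step in auto)
  moreover have "(LBINT t. indicator {0<..<T} t * (- 2 * ?m t * W t)) = - (LBINT t. indicator {0<..<T} t * (2 * ?m t * W t))"
    by (simp flip: integral_minus)
  moreover have "(LBINT x. \<bar>w0 x\<bar> * (?th 0 * 1)) = T2\<^sup>2 * (LBINT x. \<bar>w0 x\<bar>)" using T2 by (simp add: max_def mult.commute)
  ultimately show ?thesis by linarith
qed

end

section \<open>The inviscid limit\<close>

text \<open>Each approximation fits the setting with its own constant \<open>M\<close>. The bound on
  the mass at almost every time is kept alongside, since \<open>L1_decay\<close> relies on
  it.\<close>

lemma NS_weak_solution:
  assumes ns: "NS_solution \<nu> T w0 w" and nu: "\<nu> > 0" and T: "T > 0"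
    and w01: "L1 w0" and w02: "L1 (\<lambda>x. (w0 x)\<^sup>2)"
  obtains M where "weak_solution \<nu> T M w w0" "AE t in lborel. t \<in> {0<..<T} \<longrightarrow> (LBINT x. \<bar>w t x\<bar>) \<le> M"
proof -
  have wm: "(\<lambda>z. w (fst z) (snd z)) \<in> borel_measurable (borel :: (real \<times> (real^2)) measure)" using ns by (simp add: NS_solution_def)
  have jm[measurable (raw)]: "(\<lambda>z. w (f z) (g z)) \<in> borel_measurable N" if "f \<in> borel_measurable N" "g \<in> borel_measurable N" for f g N
    by (rule joint_measurable_comp[OF wm that])
  obtain M where M: "AE t in lborel. t \<in> {0<..<T} \<longrightarrow> L1 (w t) \<and> L1 (\<lambda>x. (w t x)\<^sup>2)
          \<and> (LBINT x. \<bar>w t x\<bar>) + (LBINT x. (w t x)\<^sup>2) \<le> M"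
    using ns unfolding NS_solution_def by blast
  have nn: "0 \<le> (LBINT x. \<bar>w t x\<bar>)" "0 \<le> (LBINT x. (w t x)\<^sup>2)" for t by simp_all
  have A1: "AE t in lborel. t \<in> {0<..<T} \<longrightarrow> (LBINT x. \<bar>w t x\<bar>) \<le> M"
    using M by eventually_elim (use nn in \<open>smt (verit)\<close>)
  have A2: "AE t in lborel. t \<in> {0<..<T} \<longrightarrow> L1 (\<lambda>x. (w t x)\<^sup>2) \<and> (LBINT x. (w t x)\<^sup>2) \<le> M"
    using M by eventually_elim (use nn in \<open>smt (verit)\<close>)
  have "integrable (lborel \<Otimes>\<^sub>M lborel) (\<lambda>z. indicator {0<..<T} (fst z) * w (fst z) (snd z))"
  proof (rule lborel_pair.Fubini_integrable)
    show "L1 (\<lambda>t. LBINT x. norm (indicator {0<..<T} (fst (t, x)) * w (fst (t, x)) (snd (t, x))))"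
    proof (rule Bochner_Integration.integrable_bound[of _ "\<lambda>t. indicator {0<..<T} t * M"])
      have "L1 (indicator {0<..<T} :: real \<Rightarrow> real)" using T by (intro integrable_real_indicator) auto
      then show "L1 (\<lambda>t. indicator {0<..<T} t * M)" by (rule integrable_mult_left)
      show "(\<lambda>t. LBINT x. norm (indicator {0<..<T} (fst (t, x)) * w (fst (t, x)) (snd (t, x)))) \<in> borel_measurable lborel"
        by (intro lborel.borel_measurable_lebesgue_integral) measurable
      show "AE t in lborel. norm (LBINT x. norm (indicator {0<..<T} (fst (t, x)) * w (fst (t, x)) (snd (t, x)))) \<le> norm (indicator {0<..<T} t * M)"
        using A1 by eventually_elim (auto simp: indicator_def)
    qed
    show "AE t in lborel. L1 (\<lambda>x. indicator {0<..<T} (fst (t, x)) * w (fst (t, x)) (snd (t, x)))"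
      using M by eventually_elim (auto simp: indicator_def)
  qed measurable
  then have "weak_solution \<nu> T M w w0"
    using ns nu T wm A2 w01 w02 by unfold_locales (auto simp: NS_solution_def)
  then show ?thesis using A1 that by blast
qed

text \<open>On (0, T1) the weight 2 (T2 - t) of \<open>L1_decay\<close> is at least 2 (T2 - T1);
  this explains the denominator and the role of a time T2 beyond T1. The constant \<open>M\<close>
  of the individual solution does not appear in the result.\<close>

lemma NS_L1_uniform:
  assumes ns: "NS_solution \<nu> T w0 w" and nu: "\<nu> > 0" and Ts: "0 < T1" "T1 < T2" "T2 < T"
    and w01: "L1 w0" and w02: "L1 (\<lambda>x. (w0 x)\<^sup>2)"
  shows "L1 (\<lambda>z. indicator {0<..<T} (fst z) * w (fst z) (snd z))"
    "L1 (\<lambda>z. indicator {0<..<T1} (fst z) * w (fst z) (snd z))"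
    "(LBINT z. \<bar>indicator {0<..<T1} (fst z) * w (fst z) (snd z)\<bar>) \<le> T2\<^sup>2 * (LBINT x. \<bar>w0 x\<bar>) / (2 * (T2 - T1))"
proof -
  obtain M where "weak_solution \<nu> T M w w0" and A: "AE t in lborel. t \<in> {0<..<T} \<longrightarrow> (LBINT x. \<bar>w t x\<bar>) \<le> M"
    using NS_weak_solution[OF ns nu _ w01 w02] Ts by auto
  then interpret weak_solution \<nu> T M w w0 by simp
  show i: "L1 (\<lambda>z. indicator {0<..<T} (fst z) * w (fst z) (snd z))" using w1 by (simp add: lborel_prod)
  have "integrable (lborel \<Otimes>\<^sub>M lborel) (\<lambda>z. indicator {0<..<T1} (fst z) * w (fst z) (snd z))"
    by (rule Bochner_Integration.integrable_bound[OF w1]) (use Ts in \<open>auto simp: indicator_def\<close>)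
  then have i1: "integrable (lborel \<Otimes>\<^sub>M lborel) (\<lambda>z. indicator {0<..<T1} (fst z) * w (fst z) (snd z))" .
  then show "L1 (\<lambda>z. indicator {0<..<T1} (fst z) * w (fst z) (snd z))" by (simp add: lborel_prod)
  have D: "(LBINT t. indicator {0<..<T} t * (2 * max 0 (T2 - t) * W t)) \<le> T2\<^sup>2 * (LBINT x. \<bar>w0 x\<bar>)"
    by (rule L1_decay) (use Ts A in \<open>auto simp: W_def\<close>)
  have "(LBINT z. \<bar>indicator {0<..<T1} (fst z) * w (fst z) (snd z)\<bar>) = (\<integral>z. \<bar>indicator {0<..<T1} (fst z) * w (fst z) (snd z)\<bar> \<partial>(lborel \<Otimes>\<^sub>M lborel))"
    by (simp add: lborel_prod)
  also have "\<dots> = (LBINT t. (LBINT x. \<bar>indicator {0<..<T1} t * w t x\<bar>))"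
    using lborel_pair.integral_fst'[OF integrable_abs[OF i1]] by simp
  also have "\<dots> = (LBINT t. indicator {0<..<T1} t * W t)" by (simp add: abs_mult W_def)
  finally have e: "(LBINT z. \<bar>indicator {0<..<T1} (fst z) * w (fst z) (snd z)\<bar>) = (LBINT t. indicator {0<..<T1} t * W t)" .
  have "2 * (T2 - T1) * (LBINT t. indicator {0<..<T1} t * W t) = (LBINT t. 2 * (T2 - T1) * (indicator {0<..<T1} t * W t))" by simp
  also have "\<dots> \<le> (LBINT t. indicator {0<..<T} t * (2 * max 0 (T2 - t) * W t))"
  proof (rule integral_mono)
    show "L1 (\<lambda>t. 2 * (T2 - T1) * (indicator {0<..<T1} t * W t))"
      by (intro integrable_mult_right Bochner_Integration.integrable_bound[OF W_integrable]) (use Ts W_nonneg in \<open>auto simp: indicator_def\<close>)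
    show "L1 (\<lambda>t. indicator {0<..<T} t * (2 * max 0 (T2 - t) * W t))"
    proof (rule Bochner_Integration.integrable_bound[OF integrable_mult_right[OF W_integrable, of "2 * T2"]])
      show "AE t in lborel. norm (indicator {0<..<T} t * (2 * max 0 (T2 - t) * W t)) \<le> norm (2 * T2 * (indicator {0<..<T} t * W t))"
      proof (rule AE_I2)
        fix t
        show "norm (indicator {0<..<T} t * (2 * max 0 (T2 - t) * W t)) \<le> norm (2 * T2 * (indicator {0<..<T} t * W t))"
        proof (cases "t \<in> {0<..<T}")
          case True
          then have "2 * max 0 (T2 - t) * W t \<le> 2 * T2 * W t" using Ts W_nonneg[of t] by (intro mult_right_mono) auto
          then show ?thesis using True Ts W_nonneg[of t] by (simp add: abs_mult)
        qed simp
      qed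
    qed measurable
    fix t show "2 * (T2 - T1) * (indicator {0<..<T1} t * W t) \<le> indicator {0<..<T} t * (2 * max 0 (T2 - t) * W t)"
      using Ts W_nonneg[of t] by (auto simp: indicator_def intro!: mult_right_mono)
  qed
  also note D
  finally show "(LBINT z. \<bar>indicator {0<..<T1} (fst z) * w (fst z) (snd z)\<bar>) \<le> T2\<^sup>2 * (LBINT x. \<bar>w0 x\<bar>) / (2 * (T2 - T1))"
    unfolding e using Ts by (simp add: field_simps)
qed

section \<open>Mollification in space-time and passage to the limit\<close>

definition meta :: "real \<Rightarrow> real \<times> (real^2) \<Rightarrow> real" where "meta e z = rho e (fst z) * eta e (snd z)"

lemma meta_props:
  assumes e: "e > 0"
  shows "meta e z \<ge> 0" "L1 (meta e)" "(LBINT z. meta e z) = 1" "\<exists>B. \<forall>z. \<bar>meta e z\<bar> \<le> B"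
proof -
  show "meta e z \<ge> 0" using rho_nonneg[OF e] eta_nonneg[OF e] by (simp add: meta_def)
  have "L1 (\<lambda>z. rho e (fst z) * eta e (snd z)) \<and> (LBINT z. rho e (fst z) * eta e (snd z)) = 1"
    using integral_prod_split[OF rho_int(1)[OF e] eta_int(1)[OF e]] by (simp add: lborel_prod rho_one[OF e] eta_one[OF e])
  then show "L1 (meta e)" "(LBINT z. meta e z) = 1" by (simp_all add: meta_def[abs_def])
  obtain A where A: "\<And>x. \<bar>rho e x\<bar> \<le> A" using rho_bound[OF e] by metis
  obtain C where C: "\<And>x. \<bar>eta e x\<bar> \<le> C" using eta_bound[OF e] by metis
  have "\<bar>meta e z\<bar> \<le> A * C" for z unfolding meta_def abs_mult by (intro mult_mono A C) (use order_trans[OF abs_ge_zero A] in auto)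
  then show "\<exists>B. \<forall>z. \<bar>meta e z\<bar> \<le> B" by blast
qed

lemma meta_measurable[measurable]: "meta e \<in> borel_measurable borel"
  unfolding meta_def borel_prod[symmetric] by measurable

lemma conv_L1_le:
  fixes G m :: "'a::euclidean_space \<Rightarrow> real"
  assumes G: "L1 G" and m: "L1 m" "\<And>z. m z \<ge> 0" "(LBINT z. m z) = 1"
  shows "(LBINT x. \<bar>conv G m x\<bar>) \<le> (LBINT x. \<bar>G x\<bar>)"
proof -
  have [measurable]: "G \<in> borel_measurable borel" "m \<in> borel_measurable borel" using G m by auto
  have J: "integrable (lborel \<Otimes>\<^sub>M lborel) (\<lambda>(x, y). \<bar>G y\<bar> * m (x - y))"
    by (rule conv_joint_integrable) (use G m in auto)
  have "(LBINT x. \<bar>conv G m x\<bar>) \<le> (LBINT x. conv (\<lambda>y. \<bar>G y\<bar>) m x)"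
  proof (rule integral_mono)
    show "L1 (conv (\<lambda>y. \<bar>G y\<bar>) m)" by (rule conv_integrable) (use G m in auto)
    show "\<bar>conv G m x\<bar> \<le> conv (\<lambda>y. \<bar>G y\<bar>) m x" for x
      unfolding conv_def using integral_abs_bound[of lborel "\<lambda>y. G y * m (x - y)"] m(2) by (simp add: abs_mult)
  qed (use conv_integrable[OF G m(1)] in auto)
  also have "\<dots> = (LBINT y. (LBINT x. \<bar>G y\<bar> * m (x - y)))"
    unfolding conv_def by (rule lborel_pair.Fubini_integral[OF J, symmetric])
  also have "\<dots> = (LBINT y. \<bar>G y\<bar>)" using integral_shift(2)[of m] m(3) by simp
  finally show ?thesis .
qed

text \<open>The limit is not yet known to be integrable over the plane, so it is cut off by c before
  being convolved; c must equal 1 wherever the mollifier centred at x0 is nonzero. For the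
  approximations the constant c = 1 is taken.\<close>

lemma test_pair_conv:
  assumes F: "L1 (\<lambda>z. indicator {0<..<T} (fst z) * c (snd z) * w (fst z) (snd z))" and e: "e > 0"
    and c: "\<And>x. norm (x0 - x) \<le> 2 * e \<Longrightarrow> c x = (1::real)"
  shows "(LINT t:{0<..<T}|lborel. LINT x|lborel. w t x * tphi e e t0 x0 (t, x))
    = conv (\<lambda>z. indicator {0<..<T} (fst z) * c (snd z) * w (fst z) (snd z)) (meta e) (t0, x0)"
proof -
  let ?F = "\<lambda>z. indicator {0<..<T} (fst z) * c (snd z) * w (fst z) (snd z)"
  obtain B where B: "\<And>z. \<bar>meta e z\<bar> \<le> B" using meta_props(4)[OF e] by auto
  have i: "integrable (lborel \<Otimes>\<^sub>M lborel) (\<lambda>z. ?F z * meta e ((t0, x0) - z))"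
    using conv_integrable_bounded[OF F meta_measurable B] by (simp add: lborel_prod)
  have "conv ?F (meta e) (t0, x0) = (\<integral>z. ?F z * meta e ((t0, x0) - z) \<partial>(lborel \<Otimes>\<^sub>M lborel))"
    unfolding conv_def by (simp add: lborel_prod)
  also have "\<dots> = (LBINT t. (LBINT x. ?F (t, x) * meta e ((t0, x0) - (t, x))))"
    using lborel_pair.integral_fst'[OF i] by simp
  also have "\<dots> = (LBINT t. indicator {0<..<T} t *\<^sub>R (LBINT x. w t x * tphi e e t0 x0 (t, x)))"
  proof (intro Bochner_Integration.integral_cong refl)
    fix t
    have "?F (t, x) * meta e ((t0, x0) - (t, x)) = indicator {0<..<T} t * (w t x * tphi e e t0 x0 (t, x))" for x
    proof (cases "norm (x0 - x) \<le> 2 * e")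
      case False
      then have "eta e (x0 - x) = 0" using eta_supp(1)[OF e] by simp
      then show ?thesis by (simp add: meta_def tphi_def)
    qed (simp add: meta_def tphi_def c)
    then have "(LBINT x. ?F (t, x) * meta e ((t0, x0) - (t, x))) = (LBINT x. indicator {0<..<T} t * (w t x * tphi e e t0 x0 (t, x)))"
      by (rule Bochner_Integration.integral_cong[OF refl])
    then show "(LBINT x. ?F (t, x) * meta e ((t0, x0) - (t, x))) = indicator {0<..<T} t *\<^sub>R (LBINT x. w t x * tphi e e t0 x0 (t, x))"
      by simp
  qed
  finally show ?thesis unfolding set_lebesgue_integral_def by simp
qed

text \<open>The mollification of \<open>w\<close> is the pointwise limit of the mollified approximations, so Fatou's lemma bounds it in $L^1$;
  letting the mollification parameter tend to zero and using Fatou again bounds \<open>w\<close>.\<close>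
lemma limit_L1:
  fixes w :: "real \<Rightarrow> real^2 \<Rightarrow> real" and wk :: "nat \<Rightarrow> real \<Rightarrow> real^2 \<Rightarrow> real"
  assumes T: "0 < T1" "T1 < T"
    and wm: "(\<lambda>z. w (fst z) (snd z)) \<in> borel_measurable (borel :: (real \<times> (real^2)) measure)"
    and w2: "AE t in lborel. t \<in> {0<..<T} \<longrightarrow> L1 (\<lambda>x. (w t x)\<^sup>2) \<and> (LBINT x. (w t x)\<^sup>2) \<le> M"
    and wk: "\<And>k. L1 (\<lambda>z. indicator {0<..<T} (fst z) * wk k (fst z) (snd z))"
     "\<And>k. L1 (\<lambda>z. indicator {0<..<T1} (fst z) * wk k (fst z) (snd z))"
     "\<And>k. (LBINT z. \<bar>indicator {0<..<T1} (fst z) * wk k (fst z) (snd z)\<bar>) \<le> C"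
    and lim: "\<And>\<phi>. test_fun ({0<..<T} \<times> UNIV) \<phi> \<Longrightarrow>
           (\<lambda>k. LINT t:{0<..<T}|lborel. LINT x|lborel. wk k t x * \<phi> (t, x))
             \<longlonglongrightarrow> (LINT t:{0<..<T}|lborel. LINT x|lborel. w t x * \<phi> (t, x))"
  shows "integrable (lborel \<Otimes>\<^sub>M lborel) (\<lambda>z. indicator {0<..<T1} (fst z) * w (fst z) (snd z))"
proof -
  have jm[measurable (raw)]: "(\<lambda>z. w (f z) (g z)) \<in> borel_measurable N" if "f \<in> borel_measurable N" "g \<in> borel_measurable N" for f g N
    by (rule joint_measurable_comp[OF wm that])
  have C0: "C \<ge> 0" by (rule order_trans[OF _ wk(3)[of 0]]) simp
  \<comment> \<open>On a ball, |w| \<le> w^2 + 1 turns the L^2 bound into integrability.\<close>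
  define Fl where "Fl R z = indicator {0<..<T} (fst z) * indicator (cball 0 R) (snd z) * w (fst z) (snd z)" for R :: real and z :: "real \<times> (real^2)"
  have [measurable]: "cball (0::real^2) R \<in> sets borel" for R by simp
  have Fl_m[measurable]: "Fl R \<in> borel_measurable (borel :: (real \<times> (real^2)) measure)" for R
    unfolding Fl_def borel_prod[symmetric] by measurable
  have FlI: "L1 (Fl R)" for R
  proof -
    define V where "V = measure lborel (cball (0::real^2) R)"
    have hI: "L1 (indicator (cball 0 R) :: real^2 \<Rightarrow> real)"
      using emeasure_lborel_cball_finite[of "0::real^2" R] by (intro integrable_real_indicator) auto
    have sl: "L1 (\<lambda>x. indicator (cball 0 R) x * w t x)" "(LBINT x. \<bar>indicator (cball 0 R) x * w t x\<bar>) \<le> M + V"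
      if i: "L1 (\<lambda>x. (w t x)\<^sup>2)" and M: "(LBINT x. (w t x)\<^sup>2) \<le> M" for t
    proof -
      have pt: "\<bar>indicator (cball 0 R) x * w t x\<bar> \<le> (w t x)\<^sup>2 + indicator (cball 0 R) x" for x
        using amgm[of 1 "\<bar>w t x\<bar>" 1] by (auto simp: indicator_def)
      have bi: "L1 (\<lambda>x. (w t x)\<^sup>2 + indicator (cball 0 R) x)" using i hI by simp
      show ii: "L1 (\<lambda>x. indicator (cball 0 R) x * w t x)"
        by (rule Bochner_Integration.integrable_bound[OF bi]) (use pt in \<open>auto intro!: AE_I2 intro: order_trans[OF _ abs_ge_self]\<close>)
      have "(LBINT x. \<bar>indicator (cball 0 R) x * w t x\<bar>) \<le> (LBINT x. (w t x)\<^sup>2 + indicator (cball 0 R) x)"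
        by (rule integral_mono[OF integrable_abs[OF ii] bi pt])
      also have "\<dots> = (LBINT x. (w t x)\<^sup>2) + V" using i hI by (simp add: V_def)
      finally show "(LBINT x. \<bar>indicator (cball 0 R) x * w t x\<bar>) \<le> M + V" using M by simp
    qed
    have "integrable (lborel \<Otimes>\<^sub>M lborel) (Fl R)"
    proof (rule lborel_pair.Fubini_integrable)
      show "Fl R \<in> borel_measurable (lborel \<Otimes>\<^sub>M lborel)" by (simp add: lborel_prod)
      show "L1 (\<lambda>t. LBINT x. norm (Fl R (t, x)))"
      proof (rule Bochner_Integration.integrable_bound[of _ "\<lambda>t. indicator {0<..<T} t * (M + V)"])
        have "L1 (indicator {0<..<T} :: real \<Rightarrow> real)" using T by (intro integrable_real_indicator) auto
        then show "L1 (\<lambda>t. indicator {0<..<T} t * (M + V))" by (rule integrable_mult_left)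
        show "(\<lambda>t. LBINT x. norm (Fl R (t, x))) \<in> borel_measurable lborel"
          unfolding Fl_def by (intro lborel.borel_measurable_lebesgue_integral) measurable
        show "AE t in lborel. norm (LBINT x. norm (Fl R (t, x))) \<le> norm (indicator {0<..<T} t * (M + V))"
          using w2
        proof eventually_elim
          case (elim t)
          show ?case
          proof (cases "t \<in> {0<..<T}")
            case True
            then have "(LBINT x. \<bar>indicator (cball 0 R) x * w t x\<bar>) \<le> M + V" using sl(2)[of t] elim by simp
            then show ?thesis using True by (simp add: Fl_def)
          qed (simp add: Fl_def)
        qed
      qed
      show "AE t in lborel. L1 (\<lambda>x. Fl R (t, x))"
        using w2 by eventually_elim (use sl(1) in \<open>auto simp: Fl_def indicator_def[of "{0<..<T}"]\<close>)
    qed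
    then show ?thesis by (simp add: lborel_prod)
  qed
  \<comment> \<open>An exhaustion of (0, T1) times the plane that leaves a margin for the mollifier:
    1 / (j + 1) in time and, as its spatial radius 2 e is below 2, a ball of radius j + 2 in
    \<open>Fl\<close>.\<close>
  define S where "S j = {1 / real (Suc j) <..< T1 - 1 / real (Suc j)} \<times> cball (0::real^2) (real j)" for j
  have S_m[measurable]: "S j \<in> sets (borel :: (real \<times> (real^2)) measure)" for j unfolding S_def borel_prod[symmetric] by measurable
  have Sconv: "(LBNN z. ennreal (indicator (S j) z * \<bar>conv (Fl (real j + 2)) (meta e) z\<bar>)) \<le> ennreal C"
    if e: "e > 0" "e < 1 / real (Suc j)" for e j
  proof -
    have e1: "e < 1" using e(2) by (rule less_le_trans) simp
    obtain B where B: "\<And>z. \<bar>meta e z\<bar> \<le> B" using meta_props(4)[OF e(1)] by auto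
    have step: "(LBNN z. ennreal (indicator (S j) z * \<bar>conv (\<lambda>z. indicator {0<..<T} (fst z) * 1 * wk k (fst z) (snd z)) (meta e) z\<bar>)) \<le> ennreal C" for k
    proof -
      let ?F = "\<lambda>z. indicator {0<..<T} (fst z) * 1 * wk k (fst z) (snd z)" and ?F1 = "\<lambda>z. indicator {0<..<T1} (fst z) * wk k (fst z) (snd z)"
      \<comment> \<open>Seen from \<open>S j\<close>, the mollifier does not reach times after T1,
        so only the mass on (0, T1), bounded by \<open>C\<close>, is involved.\<close>
      have eq: "conv ?F (meta e) z = conv ?F1 (meta e) z" if z: "z \<in> S j" for z
        unfolding conv_def
      proof (intro Bochner_Integration.integral_cong refl)
        fix y :: "real \<times> (real^2)"
        show "?F y * meta e (z - y) = ?F1 y * meta e (z - y)"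
        proof (cases "\<bar>fst z - fst y\<bar> \<ge> e")
          case True
          then have "rho e (fst z - fst y) = 0" by (rule rho_supp(1)[OF e(1)])
          then show ?thesis by (simp add: meta_def)
        next
          case False
          then have "fst y < T1" using z e by (auto simp: S_def)
          then show ?thesis using T by (auto simp: indicator_def)
        qed
      qed
      have "(LBNN z. ennreal (indicator (S j) z * \<bar>conv ?F (meta e) z\<bar>)) \<le> (LBNN z. ennreal \<bar>conv ?F1 (meta e) z\<bar>)"
        using eq by (intro nn_integral_mono ennreal_leI) (auto simp: indicator_def)
      also have "\<dots> = ennreal (LBINT z. \<bar>conv ?F1 (meta e) z\<bar>)"
        by (rule nn_integral_eq_integral) (use conv_integrable[OF wk(2) meta_props(2)[OF e(1)]] in auto)
      also have "\<dots> \<le> ennreal C"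
        by (intro ennreal_leI order_trans[OF conv_L1_le[OF wk(2)] wk(3)] meta_props e)
      finally show ?thesis .
    qed
    have lm: "(\<lambda>k. conv (\<lambda>z. indicator {0<..<T} (fst z) * 1 * wk k (fst z) (snd z)) (meta e) z) \<longlonglongrightarrow> conv (Fl (real j + 2)) (meta e) z" if z: "z \<in> S j" for z
    proof -
      obtain t0 x0 where zz: "z = (t0, x0)" by (cases z)
      have t0: "1 / real (Suc j) < t0" "t0 < T1 - 1 / real (Suc j)" and x0: "norm x0 \<le> real j" using z by (auto simp: zz S_def)
      have "test_fun ({0<..<T} \<times> UNIV) (tphi e e t0 x0)"
        by (rule tphi_test[OF e(1) e(1)]) (use t0 e T in \<open>auto simp: dist_real_def abs_le_iff\<close>)
      note L = lim[OF this]
      have 1: "(LINT t:{0<..<T}|lborel. LINT x|lborel. wk k t x * tphi e e t0 x0 (t, x)) = conv (\<lambda>z. indicator {0<..<T} (fst z) * 1 * wk k (fst z) (snd z)) (meta e) (t0, x0)" for k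
        by (rule test_pair_conv[where c="\<lambda>_. 1"]) (use wk(1) e in auto)
      have 2: "(LINT t:{0<..<T}|lborel. LINT x|lborel. w t x * tphi e e t0 x0 (t, x)) = conv (Fl (real j + 2)) (meta e) (t0, x0)"
        unfolding Fl_def[abs_def]
      proof (rule test_pair_conv[where c="indicator (cball 0 (real j + 2))"])
        show "L1 (\<lambda>z. indicator {0<..<T} (fst z) * indicator (cball 0 (real j + 2)) (snd z) * w (fst z) (snd z))"
          using FlI[of "real j + 2"] unfolding Fl_def[abs_def] .
        fix x assume "norm (x0 - x) \<le> 2 * e"
        then have "norm x \<le> real j + 2" using x0 e1 norm_triangle_ineq2[of x x0] by (simp add: norm_minus_commute)
        then show "indicator (cball 0 (real j + 2)) x = (1::real)" by simp
      qed (rule e)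
      show ?thesis using L unfolding 1 2 zz .
    qed
    have [measurable]: "(\<lambda>z. indicator {0<..<T} (fst z) * 1 * wk k (fst z) (snd z)) \<in> borel_measurable borel" for k
      using wk(1)[of k] by auto
    have "(LBNN z. ennreal (indicator (S j) z * \<bar>conv (Fl (real j + 2)) (meta e) z\<bar>))
      = (LBNN z. liminf (\<lambda>k. ennreal (indicator (S j) z * \<bar>conv (\<lambda>z. indicator {0<..<T} (fst z) * 1 * wk k (fst z) (snd z)) (meta e) z\<bar>)))"
    proof (intro nn_integral_cong)
      fix z
      have "(\<lambda>k. ennreal (indicator (S j) z * \<bar>conv (\<lambda>z. indicator {0<..<T} (fst z) * 1 * wk k (fst z) (snd z)) (meta e) z\<bar>))
        \<longlonglongrightarrow> ennreal (indicator (S j) z * \<bar>conv (Fl (real j + 2)) (meta e) z\<bar>)"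
        using lm[of z] by (cases "z \<in> S j") (auto intro!: tendsto_ennrealI tendsto_rabs)
      from lim_imp_Liminf[OF _ this] show "ennreal (indicator (S j) z * \<bar>conv (Fl (real j + 2)) (meta e) z\<bar>) =
        liminf (\<lambda>k. ennreal (indicator (S j) z * \<bar>conv (\<lambda>z. indicator {0<..<T} (fst z) * 1 * wk k (fst z) (snd z)) (meta e) z\<bar>))" by simp
    qed
    also have "\<dots> \<le> liminf (\<lambda>k. LBNN z. ennreal (indicator (S j) z * \<bar>conv (\<lambda>z. indicator {0<..<T} (fst z) * 1 * wk k (fst z) (snd z)) (meta e) z\<bar>))"
      by (rule nn_integral_liminf) measurable
    also have "\<dots> \<le> liminf (\<lambda>k. ennreal C)" by (intro Liminf_mono always_eventually allI step)
    also have "\<dots> = ennreal C" by (simp add: Liminf_const)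
    finally show ?thesis .
  qed
  have SF: "(LBNN z. ennreal (indicator (S j) z * \<bar>Fl (real j + 2) z\<bar>)) \<le> ennreal C" for j
  proof -
    let ?f = "Fl (real j + 2)"
    define E where "E n = 1 / (real n + real j + 2)" for n :: nat
    have E: "E n > 0" "E n < 1 / real (Suc j)" for n unfolding E_def by (simp add: add_nonneg_pos, rule frac_less2, auto)
    have El: "E \<longlonglongrightarrow> 0"
    proof (rule tendsto_sandwich[of "\<lambda>_. 0" _ _ "\<lambda>n. 1 / (real n + 1)"])
      show "(\<lambda>n. 1 / (real n + 1)) \<longlonglongrightarrow> 0" using LIMSEQ_inverse_real_of_nat by (simp add: inverse_eq_divide add.commute)
      show "\<forall>\<^sub>F n in sequentially. E n \<le> 1 / (real n + 1)"
        unfolding E_def by (intro always_eventually allI divide_left_mono mult_pos_pos add_nonneg_pos) auto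
    qed (use E(1) in \<open>auto simp: less_imp_le\<close>)
    have mo: "is_moll (\<lambda>n. meta (E n))" using is_moll_prod[OF E(1) El] by (simp add: meta_def[abs_def])
    have bd: "(LBNN z. ennreal (indicator (S j) z * \<bar>?f z\<bar>)) \<le> ennreal (LBINT z. \<bar>conv ?f (meta (E n)) z - ?f z\<bar>) + ennreal C" for n
    proof -
      have "(LBNN z. ennreal (indicator (S j) z * \<bar>?f z\<bar>)) \<le> (LBNN z. ennreal \<bar>conv ?f (meta (E n)) z - ?f z\<bar> + ennreal (indicator (S j) z * \<bar>conv ?f (meta (E n)) z\<bar>))"
        by (intro nn_integral_mono) (auto simp: indicator_def ennreal_leI simp flip: ennreal_plus)
      also have "\<dots> = (LBNN z. ennreal \<bar>conv ?f (meta (E n)) z - ?f z\<bar>) + (LBNN z. ennreal (indicator (S j) z * \<bar>conv ?f (meta (E n)) z\<bar>))"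
        by (rule nn_integral_add) measurable
      also have "(LBNN z. ennreal \<bar>conv ?f (meta (E n)) z - ?f z\<bar>) = ennreal (LBINT z. \<bar>conv ?f (meta (E n)) z - ?f z\<bar>)"
        by (rule nn_integral_eq_integral) (use conv_integrable[OF FlI meta_props(2)[OF E(1)]] FlI in auto)
      also have "ennreal (LBINT z. \<bar>conv ?f (meta (E n)) z - ?f z\<bar>) + (LBNN z. ennreal (indicator (S j) z * \<bar>conv ?f (meta (E n)) z\<bar>))
        \<le> ennreal (LBINT z. \<bar>conv ?f (meta (E n)) z - ?f z\<bar>) + ennreal C"
        by (intro add_left_mono Sconv E)
      finally show ?thesis .
    qed
    have "(\<lambda>n. ennreal (LBINT z. \<bar>conv ?f (meta (E n)) z - ?f z\<bar>) + ennreal C) \<longlonglongrightarrow> ennreal 0 + ennreal C"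
      by (intro tendsto_add tendsto_ennrealI conv_L1_approx FlI mo tendsto_const)
    then have "(LBNN z. ennreal (indicator (S j) z * \<bar>?f z\<bar>)) \<le> ennreal 0 + ennreal C"
      by (rule LIMSEQ_le_const) (use bd in auto)
    then show ?thesis by simp
  qed
  let ?g = "\<lambda>z::real \<times> (real^2). \<bar>indicator {0<..<T1} (fst z) * w (fst z) (snd z)\<bar>"
  \<comment> \<open>A last use of Fatou's lemma sends j to infinity and removes both the cutoff and
    the margin.\<close>
  have "(LBNN z. ennreal (?g z)) = (LBNN z. liminf (\<lambda>j. ennreal (indicator (S j) z * \<bar>Fl (real j + 2) z\<bar>)))"
  proof (intro nn_integral_cong)
    fix z :: "real \<times> (real^2)"
    have "(\<lambda>j. ennreal (indicator (S j) z * \<bar>Fl (real j + 2) z\<bar>)) \<longlonglongrightarrow> ennreal (?g z)"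
    proof (cases "fst z \<in> {0<..<T1}")
      case False
      have "z \<notin> S j" for j
      proof
        assume "z \<in> S j"
        moreover have "1 / real (Suc j) > 0" by simp
        ultimately show False using False unfolding S_def mem_Times_iff greaterThanLessThan_iff by (metis diff_gt_0_iff_gt less_diff_eq less_trans add_strict_increasing less_add_same_cancel1)
      qed
      then show ?thesis using False by simp
    next
      case True
      obtain n1 :: nat where n1: "n1 > 0" "1 / n1 < min (fst z) (T1 - fst z)" using True ex_inverse_of_nat_less[of "min (fst z) (T1 - fst z)"] by (auto simp: inverse_eq_divide)
      obtain n2 :: nat where n2: "norm (snd z) \<le> n2" using real_arch_simple by blast
      have "eventually (\<lambda>j. ennreal (indicator (S j) z * \<bar>Fl (real j + 2) z\<bar>) = ennreal (?g z)) sequentially"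
      proof (rule eventually_sequentiallyI[of "max n1 n2"])
        fix j assume j: "max n1 n2 \<le> j"
        have "1 / real (Suc j) \<le> 1 / real n1" using j n1 by (intro divide_left_mono) auto
        then have "1 / real (Suc j) < min (fst z) (T1 - fst z)" using n1(2) by linarith
        moreover have nz: "norm (snd z) \<le> real j" using n2 j by linarith
        ultimately have "z \<in> S j" by (auto simp: S_def mem_Times_iff)
        then show "ennreal (indicator (S j) z * \<bar>Fl (real j + 2) z\<bar>) = ennreal (?g z)" using True T nz by (simp add: Fl_def)
      qed
      then show ?thesis by (rule tendsto_eventually)
    qed
    from lim_imp_Liminf[OF _ this] show "ennreal (?g z) = liminf (\<lambda>j. ennreal (indicator (S j) z * \<bar>Fl (real j + 2) z\<bar>))" by simp
  qed
  also have "\<dots> \<le> liminf (\<lambda>j. LBNN z. ennreal (indicator (S j) z * \<bar>Fl (real j + 2) z\<bar>))"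
    by (rule nn_integral_liminf) measurable
  also have "\<dots> \<le> liminf (\<lambda>j::nat. ennreal C)" by (intro Liminf_mono always_eventually allI SF)
  also have "\<dots> = ennreal C" by (simp add: Liminf_const)
  finally have fin: "(LBNN z. ennreal (?g z)) \<le> ennreal C" .
  show ?thesis
  proof (rule integrableI_bounded)
    show "(\<lambda>z. indicator {0<..<T1} (fst z) * w (fst z) (snd z)) \<in> borel_measurable (lborel \<Otimes>\<^sub>M lborel)" by measurable
    show "(\<integral>\<^sup>+z. ennreal (norm (indicator {0<..<T1} (fst z) * w (fst z) (snd z))) \<partial>(lborel \<Otimes>\<^sub>M lborel)) < \<infinity>"
      using fin by (simp add: lborel_prod order_le_less_trans)
  qed
qed

section \<open>The logarithmic estimate\<close>

text \<open>Squaring s log^(1/4)(2 + s) leaves s^2 times the square root of the logarithm.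
  \<open>Lg\<close> is this root, and \<open>Af\<close> agrees with \<open>A_fun 2 (1/4)\<close> on
  nonnegative arguments.\<close>

definition Lg :: "real \<Rightarrow> real" where "Lg b = sqrt (ln (2 + b))"
definition Af :: "real \<Rightarrow> real" where "Af b = b\<^sup>2 * Lg b"

lemma Lg_measurable[measurable]: "Lg \<in> borel_measurable borel" unfolding Lg_def by measurable
lemma Af_measurable[measurable]: "Af \<in> borel_measurable borel" unfolding Af_def by measurable

lemma ln2_half: "b \<ge> 0 \<Longrightarrow> ln (2 + b) \<ge> (1/2::real)"
proof -
  assume "b \<ge> 0"
  then have "ln 2 \<le> ln (2 + b)" by simp
  then show ?thesis using ln2_ge_two_thirds by linarith
qed

lemma Lg_ge: "b \<ge> 0 \<Longrightarrow> Lg b \<ge> 1/2"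
  unfolding Lg_def by (rule real_le_rsqrt) (use ln2_half[of b] in \<open>simp add: power2_eq_square\<close>)

lemma Lg_mono: "0 \<le> a \<Longrightarrow> a \<le> b \<Longrightarrow> Lg a \<le> Lg b" unfolding Lg_def by simp

lemma Lg_sq: "b \<ge> 0 \<Longrightarrow> (Lg b)\<^sup>2 = ln (2 + b)" unfolding Lg_def using ln2_half[of b] by simp

lemma Af_nonneg: "b \<ge> 0 \<Longrightarrow> Af b \<ge> 0" unfolding Af_def using Lg_ge[of b] by simp

lemma sq_le_Af: "b \<ge> 0 \<Longrightarrow> b\<^sup>2 \<le> 2 * Af b"
  unfolding Af_def using mult_left_mono[OF Lg_ge[of b], of "b\<^sup>2"] by simp

lemma Af_mono: "0 \<le> a \<Longrightarrow> a \<le> b \<Longrightarrow> Af a \<le> Af b"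
  unfolding Af_def using Lg_ge[of a] Lg_mono[of a b] by (intro mult_mono power_mono) auto

lemma A_fun_eq: "s \<ge> 0 \<Longrightarrow> A_fun 2 (1/4) s = Af s"
proof -
  assume s: "s \<ge> 0"
  have l: "ln (2 + s) > 0" using ln2_half[OF s] by linarith
  have p: "(ln (2 + s) powr (1/4))\<^sup>2 = sqrt (ln (2 + s))"
    using l by (simp add: power2_eq_square powr_half_sqrt flip: powr_add)
  have "A_fun 2 (1/4) s = (s * ln (2 + s) powr (1/4))\<^sup>2"
    unfolding A_fun_def using s by (cases "s = 0") (auto simp: powr_numeral)
  then show ?thesis by (simp add: Af_def Lg_def power_mult_distrib p)
qed

lemma Af_scale_down: "s \<ge> 0 \<Longrightarrow> k \<ge> 1 \<Longrightarrow> Af (s / k) \<le> Af s / k\<^sup>2"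
proof -
  assume s: "s \<ge> 0" and k: "k \<ge> 1"
  have "s / k \<le> s / 1" using s k by (intro divide_left_mono) auto
  then have "Lg (s / k) \<le> Lg s" using s k by (intro Lg_mono) auto
  then have "(s / k)\<^sup>2 * Lg (s / k) \<le> (s / k)\<^sup>2 * Lg s" by (intro mult_left_mono) auto
  then show ?thesis by (simp add: Af_def power_divide)
qed

text \<open>Dilations change the logarithm additively: ln (2 + s) \<le> ln k + ln (2 + s / k). The
  term ln k \<le> k is absorbed because the remaining logarithm is at least 1/2. Such a bound is
  what leads from the Luxemburg norm back to the undilated integral.\<close>

lemma Af_scale_up: "s \<ge> 0 \<Longrightarrow> k \<ge> 1 \<Longrightarrow> Af s \<le> (k\<^sup>2 * (1 + 2 * k)) * Af (s / k)"
proof -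
  assume s: "s \<ge> 0" and k: "k \<ge> 1"
  have x: "s / k \<ge> 0" using s k by simp
  have "2 + s \<le> k * (2 + s / k)" using k s by (simp add: distrib_left)
  then have "ln (2 + s) \<le> ln (k * (2 + s / k))" using s by (subst ln_le_cancel_iff) auto
  also have "\<dots> = ln k + ln (2 + s / k)" using k x by (intro ln_mult_pos) (auto intro: add_pos_nonneg)
  also have "ln k \<le> k" using ln_le_minus_one[of k] k by simp
  also have "k + ln (2 + s / k) \<le> 2 * k * ln (2 + s / k) + ln (2 + s / k)"
    using mult_left_mono[OF ln2_half[OF x], of "2 * k"] k by simp
  finally have "ln (2 + s) \<le> (1 + 2 * k) * ln (2 + s / k)" by (simp add: algebra_simps)
  also have "\<dots> \<le> (1 + 2 * k)\<^sup>2 * ln (2 + s / k)"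
    using k ln2_half[OF x] by (intro mult_right_mono) (auto simp: power2_eq_square)
  finally have "sqrt (ln (2 + s)) \<le> sqrt ((1 + 2 * k)\<^sup>2 * ln (2 + s / k))" by simp
  also have "\<dots> = (1 + 2 * k) * Lg (s / k)" using k by (simp add: real_sqrt_mult Lg_def)
  finally have "Lg s \<le> (1 + 2 * k) * Lg (s / k)" by (simp add: Lg_def)
  then have "s\<^sup>2 * Lg s \<le> s\<^sup>2 * ((1 + 2 * k) * Lg (s / k))" by (intro mult_left_mono) auto
  also have "\<dots> = (k\<^sup>2 * (1 + 2 * k)) * Af (s / k)" using k by (simp add: Af_def power_divide)
  finally show ?thesis by (simp add: Af_def)
qed

definition CAf :: "real \<Rightarrow> real" where "CAf M = (max 1 (M + 1))\<^sup>2 * (1 + 2 * max 1 (M + 1))"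

lemma CAf_nonneg: "CAf M \<ge> 0" by (simp add: CAf_def)

text \<open>The norm is an infimum, so an admissible k below M + 1 is selected and the dilation by k
  is undone with \<open>Af_scale_up\<close>. The selection requires the set of admissible k to be
  nonempty, which finiteness of the undilated integral provides.\<close>

lemma lux_bound:
  assumes w: "w \<in> LlogL 2 (1/4)" and M: "lux_norm 2 (1/4) w \<le> M"
  shows "(LBNN x. ennreal (Af \<bar>w x\<bar>)) \<le> ennreal (CAf M)"
proof -
  have [measurable]: "w \<in> borel_measurable borel" using w by (simp add: LlogL_def)
  have fin: "(LBNN x. ennreal (Af \<bar>w x\<bar>)) < \<infinity>" using w by (simp add: LlogL_def A_fun_eq)
  define K where "K = {k. k > 0 \<and> (LBNN x. ennreal (Af (\<bar>w x\<bar> / k))) \<le> 1}"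
  have K: "lux_norm 2 (1/4) w = Inf K" unfolding lux_norm_def K_def
    by (intro arg_cong[where f=Inf] Collect_cong conj_cong refl) (auto simp: A_fun_eq)
  define a where "a = enn2real (LBNN x. ennreal (Af \<bar>w x\<bar>))"
  have a: "(LBNN x. ennreal (Af \<bar>w x\<bar>)) = ennreal a" "a \<ge> 0" using fin by (auto simp: a_def)
  \<comment> \<open>Dividing by k \<ge> 1 reduces the integral at least by the factor 1 / k^2, and k
    = max 1 a satisfies a \<le> k^2.\<close>
  have "max 1 a \<in> K"
  proof -
    let ?k = "max 1 a"
    have k: "?k \<ge> 1" "a \<le> ?k * ?k"
    proof -
      show "?k \<ge> 1" by simp
      have "a * 1 \<le> ?k * ?k" using a(2) by (intro mult_mono) auto
      then show "a \<le> ?k * ?k" by simp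
    qed
    have "(LBNN x. ennreal (Af (\<bar>w x\<bar> / ?k))) \<le> (LBNN x. ennreal (1 / ?k\<^sup>2) * ennreal (Af \<bar>w x\<bar>))"
    proof (intro nn_integral_mono)
      fix x
      have "ennreal (Af (\<bar>w x\<bar> / ?k)) \<le> ennreal (Af \<bar>w x\<bar> / ?k\<^sup>2)" using k(1) by (intro ennreal_leI Af_scale_down) auto
      then show "ennreal (Af (\<bar>w x\<bar> / ?k)) \<le> ennreal (1 / ?k\<^sup>2) * ennreal (Af \<bar>w x\<bar>)"
        by (simp flip: ennreal_mult')
    qed
    also have "\<dots> = ennreal (1 / ?k\<^sup>2) * ennreal a" by (subst nn_integral_cmult) (auto simp: a)
    also have "\<dots> = ennreal (a / ?k\<^sup>2)" by (simp flip: ennreal_mult')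
    also have "\<dots> \<le> 1" using k by (simp add: power2_eq_square divide_le_eq)
    finally show ?thesis using k(1) by (simp add: K_def)
  qed
  moreover have "Inf K < M + 1" using M K by simp
  ultimately obtain k where k: "k \<in> K" "k < M + 1" using cInf_lessD[of K "M + 1"] by blast
  \<comment> \<open>The selected k may be smaller than 1; \<open>k0\<close> meets the hypothesis of
    \<open>Af_scale_up\<close> and depends on \<open>M\<close> only.\<close>
  define k0 where "k0 = max 1 (M + 1)"
  have k0: "k0 \<ge> 1" "k \<le> k0" using k by (auto simp: k0_def)
  have kp: "k > 0" "(LBNN x. ennreal (Af (\<bar>w x\<bar> / k))) \<le> 1" using k(1) by (auto simp: K_def)
  have "(LBNN x. ennreal (Af \<bar>w x\<bar>)) \<le> (LBNN x. ennreal (CAf M) * ennreal (Af (\<bar>w x\<bar> / k)))"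
  proof (intro nn_integral_mono)
    fix x
    have "Af \<bar>w x\<bar> \<le> CAf M * Af (\<bar>w x\<bar> / k0)" using Af_scale_up[of "\<bar>w x\<bar>" k0] k0 by (simp add: CAf_def k0_def)
    also have "\<dots> \<le> CAf M * Af (\<bar>w x\<bar> / k)"
      using k0 kp by (intro mult_left_mono Af_mono divide_left_mono CAf_nonneg) auto
    finally show "ennreal (Af \<bar>w x\<bar>) \<le> ennreal (CAf M) * ennreal (Af (\<bar>w x\<bar> / k))"
      using CAf_nonneg[of M] by (simp add: ennreal_leI flip: ennreal_mult')
  qed
  also have "\<dots> = ennreal (CAf M) * (LBNN x. ennreal (Af (\<bar>w x\<bar> / k)))" by (rule nn_integral_cmult) measurable
  also have "\<dots> \<le> ennreal (CAf M) * 1" by (intro mult_left_mono kp) auto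
  finally show ?thesis by simp
qed

lemma Af_L2:
  assumes [measurable]: "w \<in> borel_measurable borel" and A: "(LBNN x. ennreal (Af \<bar>w x\<bar>)) \<le> ennreal C" and C: "C \<ge> 0"
  shows "L1 (\<lambda>x. (w x)\<^sup>2)" "(LBINT x. (w x)\<^sup>2) \<le> 2 * C"
proof -
  have "(LBNN x. ennreal ((w x)\<^sup>2)) \<le> (LBNN x. 2 * ennreal (Af \<bar>w x\<bar>))"
  proof (intro nn_integral_mono)
    fix x show "ennreal ((w x)\<^sup>2) \<le> 2 * ennreal (Af \<bar>w x\<bar>)"
      using ennreal_leI[OF sq_le_Af[of "\<bar>w x\<bar>"]] by (simp add: ennreal_mult')
  qed
  also have "\<dots> = 2 * (LBNN x. ennreal (Af \<bar>w x\<bar>))" by (rule nn_integral_cmult) measurable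
  also have "\<dots> \<le> 2 * ennreal C" by (intro mult_left_mono A) auto
  also have "\<dots> = ennreal (2 * C)" using C by (simp add: ennreal_mult')
  finally have *: "(LBNN x. ennreal ((w x)\<^sup>2)) \<le> ennreal (2 * C)" .
  show i: "L1 (\<lambda>x. (w x)\<^sup>2)" using * by (intro integrableI_bounded) (auto simp: order_le_less_trans)
  show "(LBINT x. (w x)\<^sup>2) \<le> 2 * C" using * i C by (subst (asm) nn_integral_eq_integral) (auto simp: ennreal_le_iff)
qed

text \<open>The power r^(-3/2) is still integrable at the origin of the plane and suits the region r
  b^2 \<le> 1. Beyond it \<open>jk\<close> takes over, the critical kernel 1/r^2 cut off at r =
  b^(-2), whose integral is only logarithmic in b.\<close>

definition k3 :: "real \<Rightarrow> real" where "k3 r = (if 0 \<le> r \<and> r < 1 then r powr (-3/2) else 0)"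
definition jk :: "real \<Rightarrow> real \<Rightarrow> real" where "jk b r = (if 1 < r * b\<^sup>2 \<and> r < 1 then 1 / r\<^sup>2 else 0)"

lemma k3_measurable[measurable]: "k3 \<in> borel_measurable borel" unfolding k3_def by measurable
lemma jk_measurable[measurable (raw)]:
  assumes [measurable]: "f \<in> borel_measurable N" "g \<in> borel_measurable N" shows "(\<lambda>z. jk (f z) (g z)) \<in> borel_measurable N"
  unfolding jk_def by measurable

text \<open>Here \<open>a\<close>, \<open>b\<close>, \<open>r\<close> stand for $|\omega(y)|$, $|\omega(x)|$, $|x - y|$. The integral of \<open>jk b\<close> over the plane grows like $\log b$;
  the weight \<open>Lg b\<close> in the inequality between the means balances this factor, which is why the exponent $1/4$ suffices.\<close>
lemma triple_pointwise:
  assumes a: "a \<ge> 0" and b: "b \<ge> 0" and r: "r \<ge> 0"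
  shows "b\<^sup>2 * (a / r) \<le> b\<^sup>2 * a + (a\<^sup>2 + b\<^sup>2) * k3 r + a\<^sup>2 * Af b + b\<^sup>2 / Lg b * jk b r"
proof -
  have nn: "0 \<le> b\<^sup>2 * a" "0 \<le> (a\<^sup>2 + b\<^sup>2) * k3 r" "0 \<le> a\<^sup>2 * Af b" "0 \<le> b\<^sup>2 / Lg b * jk b r"
    using a Af_nonneg[OF b] Lg_ge[OF b] by (auto simp: k3_def jk_def)
  consider "r = 0" | "r \<ge> 1" | "0 < r" "r < 1" "r * b\<^sup>2 \<le> 1" | "0 < r" "r < 1" "1 < r * b\<^sup>2" using r by linarith
  then show ?thesis
  proof cases
    case 1 then show ?thesis using nn by simp
  next
    case 2
    then have "a / r \<le> a / 1" using a by (intro divide_left_mono) auto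
    then have "b\<^sup>2 * (a / r) \<le> b\<^sup>2 * a" by (intro mult_left_mono) auto
    then show ?thesis using nn by linarith
  next
    case 3
    have k3: "k3 r = r powr (-3/2)" using 3 by (simp add: k3_def)
    have kp: "k3 r > 0" using 3 by (simp add: k3)
    have kk: "k3 r * k3 r = 1 / (r * (r * r))"
    proof -
      have "k3 r * k3 r = r powr (-3)" unfolding k3 by (simp flip: powr_add)
      also have "\<dots> = 1 / r powr 3" by (simp add: powr_minus divide_inverse)
      also have "r powr 3 = r ^ 3" using 3 by (simp add: powr_numeral)
      finally show ?thesis by (simp add: power3_eq_cube mult.assoc)
    qed
    \<comment> \<open>The inequality between the means with weight \<open>k3 r\<close>. Since b^2
      \<le> 1/r, the second square is at most b^2 r^(-3), that is b^2 times the square of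
      \<open>k3 r\<close>.\<close>
    have "a * (b\<^sup>2 / r) \<le> (k3 r * a\<^sup>2 + (b\<^sup>2 / r)\<^sup>2 / k3 r) / 2" using a 3 by (intro amgm kp) auto
    also have "(b\<^sup>2 / r)\<^sup>2 / k3 r \<le> b\<^sup>2 * k3 r"
    proof -
      have "(b\<^sup>2 / r)\<^sup>2 = b\<^sup>2 * ((r * b\<^sup>2) * (1 / (r * (r * r))))" using 3 by (simp add: power2_eq_square)
      also have "\<dots> \<le> b\<^sup>2 * (1 * (1 / (r * (r * r))))" using 3 by (intro mult_left_mono mult_right_mono) auto
      also have "\<dots> = b\<^sup>2 * k3 r * k3 r" by (simp only: mult.assoc kk mult_1_left)
      finally show ?thesis using kp by (simp add: divide_le_eq)
    qed
    finally have "a * (b\<^sup>2 / r) \<le> (k3 r * a\<^sup>2 + b\<^sup>2 * k3 r) / 2" by simp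
    also have "\<dots> \<le> (a\<^sup>2 + b\<^sup>2) * k3 r" using kp by (simp add: algebra_simps)
    finally show ?thesis using nn by (simp add: mult.commute)
  next
    case 4
    have L: "Lg b > 0" using Lg_ge[OF b] by linarith
    \<comment> \<open>One factor b is set aside; the weight b \<open>Lg b\<close> is chosen so that
      multiplying by it afterwards turns the coefficient of a^2 into \<open>Af b\<close>.\<close>
    have "a * (b / r) \<le> ((b * Lg b) * a\<^sup>2 + (b / r)\<^sup>2 / (b * Lg b)) / 2"
    proof (rule amgm)
      show "b * Lg b > 0" using L b 4 by (cases "b = 0") auto
    qed (use a b 4 in auto)
    then have "b * (a * (b / r)) \<le> b * (((b * Lg b) * a\<^sup>2 + (b / r)\<^sup>2 / (b * Lg b)) / 2)" using b by (rule mult_left_mono)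
    also have "\<dots> = (a\<^sup>2 * Af b + b\<^sup>2 / Lg b * (1 / r\<^sup>2)) / 2"
      using L b 4 by (cases "b = 0") (auto simp: Af_def field_simps power2_eq_square)
    also have "1 / r\<^sup>2 = jk b r" using 4 by (simp add: jk_def)
    finally have "b\<^sup>2 * (a / r) \<le> (a\<^sup>2 * Af b + b\<^sup>2 / Lg b * jk b r) / 2" by (simp add: power2_eq_square mult_ac)
    moreover have "x \<le> (p + q) / 2 \<Longrightarrow> 0 \<le> u \<Longrightarrow> 0 \<le> v \<Longrightarrow> 0 \<le> p \<Longrightarrow> 0 \<le> q \<Longrightarrow> x \<le> u + v + p + q" for x p q u v :: real by simp
    ultimately show ?thesis using nn by blast
  qed
qed

lemma k3_integral: "(LBNN z. ennreal (k3 (norm (z::real^2)))) \<le> ennreal (4 * pi)"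
proof -
  have "(LBNN z. ennreal (k3 (norm (z::real^2)))) = (LBNN r. ennreal (2 * pi * r * k3 r) * indicator {0..} r)"
    by (rule nn_integral_radial_real) (auto simp: k3_def)
  also have "\<dots> \<le> (LBNN r. ennreal (2 * pi) * ennreal (indicator {0..1} r * (r powr (-1/2))))"
  proof (intro nn_integral_mono)
    fix r :: real
    show "ennreal (2 * pi * r * k3 r) * indicator {0..} r \<le> ennreal (2 * pi) * ennreal (indicator {0..1} r * (r powr (-1/2)))"
    proof (cases "0 < r \<and> r < 1")
      case True
      have "r * r powr (-3/2) = r powr 1 * r powr (-3/2)" using True by simp
      also have "\<dots> = r powr (1 + -3/2)" by (rule powr_add[symmetric])
      finally have "r * r powr (-3/2) = r powr (-1/2)" by simp
      then show ?thesis using True by (simp add: k3_def mult.assoc flip: ennreal_mult')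
    qed (auto simp: k3_def indicator_def)
  qed
  also have "\<dots> = ennreal (2 * pi) * (LBNN r. ennreal (indicator {0..1} r * (r powr (-1/2))))"
    by (rule nn_integral_cmult) measurable
  also have "(LBNN r. ennreal (indicator {0..1} r * (r powr (-1/2)))) = ennreal 2"
  proof -
    have "((\<lambda>r::real. r powr (-1/2)) has_integral (1 powr (-1/2 + 1) / (-1/2 + 1))) {0..1}"
      by (rule has_integral_powr_from_0) auto
    then have "((\<lambda>r::real. r powr (-1/2)) has_integral 2) {0..1}" by simp
    from nn_integral_has_integral_lebesgue'[OF _ this] have "(LBNN r. ennreal (r powr (-1/2)) * indicator {0..1::real} r) = ennreal 2" by simp
    moreover have "ennreal (indicator {0..1} r * (r powr (-1/2))) = ennreal (r powr (-1/2)) * indicator {0..1::real} r" for r by (simp add: indicator_def)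
    ultimately show ?thesis by simp
  qed
  also have "ennreal (2 * pi) * ennreal 2 = ennreal (2 * pi * 2)" by (rule ennreal_mult[symmetric]) auto
  also have "2 * pi * 2 = 4 * pi" by simp
  finally show ?thesis .
qed

text \<open>In polar coordinates 1/r^2 becomes 2 pi / r, and integrating from b^(-2) to 1 gives 2 pi
  ln (b^2) = 4 pi ln b. For b \<le> 1 the range is empty.\<close>

lemma jk_integral:
  assumes b: "b \<ge> 0"
  shows "(LBNN z. ennreal (jk b (norm (z::real^2)))) \<le> ennreal (4 * pi * (Lg b)\<^sup>2)"
proof (cases "b \<le> 1")
  case True
  have b2: "b\<^sup>2 \<le> 1" using True b by (simp add: power_le_one)
  have "jk b (norm z) = 0" for z :: "real^2"
  proof -
    have "norm z * b\<^sup>2 \<le> norm z * 1" using b2 by (intro mult_left_mono) auto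
    then show ?thesis by (auto simp: jk_def)
  qed
  then show ?thesis by simp
next
  case False
  define \<rho> where "\<rho> = 1 / b\<^sup>2"
  have b1: "b > 1" using False by simp
  have b2: "b\<^sup>2 > 1" using b1 by (simp add: one_less_power)
  have rho: "\<rho> > 0" "\<rho> < 1" unfolding \<rho>_def using b1 b2 by (simp_all add: divide_less_eq)
  let ?F = "\<lambda>r. if \<rho> < r \<and> r < 1 then 1 / r\<^sup>2 else 0"
  have "jk b (norm z) = ?F (norm z)" for z :: "real^2"
    using b1 b2 by (simp add: jk_def \<rho>_def divide_less_eq mult.commute)
  then have "(LBNN z. ennreal (jk b (norm (z::real^2)))) = (LBNN z. ennreal (?F (norm (z::real^2))))" by simp
  also have "\<dots> = (LBNN r. ennreal (2 * pi * r * ?F r) * indicator {0..} r)"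
    by (rule nn_integral_radial_real) auto
  also have "\<dots> \<le> (LBNN r. ennreal (2 * pi / r) * indicator {\<rho>..1} r)"
    by (intro nn_integral_mono) (auto simp: indicator_def power2_eq_square)
  also have "\<dots> = 2 * pi * ln 1 - 2 * pi * ln \<rho>"
    by (rule nn_integral_FTC_Icc) (use rho in \<open>auto intro!: derivative_eq_intros\<close>)
  also have "2 * pi * ln 1 - 2 * pi * ln \<rho> = 4 * pi * ln b" using b1 by (simp add: \<rho>_def ln_div ln_realpow)
  also have "ennreal (4 * pi * ln b) \<le> ennreal (4 * pi * (Lg b)\<^sup>2)"
    unfolding Lg_sq[OF b] using b1 by (intro ennreal_leI mult_left_mono) auto
  finally show ?thesis .
qed

text \<open>Of the five terms from \<open>triple_pointwise\<close>, two factorise into a function of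
  x times one of y, two are convolutions with the integrable \<open>k3\<close>, and in the last the
  y-integral of \<open>jk\<close> produces 4 pi times the square of \<open>Lg\<close>, which
  restores \<open>Af\<close>.\<close>

lemma triple_bound:
  assumes f: "L1 f" and f2: "L1 (\<lambda>x. (f x)\<^sup>2)" and A: "(LBNN x. ennreal (Af \<bar>f x\<bar>)) \<le> ennreal C" and C: "C \<ge> 0"
  defines "Q \<equiv> LBINT x. (f x)\<^sup>2" and "W \<equiv> LBINT x. \<bar>f x\<bar>"
  shows "(LBNN x. ennreal ((f x)\<^sup>2) * Upot f x) \<le> ennreal (Q * W + 8 * pi * Q + Q * C + 4 * pi * C)"
proof -
  have [measurable]: "f \<in> borel_measurable borel" using f by auto
  have Q0: "Q \<ge> 0" "W \<ge> 0" by (simp_all add: Q_def W_def)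
  have q: "(LBNN x. ennreal ((f x)\<^sup>2)) = ennreal Q" "(LBNN x. ennreal \<bar>f x\<bar>) = ennreal W"
    using nn_w2[OF f2] nn_w1[OF f] by (simp_all add: Q_def W_def)
  let ?T1 = "\<lambda>x y. ennreal ((f x)\<^sup>2) * ennreal \<bar>f y\<bar>"
  let ?T2 = "\<lambda>x y. ennreal ((f y)\<^sup>2) * ennreal (k3 (norm (x - y)))"
  let ?T3 = "\<lambda>x y. ennreal ((f x)\<^sup>2) * ennreal (k3 (norm (x - y)))"
  let ?T4 = "\<lambda>x y. ennreal ((f y)\<^sup>2) * ennreal (Af \<bar>f x\<bar>)"
  let ?T5 = "\<lambda>x y. ennreal ((f x)\<^sup>2 / Lg \<bar>f x\<bar>) * ennreal (jk \<bar>f x\<bar> (norm (x - y)))"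
  have k30: "k3 r \<ge> 0" "jk b r \<ge> 0" for b r by (auto simp: k3_def jk_def)
  have pt: "ennreal ((f x)\<^sup>2) * ennreal (\<bar>f y\<bar> / norm (x - y)) \<le> ?T1 x y + (?T2 x y + (?T3 x y + (?T4 x y + ?T5 x y)))" for x y
  proof -
    have L: "Lg \<bar>f x\<bar> \<ge> 0" using Lg_ge[of "\<bar>f x\<bar>"] by simp
    have "(f x)\<^sup>2 * (\<bar>f y\<bar> / norm (x - y)) \<le> (f x)\<^sup>2 * \<bar>f y\<bar> + ((f y)\<^sup>2 * k3 (norm (x - y)) + ((f x)\<^sup>2 * k3 (norm (x - y)) + ((f y)\<^sup>2 * Af \<bar>f x\<bar> + (f x)\<^sup>2 / Lg \<bar>f x\<bar> * jk \<bar>f x\<bar> (norm (x - y)))))"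
      using triple_pointwise[of "\<bar>f y\<bar>" "\<bar>f x\<bar>" "norm (x - y)"] by (simp add: distrib_right)
    from ennreal_leI[OF this] show ?thesis
      using k30 L Af_nonneg[of "\<bar>f x\<bar>"] by (simp add: ennreal_mult ennreal_plus[symmetric] del: ennreal_plus flip: ennreal_mult ennreal_mult')
  qed
  have "(LBNN x. ennreal ((f x)\<^sup>2) * Upot f x) = (LBNN x. (LBNN y. ennreal ((f x)\<^sup>2) * ennreal (\<bar>f y\<bar> / norm (x - y))))"
    unfolding Upot_def by (intro nn_integral_cong nn_integral_cmult[symmetric]) measurable
  also have "\<dots> \<le> (LBNN x. (LBNN y. ?T1 x y + (?T2 x y + (?T3 x y + (?T4 x y + ?T5 x y)))))"
    by (intro nn_integral_mono pt)
  also have "\<dots> = (LBNN x. (LBNN y. ?T1 x y)) + ((LBNN x. (LBNN y. ?T2 x y)) +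
     ((LBNN x. (LBNN y. ?T3 x y)) + ((LBNN x. (LBNN y. ?T4 x y)) + (LBNN x. (LBNN y. ?T5 x y)))))"
    by (simp add: nn_integral_add)
  also have "\<dots> \<le> ennreal (Q * W) + (ennreal (4 * pi * Q) + (ennreal (4 * pi * Q) + (ennreal (Q * C) + ennreal (4 * pi * C))))"
  proof (intro add_mono)
    have K: "(LBNN y. ennreal (k3 (norm (x - y)))) \<le> ennreal (4 * pi)" for x :: "real^2"
      using k3_integral nn_integral_shift(3)[of "\<lambda>z::real^2. ennreal (k3 (norm z))" x] by simp
    have K': "(LBNN x. ennreal (k3 (norm (x - y)))) \<le> ennreal (4 * pi)" for y :: "real^2"
      using k3_integral nn_integral_shift(2)[of "\<lambda>z::real^2. ennreal (k3 (norm z))" y] by simp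
    show "(LBNN x. (LBNN y. ?T1 x y)) \<le> ennreal (Q * W)"
      using Q0 by (simp add: nn_integral_cmult nn_integral_multc q ennreal_mult)
    have "(LBNN x. (LBNN y. ?T2 x y)) = (LBNN y. (LBNN x. ?T2 x y))"
      by (rule lborel_pair.Fubini'[symmetric]) measurable
    also have "\<dots> = (LBNN y. ennreal ((f y)\<^sup>2) * (LBNN x. ennreal (k3 (norm (x - y)))))"
      by (intro nn_integral_cong nn_integral_cmult) measurable
    also have "\<dots> \<le> (LBNN y. ennreal ((f y)\<^sup>2) * ennreal (4 * pi))" by (intro nn_integral_mono mult_left_mono K') auto
    also have "\<dots> = ennreal Q * ennreal (4 * pi)" unfolding q(1)[symmetric] by (rule nn_integral_multc) measurable
    also have "\<dots> = ennreal (4 * pi * Q)" using Q0 by (simp add: ennreal_mult mult.commute)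
    finally show "(LBNN x. (LBNN y. ?T2 x y)) \<le> ennreal (4 * pi * Q)" .
    have "(LBNN x. (LBNN y. ?T3 x y)) = (LBNN x. ennreal ((f x)\<^sup>2) * (LBNN y. ennreal (k3 (norm (x - y)))))"
      by (intro nn_integral_cong nn_integral_cmult) measurable
    also have "\<dots> \<le> (LBNN y. ennreal ((f y)\<^sup>2) * ennreal (4 * pi))" by (intro nn_integral_mono mult_left_mono K) auto
    also have "\<dots> = ennreal Q * ennreal (4 * pi)" unfolding q(1)[symmetric] by (rule nn_integral_multc) measurable
    also have "\<dots> = ennreal (4 * pi * Q)" using Q0 by (simp add: ennreal_mult mult.commute)
    finally show "(LBNN x. (LBNN y. ?T3 x y)) \<le> ennreal (4 * pi * Q)" .
    have "(LBNN x. (LBNN y. ?T4 x y)) = ennreal Q * (LBNN x. ennreal (Af \<bar>f x\<bar>))"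
      by (simp add: nn_integral_cmult nn_integral_multc q)
    also have "\<dots> \<le> ennreal Q * ennreal C" by (intro mult_left_mono A) auto
    finally show "(LBNN x. (LBNN y. ?T4 x y)) \<le> ennreal (Q * C)" using Q0 C by (simp add: ennreal_mult)
    have "(LBNN x. (LBNN y. ?T5 x y)) \<le> (LBNN x. ennreal (4 * pi) * ennreal (Af \<bar>f x\<bar>))"
    proof (intro nn_integral_mono)
      fix x
      have L: "Lg \<bar>f x\<bar> > 0" using Lg_ge[of "\<bar>f x\<bar>"] by simp
      have "(LBNN y. ?T5 x y) = ennreal ((f x)\<^sup>2 / Lg \<bar>f x\<bar>) * (LBNN y. ennreal (jk \<bar>f x\<bar> (norm (x - y))))"
        by (rule nn_integral_cmult) measurable
      also have "(LBNN y. ennreal (jk \<bar>f x\<bar> (norm (x - y)))) = (LBNN y. ennreal (jk \<bar>f x\<bar> (norm (y::real^2))))"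
        by (rule nn_integral_shift(3)[of "\<lambda>z::real^2. ennreal (jk \<bar>f x\<bar> (norm z))" x]) measurable
      also have "ennreal ((f x)\<^sup>2 / Lg \<bar>f x\<bar>) * \<dots> \<le> ennreal ((f x)\<^sup>2 / Lg \<bar>f x\<bar>) * ennreal (4 * pi * (Lg \<bar>f x\<bar>)\<^sup>2)"
        by (intro mult_left_mono jk_integral) auto
      also have "\<dots> = ennreal ((f x)\<^sup>2 / Lg \<bar>f x\<bar> * (4 * pi * (Lg \<bar>f x\<bar>)\<^sup>2))" using L by (intro ennreal_mult[symmetric]) auto
      also have "(f x)\<^sup>2 / Lg \<bar>f x\<bar> * (4 * pi * (Lg \<bar>f x\<bar>)\<^sup>2) = 4 * pi * Af \<bar>f x\<bar>" using L by (simp add: Af_def power2_eq_square)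
      finally show "(LBNN y. ?T5 x y) \<le> ennreal (4 * pi) * ennreal (Af \<bar>f x\<bar>)"
        using Af_nonneg[of "\<bar>f x\<bar>"] by (simp flip: ennreal_mult)
    qed
    also have "\<dots> = ennreal (4 * pi) * (LBNN x. ennreal (Af \<bar>f x\<bar>))" by (rule nn_integral_cmult) measurable
    also have "\<dots> \<le> ennreal (4 * pi) * ennreal C" by (intro mult_left_mono A) auto
    finally show "(LBNN x. (LBNN y. ?T5 x y)) \<le> ennreal (4 * pi * C)" using C by (simp add: ennreal_mult)
  qed
  also have "\<dots> = ennreal (Q * W + 8 * pi * Q + Q * C + 4 * pi * C)"
    using Q0 C by (simp flip: ennreal_plus)
  finally show ?thesis .
qed

text \<open>Quadratic near 0 and saturating at m. It lies below s^2 and converges to it, so the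
  square itself is the majorant in the limit; the slope bound m is admissible for each fixed m but
  not uniform.\<close>

definition bt :: "real \<Rightarrow> real \<Rightarrow> real" where "bt m s = m * s\<^sup>2 / (m + s\<^sup>2)"

lemma bt_nice:
  assumes m: "m \<ge> 1"
  shows "nice_beta m (bt m) (\<lambda>s. 2 * m\<^sup>2 * s / (m + s\<^sup>2)\<^sup>2) (\<lambda>s. (2 * m\<^sup>2 * (m + s\<^sup>2)\<^sup>2 - 2 * m\<^sup>2 * s * (2 * (m + s\<^sup>2) * (2 * s))) / ((m + s\<^sup>2)\<^sup>2 * (m + s\<^sup>2)\<^sup>2))"
proof -
  have p: "m + s\<^sup>2 > 0" for s :: real using m by (simp add: add_pos_nonneg)
  have n: "m + s\<^sup>2 \<noteq> 0" "(m + s\<^sup>2)\<^sup>2 \<noteq> 0" for s :: real using p[of s] by auto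
  have dd: "((\<lambda>s. m + s\<^sup>2) has_real_derivative 2 * s) (at s)" for s by (auto intro!: derivative_eq_intros)
  have d0: "(bt m has_real_derivative 2 * m\<^sup>2 * s / (m + s\<^sup>2)\<^sup>2) (at s)" for s
  proof -
    have "((\<lambda>s. m * s\<^sup>2) has_real_derivative m * (2 * s)) (at s)" by (auto intro!: derivative_eq_intros)
    from DERIV_divide[OF this dd n(1)] have "((\<lambda>s. m * s\<^sup>2 / (m + s\<^sup>2)) has_real_derivative (m * (2 * s) * (m + s\<^sup>2) - m * s\<^sup>2 * (2 * s)) / ((m + s\<^sup>2) * (m + s\<^sup>2))) (at s)" .
    moreover have "(m * (2 * s) * (m + s\<^sup>2) - m * s\<^sup>2 * (2 * s)) / ((m + s\<^sup>2) * (m + s\<^sup>2)) = 2 * m\<^sup>2 * s / (m + s\<^sup>2)\<^sup>2"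
      by (simp add: power2_eq_square algebra_simps)
    ultimately show ?thesis unfolding bt_def[abs_def] by simp
  qed
  have d1: "((\<lambda>s. 2 * m\<^sup>2 * s / (m + s\<^sup>2)\<^sup>2) has_real_derivative (2 * m\<^sup>2 * (m + s\<^sup>2)\<^sup>2 - 2 * m\<^sup>2 * s * (2 * (m + s\<^sup>2) * (2 * s))) / ((m + s\<^sup>2)\<^sup>2 * (m + s\<^sup>2)\<^sup>2)) (at s)" for s
  proof -
    have h1: "((\<lambda>s. 2 * m\<^sup>2 * s) has_real_derivative 2 * m\<^sup>2) (at s)" by (auto intro!: derivative_eq_intros)
    have h2: "((\<lambda>s. (m + s\<^sup>2)\<^sup>2) has_real_derivative 2 * (m + s\<^sup>2) * (2 * s)) (at s)" by (auto intro!: derivative_eq_intros)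
    show ?thesis by (rule DERIV_divide[OF h1 h2 n(2)])
  qed
  have b: "\<bar>2 * m\<^sup>2 * s / (m + s\<^sup>2)\<^sup>2\<bar> \<le> m" for s
  proof -
    have "2 * \<bar>s\<bar> \<le> 1 + s\<^sup>2" using zero_le_power2[of "\<bar>s\<bar> - 1"] by (simp add: power2_diff)
    then have "2 * \<bar>s\<bar> \<le> m + s\<^sup>2" using m by linarith
    then have "m * (2 * \<bar>s\<bar>) \<le> (m + s\<^sup>2) * (m + s\<^sup>2)" using m by (intro mult_mono) auto
    then have "m * (m * (2 * \<bar>s\<bar>)) \<le> m * ((m + s\<^sup>2) * (m + s\<^sup>2))" using m by (intro mult_left_mono) auto
    then have "2 * m\<^sup>2 * \<bar>s\<bar> \<le> m * (m + s\<^sup>2)\<^sup>2" by (simp add: power2_eq_square mult_ac)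
    then show ?thesis using p[of s] m by (simp add: abs_mult divide_le_eq)
  qed
  have "continuous_on UNIV (\<lambda>s. (2 * m\<^sup>2 * (m + s\<^sup>2)\<^sup>2 - 2 * m\<^sup>2 * s * (2 * (m + s\<^sup>2) * (2 * s))) / ((m + s\<^sup>2)\<^sup>2 * (m + s\<^sup>2)\<^sup>2))"
    using n by (intro continuous_intros ballI) (metis mult_eq_0_iff)
  then show ?thesis unfolding nice_beta_def using d0 d1 b by (simp add: bt_def)
qed

lemma nice_beta_uminus:
  assumes "nice_beta L \<beta> \<beta>' \<beta>''"
  shows "nice_beta L (\<lambda>s. - \<beta> s) (\<lambda>s. - \<beta>' s) (\<lambda>s. - \<beta>'' s)"
  using assms unfolding nice_beta_def by (auto intro: DERIV_minus continuous_intros)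

lemma bt_bounds: "m > 0 \<Longrightarrow> 0 \<le> bt m s" "m > 0 \<Longrightarrow> bt m s \<le> s\<^sup>2"
proof -
  assume m: "m > 0"
  then have p: "m + s\<^sup>2 > 0" by (simp add: add_pos_nonneg)
  show "0 \<le> bt m s" using m p by (simp add: bt_def)
  have "m * s\<^sup>2 \<le> s\<^sup>2 * (m + s\<^sup>2)" by (simp add: algebra_simps)
  then show "bt m s \<le> s\<^sup>2" using p by (simp add: bt_def divide_le_eq)
qed

lemma bt_tendsto: "(\<lambda>n. bt (real n + 1) s) \<longlonglongrightarrow> s\<^sup>2"
proof -
  have l: "(\<lambda>n. 1 / (real n + 1)) \<longlonglongrightarrow> 0" using LIMSEQ_inverse_real_of_nat by (simp add: inverse_eq_divide add.commute)
  have "(\<lambda>n. s\<^sup>2 / (1 + s\<^sup>2 * (1 / (real n + 1)))) \<longlonglongrightarrow> s\<^sup>2 / (1 + s\<^sup>2 * 0)" by (intro tendsto_intros l) auto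
  moreover have "s\<^sup>2 / (1 + s\<^sup>2 * (1 / (real n + 1))) = bt (real n + 1) s" for n
  proof -
    have n: "real n + 1 > 0" by simp
    have "1 + s\<^sup>2 * (1 / (real n + 1)) = (real n + 1 + s\<^sup>2) / (real n + 1)" using n by (simp add: add_divide_distrib)
    then show ?thesis by (simp add: bt_def mult.commute)
  qed
  ultimately show ?thesis by simp
qed

section \<open>Renormalisation with the square\<close>

lemma square_Upot_integrable:
  assumes f: "L1 f" and f2: "L1 (\<lambda>x. (f x)\<^sup>2)"
    and A: "(LBNN x. ennreal (Af \<bar>f x\<bar>)) \<le> ennreal C" and C: "C \<ge> 0"
    and M: "(LBINT x. (f x)\<^sup>2) \<le> M"
  shows "L1 (\<lambda>x. (f x)\<^sup>2 * enn2real (Upot f x))"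
    "(LBINT x. (f x)\<^sup>2 * enn2real (Upot f x)) \<le> M * (LBINT x. \<bar>f x\<bar>) + 8 * pi * M + M * C + 4 * pi * C"
proof -
  have [measurable]: "f \<in> borel_measurable borel" using f by auto
  let ?Q = "LBINT x. (f x)\<^sup>2" and ?W = "LBINT x. \<bar>f x\<bar>"
  let ?b = "?Q * ?W + 8 * pi * ?Q + ?Q * C + 4 * pi * C"
  have nn: "?Q \<ge> 0" "?W \<ge> 0" by simp_all
  have b0: "?b \<ge> 0" using nn C by (intro add_nonneg_nonneg mult_nonneg_nonneg) auto
  have "(LBNN x. ennreal ((f x)\<^sup>2 * enn2real (Upot f x))) = (LBNN x. ennreal ((f x)\<^sup>2) * Upot f x)"
    using Upot_finite[OF f f2] by (intro nn_integral_cong_AE) (auto elim!: eventually_mono simp: ennreal_mult')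
  also have "\<dots> \<le> ennreal ?b" by (rule triple_bound[OF f f2 A C])
  finally have *: "(LBNN x. ennreal ((f x)\<^sup>2 * enn2real (Upot f x))) \<le> ennreal ?b" .
  show i: "L1 (\<lambda>x. (f x)\<^sup>2 * enn2real (Upot f x))"
    using * by (intro integrableI_bounded) (auto simp: order_le_less_trans)
  have "(LBINT x. (f x)\<^sup>2 * enn2real (Upot f x)) \<le> ?b"
    using * b0 by (subst (asm) nn_integral_eq_integral[OF i]) (auto simp: ennreal_le_iff)
  also have "\<dots> \<le> M * ?W + 8 * pi * M + M * C + 4 * pi * C"
    using M nn C by (intro add_mono mult_right_mono mult_left_mono) auto
  finally show "(LBINT x. (f x)\<^sup>2 * enn2real (Upot f x)) \<le> M * ?W + 8 * pi * M + M * C + 4 * pi * C" .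
qed

lemma bt_measurable[measurable]: "bt m \<in> borel_measurable borel" unfolding bt_def by measurable

text \<open>The bounds by the integral of d do not depend on n, as the subsequent limit under the
  time integral demands.\<close>

lemma bt_pair:
  assumes [measurable]: "f \<in> borel_measurable borel" "g \<in> borel_measurable borel"
    and d: "L1 d" and le: "AE x in lborel. (f x)\<^sup>2 * \<bar>g x\<bar> \<le> d x"
  shows "(\<lambda>n. LBINT x. bt (real n + 1) (f x) * g x) \<longlonglongrightarrow> (LBINT x. (f x)\<^sup>2 * g x)"
    "\<bar>LBINT x. bt (real n + 1) (f x) * g x\<bar> \<le> (LBINT x. d x)"
    "\<bar>LBINT x. (f x)\<^sup>2 * g x\<bar> \<le> (LBINT x. d x)"
proof -
  have le': "AE x in lborel. \<bar>bt (real n + 1) (f x) * g x\<bar> \<le> d x" for n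
    using le
  proof eventually_elim
    case (elim x)
    have "\<bar>bt (real n + 1) (f x)\<bar> * \<bar>g x\<bar> \<le> (f x)\<^sup>2 * \<bar>g x\<bar>"
      using bt_bounds[of "real n + 1" "f x"] by (intro mult_right_mono) auto
    then show ?case using elim by (simp add: abs_mult)
  qed
  show "(\<lambda>n. LBINT x. bt (real n + 1) (f x) * g x) \<longlonglongrightarrow> (LBINT x. (f x)\<^sup>2 * g x)"
    by (rule integral_dominated_convergence[OF _ _ d]) (use le' in \<open>auto intro!: tendsto_mult bt_tendsto\<close>)
  have gen: "\<bar>LBINT x. h x\<bar> \<le> (LBINT x. d x)" if [measurable]: "h \<in> borel_measurable borel" and h: "AE x in lborel. \<bar>h x\<bar> \<le> d x" for h
  proof -
    have "L1 h" by (rule Bochner_Integration.integrable_bound[OF d]) (use h in \<open>auto elim: eventually_mono\<close>)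
    then have "(LBINT x. \<bar>h x\<bar>) \<le> (LBINT x. d x)" using d h by (intro integral_mono_AE) auto
    then show ?thesis using integral_abs_bound[of lborel h] by linarith
  qed
  show "\<bar>LBINT x. bt (real n + 1) (f x) * g x\<bar> \<le> (LBINT x. d x)" by (rule gen) (use le' in auto)
  show "\<bar>LBINT x. (f x)\<^sup>2 * g x\<bar> \<le> (LBINT x. d x)" by (rule gen) (use le in \<open>auto simp: abs_mult\<close>)
qed

lemma velocity_flux_le:
  assumes "f \<in> borel_measurable borel" "Upot f x < \<infinity>" "\<bar>a\<bar> \<le> B" "\<bar>b\<bar> \<le> B"
  shows "\<bar>velocity f x $ 1 * a + velocity f x $ 2 * b\<bar> \<le> 2 * B * enn2real (Upot f x)"
proof -
  have c: "\<bar>velocity f x $ i\<bar> \<le> enn2real (Upot f x)" for i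
    using velocity_le_real[OF assms(1,2)] component_le_norm_cart[of "velocity f x" i] by simp
  have "\<bar>velocity f x $ 1\<bar> * \<bar>a\<bar> \<le> enn2real (Upot f x) * B" "\<bar>velocity f x $ 2\<bar> * \<bar>b\<bar> \<le> enn2real (Upot f x) * B"
    using c assms(3,4) by (auto intro!: mult_mono)
  moreover have "\<bar>velocity f x $ 1 * a + velocity f x $ 2 * b\<bar> \<le> \<bar>velocity f x $ 1\<bar> * \<bar>a\<bar> + \<bar>velocity f x $ 2\<bar> * \<bar>b\<bar>"
    using abs_triangle_ineq[of "velocity f x $ 1 * a" "velocity f x $ 2 * b"] by (simp add: abs_mult)
  ultimately show ?thesis by (simp add: algebra_simps)
qed

context weak_solution
begin

text \<open>For fixed n, \<open>renormalized_inequality\<close> applied to \<open>bt\<close> and to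
  its negative gives equality, and the initial term is absent because p vanishes at time 0. The
  limit in n is taken first in x, at almost every t, and then in t with a majorant proportional to 1
  + W t.\<close>

theorem renormalized_square:
  assumes nu0: "\<nu> = 0" and C: "C \<ge> 0"
    and A: "AE t in lborel. t \<in> {0<..<T} \<longrightarrow> (LBNN x. ennreal (Af \<bar>w t x\<bar>)) \<le> ennreal C"
    and T2: "0 < T2" "T2 < T" and p: "nice_st R B T T2 p pt p1 p2 p11 p22" and p0: "\<And>x. p 0 x = 0"
  shows "L1 (\<lambda>t. indicator {0<..<T} t * (LBINT x. (w t x)\<^sup>2 * pt t x))"
    "L1 (\<lambda>t. indicator {0<..<T} t * (LBINT x. (w t x)\<^sup>2 * (velocity (w t) x $ 1 * p1 t x + velocity (w t) x $ 2 * p2 t x)))"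
    "(LBINT t. indicator {0<..<T} t * (LBINT x. (w t x)\<^sup>2 * pt t x))
     + (LBINT t. indicator {0<..<T} t * (LBINT x. (w t x)\<^sup>2 * (velocity (w t) x $ 1 * p1 t x + velocity (w t) x $ 2 * p2 t x))) = 0"
proof -
  have pm: "(\<lambda>z. f (fst z) (snd z)) \<in> borel_measurable (borel :: (real \<times> (real^2)) measure)" if "f \<in> {p, pt, p1, p2, p11, p22}" for f
    using p that by (auto simp: nice_st_def)
  have [measurable (raw)]: "\<And>f g N. f \<in> borel_measurable N \<Longrightarrow> g \<in> borel_measurable N \<Longrightarrow> (\<lambda>z. pt (f z) (g z)) \<in> borel_measurable N"
    "\<And>f g N. f \<in> borel_measurable N \<Longrightarrow> g \<in> borel_measurable N \<Longrightarrow> (\<lambda>z. p1 (f z) (g z)) \<in> borel_measurable N"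
    "\<And>f g N. f \<in> borel_measurable N \<Longrightarrow> g \<in> borel_measurable N \<Longrightarrow> (\<lambda>z. p2 (f z) (g z)) \<in> borel_measurable N"
    by (rule joint_measurable_comp[OF pm]; simp)+
  have [measurable]: "pt t \<in> borel_measurable borel" "p1 t \<in> borel_measurable borel" "p2 t \<in> borel_measurable borel" for t by measurable
  have pB: "\<bar>pt t x\<bar> \<le> B" "\<bar>p1 t x\<bar> \<le> B" "\<bar>p2 t x\<bar> \<le> B" if "t \<in> {0<..<T}" for t x
    using p that by (auto simp: nice_st_def)
  have B0: "B \<ge> 0" using pB(1)[of "T / 2" 0] T by auto
  let ?v = "\<lambda>t x. velocity (w t) x $ 1 * p1 t x + velocity (w t) x $ 2 * p2 t x"
  let ?b = "\<lambda>n::nat. bt (real n + 1)"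
  define N where "N t \<longleftrightarrow> t \<in> {0<..<T} \<and> good t \<and> (LBNN x. ennreal (Af \<bar>w t x\<bar>)) \<le> ennreal C" for t
  have aeN: "AE t in lborel. t \<in> {0<..<T} \<longrightarrow> N t" using ae_good A by eventually_elim (auto simp: N_def)
  let ?S = "\<lambda>t. M * W t + 8 * pi * M + M * C + 4 * pi * C"
  define K where "K = 2 * B * (M + 8 * pi * M + M * C + 4 * pi * C) + B * M"
  have KS: "B * M \<le> K * (1 + W t)" "2 * B * ?S t \<le> K * (1 + W t)" for t
  proof -
    have nn: "0 \<le> B * M" "0 \<le> 8 * pi * M + M * C + 4 * pi * C" using B0 M_nonneg C by auto
    have K1: "B * M \<le> K" "0 \<le> K" using B0 M_nonneg C by (auto simp: K_def intro!: mult_nonneg_nonneg add_nonneg_nonneg)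
    have "K * 1 \<le> K * (1 + W t)" using K1 W_nonneg by (intro mult_left_mono) auto
    then show "B * M \<le> K * (1 + W t)" using K1 by simp
    have "?S t \<le> (M + 8 * pi * M + M * C + 4 * pi * C) * (1 + W t)"
    proof -
      have "0 \<le> M" "0 \<le> (8 * pi * M + M * C + 4 * pi * C) * W t" using M_nonneg nn W_nonneg[of t] by auto
      then show ?thesis by (simp add: algebra_simps)
    qed
    then have "2 * B * ?S t \<le> 2 * B * ((M + 8 * pi * M + M * C + 4 * pi * C) * (1 + W t))" using B0 by (intro mult_left_mono) auto
    also have "\<dots> \<le> K * (1 + W t)"
    proof -
      have "2 * B * (M + 8 * pi * M + M * C + 4 * pi * C) * (1 + W t) \<le> K * (1 + W t)"
        using nn W_nonneg[of t] by (intro mult_right_mono) (auto simp: K_def)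
      then show ?thesis by (simp only: mult.assoc)
    qed
    finally show "2 * B * ?S t \<le> K * (1 + W t)" .
  qed
  have F1: "(\<lambda>n. LBINT x. ?b n (w t x) * pt t x) \<longlonglongrightarrow> (LBINT x. (w t x)\<^sup>2 * pt t x)"
    "\<bar>LBINT x. ?b n (w t x) * pt t x\<bar> \<le> K * (1 + W t)" "\<bar>LBINT x. (w t x)\<^sup>2 * pt t x\<bar> \<le> K * (1 + W t)" if "N t" for t n
  proof -
    have g: "L1 (\<lambda>x. (w t x)\<^sup>2)" "(LBINT x. (w t x)\<^sup>2) \<le> M" "t \<in> {0<..<T}" using that by (auto simp: N_def good_def)
    have d: "L1 (\<lambda>x. (w t x)\<^sup>2 * B)" using g(1) by (rule integrable_mult_left)
    have le: "AE x in lborel. (w t x)\<^sup>2 * \<bar>pt t x\<bar> \<le> (w t x)\<^sup>2 * B" using pB[OF g(3)] by (intro AE_I2 mult_left_mono) auto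
    have "(LBINT x. (w t x)\<^sup>2 * B) \<le> K * (1 + W t)" using mult_left_mono[OF g(2) B0] KS(1)[of t] by (simp add: mult.commute)
    then show "(\<lambda>n. LBINT x. ?b n (w t x) * pt t x) \<longlonglongrightarrow> (LBINT x. (w t x)\<^sup>2 * pt t x)"
      "\<bar>LBINT x. ?b n (w t x) * pt t x\<bar> \<le> K * (1 + W t)" "\<bar>LBINT x. (w t x)\<^sup>2 * pt t x\<bar> \<le> K * (1 + W t)"
      using bt_pair(1,3)[OF _ _ d le] bt_pair(2)[OF _ _ d le, of n] by auto
  qed
  have F2: "(\<lambda>n. LBINT x. ?b n (w t x) * ?v t x) \<longlonglongrightarrow> (LBINT x. (w t x)\<^sup>2 * ?v t x)"
    "\<bar>LBINT x. ?b n (w t x) * ?v t x\<bar> \<le> K * (1 + W t)" "\<bar>LBINT x. (w t x)\<^sup>2 * ?v t x\<bar> \<le> K * (1 + W t)" if "N t" for t n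
  proof -
    have g: "L1 (w t)" "L1 (\<lambda>x. (w t x)\<^sup>2)" "(LBINT x. (w t x)\<^sup>2) \<le> M" "t \<in> {0<..<T}"
      "(LBNN x. ennreal (Af \<bar>w t x\<bar>)) \<le> ennreal C" using that by (auto simp: N_def good_def)
    note S = square_Upot_integrable[OF g(1,2,5) C g(3)]
    have d: "L1 (\<lambda>x. 2 * B * ((w t x)\<^sup>2 * enn2real (Upot (w t) x)))" using S(1) by (rule integrable_mult_right)
    have le: "AE x in lborel. (w t x)\<^sup>2 * \<bar>?v t x\<bar> \<le> 2 * B * ((w t x)\<^sup>2 * enn2real (Upot (w t) x))"
      using Upot_finite[OF g(1,2)]
    proof eventually_elim
      case (elim x)
      have "(w t x)\<^sup>2 * \<bar>?v t x\<bar> \<le> (w t x)\<^sup>2 * (2 * B * enn2real (Upot (w t) x))"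
        using pB[OF g(4)] elim by (intro mult_left_mono velocity_flux_le) auto
      then show ?case by (simp add: mult_ac)
    qed
    have "(LBINT x. 2 * B * ((w t x)\<^sup>2 * enn2real (Upot (w t) x))) = 2 * B * (LBINT x. (w t x)\<^sup>2 * enn2real (Upot (w t) x))"
      by (rule integral_mult_right_zero)
    also have "\<dots> \<le> 2 * B * ?S t" using S(2) B0 by (intro mult_left_mono) (auto simp: W_def)
    also have "\<dots> \<le> K * (1 + W t)" by (rule KS(2))
    finally show "(\<lambda>n. LBINT x. ?b n (w t x) * ?v t x) \<longlonglongrightarrow> (LBINT x. (w t x)\<^sup>2 * ?v t x)"
      "\<bar>LBINT x. ?b n (w t x) * ?v t x\<bar> \<le> K * (1 + W t)" "\<bar>LBINT x. (w t x)\<^sup>2 * ?v t x\<bar> \<le> K * (1 + W t)"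
      using bt_pair(1,3)[OF _ _ d le] bt_pair(2)[OF _ _ d le, of n] by auto
  qed
  have [measurable]: "(\<lambda>t. LBINT x. (w t x)\<^sup>2 * pt t x) \<in> borel_measurable borel" "(\<lambda>t. LBINT x. (w t x)\<^sup>2 * ?v t x) \<in> borel_measurable borel"
    "(\<lambda>t. LBINT x. ?b n (w t x) * pt t x) \<in> borel_measurable borel" "(\<lambda>t. LBINT x. ?b n (w t x) * ?v t x) \<in> borel_measurable borel" for n
    by (intro lborel.borel_measurable_lebesgue_integral; measurable)+
  show i1: "L1 (\<lambda>t. indicator {0<..<T} t * (LBINT x. (w t x)\<^sup>2 * pt t x))"
  proof (rule Bochner_Integration.integrable_bound[OF dom_integrable[of K]])
    show "AE t in lborel. norm (indicator {0<..<T} t * (LBINT x. (w t x)\<^sup>2 * pt t x)) \<le> norm (indicator {0<..<T} t * (K * (1 + W t)))"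
      using aeN by eventually_elim (use F1(3) in \<open>auto simp: indicator_def intro: order_trans[OF _ abs_ge_self]\<close>)
  qed measurable
  show i2: "L1 (\<lambda>t. indicator {0<..<T} t * (LBINT x. (w t x)\<^sup>2 * ?v t x))"
  proof (rule Bochner_Integration.integrable_bound[OF dom_integrable[of K]])
    show "AE t in lborel. norm (indicator {0<..<T} t * (LBINT x. (w t x)\<^sup>2 * ?v t x)) \<le> norm (indicator {0<..<T} t * (K * (1 + W t)))"
      using aeN by eventually_elim (use F2(3) in \<open>auto simp: indicator_def intro: order_trans[OF _ abs_ge_self]\<close>)
  qed measurable
  let ?F = "\<lambda>n t. (LBINT x. ?b n (w t x) * pt t x) + (LBINT x. ?b n (w t x) * ?v t x)"
  have zero: "(LBINT t. indicator {0<..<T} t * ?F n t) = 0" for n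
  proof (rule antisym)
    note b = bt_nice[of "real n + 1", simplified]
    show "0 \<le> (LBINT t. indicator {0<..<T} t * ?F n t)"
      using renormalized_inequality[OF b T2 p disjI1[OF nu0]] by (simp add: nu0 p0)
    have "0 \<le> (LBINT t. indicator {0<..<T} t * (- (LBINT x. ?b n (w t x) * pt t x) - (LBINT x. ?b n (w t x) * ?v t x)))"
      using renormalized_inequality[OF nice_beta_uminus[OF b] T2 p disjI1[OF nu0]] by (simp add: nu0 p0)
    moreover have "indicator {0<..<T} t * (- (LBINT x. ?b n (w t x) * pt t x) - (LBINT x. ?b n (w t x) * ?v t x)) = - (indicator {0<..<T} t * ?F n t)" for t
      by (simp only: mult_minus_right[symmetric] minus_add_distrib diff_conv_add_uminus)
    ultimately have "0 \<le> (LBINT t. - (indicator {0<..<T} t * ?F n t))" by (simp only:)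
    then show "(LBINT t. indicator {0<..<T} t * ?F n t) \<le> 0" by (simp only: integral_minus neg_0_le_iff_le)
  qed
  have "(\<lambda>n. LBINT t. indicator {0<..<T} t * ?F n t) \<longlonglongrightarrow> (LBINT t. indicator {0<..<T} t * ((LBINT x. (w t x)\<^sup>2 * pt t x) + (LBINT x. (w t x)\<^sup>2 * ?v t x)))"
  proof (rule integral_dominated_convergence[OF _ _ dom_integrable[of "2 * K"]])
    show "AE t in lborel. (\<lambda>n. indicator {0<..<T} t * ?F n t) \<longlonglongrightarrow> indicator {0<..<T} t * ((LBINT x. (w t x)\<^sup>2 * pt t x) + (LBINT x. (w t x)\<^sup>2 * ?v t x))"
      using aeN
    proof eventually_elim
      case (elim t)
      show ?case
      proof (cases "t \<in> {0<..<T}")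
        case True
        then show ?thesis using elim by (intro tendsto_mult tendsto_const tendsto_add F1(1) F2(1)) auto
      qed auto
    qed
    show "AE t in lborel. norm (indicator {0<..<T} t * ?F n t) \<le> indicator {0<..<T} t * (2 * K * (1 + W t))" for n
      using aeN
    proof eventually_elim
      case (elim t)
      show ?case
      proof (cases "t \<in> {0<..<T}")
        case True
        then have "N t" using elim by simp
        then have "\<bar>?F n t\<bar> \<le> K * (1 + W t) + K * (1 + W t)" using F1(2) F2(2) by (intro order_trans[OF abs_triangle_ineq] add_mono)
        then show ?thesis using True by simp
      qed auto
    qed
  qed measurable
  then have "(LBINT t. indicator {0<..<T} t * ((LBINT x. (w t x)\<^sup>2 * pt t x) + (LBINT x. (w t x)\<^sup>2 * ?v t x))) = 0"
    unfolding zero by (simp add: LIMSEQ_const_iff)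
  then show "(LBINT t. indicator {0<..<T} t * (LBINT x. (w t x)\<^sup>2 * pt t x)) + (LBINT t. indicator {0<..<T} t * (LBINT x. (w t x)\<^sup>2 * ?v t x)) = 0"
    unfolding Bochner_Integration.integral_add[OF i1 i2, symmetric] distrib_left[symmetric] .
qed

end

text \<open>\<open>nl_pair\<close> integrates over x first, with the kernel acting on the test
  field. \<open>triple_bound\<close> makes the double integral absolutely convergent, so the order
  can be exchanged and the velocity appears; oddness of the kernel absorbs the minus sign.\<close>

lemma nl_pair_eq:
  assumes f: "L1 f" and f2: "L1 (\<lambda>x. (f x)\<^sup>2)"
    and A: "(LBNN x. ennreal (Af \<bar>f x\<bar>)) \<le> ennreal C" and C: "C \<ge> 0"
    and [measurable]: "\<Phi> \<in> borel_measurable borel" and B: "\<And>x. norm (\<Phi> x) \<le> B"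
  shows "nl_pair f \<Phi> = (LBINT x. (f x)\<^sup>2 * (velocity f x \<bullet> \<Phi> x))"
proof -
  have [measurable]: "f \<in> borel_measurable borel" using f by auto
  have B0: "B \<ge> 0" using B[of 0] norm_ge_zero order_trans by blast
  define H where "H x y = f y * (BS_K (x - y) \<bullet> \<Phi> x) * (f x)\<^sup>2" for x y
  have Hm[measurable]: "(\<lambda>z. H (fst z) (snd z)) \<in> borel_measurable (lborel \<Otimes>\<^sub>M lborel)" unfolding H_def by measurable
  have Hle: "ennreal (norm (H x y)) \<le> ennreal B * (ennreal ((f x)\<^sup>2) * ennreal (\<bar>f y\<bar> / norm (x - y)))" for x y
  proof -
    have "norm (H x y) = \<bar>(f y *\<^sub>R BS_K (x - y)) \<bullet> \<Phi> x\<bar> * (f x)\<^sup>2" by (simp add: H_def abs_mult)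
    also have "\<dots> \<le> ((\<bar>f y\<bar> / norm (x - y)) * B) * (f x)\<^sup>2"
    proof (intro mult_right_mono)
      have "\<bar>(f y *\<^sub>R BS_K (x - y)) \<bullet> \<Phi> x\<bar> \<le> norm (f y *\<^sub>R BS_K (x - y)) * norm (\<Phi> x)" by (rule Cauchy_Schwarz_ineq2)
      also have "\<dots> \<le> (\<bar>f y\<bar> / norm (x - y)) * B" by (intro mult_mono BS_K_le B) auto
      finally show "\<bar>(f y *\<^sub>R BS_K (x - y)) \<bullet> \<Phi> x\<bar> \<le> (\<bar>f y\<bar> / norm (x - y)) * B" .
    qed auto
    finally have "norm (H x y) \<le> B * ((f x)\<^sup>2 * (\<bar>f y\<bar> / norm (x - y)))" by (simp add: mult_ac)
    moreover have "ennreal (B * (a * b)) = ennreal B * (ennreal a * ennreal b)" if "a \<ge> 0" "b \<ge> 0" for a b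
      using B0 that by (simp add: ennreal_mult)
    ultimately show ?thesis using ennreal_leI by (metis abs_ge_zero divide_nonneg_nonneg norm_ge_zero zero_le_power2)
  qed
  have int: "integrable (lborel \<Otimes>\<^sub>M lborel) (\<lambda>z. H (fst z) (snd z))"
  proof (rule integrableI_bounded)
    have "(\<integral>\<^sup>+z. ennreal (norm (H (fst z) (snd z))) \<partial>(lborel \<Otimes>\<^sub>M lborel)) = (LBNN x. LBNN y. ennreal (norm (H x y)))"
      by (subst lborel.nn_integral_fst[symmetric]) auto
    also have "\<dots> \<le> (LBNN x. LBNN y. ennreal B * (ennreal ((f x)\<^sup>2) * ennreal (\<bar>f y\<bar> / norm (x - y))))"
      by (intro nn_integral_mono Hle)
    also have "\<dots> = (LBNN x. ennreal B * (ennreal ((f x)\<^sup>2) * Upot f x))"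
    proof (intro nn_integral_cong)
      fix x
      have "(LBNN y. ennreal B * (ennreal ((f x)\<^sup>2) * ennreal (\<bar>f y\<bar> / norm (x - y)))) = ennreal B * (LBNN y. ennreal ((f x)\<^sup>2) * ennreal (\<bar>f y\<bar> / norm (x - y)))"
        by (rule nn_integral_cmult) measurable
      also have "(LBNN y. ennreal ((f x)\<^sup>2) * ennreal (\<bar>f y\<bar> / norm (x - y))) = ennreal ((f x)\<^sup>2) * Upot f x"
        unfolding Upot_def by (rule nn_integral_cmult) measurable
      finally show "(LBNN y. ennreal B * (ennreal ((f x)\<^sup>2) * ennreal (\<bar>f y\<bar> / norm (x - y)))) = ennreal B * (ennreal ((f x)\<^sup>2) * Upot f x)" .
    qed
    also have "\<dots> = ennreal B * (LBNN x. ennreal ((f x)\<^sup>2) * Upot f x)" by (rule nn_integral_cmult) measurable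
    also have "\<dots> < \<infinity>" using triple_bound[OF f f2 A C] by (auto simp: ennreal_mult_less_top order_le_less_trans)
    finally show "(\<integral>\<^sup>+z. ennreal (norm (H (fst z) (snd z))) \<partial>(lborel \<Otimes>\<^sub>M lborel)) < \<infinity>" .
  qed measurable
  have "nl_pair f \<Phi> = (LBINT y. (LBINT x. H x y))"
  proof -
    have "f y * (LBINT x. (BS_K (y - x) \<bullet> \<Phi> x) * (f x)\<^sup>2) = - (LBINT x. H x y)" for y
    proof -
      have "BS_K (y - x) = - BS_K (x - y)" for x using BS_K_minus[of "x - y"] by simp
      then have "f y * ((BS_K (y - x) \<bullet> \<Phi> x) * (f x)\<^sup>2) = - H x y" for x by (simp add: H_def)
      then show ?thesis by (simp only: integral_mult_right_zero[symmetric] integral_minus[symmetric])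
    qed
    then show ?thesis unfolding nl_pair_def by simp
  qed
  also have "\<dots> = (LBINT x. (LBINT y. H x y))"
    by (rule lborel_pair.Fubini_integral) (use int in \<open>simp add: case_prod_unfold\<close>)
  also have "\<dots> = (LBINT x. (f x)\<^sup>2 * (velocity f x \<bullet> \<Phi> x))"
  proof (rule integral_cong_AE)
    show "AE x in lborel. (LBINT y. H x y) = (f x)\<^sup>2 * (velocity f x \<bullet> \<Phi> x)"
      using Upot_finite[OF f f2]
    proof eventually_elim
      case (elim x)
      have i: "L1 (\<lambda>y. f y *\<^sub>R BS_K (x - y))" by (rule BS_K_integrable) (use elim in auto)
      have "(LBINT y. H x y) = (LBINT y. (f x)\<^sup>2 * ((f y *\<^sub>R BS_K (x - y)) \<bullet> \<Phi> x))" by (simp add: H_def mult_ac)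
      also have "\<dots> = (f x)\<^sup>2 * (LBINT y. (f y *\<^sub>R BS_K (x - y)) \<bullet> \<Phi> x)" by (rule integral_mult_right_zero)
      also have "(LBINT y. (f y *\<^sub>R BS_K (x - y)) \<bullet> \<Phi> x) = velocity f x \<bullet> \<Phi> x"
        unfolding velocity_def using i by (intro integral_inner_left) auto
      finally show ?case .
    qed
    show "(\<lambda>x. LBINT y. H x y) \<in> borel_measurable lborel"
      unfolding H_def by (intro lborel.borel_measurable_lebesgue_integral) measurable
  qed measurable
  finally show ?thesis .
qed

section \<open>Test functions and their derivatives\<close>

lemma smooth_fun_props:
  assumes "smooth_fun f"
  shows "f differentiable (at z)" "continuous_on UNIV f" "b \<in> Basis \<Longrightarrow> smooth_fun (\<lambda>z. frechet_derivative f (at z) b)"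
proof -
  have "Ck (Suc 0) f" "Ck 0 f" "Ck (Suc k) f" for k using assms unfolding smooth_fun_def by blast+
  then show "f differentiable (at z)" "continuous_on UNIV f" "b \<in> Basis \<Longrightarrow> smooth_fun (\<lambda>z. frechet_derivative f (at z) b)"
    by (auto simp: smooth_fun_def differentiable_on_def)
qed

lemma frechet_derivative_off_support:
  assumes "z \<notin> tsupport f" shows "frechet_derivative f (at z) b = 0"
proof -
  have "(f has_derivative (\<lambda>_. 0)) (at z)"
  proof (rule has_derivative_transform_within_open[of "\<lambda>_. 0" _ z UNIV "- tsupport f"])
    show "open (- tsupport f)" unfolding tsupport_def by (intro open_Compl closed_closure)
    show "0 = f x" if "x \<in> - tsupport f" for x
      using that closure_subset[of "{x. f x \<noteq> 0}"] unfolding tsupport_def by force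
  qed (use assms in auto)
  then show ?thesis by (metis frechet_derivative_at)
qed

lemma off_support: "z \<notin> tsupport f \<Longrightarrow> f z = 0"
  using closure_subset[of "{x. f x \<noteq> 0}"] unfolding tsupport_def by auto

lemma tsupport_frechet_derivative: "tsupport (\<lambda>z. frechet_derivative f (at z) b) \<subseteq> tsupport f"
proof -
  have "{z. frechet_derivative f (at z) b \<noteq> 0} \<subseteq> tsupport f" using frechet_derivative_off_support by blast
  then show ?thesis unfolding tsupport_def[of "\<lambda>z. frechet_derivative f (at z) b"]
    by (rule closure_minimal) (simp add: tsupport_def)
qed

lemma dird_frechet:
  assumes "\<And>z. f differentiable (at z)"
  shows "dird f v (\<lambda>z. frechet_derivative f (at z) v)"
  unfolding dird_def
proof
  fix z
  have d: "(f has_derivative frechet_derivative f (at z)) (at z)" using assms frechet_derivative_works by blast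
  have l: "((\<lambda>s. z + s *\<^sub>R v) has_derivative (\<lambda>s. s *\<^sub>R v)) (at 0)" by (auto intro!: derivative_eq_intros)
  have "((\<lambda>s. f (z + s *\<^sub>R v)) has_derivative (\<lambda>s. frechet_derivative f (at z) (s *\<^sub>R v))) (at 0)"
    by (rule has_derivative_compose[OF l]) (use d in simp)
  moreover have "frechet_derivative f (at z) (s *\<^sub>R v) = frechet_derivative f (at z) v * s" for s
    using linear_cmul[OF has_derivative_linear[OF d], of s v] by simp
  ultimately show "((\<lambda>s. f (z + s *\<^sub>R v)) has_real_derivative frechet_derivative f (at z) v) (at 0)"
    by (simp add: has_field_derivative_def)
qed

text \<open>Translates a test function into the explicit families of derivatives used above.
  Compactness of its support leaves room for T2 < T and yields the radius and a common bound; as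
  these hold at all times, \<open>nice_st\<close> is available for every T1.\<close>

lemma test_fun_nice:
  assumes T: "T > 0" and phi: "test_fun ({0<..<T} \<times> UNIV) \<phi>"
  obtains R B T2 where "0 < T2" "T2 < T"
    "\<And>T1. nice_st R B T1 T2 (\<lambda>t x. \<phi> (t, x)) (dt \<phi>) (dx 1 \<phi>) (dx 2 \<phi>)
      (dx 1 (\<lambda>z. dx 1 \<phi> (fst z) (snd z))) (dx 2 (\<lambda>z. dx 2 \<phi> (fst z) (snd z)))"
    "\<And>t x i. T2 \<le> t \<Longrightarrow> dx i \<phi> t x = 0" "\<And>x. \<phi> (0, x) = 0" "\<And>i t x. \<bar>dx i \<phi> t x\<bar> \<le> B" "\<And>t i. dx i \<phi> t \<in> borel_measurable borel"
proof -
  let ?S = "tsupport \<phi>"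
  have sm: "smooth_fun \<phi>" and cS: "compact ?S" and S: "?S \<subseteq> {0<..<T} \<times> UNIV" using phi by (auto simp: test_fun_def)
  have "\<exists>m. 0 \<le> m \<and> m < T \<and> (\<forall>z\<in>?S. fst z \<le> m)"
  proof (cases "?S = {}")
    case False
    have "compact (fst ` ?S)" by (intro compact_continuous_image cS continuous_intros)
    then obtain m where "m \<in> fst ` ?S" "\<forall>y\<in>fst ` ?S. y \<le> m" using compact_attains_sup[of "fst ` ?S"] False by blast
    then show ?thesis using S by (intro exI[of _ m]) fastforce
  qed (use T in auto)
  then obtain m where m: "0 \<le> m" "m < T" "\<And>z. z \<in> ?S \<Longrightarrow> fst z \<le> m" by auto
  \<comment> \<open>Midway between T and m, a time bound for the support; m is 0 when the support is
    empty.\<close>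
  define T2 where "T2 = (m + T) / 2"
  have T2: "0 < T2" "T2 < T" "m < T2" using m T by (auto simp: T2_def)
  obtain R where R: "\<And>z. z \<in> ?S \<Longrightarrow> norm z \<le> R" using compact_imp_bounded[OF cS] bounded_iff by blast
  have off: "(t, x) \<notin> ?S" if "T2 \<le> t \<or> t \<le> 0 \<or> norm x > R" for t x
  proof
    assume s: "(t, x) \<in> ?S"
    have "norm x \<le> norm (t, x)" by (rule norm_snd_le)
    then show False using that s m(3)[OF s] R[OF s] T2 S by auto
  qed
  have bas: "(1, 0) \<in> (Basis :: (real \<times> (real^2)) set)" "(0, axis i 1) \<in> (Basis :: (real \<times> (real^2)) set)" for i
    by (auto simp: Basis_prod_def axis_in_Basis_iff)
  let ?D = "\<lambda>b z. frechet_derivative \<phi> (at z) b" let ?E = "\<lambda>b z. frechet_derivative (?D b) (at z) b"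
  let ?e = "\<lambda>i. (0::real, axis i (1::real) :: real^2)"
  have sD: "smooth_fun (?D (1, 0))" "smooth_fun (?D (?e i))" "smooth_fun (?E (?e i))" for i
    using smooth_fun_props(3) sm bas by blast+
  have ts: "tsupport (?D b) \<subseteq> ?S" "tsupport (?E b) \<subseteq> ?S" for b
    using tsupport_frechet_derivative[of \<phi> b] tsupport_frechet_derivative[of "?D b" b] by auto
  have dtD: "dt \<phi> t x = ?D (1, 0) (t, x)" "dx i \<phi> t x = ?D (?e i) (t, x)" for t x i by (simp_all add: dt_def dx_def)
  have dxE: "dx i (\<lambda>z. dx i \<phi> (fst z) (snd z)) t x = ?E (?e i) (t, x)" for t x i
    unfolding dx_def by simp
  have z: "\<phi> (t, x) = 0 \<and> ?D b (t, x) = 0 \<and> ?E b (t, x) = 0" if "T2 \<le> t \<or> t \<le> 0 \<or> norm x > R" for t x b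
  proof -
    have "(t, x) \<notin> tsupport (?D b)" "(t, x) \<notin> tsupport (?E b)" using off[OF that] ts[of b] by blast+
    then show ?thesis using off_support off[OF that] by blast
  qed
  have bd: "\<exists>B\<ge>0. \<forall>z. \<bar>f z\<bar> \<le> B" if "smooth_fun f" "tsupport f \<subseteq> ?S" for f
  proof (rule cont_supp_integrable(2))
    show "f z = 0" if "norm z > R" for z using R[of z] that \<open>tsupport f \<subseteq> ?S\<close> off_support[of z f] by force
  qed (rule smooth_fun_props(2)[OF that(1)])
  \<comment> \<open>The function, its time derivative, and its first and pure second space
    derivatives; continuity and bounds are obtained for all six at once.\<close>
  let ?fs = "{\<phi>, ?D (1, 0), ?D (?e 1), ?D (?e 2), ?E (?e 1), ?E (?e 2)}"
  have fs: "smooth_fun f \<and> tsupport f \<subseteq> ?S" if "f \<in> ?fs" for f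
  proof -
    have "\<forall>f\<in>?fs. smooth_fun f \<and> tsupport f \<subseteq> ?S" by (simp only: ball_simps) (intro conjI TrueI sm sD ts subset_refl)
    from this that show ?thesis by (rule bspec)
  qed
  have "\<forall>f\<in>?fs. \<exists>B\<ge>0. \<forall>z. \<bar>f z\<bar> \<le> B" by (intro ballI bd fs[THEN conjunct1] fs[THEN conjunct2])
  from bchoice[OF this] obtain b where b: "\<forall>f\<in>?fs. b f \<ge> 0 \<and> (\<forall>z. \<bar>f z\<bar> \<le> b f)" by (rule exE)
  define B where "B = sum b ?fs"
  have B: "\<bar>f z\<bar> \<le> B" if "f \<in> ?fs" for f z
  proof -
    have "b f \<le> B" unfolding B_def
    proof (rule member_le_sum[OF that])
      show "0 \<le> b g" if "g \<in> ?fs - {f}" for g using bspec[OF b DiffD1[OF that]] by simp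
    qed simp
    then show ?thesis using bspec[OF b that] order_trans by blast
  qed
  have cont: "continuous_on UNIV f" if "f \<in> ?fs" for f using smooth_fun_props(2) fs[OF that] by blast
  have sl: "continuous_on UNIV (\<lambda>x. f (t, x))" "continuous_on UNIV (\<lambda>t. f (t, y))" if "f \<in> ?fs" for f t y
    by (auto intro!: continuous_on_compose2[OF cont[OF that]] continuous_intros)
  have dx': "dird (\<lambda>x. f (t, x)) e (\<lambda>x. frechet_derivative f (at (t, x)) (0, e))" if "smooth_fun f" for f t e
    using dird_frechet[OF smooth_fun_props(1)[OF that], of "(0, e)"] unfolding dird_def by (simp add: split_paired_all)
  have dt': "((\<lambda>t. \<phi> (t, x)) has_real_derivative ?D (1, 0) (t, x)) (at t)" for t x
  proof -
    have "((\<lambda>s. \<phi> ((t, x) + s *\<^sub>R (1, 0))) has_real_derivative ?D (1, 0) (t, x)) (at 0)"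
      using dird_frechet[OF smooth_fun_props(1)[OF sm], of "(1, 0)"] unfolding dird_def by blast
    then have "((\<lambda>s. \<phi> (s + t, x)) has_real_derivative ?D (1, 0) (t, x)) (at 0)" by (simp add: add.commute)
    then show ?thesis using DERIV_shift[of "\<lambda>s. \<phi> (s, x)" "?D (1, 0) (t, x)" 0 t] by simp
  qed
  have meas: "f \<in> borel_measurable borel" if "f \<in> ?fs" for f using cont[OF that] by (rule borel_measurable_continuous_onI)
  have eta: "(\<lambda>z. f (fst z, snd z)) = f" for f :: "real \<times> (real^2) \<Rightarrow> real" by simp
  have E0: "dt \<phi> = (\<lambda>t x. ?D (1, 0) (t, x))" and E1: "\<And>i. dx i \<phi> = (\<lambda>t x. ?D (?e i) (t, x))"
    and E2: "\<And>i. dx i (\<lambda>z. dx i \<phi> (fst z) (snd z)) = (\<lambda>t x. ?E (?e i) (t, x))"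
    by (intro ext dtD dxE)+
  have fsI: "\<phi> \<in> ?fs" "?D (1, 0) \<in> ?fs" "?D (?e 1) \<in> ?fs" "?D (?e 2) \<in> ?fs" "?E (?e 1) \<in> ?fs" "?E (?e 2) \<in> ?fs"
    by (simp_all only: insert_iff simp_thms)
  show ?thesis
  proof (rule that[OF T2(1,2)])
    show "nice_st R B T1 T2 (\<lambda>t x. \<phi> (t, x)) (dt \<phi>) (dx 1 \<phi>) (dx 2 \<phi>)
      (dx 1 (\<lambda>z. dx 1 \<phi> (fst z) (snd z))) (dx 2 (\<lambda>z. dx 2 \<phi> (fst z) (snd z)))" for T1
      unfolding E2 unfolding E1 E0 nice_st_def
    proof (intro conjI allI ballI)
      show "nice_test R (\<lambda>x. \<phi> (t, x)) (\<lambda>x. ?D (?e 1) (t, x)) (\<lambda>x. ?D (?e 2) (t, x)) (\<lambda>x. ?E (?e 1) (t, x)) (\<lambda>x. ?E (?e 2) (t, x))" for t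
        unfolding nice_test_def using z by (intro conjI allI impI dx'[OF sm] dx'[OF sD(2)] sl(1) fsI) blast+
      show "continuous_on UNIV (\<lambda>t. ?D (1, 0) (t, x))" for x by (intro sl(2) fsI)
      show "((\<lambda>t. \<phi> (t, x)) has_real_derivative ?D (1, 0) (t, x)) (at t)" for t x by (rule dt')
      show "T2 \<le> t \<longrightarrow> \<phi> (t, x) = 0 \<and> ?D (1, 0) (t, x) = 0" "norm x > R \<longrightarrow> ?D (1, 0) (t, x) = 0" for t x using z by blast+
      show "\<bar>\<phi> (t, x)\<bar> \<le> B" "\<bar>?D (1, 0) (t, x)\<bar> \<le> B" "\<bar>?D (?e 1) (t, x)\<bar> \<le> B" "\<bar>?D (?e 2) (t, x)\<bar> \<le> B"
        "\<bar>?E (?e 1) (t, x)\<bar> \<le> B" "\<bar>?E (?e 2) (t, x)\<bar> \<le> B" for t x by (intro B fsI)+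
    next
      fix f assume "f \<in> {\<lambda>t x. \<phi> (t, x), \<lambda>t x. ?D (1, 0) (t, x), \<lambda>t x. ?D (?e 1) (t, x), \<lambda>t x. ?D (?e 2) (t, x), \<lambda>t x. ?E (?e 1) (t, x), \<lambda>t x. ?E (?e 2) (t, x)}"
      then have "\<exists>g\<in>?fs. f = (\<lambda>t x. g (t, x))" by (elim insertE emptyE) (erule bexI, intro fsI)+
      then obtain g where g: "g \<in> ?fs" "f = (\<lambda>t x. g (t, x))" by (rule bexE)
      then show "(\<lambda>z. f (fst z) (snd z)) \<in> borel_measurable borel" using meas[OF g(1)] by (simp add: eta)
    qed
    show "dx i \<phi> t x = 0" if "T2 \<le> t" for i t x unfolding dtD using z that by blast
    show "\<phi> (0, x) = 0" for x using z[of 0 x] by auto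
    show "\<bar>dx i \<phi> t x\<bar> \<le> B" for i t x unfolding E1 using B[OF fsI(3)] B[OF fsI(4)] exhaust_2[of i] by metis
    show "dx i \<phi> t \<in> borel_measurable borel" for t i
      unfolding E1 using sl(1)[OF fsI(3)] sl(1)[OF fsI(4)] exhaust_2[of i] by (intro borel_measurable_continuous_onI) metis
  qed
qed

text \<open>Local integrability is part of the definition of the space, and compact support makes it
  global. Square integrability follows because the logarithmic factor is bounded below.\<close>

lemma LlogL_compact_support:
  assumes w0: "w0 \<in> LlogL 2 (1/4)" and supp: "\<exists>r. AE x in lborel. norm x > r \<longrightarrow> w0 x = 0"
  shows "L1 w0" "L1 (\<lambda>x. (w0 x)\<^sup>2)"
proof -
  have [measurable]: "w0 \<in> borel_measurable borel" using w0 by (simp add: LlogL_def)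
  obtain r where r: "AE x in lborel. norm x > r \<longrightarrow> w0 x = 0" using supp by blast
  have "L1 (\<lambda>x. indicator (cball 0 r) x *\<^sub>R w0 x)"
    using w0 by (simp add: LlogL_def set_integrable_def)
  moreover have "AE x in lborel. w0 x = indicator (cball 0 r) x *\<^sub>R w0 x"
    using r by eventually_elim (auto simp: indicator_def)
  ultimately show "L1 w0" by (subst integrable_cong_AE) auto
  have "(LBNN x. ennreal (Af \<bar>w0 x\<bar>)) < \<infinity>" using w0 by (simp add: LlogL_def A_fun_eq)
  then have "(LBNN x. ennreal (Af \<bar>w0 x\<bar>)) \<le> ennreal (enn2real (LBNN x. ennreal (Af \<bar>w0 x\<bar>)))" by simp
  from Af_L2(1)[OF _ this] show "L1 (\<lambda>x. (w0 x)\<^sup>2)" by simp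
qed

text \<open>Integrability of the limit is available up to times T1 < T, so the equation is
  restricted accordingly. The test functions and their first derivatives vanish from T1 on, which
  makes the two time integrals equal.\<close>

lemma vort_weak_restrict:
  assumes weak: "vort_weak 0 T w0 w" and T1: "T1 \<le> T"
  shows "vort_weak 0 T1 w0 w"
  unfolding vort_weak_def
proof (intro allI impI)
  fix \<phi> :: "real \<times> (real^2) \<Rightarrow> real" assume phi: "test_fun ({..<T1} \<times> UNIV) \<phi>"
  have off: "(t, x) \<notin> tsupport \<phi>" if "t \<ge> T1" for t x using phi that by (auto simp: test_fun_def)
  have z: "dt \<phi> t x = 0" "gradx \<phi> t x = 0" if "t \<ge> T1" for t x
    using frechet_derivative_off_support[OF off[OF that]] by (simp_all add: dt_def gradx_def dx_def vec_eq_iff)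
  have "test_fun ({..<T} \<times> UNIV) \<phi>" using phi T1 by (auto simp: test_fun_def)
  then have "(LINT t:{0<..<T}|lborel. LINT x|lborel. w t x * (dt \<phi> t x + velocity (w t) x \<bullet> gradx \<phi> t x + 0 * lapx \<phi> t x))
      + (LINT x|lborel. w0 x * \<phi> (0, x)) = 0"
    using weak unfolding vort_weak_def by blast
  moreover have "(LINT t:{0<..<T}|lborel. LINT x|lborel. w t x * (dt \<phi> t x + velocity (w t) x \<bullet> gradx \<phi> t x + 0 * lapx \<phi> t x))
    = (LINT t:{0<..<T1}|lborel. LINT x|lborel. w t x * (dt \<phi> t x + velocity (w t) x \<bullet> gradx \<phi> t x + 0 * lapx \<phi> t x))"
    unfolding set_lebesgue_integral_def using T1 by (intro Bochner_Integration.integral_cong refl) (auto simp: indicator_def z)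
  ultimately show "(LINT t:{0<..<T1}|lborel. LINT x|lborel. w t x * (dt \<phi> t x + velocity (w t) x \<bullet> gradx \<phi> t x + 0 * lapx \<phi> t x))
      + (LINT x|lborel. w0 x * \<phi> (0, x)) = 0" by simp
qed

lemma nl_pair_0: "nl_pair f (\<lambda>x. 0) = 0" by (simp add: nl_pair_def)

theorem theorem4p2:
  fixes T :: real and w0 :: "real^2 \<Rightarrow> real" and w :: "real \<Rightarrow> real^2 \<Rightarrow> real"
  assumes "T > 0"
    and "w0 \<in> LlogL 2 (1/4)"
    and "\<exists>r. AE x in lborel. norm x > r \<longrightarrow> w0 x = 0"
    and "Linf_LlogL T 2 (1/4) w"
    and "viscosity_solution T w0 w"
  shows "\<forall>\<phi>. test_fun ({0<..<T} \<times> UNIV) \<phi> \<longrightarrow>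
           (LINT t:{0<..<T}|lborel. LINT x|lborel. (w t x)\<^sup>2 * dt \<phi> t x)
           + (LINT t:{0<..<T}|lborel. nl_pair (w t) (gradx \<phi> t)) = 0"
proof (intro allI impI)
  fix \<phi> :: "real \<times> (real^2) \<Rightarrow> real" assume phi: "test_fun ({0<..<T} \<times> UNIV) \<phi>"
  note w0 = LlogL_compact_support[OF assms(2,3)]
  have wm: "(\<lambda>z. w (fst z) (snd z)) \<in> borel_measurable (borel :: (real \<times> (real^2)) measure)"
    using assms(4) by (simp add: Linf_LlogL_def)
  obtain M where M: "AE t in lborel. t \<in> {0..<T} \<longrightarrow> w t \<in> LlogL 2 (1/4) \<and> lux_norm 2 (1/4) (w t) \<le> M"
    using assms(4) unfolding Linf_LlogL_def by blast
  let ?C = "CAf M"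
  have A: "AE t in lborel. t \<in> {0<..<T} \<longrightarrow> (LBNN x. ennreal (Af \<bar>w t x\<bar>)) \<le> ennreal ?C"
    using M by eventually_elim (auto intro: lux_bound)
  have w2: "AE t in lborel. t \<in> {0<..<T} \<longrightarrow> L1 (\<lambda>x. (w t x)\<^sup>2) \<and> (LBINT x. (w t x)\<^sup>2) \<le> 2 * ?C"
    using M A
  proof eventually_elim
    case (elim t)
    show ?case
    proof
      assume t: "t \<in> {0<..<T}"
      then have "w t \<in> borel_measurable borel" using elim(1) by (auto simp: LlogL_def)
      from Af_L2[OF this _ CAf_nonneg] show "L1 (\<lambda>x. (w t x)\<^sup>2) \<and> (LBINT x. (w t x)\<^sup>2) \<le> 2 * ?C"
        using elim(2) t by blast
    qed
  qed
  obtain \<nu> :: "nat \<Rightarrow> real" and wk where nu: "\<And>k. \<nu> k > 0" and ns: "\<And>k. NS_solution (\<nu> k) T w0 (wk k)"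
    and lim: "\<And>\<phi>. test_fun ({0<..<T} \<times> UNIV) \<phi> \<Longrightarrow>
           (\<lambda>k. LINT t:{0<..<T}|lborel. LINT x|lborel. wk k t x * \<phi> (t, x))
             \<longlonglongrightarrow> (LINT t:{0<..<T}|lborel. LINT x|lborel. w t x * \<phi> (t, x))"
    and weak: "vort_weak 0 T w0 w"
    using assms(5) unfolding viscosity_solution_def by blast
  obtain R B T2 where T2: "0 < T2" "T2 < T"
    and st: "\<And>T1. nice_st R B T1 T2 (\<lambda>t x. \<phi> (t, x)) (dt \<phi>) (dx 1 \<phi>) (dx 2 \<phi>)
      (dx 1 (\<lambda>z. dx 1 \<phi> (fst z) (snd z))) (dx 2 (\<lambda>z. dx 2 \<phi> (fst z) (snd z)))"
    and dx0: "\<And>t x i. T2 \<le> t \<Longrightarrow> dx i \<phi> t x = 0" and phi0: "\<And>x. \<phi> (0, x) = 0"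
    and dxB: "\<And>i t x. \<bar>dx i \<phi> t x\<bar> \<le> B" and dxm: "\<And>t i. dx i \<phi> t \<in> borel_measurable borel"
    by (rule test_fun_nice[OF assms(1) phi]) blast
  \<comment> \<open>T2 < T1 < T3 < T: the test function is supported before T2, integrability is
    needed up to T1, and the uniform mass bound on (0, T1) calls for a further time T3 below
    T.\<close>
  define T1 where "T1 = (T2 + T) / 2"
  define T3 where "T3 = (T1 + T) / 2"
  have Ts: "0 < T1" "T2 < T1" "T1 < T3" "T3 < T" "T1 < T" using T2 by (auto simp: T1_def T3_def)
  have w1: "integrable (lborel \<Otimes>\<^sub>M lborel) (\<lambda>z. indicator {0<..<T1} (fst z) * w (fst z) (snd z))"
    by (rule limit_L1[OF Ts(1,5) wm w2 NS_L1_uniform(1-3)[OF ns nu Ts(1,3,4) w0] lim])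
  \<comment> \<open>The limit is an instance with zero viscosity on (0, T1), where its mass is now
    known to be integrable.\<close>
  interpret weak_solution 0 T1 "2 * ?C" w w0
  proof
    show "AE t in lborel. t \<in> {0<..<T1} \<longrightarrow> L1 (\<lambda>x. (w t x)\<^sup>2) \<and> (LBINT x. (w t x)\<^sup>2) \<le> 2 * ?C"
      using w2 by eventually_elim (use Ts in auto)
    show "vort_weak 0 T1 w0 w" by (rule vort_weak_restrict[OF weak]) (use Ts in simp)
  qed (use Ts wm w1 w0 in auto)
  have A1: "AE t in lborel. t \<in> {0<..<T1} \<longrightarrow> (LBNN x. ennreal (Af \<bar>w t x\<bar>)) \<le> ennreal ?C"
    using A by eventually_elim (use Ts in auto)
  note main = renormalized_square[OF refl CAf_nonneg A1 T2(1) Ts(2) st phi0]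
  have dt0: "dt \<phi> t x = 0" if "T2 \<le> t" for t x using st[of 0] that by (auto simp: nice_st_def)
  have g0: "gradx \<phi> t = (\<lambda>x. 0)" if "T2 \<le> t" for t using dx0[OF that] by (simp add: gradx_def fun_eq_iff vec_eq_iff)
  \<comment> \<open>From T2 on the derivatives of the test function vanish, so the integrals over
    (0, T) and (0, T1) agree.\<close>
  have e1: "(LINT t:{0<..<T}|lborel. LINT x|lborel. (w t x)\<^sup>2 * dt \<phi> t x)
      = (LBINT t. indicator {0<..<T1} t * (LBINT x. (w t x)\<^sup>2 * dt \<phi> t x))"
    unfolding set_lebesgue_integral_def using Ts by (intro Bochner_Integration.integral_cong refl) (auto simp: indicator_def dt0)
  \<comment> \<open>At such times Fubini applies to the pairing; they make up almost all of (0, T1),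
    which is enough for the time integral.\<close>
  have nl: "nl_pair (w t) (gradx \<phi> t) = (LBINT x. (w t x)\<^sup>2 * (velocity (w t) x $ 1 * dx 1 \<phi> t x + velocity (w t) x $ 2 * dx 2 \<phi> t x))"
    if "good t" "(LBNN x. ennreal (Af \<bar>w t x\<bar>)) \<le> ennreal ?C" for t
  proof -
    have ip: "v \<bullet> gradx \<phi> t x = v $ 1 * dx 1 \<phi> t x + v $ 2 * dx 2 \<phi> t x" for v x
      by (simp add: inner_vec_def sum_2 gradx_def)
    have "gradx \<phi> t = (\<lambda>x. dx 1 \<phi> t x *\<^sub>R e1 + dx 2 \<phi> t x *\<^sub>R e2)"
      by (auto simp: fun_eq_iff vec_eq_iff forall_2 gradx_def axis_def)
    then have gm: "gradx \<phi> t \<in> borel_measurable borel" using dxm by simp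
    have gB: "norm (gradx \<phi> t x) \<le> 2 * B" for x
      using norm_le_vec2[of "gradx \<phi> t x"] dxB[of 1 t x] dxB[of 2 t x] by (simp add: gradx_def)
    show ?thesis using nl_pair_eq[OF _ _ that(2) CAf_nonneg gm gB] that(1) by (simp add: good_def ip)
  qed
  have e2: "(LINT t:{0<..<T}|lborel. nl_pair (w t) (gradx \<phi> t))
      = (LBINT t. indicator {0<..<T1} t * (LBINT x. (w t x)\<^sup>2 * (velocity (w t) x $ 1 * dx 1 \<phi> t x + velocity (w t) x $ 2 * dx 2 \<phi> t x)))"
  proof -
    have "(LINT t:{0<..<T}|lborel. nl_pair (w t) (gradx \<phi> t)) = (LBINT t. indicator {0<..<T1} t * nl_pair (w t) (gradx \<phi> t))"
      unfolding set_lebesgue_integral_def using Ts by (intro Bochner_Integration.integral_cong refl) (auto simp: indicator_def g0 nl_pair_0)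
    also have "\<dots> = (LBINT t. indicator {0<..<T1} t * (LBINT x. (w t x)\<^sup>2 * (velocity (w t) x $ 1 * dx 1 \<phi> t x + velocity (w t) x $ 2 * dx 2 \<phi> t x)))"
    proof (rule integral_cong_AE)
      show "AE t in lborel. indicator {0<..<T1} t * nl_pair (w t) (gradx \<phi> t) =
         indicator {0<..<T1} t * (LBINT x. (w t x)\<^sup>2 * (velocity (w t) x $ 1 * dx 1 \<phi> t x + velocity (w t) x $ 2 * dx 2 \<phi> t x))"
        using ae_good A1
      proof eventually_elim
        case (elim t)
        then show ?case by (cases "t \<in> {0<..<T1}") (simp_all add: nl)
      qed
      show "(\<lambda>t. indicator {0<..<T1} t * (LBINT x. (w t x)\<^sup>2 * (velocity (w t) x $ 1 * dx 1 \<phi> t x + velocity (w t) x $ 2 * dx 2 \<phi> t x))) \<in> borel_measurable lborel"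
        using main(2) by (rule borel_measurable_integrable)
      have dxj: "(\<lambda>z. dx i \<phi> (fst z) (snd z)) \<in> borel_measurable (borel :: (real \<times> (real^2)) measure)" for i
        using st[of 0] exhaust_2[of i] by (auto simp: nice_st_def)
      have [measurable (raw)]: "(\<lambda>z. dx i \<phi> (f z) (g z)) \<in> borel_measurable N" if "f \<in> borel_measurable N" "g \<in> borel_measurable N" for f g N i
        by (rule joint_measurable_comp[OF dxj that])
      have [measurable (raw)]: "(\<lambda>z. gradx \<phi> (f z) (g z)) \<in> borel_measurable N" if [measurable]: "f \<in> borel_measurable N" "g \<in> borel_measurable N" for f g N
      proof -
        have "(\<lambda>z. gradx \<phi> (f z) (g z)) = (\<lambda>z. dx 1 \<phi> (f z) (g z) *\<^sub>R e1 + dx 2 \<phi> (f z) (g z) *\<^sub>R e2)"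
          by (auto simp: fun_eq_iff vec_eq_iff forall_2 gradx_def axis_def)
        then show ?thesis by simp
      qed
      have "(\<lambda>t. nl_pair (w t) (gradx \<phi> t)) \<in> borel_measurable borel"
        unfolding nl_pair_def by (intro borel_measurable_uminus borel_measurable_times lborel.borel_measurable_lebesgue_integral) measurable
      then show "(\<lambda>t. indicator {0<..<T1} t * nl_pair (w t) (gradx \<phi> t)) \<in> borel_measurable lborel" by simp
    qed
    finally show ?thesis .
  qed
  show "(LINT t:{0<..<T}|lborel. LINT x|lborel. (w t x)\<^sup>2 * dt \<phi> t x) + (LINT t:{0<..<T}|lborel. nl_pair (w t) (gradx \<phi> t)) = 0"
    unfolding e1 e2 using main(3) .
qed

end
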